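(* Let $p_j,q_j\in[1,\infty]$, $\vartheta_j\in\mathscr P(\mathbf R^{2d})$ for $j=0,1,2$, and define $\omega_j\in\mathscr P(\mathbf R^{4d})$, $j=0,1,2$, by $$\omega_0(X,Y)=\frac{\vartheta_0(X+Y)}{\vartheta_2(X-Y)},\quad\omega_1(X,Y)=\frac{\vartheta_2(X-Y)}{\vartheta_1(X+Y)},\quad\omega_2(X,Y)=\frac{\vartheta_1(X-Y)}{\vartheta_0(X+Y)},\qquad X,Y\in\mathbf R^{2d}.$$ If the map $(a_1,a_2)\mapsto a_1\#a_2$ from $\mathcal S_{1/2}(\mathbf R^{2d})\times\mathcal S_{1/2}(\mathbf R^{2d})$ to $\mathcal S_{1/2}(\mathbf R^{2d})$ is extendable to a continuous map from $\mathcal M^{p_1,q_1}_{(\omega_1)}(\mathbf R^{2d})\times\mathcal M^{p_2,q_2}_{(\omega_2)}(\mathbf R^{2d})$ to $\mathcal M^{p_0',q_0'}_{(1/\omega_0)}(\mathbf R^{2d})$, then $$\max\left(\mathsf R_2(\mathbf q'),0\right)\le\min_{j=0,1,2}\left(\frac1{p_j},\frac1{q_j'},\mathsf R_2(\mathbf p)\right),$$ where $\mathbf p=(p_0,p_1,p_2)$ and $\mathbf q'=(q_0',q_1',q_2')$.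
   Context: Exponents: $1/p+1/p'=1$ for $p\in[1,\infty]$, and $\mathsf R_2(\mathbf p)=\frac1{p_0}+\frac1{p_1}+\frac1{p_2}-1$ for $\mathbf p\in[1,\infty]^3$. Gelfand–Shilov space: $\mathcal S_{1/2}(\mathbf R^n)=\bigcup_{h>0}\mathcal S_{1/2,h}(\mathbf R^n)$ with the inductive limit topology, where $\mathcal S_{s,h}$ is the Banach space of $f\in C^\infty(\mathbf R^n)$ with finite norm $\sup_{x,\alpha,\beta}\frac{|x^\beta\partial^\alpha f(x)|}{h^{|\alpha|+|\beta|}\alpha!^s\beta!^s}$. $\mathcal S_{1/2}'$ is its topological dual. Weyl product: $\operatorname{Op}^w(a)f(x)=(2\pi)^{-d}\iint a(\tfrac{x+y}2,\xi)f(y)e^{i\langle x-y,\xi\rangle}\,dy\,d\xi$, and $a\#b$ is defined by $\operatorname{Op}^w(a\#b)=\operatorname{Op}^w(a)\circ\operatorname{Op}^w(b)$. Weights: $\mathscr P(\mathbf R^n)$ (polynomially moderate functions) is the set of $\omega$ with $0<\omega\in L^\infty_{\rm loc}(\mathbf R^n)$ for which there are $C>0$ and $s\ge0$ with $\omega(x+y)\le C\omega(x)(1+|y|^2)^{s/2}$ for all $x,y$. Symplectic modulation spaces: $\sigma(X,Y)=\langle y,\xi\rangle-\langle x,\eta\rangle$ for $X=(x,\xi)$, $Y=(y,\eta)\in\mathbf R^{2d}$; $\mathscr F_\sigma a(X)=\pi^{-d}\int_{\mathbf R^{2d}}a(Y)e^{2i\sigma(X,Y)}dY$, extended to $\mathcal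 S_{1/2}'(\mathbf R^{2d})$; $\mathcal V_\Phi a(X,Y)=\mathscr F_\sigma\big(a\,\overline{\Phi(\cdot-X)}\big)(Y)$ for a fixed $\Phi\in\mathcal S_{1/2}(\mathbf R^{2d})\setminus0$. For $p,q\in[1,\infty]$ and $\omega\in\mathscr P(\mathbf R^{4d})$, $\mathcal M^{p,q}_{(\omega)}(\mathbf R^{2d})$ is the Banach space of all $a\in\mathcal S_{1/2}'(\mathbf R^{2d})$ with $$\|a\|_{\mathcal M^{p,q}_{(\omega)}}=\Big(\int\Big(\int|\mathcal V_\Phi a(X,Y)\omega(X,Y)|^p\,dX\Big)^{q/p}dY\Big)^{1/q}<\infty$$ (usual modifications if $p$ or $q$ is $\infty$); different $\Phi$ give equivalent norms. *)

theory Defs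
  imports "HOL-Analysis.Analysis" "HOL-Probability.Essential_Supremum"
begin

section \<open>Lebesgue exponents\<close>

text \<open>Exponents in \<open>[1,\<infinity>]\<close> are extended nonnegative reals \<open>p\<close> with \<open>1 \<le> p\<close>; in \<^typ>\<open>ennreal\<close>
  one has \<open>1 / \<infinity> = 0\<close> and \<open>1 / 0 = \<infinity>\<close>.\<close>

definition conj_exponent :: "ennreal \<Rightarrow> ennreal" where
  "conj_exponent p = 1 / (1 - 1 / p)"

lemma conj_exponent_sum:
  assumes "1 \<le> p"
  shows "1 / p + 1 / conj_exponent p = 1"
proof -
  have le: "1 / p \<le> 1"
    using assms by (intro divide_le_posI_ennreal) (auto intro: less_le_trans[OF zero_less_one])
  have "1 / conj_exponent p = 1 - 1 / p"
    by (simp add: conj_exponent_def one_divide_one_divide_ennreal)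
  with le show ?thesis
    by (simp add: add_diff_inverse_ennreal)
qed

definition recip :: "ennreal \<Rightarrow> real" where
  "recip p = enn2real (1 / p)"

definition R2 :: "(nat \<Rightarrow> ennreal) \<Rightarrow> real" where
  "R2 p = recip (p 0) + recip (p 1) + recip (p 2) - 1"

text \<open>Only used with \<open>r > 0\<close>, so that \<open>\<infinity>\<^sup>r = \<infinity>\<close> is correct.\<close>

definition ennreal_powr :: "ennreal \<Rightarrow> real \<Rightarrow> ennreal" where
  "ennreal_powr x r = (if x = \<infinity> then \<infinity> else ennreal (enn2real x powr r))"

definition Lp_norm :: "ennreal \<Rightarrow> ('n::euclidean_space \<Rightarrow> ennreal) \<Rightarrow> ennreal" where
  "Lp_norm p f = (if p = \<infinity> then esssup lebesgue f
     else ennreal_powr (\<integral>\<^sup>+x. ennreal_powr (f x) (enn2real p) \<partial>lebesgue) (1 / enn2real p))"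


section \<open>Gelfand--Shilov spaces\<close>

fun partials :: "'n list \<Rightarrow> ('n::euclidean_space \<Rightarrow> complex) \<Rightarrow> 'n \<Rightarrow> complex" where
  "partials [] f = f"
| "partials (b # bs) f = (\<lambda>x. frechet_derivative (partials bs f) (at x) b)"

text \<open>Differentiability of all iterated partial derivatives makes all of them continuous, so this
  is \<open>C\<^sup>\<infinity>\<close>.\<close>

definition smooth :: "('n::euclidean_space \<Rightarrow> complex) \<Rightarrow> bool" where
  "smooth f \<longleftrightarrow> (\<forall>bs. set bs \<subseteq> Basis \<longrightarrow> (\<forall>x. partials bs f differentiable (at x)))"

text \<open>Multi-indices are functions \<open>'n \<Rightarrow> nat\<close> of which only the values on \<^const>\<open>Basis\<close> matter.
  The order in which the partial derivatives are taken is an arbitrary fixed one; it is immaterial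
  for smooth functions.\<close>

definition basis_list :: "'n::euclidean_space list" where
  "basis_list = (SOME bs. set bs = Basis \<and> distinct bs)"

definition mi_deriv :: "('n::euclidean_space \<Rightarrow> nat) \<Rightarrow> ('n \<Rightarrow> complex) \<Rightarrow> 'n \<Rightarrow> complex" where
  "mi_deriv \<alpha> f = partials (concat (map (\<lambda>b. replicate (\<alpha> b) b) basis_list)) f"

definition mi_abs :: "('n::euclidean_space \<Rightarrow> nat) \<Rightarrow> nat" where
  "mi_abs \<alpha> = (\<Sum>b\<in>Basis. \<alpha> b)"

definition mi_fact :: "('n::euclidean_space \<Rightarrow> nat) \<Rightarrow> real" where
  "mi_fact \<alpha> = (\<Prod>b\<in>Basis. fact (\<alpha> b))"

definition mi_power :: "'n::euclidean_space \<Rightarrow> ('n \<Rightarrow> nat) \<Rightarrow> real" where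
  "mi_power x \<beta> = (\<Prod>b\<in>Basis. (x \<bullet> b) ^ \<beta> b)"

definition GS_norm :: "real \<Rightarrow> real \<Rightarrow> ('n::euclidean_space \<Rightarrow> complex) \<Rightarrow> ennreal" where
  "GS_norm s h f = (SUP (x, \<alpha>, \<beta>) \<in> UNIV.
     ennreal (cmod (complex_of_real (mi_power x \<beta>) * mi_deriv \<alpha> f x) /
       (h ^ (mi_abs \<alpha> + mi_abs \<beta>) * mi_fact \<alpha> powr s * mi_fact \<beta> powr s)))"

definition GS_h :: "real \<Rightarrow> real \<Rightarrow> ('n::euclidean_space \<Rightarrow> complex) set" where
  "GS_h s h = {f. smooth f \<and> GS_norm s h f < \<infinity>}"

definition GS :: "real \<Rightarrow> ('n::euclidean_space \<Rightarrow> complex) set" where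
  "GS s = (\<Union>h\<in>{0<..}. GS_h s h)"

text \<open>Neighbourhood base at \<open>0\<close> of the (locally convex) inductive limit topology: the absolutely
  convex sets whose trace on each step \<open>GS_h s h\<close> is a neighbourhood of \<open>0\<close> in that step.\<close>

definition GS_nhd0 :: "real \<Rightarrow> ('n::euclidean_space \<Rightarrow> complex) set \<Rightarrow> bool" where
  "GS_nhd0 s V \<longleftrightarrow> V \<subseteq> GS s \<and>
     (\<forall>f\<in>V. \<forall>g\<in>V. \<forall>a b. cmod a + cmod b \<le> 1 \<longrightarrow> (\<lambda>x. a * f x + b * g x) \<in> V) \<and>
     (\<forall>h>0. \<exists>\<epsilon>>0. \<forall>f\<in>GS_h s h. GS_norm s h f < ennreal \<epsilon> \<longrightarrow> f \<in> V)"

definition GS_open :: "real \<Rightarrow> ('n::euclidean_space \<Rightarrow> complex) set \<Rightarrow> bool" where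
  "GS_open s U \<longleftrightarrow> U \<subseteq> GS s \<and>
     (\<forall>f\<in>U. \<exists>V. GS_nhd0 s V \<and> (\<forall>v\<in>V. (\<lambda>x. f x + v x) \<in> U))"

definition GS_topology :: "real \<Rightarrow> ('n::euclidean_space \<Rightarrow> complex) topology" where
  "GS_topology s = topology (GS_open s)"

lemma GS_nhd0_Int:
  fixes V W :: "('n::euclidean_space \<Rightarrow> complex) set"
  assumes "GS_nhd0 s V" "GS_nhd0 s W"
  shows "GS_nhd0 s (V \<inter> W)"
proof -
  have "\<exists>\<epsilon>>0. \<forall>f\<in>GS_h s h. GS_norm s h f < ennreal \<epsilon> \<longrightarrow> f \<in> V \<inter> W" if h: "h > 0" for h
  proof -
    obtain e1 where e1: "e1 > 0" "\<forall>f\<in>GS_h s h. GS_norm s h f < ennreal e1 \<longrightarrow> f \<in> V"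
      using assms(1)[unfolded GS_nhd0_def, THEN conjunct2, THEN conjunct2] h by blast
    obtain e2 where e2: "e2 > 0" "\<forall>f\<in>GS_h s h. GS_norm s h f < ennreal e2 \<longrightarrow> f \<in> W"
      using assms(2)[unfolded GS_nhd0_def, THEN conjunct2, THEN conjunct2] h by blast
    show ?thesis
    proof (intro exI[of _ "min e1 e2"] conjI ballI impI)
      fix f :: "'n \<Rightarrow> complex" assume f: "f \<in> GS_h s h" "GS_norm s h f < ennreal (min e1 e2)"
      have "ennreal (min e1 e2) \<le> ennreal e1" "ennreal (min e1 e2) \<le> ennreal e2"
        by (auto intro: ennreal_leI)
      with f have "GS_norm s h f < ennreal e1" "GS_norm s h f < ennreal e2"
        by (auto dest: less_le_trans)
      with f e1 e2 show "f \<in> V \<inter> W" by blast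
    qed (use e1 e2 in auto)
  qed
  moreover have "V \<inter> W \<subseteq> GS s"
    using assms(1)[unfolded GS_nhd0_def, THEN conjunct1] by blast
  moreover have "\<forall>f\<in>V \<inter> W. \<forall>g\<in>V \<inter> W. \<forall>a b. cmod a + cmod b \<le> 1 \<longrightarrow>
      (\<lambda>x. a * f x + b * g x) \<in> V \<inter> W"
    using assms[unfolded GS_nhd0_def, THEN conjunct2, THEN conjunct1] by simp
  ultimately show ?thesis
    unfolding GS_nhd0_def by (intro conjI) simp_all
qed

lemma istopology_GS_open: "istopology (GS_open s)"
  unfolding istopology_def
proof (intro conjI allI impI)
  fix U W :: "('n::euclidean_space \<Rightarrow> complex) set"
  assume U: "GS_open s U" and W: "GS_open s W"
  show "GS_open s (U \<inter> W)"
    unfolding GS_open_def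
  proof (intro conjI ballI)
    show "U \<inter> W \<subseteq> GS s" using U unfolding GS_open_def by blast
    fix f assume f: "f \<in> U \<inter> W"
    obtain V1 where V1: "GS_nhd0 s V1" "\<forall>v\<in>V1. (\<lambda>x. f x + v x) \<in> U"
      using U f unfolding GS_open_def by blast
    obtain V2 where V2: "GS_nhd0 s V2" "\<forall>v\<in>V2. (\<lambda>x. f x + v x) \<in> W"
      using W f unfolding GS_open_def by blast
    show "\<exists>V. GS_nhd0 s V \<and> (\<forall>v\<in>V. (\<lambda>x. f x + v x) \<in> U \<inter> W)"
      using GS_nhd0_Int[OF V1(1) V2(1)] V1(2) V2(2) by blast
  qed
next
  fix \<U> :: "('n::euclidean_space \<Rightarrow> complex) set set"
  assume *: "\<forall>U\<in>\<U>. GS_open s U"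
  show "GS_open s (\<Union>\<U>)"
    unfolding GS_open_def
  proof (intro conjI ballI)
    show "\<Union>\<U> \<subseteq> GS s" using * unfolding GS_open_def by blast
    fix f assume "f \<in> \<Union>\<U>"
    then obtain U where "U \<in> \<U>" "f \<in> U" by blast
    with * obtain V where "GS_nhd0 s V" "\<forall>v\<in>V. (\<lambda>x. f x + v x) \<in> U"
      unfolding GS_open_def by blast
    with \<open>U \<in> \<U>\<close> show "\<exists>V. GS_nhd0 s V \<and> (\<forall>v\<in>V. (\<lambda>x. f x + v x) \<in> \<Union>\<U>)"
      by blast
  qed
qed

lemma openin_GS_topology: "openin (GS_topology s) U \<longleftrightarrow> GS_open s U"
  by (simp add: GS_topology_def topology_inverse' istopology_GS_open)


section \<open>Gelfand--Shilov distributions\<close>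

type_synonym 'n distr = "('n \<Rightarrow> complex) \<Rightarrow> complex"

text \<open>A distribution is a functional on all functions that is \<open>0\<close> outside the test function space,
  so that equality and pointwise operations are those of the dual space.\<close>

definition GS_dual :: "real \<Rightarrow> ('n::euclidean_space) distr set" where
  "GS_dual s = {u.
     (\<forall>\<phi>\<in>GS s. \<forall>\<psi>\<in>GS s. u (\<lambda>x. \<phi> x + \<psi> x) = u \<phi> + u \<psi>) \<and>
     (\<forall>c. \<forall>\<phi>\<in>GS s. u (\<lambda>x. c * \<phi> x) = c * u \<phi>) \<and>
     continuous_map (GS_topology s) euclidean u \<and>
     (\<forall>\<phi>. \<phi> \<notin> GS s \<longrightarrow> u \<phi> = 0)}"

abbreviation GS_half :: "('n::euclidean_space \<Rightarrow> complex) set" where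
  "GS_half \<equiv> GS (1 / 2)"

abbreviation GS_half_dual :: "('n::euclidean_space) distr set" where
  "GS_half_dual \<equiv> GS_dual (1 / 2)"

definition distr_of :: "('n::euclidean_space \<Rightarrow> complex) \<Rightarrow> 'n distr" where
  "distr_of f = (\<lambda>\<phi>. if \<phi> \<in> GS_half then (LINT x|lebesgue. f x * \<phi> x) else 0)"

text \<open>The continuous function with which a distribution is identified, if there is one.\<close>

definition fun_of_distr :: "('n::euclidean_space) distr \<Rightarrow> 'n \<Rightarrow> complex" where
  "fun_of_distr u = (THE g. continuous_on UNIV g \<and>
     (\<forall>\<phi>\<in>GS_half. integrable lebesgue (\<lambda>x. g x * \<phi> x)) \<and> distr_of g = u)"

definition distr_mult :: "('n::euclidean_space) distr \<Rightarrow> ('n \<Rightarrow> complex) \<Rightarrow> 'n distr" where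
  "distr_mult u g = (\<lambda>\<phi>. if \<phi> \<in> GS_half then u (\<lambda>x. g x * \<phi> x) else 0)"


section \<open>Weyl product\<close>

text \<open>Points of \<open>\<real>\<^sup>2\<^sup>d\<close> are pairs \<open>(x, \<xi>)\<close> with \<open>x\<close>, \<open>\<xi>\<close> in the \<open>d\<close>-dimensional space \<open>'a\<close>.\<close>

definition weyl_op ::
  "('a::euclidean_space \<times> 'a \<Rightarrow> complex) \<Rightarrow> ('a \<Rightarrow> complex) \<Rightarrow> 'a \<Rightarrow> complex" where
  "weyl_op a f x = complex_of_real (1 / (2 * pi) ^ DIM('a)) *
     (LINT z|lebesgue. (case z of (y, \<xi>) \<Rightarrow>
        a ((1 / 2) *\<^sub>R (x + y), \<xi>) * f y * cis ((x - y) \<bullet> \<xi>)))"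

definition weyl_prod ::
  "('a::euclidean_space \<times> 'a \<Rightarrow> complex) \<Rightarrow> ('a \<times> 'a \<Rightarrow> complex) \<Rightarrow> 'a \<times> 'a \<Rightarrow> complex" where
  "weyl_prod a b =
     (THE c. c \<in> GS_half \<and> (\<forall>f\<in>GS_half. weyl_op c f = weyl_op a (weyl_op b f)))"


section \<open>Symplectic modulation spaces\<close>

definition poly_moderate :: "('n::euclidean_space \<Rightarrow> real) \<Rightarrow> bool" where
  "poly_moderate \<omega> \<longleftrightarrow>
     (\<forall>x. \<omega> x > 0) \<and> \<omega> \<in> borel_measurable lebesgue \<and>
     (\<forall>K. compact K \<longrightarrow> (\<exists>B. AE x in lebesgue. x \<in> K \<longrightarrow> \<bar>\<omega> x\<bar> \<le> B)) \<and>
     (\<exists>C>0. \<exists>s\<ge>0. \<forall>x y. \<omega> (x + y) \<le> C * \<omega> x * (1 + (norm y)\<^sup>2) powr (s / 2))"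

definition symp :: "'a::euclidean_space \<times> 'a \<Rightarrow> 'a \<times> 'a \<Rightarrow> real" where
  "symp X Y = fst Y \<bullet> snd X - fst X \<bullet> snd Y"

definition symp_fourier ::
  "('a::euclidean_space \<times> 'a \<Rightarrow> complex) \<Rightarrow> 'a \<times> 'a \<Rightarrow> complex" where
  "symp_fourier a X = complex_of_real (1 / pi ^ DIM('a)) *
     (LINT Y|lebesgue. a Y * cis (2 * symp X Y))"

text \<open>Extension to distributions by transposition: since \<open>\<sigma>\<close> is antisymmetric, the transpose of
  the symplectic Fourier transform is \<open>\<phi> \<mapsto> (\<F>\<^sub>\<sigma> \<phi>)(- \<cdot>)\<close>.\<close>

definition symp_fourier_distr ::
  "('a::euclidean_space \<times> 'a) distr \<Rightarrow> ('a \<times> 'a) distr" where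
  "symp_fourier_distr u =
     (\<lambda>\<phi>. if \<phi> \<in> GS_half then u (\<lambda>X. symp_fourier \<phi> (- X)) else 0)"

definition symp_stft :: "('a::euclidean_space \<times> 'a \<Rightarrow> complex) \<Rightarrow> ('a \<times> 'a) distr \<Rightarrow>
    'a \<times> 'a \<Rightarrow> 'a \<times> 'a \<Rightarrow> complex" where
  "symp_stft \<Phi> a X Y =
     fun_of_distr (symp_fourier_distr (distr_mult a (\<lambda>Z. cnj (\<Phi> (Z - X))))) Y"

definition modulation_norm :: "('a::euclidean_space \<times> 'a \<Rightarrow> complex) \<Rightarrow> ennreal \<Rightarrow> ennreal \<Rightarrow>
    (('a \<times> 'a) \<times> ('a \<times> 'a) \<Rightarrow> real) \<Rightarrow> ('a \<times> 'a) distr \<Rightarrow> ennreal" where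
  "modulation_norm \<Phi> p q \<omega> a =
     Lp_norm q (\<lambda>Y. Lp_norm p (\<lambda>X.
       ennreal (cmod (symp_stft \<Phi> a X Y * complex_of_real (\<omega> (X, Y))))))"

definition modulation_space :: "('a::euclidean_space \<times> 'a \<Rightarrow> complex) \<Rightarrow> ennreal \<Rightarrow> ennreal \<Rightarrow>
    (('a \<times> 'a) \<times> ('a \<times> 'a) \<Rightarrow> real) \<Rightarrow> ('a \<times> 'a) distr set" where
  "modulation_space \<Phi> p q \<omega> = {a \<in> GS_half_dual. modulation_norm \<Phi> p q \<omega> a < \<infinity>}"

definition modulation_topology :: "('a::euclidean_space \<times> 'a \<Rightarrow> complex) \<Rightarrow> ennreal \<Rightarrow> ennreal \<Rightarrow>
    (('a \<times> 'a) \<times> ('a \<times> 'a) \<Rightarrow> real) \<Rightarrow> ('a \<times> 'a) distr topology" where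
  "modulation_topology \<Phi> p q \<omega> = Metric_space.mtopology (modulation_space \<Phi> p q \<omega>)
     (\<lambda>a b. enn2real (modulation_norm \<Phi> p q \<omega> (\<lambda>\<phi>. a \<phi> - b \<phi>)))"

end

theory Submission
  imports Defs "HOL-Probability.Characteristic_Functions" "HOL-Real_Asymp.Real_Asymp"
begin

text \<open>The operator with Weyl symbol \<open>W\<^sub>u\<^sub>v\<close>, the cross-Wigner distribution of the Gaussians centred at
  \<open>u\<close> and \<open>v\<close>, has rank one, so that \<open>W\<^sub>u\<^sub>v # W\<^sub>v\<^sub>w\<close> is a positive multiple of \<open>W\<^sub>u\<^sub>w\<close>, and the short-time
  Fourier transform of \<open>W\<^sub>u\<^sub>v\<close> is concentrated at the point \<open>(X, Y)\<close> with \<open>X - Y = u\<close> and \<open>X + Y = v\<close>.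
  Hence the coefficients \<open>\<zeta> v / \<eta> u\<close> neutralise the weight \<open>\<eta> (X - Y) / \<zeta> (X + Y)\<close>, and the norm of
  a sum of such symbols, with \<open>u\<close> and \<open>v\<close> running through pairs of integer points of a line, is
  controlled by \<open>A\<^bsup>1/p\<^esup> B\<^bsup>1/q\<^esup>\<close>, where \<open>B\<close> is the number of differences \<open>v - u\<close> and \<open>A\<close> the largest
  number of pairs with the same difference. Continuity of the product, tested against a third sum, bounds
  the number of triangles \<open>(u, v), (v, w), (u, w)\<close> by the product of three such quantities. Diagonal,
  full, linear and one-point sets of pairs of size \<open>N\<close> yield all the inequalities as \<open>N \<rightarrow> \<infinity>\<close>.\<close>

subsection \<open>Iterated partial derivatives\<close>

text \<open>Two obstacles shape the proof. A value of the short-time Fourier transform is a definite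
  description of a continuous representative, so nothing can be computed until a functional is known
  to commute with integrals over characters; and the topology of a modulation space says nothing
  before the metric axioms are proved, which include injectivity of the transform. Both rest on the
  class \<open>gsd\<close>. A continuous functional on an inductive limit is bounded only on each
  step; with Gaussian bounds on all derivatives the step depends on \<open>h\<close> and
  \<open>c\<close> alone, and the bound is linear in \<open>A\<close>. The order 1/2 fits Gaussians:
  a power |x|^k costs sqrt(k!) against a Gaussian. The extended product is a bare continuous map, so
  the test symbols are scaled into a fixed ball around 0 instead of using bilinearity. The
  inequalities appear by comparing a triangle count N^m with N raised to the sum of
  \<open>\<alpha> / p + \<beta> / q\<close> over the three sets.\<close>

lemma partials_append: "partials (bs @ cs) f = partials bs (partials cs f)"
  by (induction bs) auto

lemma smooth_has_derivative:
  assumes "smooth f" "set bs \<subseteq> Basis"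
  shows "(partials bs f has_derivative frechet_derivative (partials bs f) (at x)) (at x)"
  using assms unfolding smooth_def by (simp add: frechet_derivative_works)

lemma smooth_partials:
  assumes "smooth f" "set bs \<subseteq> Basis"
  shows "smooth (partials bs f)"
  using assms by (simp add: smooth_def flip: partials_append)

lemma smooth_continuous:
  assumes "smooth f" "set bs \<subseteq> Basis"
  shows "continuous_on UNIV (partials bs f)"
  using smooth_has_derivative[OF assms]
  by (meson continuous_at_imp_continuous_on has_derivative_continuous)

text \<open>Iterated Frechet derivatives are not computed directly: candidates indexed by lists are
  guessed, one differentiation step is checked, and induction on the list forces agreement. Sums,
  products, translates, characters and integrals are all treated in this way.\<close>

lemma smooth_family:
  fixes f :: "'n::euclidean_space \<Rightarrow> complex"
  assumes "G [] = f"
    and "\<And>bs x. set bs \<subseteq> Basis \<Longrightarrow>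
      \<exists>D. (G bs has_derivative D) (at x) \<and> (\<forall>b\<in>Basis. D b = G (b # bs) x)"
  shows "smooth f" "set bs \<subseteq> Basis \<Longrightarrow> partials bs f = G bs"
proof -
  have *: "set bs \<subseteq> Basis \<Longrightarrow> partials bs f = G bs" for bs
  proof (induction bs)
    case (Cons b bs)
    then have "partials (b # bs) f x = G (b # bs) x" for x
      using assms(2)[of bs x] frechet_derivative_at[of "G bs" _ x] by force
    then show ?case by blast
  qed (simp add: assms)
  then show "set bs \<subseteq> Basis \<Longrightarrow> partials bs f = G bs" .
  show "smooth f"
    unfolding smooth_def using * assms(2) by (metis differentiableI)
qed

text \<open>The quotient is symmetric in \<open>a\<close> and \<open>b\<close>, so identifying its
  limit with a second derivative in one order yields the equality of mixed partials by exchanging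
  the roles. The mean value inequality runs in direction \<open>a\<close> on the increment in
  direction \<open>b\<close>; the expansion of \<open>f' y a\<close> at \<open>x\<close> does the
  rest.\<close>

lemma second_difference_tendsto:
  fixes f :: "'n::euclidean_space \<Rightarrow> complex"
  assumes f: "\<And>y. (f has_derivative f' y) (at y)"
    and D: "((\<lambda>y. f' y a) has_derivative D) (at x)"
  shows "((\<lambda>h. (f (x + h *\<^sub>R a + h *\<^sub>R b) - f (x + h *\<^sub>R a) - f (x + h *\<^sub>R b) + f x) /
     complex_of_real (h\<^sup>2)) \<longlongrightarrow> D b) (at_right 0)"
proof (rule tendstoI)
  fix e :: real assume "e > 0"
  \<comment> \<open>All points involved stay within \<open>h * m\<close> of \<open>x\<close>. Two
    expansion errors \<open>e' * (h * m)\<close> over a segment of length \<open>h\<close> then add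
    up to \<open>h\<^sup>2 * (e / 2)\<close>.\<close>
  define m where "m = norm a + norm b + 1"
  have m: "m > 0" by (simp add: m_def add_nonneg_pos)
  define e' where "e' = e / (4 * m)"
  have e': "e' > 0" using \<open>e > 0\<close> m by (simp add: e'_def)
  interpret D: bounded_linear D using D by (rule has_derivative_bounded_linear)
  obtain d where d: "d > 0" "\<And>y. norm (y - x) < d \<Longrightarrow>
      norm (f' y a - f' x a - D (y - x)) \<le> e' * norm (y - x)"
    using D e' unfolding has_derivative_at_alt by blast
  have d2: "norm (f' (x + v) a - f' x a - D v) \<le> e' * t" if "norm v \<le> t" "t < d" for v t
    using order_trans[OF d(2)[of "x + v", simplified] mult_left_mono[OF that(1), of e']] that e' by simp
  have "dist ((f (x + h *\<^sub>R a + h *\<^sub>R b) - f (x + h *\<^sub>R a) - f (x + h *\<^sub>R b) + f x) /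
      complex_of_real (h\<^sup>2)) (D b) < e" if h: "0 < h" "h < d / m" for h
  proof -
    have hm: "h * m < d" using h m by (simp add: field_simps)
    \<comment> \<open>The increment in direction \<open>b\<close> minus its expected linear part, so
      that the derivative in \<open>s\<close> is uniformly small on \<open>{0..h}\<close>.\<close>
    define \<phi> where "\<phi> s = f (x + s *\<^sub>R a + h *\<^sub>R b) - f (x + s *\<^sub>R a) - s *\<^sub>R (h *\<^sub>R D b)" for s
    define \<phi>' where "\<phi>' s t = t *\<^sub>R (f' (x + s *\<^sub>R a + h *\<^sub>R b) a - f' (x + s *\<^sub>R a) a - h *\<^sub>R D b)" for s t
    have "norm (\<phi> h - \<phi> 0) \<le> (2 * e' * (h * m)) * norm (h - 0)"
    proof (rule differentiable_bound[of "{0..h}" \<phi> \<phi>'])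
      fix s assume s: "s \<in> {0..h}"
      have lin: "f' y (t *\<^sub>R a) = t *\<^sub>R f' y a" for y t
        using has_derivative_bounded_linear[OF f[of y]] by (simp add: linear_simps)
      have c: "((\<lambda>s. f (x + s *\<^sub>R a + w)) has_derivative (\<lambda>t. f' (x + s *\<^sub>R a + w) (t *\<^sub>R a))) (at s within {0..h})" for w
        by (rule has_derivative_compose[OF _ f, of "\<lambda>s. x + s *\<^sub>R a + w"])
          (auto intro!: derivative_eq_intros)
      show "(\<phi> has_derivative \<phi>' s) (at s within {0..h})"
        unfolding \<phi>_def \<phi>'_def
        by (rule derivative_eq_intros c c[of 0, simplified] refl)+
          (auto simp: lin scaleR_diff_right)
      have n: "norm (s *\<^sub>R a + h *\<^sub>R b) \<le> h * m" "norm (s *\<^sub>R a) \<le> h * m"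
      proof -
        have "norm (s *\<^sub>R a) \<le> h * norm a" using s by (simp add: mult_right_mono)
        moreover have "norm (h *\<^sub>R b) = h * norm b" using h by simp
        moreover have "h * m = h * norm a + h * norm b + h" by (simp add: m_def algebra_simps)
        moreover have "norm (s *\<^sub>R a + h *\<^sub>R b) \<le> norm (s *\<^sub>R a) + norm (h *\<^sub>R b)"
          by (rule norm_triangle_ineq)
        moreover have "0 \<le> h * norm b" using h by simp
        ultimately show "norm (s *\<^sub>R a + h *\<^sub>R b) \<le> h * m" "norm (s *\<^sub>R a) \<le> h * m"
          using h by linarith+
      qed
      have b1: "norm (f' (x + s *\<^sub>R a + h *\<^sub>R b) a - f' x a - D (s *\<^sub>R a + h *\<^sub>R b)) \<le> e' * (h * m)"
        using d2[OF n(1) hm] by (simp add: add.assoc)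
      have b2: "norm (f' (x + s *\<^sub>R a) a - f' x a - D (s *\<^sub>R a)) \<le> e' * (h * m)"
        using d2[OF n(2) hm] .
      have "norm (f' (x + s *\<^sub>R a + h *\<^sub>R b) a - f' (x + s *\<^sub>R a) a - h *\<^sub>R D b) \<le> 2 * e' * (h * m)"
        using norm_triangle_ineq4[of "f' (x + s *\<^sub>R a + h *\<^sub>R b) a - f' x a - D (s *\<^sub>R a + h *\<^sub>R b)"
            "f' (x + s *\<^sub>R a) a - f' x a - D (s *\<^sub>R a)"] b1 b2
        by (simp add: D.add D.scaleR algebra_simps)
      then show "onorm (\<phi>' s) \<le> 2 * e' * (h * m)"
        unfolding \<phi>'_def using h m e'
        by (intro onorm_le) (auto simp: mult.commute intro!: mult_left_mono)
    qed (use h in auto)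
    also have "\<dots> = h\<^sup>2 * (e / 2)"
      using h m by (simp add: e'_def power2_eq_square field_simps)
    finally have "norm (\<phi> h - \<phi> 0) \<le> h\<^sup>2 * (e / 2)" .
    moreover have "\<phi> h - \<phi> 0 = (f (x + h *\<^sub>R a + h *\<^sub>R b) - f (x + h *\<^sub>R a) - f (x + h *\<^sub>R b) + f x)
       - complex_of_real (h\<^sup>2) * D b"
      by (simp add: \<phi>_def scaleR_conv_of_real power2_eq_square)
    ultimately have "norm (((f (x + h *\<^sub>R a + h *\<^sub>R b) - f (x + h *\<^sub>R a) - f (x + h *\<^sub>R b) + f x)
       - complex_of_real (h\<^sup>2) * D b) / complex_of_real (h\<^sup>2)) \<le> e / 2"
      using h by (simp add: norm_divide norm_power divide_le_eq mult.commute)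
    then show ?thesis
      using h \<open>e > 0\<close> by (simp add: dist_norm diff_divide_distrib)
  qed
  then show "\<forall>\<^sub>F h in at_right 0. dist ((f (x + h *\<^sub>R a + h *\<^sub>R b) - f (x + h *\<^sub>R a) - f (x + h *\<^sub>R b) + f x) /
      complex_of_real (h\<^sup>2)) (D b) < e"
    using d(1) m by (intro eventually_at_rightI[of 0 "d / m"]) auto
qed

lemma partials_swap:
  assumes f: "smooth f" and ab: "a \<in> Basis" "b \<in> Basis" and cs: "set cs \<subseteq> Basis"
  shows "partials (a # b # cs) f = partials (b # a # cs) f"
proof
  fix x
  let ?g = "partials cs f"
  note g = smooth_has_derivative[OF f cs]
  have 1: "((\<lambda>y. frechet_derivative ?g (at y) c) has_derivative
      frechet_derivative (partials (c # cs) f) (at x)) (at x)" if "c \<in> Basis" for c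
    using smooth_has_derivative[OF f, of "c # cs" x] that cs by simp
  have "((\<lambda>h. (?g (x + h *\<^sub>R a + h *\<^sub>R b) - ?g (x + h *\<^sub>R a) - ?g (x + h *\<^sub>R b) + ?g x) /
     complex_of_real (h\<^sup>2)) \<longlongrightarrow> frechet_derivative (partials (b # cs) f) (at x) a) (at_right 0)"
    by (rule tendsto_eq_rhs[OF tendsto_cong[THEN iffD1, OF _ second_difference_tendsto[OF g 1[OF ab(2)], of a]]])
      (simp_all add: add_ac)
  from tendsto_unique[OF trivial_limit_at_right_real this second_difference_tendsto[OF g 1[OF ab(1)], of b]]
  show "partials (a # b # cs) f x = partials (b # a # cs) f x" by simp
qed

text \<open>The bridge between \<open>mi_deriv\<close>, which differentiates in one fixed order, and
  the arbitrary lists in \<open>gsd\<close>. The head letter of one list is located in the other and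
  moved to its front by adjacent swaps.\<close>

lemma partials_perm:
  assumes "smooth f" "mset bs = mset cs" "set bs \<subseteq> Basis"
  shows "partials bs f = partials cs f"
  using assms(2,3)
proof (induction bs arbitrary: cs)
  case (Cons b bs)
  then have "b \<in> set cs" using mset_eq_setD by fastforce
  then obtain us vs where cs: "cs = us @ b # vs" by (meson split_list)
  have sub: "set us \<subseteq> Basis" "set vs \<subseteq> Basis"
    using Cons.prems cs mset_eq_setD[OF Cons.prems(1)] by auto
  have "set us \<subseteq> Basis \<Longrightarrow> partials (us @ b # vs) f = partials (b # us @ vs) f"
  proof (induction us)
    case (Cons u us)
    then have "partials ((u # us) @ b # vs) f = partials (u # b # us @ vs) f" by simp
    also have "\<dots> = partials (b # u # us @ vs) f"
      using Cons.prems Cons.prems \<open>set (b # bs) \<subseteq> Basis\<close> sub(2) by (intro partials_swap assms(1)) auto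
    finally show ?case by simp
  qed auto
  moreover have "partials bs f = partials (us @ vs) f"
    using Cons.prems cs by (intro Cons.IH) auto
  ultimately show ?case using sub cs by simp
qed auto

subsection \<open>Gaussian bounds on all derivatives\<close>

lemma power_div_fact_le_exp:
  fixes x :: real
  assumes "x \<ge> 0"
  shows "x ^ k / fact k \<le> exp x"
proof -
  have "(\<Sum>n\<in>{k}. x ^ n /\<^sub>R fact n) \<le> (\<Sum>n. x ^ n /\<^sub>R fact n)"
    using assms summable_exp_generic[of x] by (intro sum_le_suminf) auto
  then show ?thesis by (simp add: exp_def divide_inverse mult.commute)
qed

text \<open>After squaring, a single term of the exponential series of
  \<open>\<eta>\<^sup>2 * t\<^sup>2\<close>. The free parameter trades the geometric rate
  \<open>1 / \<eta>\<close> against the Gaussian exponent; every exchange between powers, square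
  roots of factorials and Gaussians goes through this estimate.\<close>

lemma power_le_gauss:
  fixes t \<eta> :: real
  assumes "t \<ge> 0" "\<eta> > 0"
  shows "t ^ k \<le> sqrt (fact k) * (1 / \<eta>) ^ k * exp (\<eta>\<^sup>2 * t\<^sup>2 / 2)"
proof (rule power2_le_imp_le)
  have "(\<eta>\<^sup>2 * t\<^sup>2) ^ k / fact k \<le> exp (\<eta>\<^sup>2 * t\<^sup>2)"
    by (rule power_div_fact_le_exp) simp
  then have "(\<eta> ^ k)\<^sup>2 * (t ^ k)\<^sup>2 \<le> fact k * exp (\<eta>\<^sup>2 * t\<^sup>2)"
    by (simp add: field_simps power_mult_distrib flip: power_mult)
  then have "(t ^ k)\<^sup>2 \<le> fact k * exp (\<eta>\<^sup>2 * t\<^sup>2) / (\<eta> ^ k)\<^sup>2"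
    using assms by (simp add: field_simps)
  also have "\<dots> = (sqrt (fact k) * (1 / \<eta>) ^ k * exp (\<eta>\<^sup>2 * t\<^sup>2 / 2))\<^sup>2"
  proof -
    have "(exp (\<eta>\<^sup>2 * t\<^sup>2 / 2))\<^sup>2 = exp (\<eta>\<^sup>2 * t\<^sup>2)"
      by (simp add: power2_eq_square flip: exp_add)
    then show ?thesis by (simp add: power_mult_distrib power_divide)
  qed
  finally show "(t ^ k)\<^sup>2 \<le> (sqrt (fact k) * (1 / \<eta>) ^ k * exp (\<eta>\<^sup>2 * t\<^sup>2 / 2))\<^sup>2" .
qed (use assms in simp)

text \<open>A quantitative form of the space of order 1/2, with amplitude \<open>A\<close>,
  geometric rate \<open>h\<close> and Gaussian decay \<open>c\<close>. A negative \<open>c\<close>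
  expresses bounded growth. Lists of directions replace multi-indices so that differentiation is
  plain recursion; the factorial of the total order differs from \<open>mi_fact\<close> only by a
  geometric factor.\<close>

definition gsd :: "real \<Rightarrow> real \<Rightarrow> real \<Rightarrow> ('n::euclidean_space \<Rightarrow> complex) \<Rightarrow> bool" where
  "gsd A h c f \<longleftrightarrow> smooth f \<and> (\<forall>bs x. set bs \<subseteq> Basis \<longrightarrow>
     cmod (partials bs f x) \<le> A * h ^ length bs * sqrt (fact (length bs)) * exp (- c * (norm x)\<^sup>2))"

lemma gsd_smooth: "gsd A h c f \<Longrightarrow> smooth f"
  by (simp add: gsd_def)

lemma gsd_bound:
  "gsd A h c f \<Longrightarrow> set bs \<subseteq> Basis \<Longrightarrow>
    cmod (partials bs f x) \<le> A * h ^ length bs * sqrt (fact (length bs)) * exp (- c * (norm x)\<^sup>2)"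
  by (simp add: gsd_def)

lemma gsd_bound0: "gsd A h c f \<Longrightarrow> cmod (f x) \<le> A * exp (- c * (norm x)\<^sup>2)"
  using gsd_bound[of A h c f "[]" x] by simp

lemma gsd_nonneg:
  assumes "gsd A h c f" shows "0 \<le> A"
proof -
  have "0 \<le> A * exp (- c * (norm (0::'a))\<^sup>2)"
    using order_trans[OF norm_ge_zero gsd_bound0[OF assms]] .
  then show ?thesis by simp
qed

lemma gsd_continuous: "gsd A h c f \<Longrightarrow> continuous_on UNIV f"
  using smooth_continuous[of f "[]"] by (simp add: gsd_smooth)

lemma gsd_mono:
  assumes "gsd A h c f" "A \<le> A'" "0 \<le> h" "h \<le> h'" "c' \<le> c"
  shows "gsd A' h' c' f"
  unfolding gsd_def
proof (intro conjI allI impI)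
  fix bs :: "'a list" and x :: 'a assume bs: "set bs \<subseteq> Basis"
  have "A * h ^ length bs * sqrt (fact (length bs)) * exp (- c * (norm x)\<^sup>2)
     \<le> A' * h' ^ length bs * sqrt (fact (length bs)) * exp (- c' * (norm x)\<^sup>2)"
    using assms gsd_nonneg[OF assms(1)]
    by (intro mult_mono power_mono) (auto intro: mult_right_mono)
  with gsd_bound[OF assms(1) bs, of x]
  show "cmod (partials bs f x) \<le> A' * h' ^ length bs * sqrt (fact (length bs)) * exp (- c' * (norm x)\<^sup>2)"
    by linarith
qed (use assms in \<open>auto simp: gsd_def\<close>)

lemma gsd_family:
  fixes f :: "'n::euclidean_space \<Rightarrow> complex"
  assumes "G [] = f"
    and "\<And>bs x. set bs \<subseteq> Basis \<Longrightarrow>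
      \<exists>D. (G bs has_derivative D) (at x) \<and> (\<forall>b\<in>Basis. D b = G (b # bs) x)"
    and "\<And>bs x. set bs \<subseteq> Basis \<Longrightarrow>
      cmod (G bs x) \<le> A * h ^ length bs * sqrt (fact (length bs)) * exp (- c * (norm x)\<^sup>2)"
  shows "gsd A h c f"
  unfolding gsd_def using assms(3) smooth_family[of G f, OF assms(1,2)] by simp

section \<open>Sums, multiples, translates and reflections under Gaussian bounds\<close>

lemma partials_add:
  assumes "smooth f" "smooth g"
  shows "smooth (\<lambda>x. f x + g x)"
    "set bs \<subseteq> Basis \<Longrightarrow> partials bs (\<lambda>x. f x + g x) = (\<lambda>x. partials bs f x + partials bs g x)"
proof -
  have *: "\<exists>D. ((\<lambda>x. partials bs f x + partials bs g x) has_derivative D) (at x) \<and>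
     (\<forall>b\<in>Basis. D b = partials (b # bs) f x + partials (b # bs) g x)" if "set bs \<subseteq> Basis" for bs x
    using has_derivative_add[OF smooth_has_derivative smooth_has_derivative, OF assms(1) that assms(2) that]
    by auto
  show "smooth (\<lambda>x. f x + g x)"
    "set bs \<subseteq> Basis \<Longrightarrow> partials bs (\<lambda>x. f x + g x) = (\<lambda>x. partials bs f x + partials bs g x)"
    using smooth_family[of "\<lambda>bs x. partials bs f x + partials bs g x", OF _ *] by auto
qed

lemma partials_cmult:
  assumes "smooth f"
  shows "smooth (\<lambda>x. a * f x)"
    "set bs \<subseteq> Basis \<Longrightarrow> partials bs (\<lambda>x. a * f x) = (\<lambda>x. a * partials bs f x)"
proof -
  have *: "\<exists>D. ((\<lambda>x. a * partials bs f x) has_derivative D) (at x) \<and>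
     (\<forall>b\<in>Basis. D b = a * partials (b # bs) f x)" if "set bs \<subseteq> Basis" for bs x
    using has_derivative_mult_right[OF smooth_has_derivative, OF assms that] by fastforce
  show "smooth (\<lambda>x. a * f x)"
    "set bs \<subseteq> Basis \<Longrightarrow> partials bs (\<lambda>x. a * f x) = (\<lambda>x. a * partials bs f x)"
    using smooth_family[of "\<lambda>bs x. a * partials bs f x", OF _ *] by auto
qed

lemma gsd_add:
  assumes "gsd A h c f" "gsd B h c g"
  shows "gsd (A + B) h c (\<lambda>x. f x + g x)"
  unfolding gsd_def
proof (intro conjI allI impI)
  fix bs :: "'a list" and x :: 'a assume bs: "set bs \<subseteq> Basis"
  show "cmod (partials bs (\<lambda>x. f x + g x) x)
    \<le> (A + B) * h ^ length bs * sqrt (fact (length bs)) * exp (- c * (norm x)\<^sup>2)"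
    using norm_triangle_le[OF add_mono[OF assms[THEN gsd_bound, OF bs]], of x]
    by (simp add: partials_add(2)[OF assms[THEN gsd_smooth] bs] algebra_simps)
qed (use assms in \<open>simp add: partials_add gsd_smooth\<close>)

lemma gsd_cmult:
  assumes "gsd A h c f"
  shows "gsd (cmod a * A) h c (\<lambda>x. a * f x)"
  unfolding gsd_def
proof (intro conjI allI impI)
  fix bs :: "'a list" and x :: 'a assume bs: "set bs \<subseteq> Basis"
  show "cmod (partials bs (\<lambda>x. a * f x) x)
    \<le> cmod a * A * h ^ length bs * sqrt (fact (length bs)) * exp (- c * (norm x)\<^sup>2)"
    using mult_left_mono[OF gsd_bound[OF assms bs, of x], of "cmod a"]
    by (simp add: partials_cmult(2)[OF assms[THEN gsd_smooth] bs] norm_mult mult.assoc)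
qed (use assms in \<open>simp add: partials_cmult gsd_smooth\<close>)

lemma gsd_cnj:
  assumes "gsd A h c f"
  shows "gsd A h c (\<lambda>x. cnj (f x))"
proof (rule gsd_family[where G = "\<lambda>bs x. cnj (partials bs f x)"])
  fix bs :: "'a list" and x :: 'a assume "set bs \<subseteq> Basis"
  then show "\<exists>D. ((\<lambda>x. cnj (partials bs f x)) has_derivative D) (at x) \<and>
     (\<forall>b\<in>Basis. D b = cnj (partials (b # bs) f x))"
    using has_derivative_cnj[OF smooth_has_derivative[OF gsd_smooth[OF assms]], of bs x] by auto
qed (use gsd_bound[OF assms] in auto)

lemma gsd_translate:
  assumes "gsd A h c f" "0 \<le> h"
    and "\<And>x. A * exp (- c * (norm (x - X))\<^sup>2) \<le> A' * exp (- c' * (norm x)\<^sup>2)"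
  shows "gsd A' h c' (\<lambda>x. f (x - X))"
proof (rule gsd_family[where G = "\<lambda>bs x. partials bs f (x - X)"])
  fix bs :: "'a list" and x :: 'a assume bs: "set bs \<subseteq> Basis"
  have d: "((\<lambda>x. x - X) has_derivative (\<lambda>v. v)) (at x)"
    by (auto intro!: derivative_eq_intros)
  have "((\<lambda>x. partials bs f (x - X)) has_derivative frechet_derivative (partials bs f) (at (x - X))) (at x)"
    by (rule has_derivative_compose[OF d smooth_has_derivative[OF gsd_smooth[OF assms(1)] bs]])
  then show "\<exists>D. ((\<lambda>x. partials bs f (x - X)) has_derivative D) (at x) \<and>
     (\<forall>b\<in>Basis. D b = partials (b # bs) f (x - X))"
    by auto
  have "cmod (partials bs f (x - X)) \<le> (A * exp (- c * (norm (x - X))\<^sup>2)) * (h ^ length bs * sqrt (fact (length bs)))"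
    using gsd_bound[OF assms(1) bs, of "x - X"] by (simp add: mult_ac)
  also have "\<dots> \<le> (A' * exp (- c' * (norm x)\<^sup>2)) * (h ^ length bs * sqrt (fact (length bs)))"
    using assms(2,3) by (intro mult_right_mono) auto
  finally show "cmod (partials bs f (x - X))
    \<le> A' * h ^ length bs * sqrt (fact (length bs)) * exp (- c' * (norm x)\<^sup>2)"
    by (simp add: mult_ac)
qed auto

lemma norm_diff_sq_ge: "(norm (x - y))\<^sup>2 \<ge> (norm x)\<^sup>2 / 2 - (norm y)\<^sup>2" for x y :: "'n::real_inner"
proof -
  have "0 \<le> (norm (x - 2 *\<^sub>R y))\<^sup>2" by simp
  then show ?thesis
    by (simp add: power2_norm_eq_inner algebra_simps inner_commute)
qed

lemma gsd_translate_decay: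
  assumes "gsd A h c f" "0 \<le> h" "0 \<le> c"
  shows "gsd (A * exp (c * (norm X)\<^sup>2)) h (c / 2) (\<lambda>x. f (x - X))"
proof (rule gsd_translate[OF assms(1,2)])
  fix x
  have "- c * (norm (x - X))\<^sup>2 \<le> c * (norm X)\<^sup>2 + - (c / 2) * (norm x)\<^sup>2"
    using mult_left_mono[OF norm_diff_sq_ge[of x X] assms(3)] by (simp add: algebra_simps)
  then show "A * exp (- c * (norm (x - X))\<^sup>2) \<le> A * exp (c * (norm X)\<^sup>2) * exp (- (c / 2) * (norm x)\<^sup>2)"
    using gsd_nonneg[OF assms(1)] by (simp add: mult_left_mono mult.assoc flip: exp_add)
qed

lemma gsd_translate_growth:
  assumes "gsd A h c f" "0 \<le> h" "0 \<le> c"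
  shows "gsd (A * exp (- (c / 2) * (norm X)\<^sup>2)) h (- c) (\<lambda>x. f (x - X))"
proof (rule gsd_translate[OF assms(1,2)])
  fix x
  have "- c * (norm (x - X))\<^sup>2 \<le> - (c / 2) * (norm X)\<^sup>2 + c * (norm x)\<^sup>2"
    using mult_left_mono[OF norm_diff_sq_ge[of X x] assms(3)]
    by (simp add: algebra_simps norm_minus_commute)
  then show "A * exp (- c * (norm (x - X))\<^sup>2) \<le> A * exp (- (c / 2) * (norm X)\<^sup>2) * exp (- (- c) * (norm x)\<^sup>2)"
    using gsd_nonneg[OF assms(1)] by (simp add: mult_left_mono mult.assoc flip: exp_add)
qed

lemma gsd_reflect:
  assumes "gsd A h c f"
  shows "gsd A h c (\<lambda>x. f (- x))"
proof (rule gsd_family[where G = "\<lambda>bs x. (- 1) ^ length bs * partials bs f (- x)"])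
  fix bs :: "'a list" and x :: 'a assume bs: "set bs \<subseteq> Basis"
  note d = smooth_has_derivative[OF gsd_smooth[OF assms] bs, of "- x"]
  have m: "((\<lambda>x. - x) has_derivative (\<lambda>v. - v)) (at x)"
    by (auto intro!: derivative_eq_intros)
  have "((\<lambda>x. partials bs f (- x)) has_derivative (\<lambda>v. frechet_derivative (partials bs f) (at (- x)) (- v))) (at x)"
    by (rule has_derivative_compose[OF m d])
  from has_derivative_mult_right[OF this, of "(- 1) ^ length bs"]
  show "\<exists>D. ((\<lambda>x. (- 1) ^ length bs * partials bs f (- x)) has_derivative D) (at x) \<and>
     (\<forall>b\<in>Basis. D b = (- 1) ^ length (b # bs) * partials (b # bs) f (- x))"
    using has_derivative_bounded_linear[OF d] by (force simp: linear_simps)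
  show "cmod ((- 1) ^ length bs * partials bs f (- x))
    \<le> A * h ^ length bs * sqrt (fact (length bs)) * exp (- c * (norm x)\<^sup>2)"
    using gsd_bound[OF assms bs, of "- x"] by (simp add: norm_mult norm_power)
qed auto

text \<open>All ways of distributing a list of derivatives over two factors, with repetition.
  Leibniz' rule becomes a plain sum of \<open>2 ^ length bs\<close> terms without binomial
  coefficients.\<close>

fun splits :: "'a list \<Rightarrow> ('a list \<times> 'a list) list" where
  "splits [] = [([], [])]"
| "splits (b # bs) = map (\<lambda>(p, q). (b # p, q)) (splits bs) @ map (\<lambda>(p, q). (p, b # q)) (splits bs)"

lemma length_splits: "length (splits bs) = 2 ^ length bs"
  by (induction bs) auto

lemma splits_mem: "(p, q) \<in> set (splits bs) \<Longrightarrow>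
    length p + length q = length bs \<and> set p \<subseteq> set bs \<and> set q \<subseteq> set bs"
  by (induction bs arbitrary: p q) fastforce+

lemma has_derivative_sum_list:
  assumes "\<And>z. z \<in> set zs \<Longrightarrow> (F z has_derivative D z) (at x)"
  shows "((\<lambda>x. \<Sum>z\<leftarrow>zs. F z x) has_derivative (\<lambda>v. \<Sum>z\<leftarrow>zs. D z v)) (at x)"
  using assms by (induction zs) (auto intro!: derivative_intros)

lemma norm_sum_list_le:
  fixes F :: "'a \<Rightarrow> 'b::real_normed_vector"
    and B :: real
  assumes "\<And>z. z \<in> set zs \<Longrightarrow> norm (F z) \<le> B"
  shows "norm (\<Sum>z\<leftarrow>zs. F z) \<le> length zs * B"
  using assms
proof (induction zs)
  case (Cons z zs)
  then have "norm (F z + (\<Sum>z\<leftarrow>zs. F z)) \<le> B + length zs * B"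
    by (intro norm_triangle_le add_mono) auto
  then show ?case by (simp add: algebra_simps)
qed simp

lemma partials_mult:
  assumes "smooth f" "smooth g"
  shows "smooth (\<lambda>x. f x * g x)"
    "set bs \<subseteq> Basis \<Longrightarrow> partials bs (\<lambda>x. f x * g x) =
       (\<lambda>x. \<Sum>(p, q)\<leftarrow>splits bs. partials p f x * partials q g x)"
proof -
  let ?G = "\<lambda>bs x. \<Sum>(p, q)\<leftarrow>splits bs. partials p f x * partials q g x"
  have *: "\<exists>D. (?G bs has_derivative D) (at x) \<and> (\<forall>b\<in>Basis. D b = ?G (b # bs) x)"
    if bs: "set bs \<subseteq> Basis" for bs x
  proof (intro exI conjI ballI)
    show "(?G bs has_derivative (\<lambda>v. \<Sum>(p, q)\<leftarrow>splits bs. partials p f x * frechet_derivative (partials q g) (at x) v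
        + frechet_derivative (partials p f) (at x) v * partials q g x)) (at x)"
      unfolding split_def
    proof (rule has_derivative_sum_list)
      fix z assume z: "z \<in> set (splits bs)"
      have s: "set (fst z) \<subseteq> Basis" "set (snd z) \<subseteq> Basis"
        using splits_mem[of "fst z" "snd z" bs] z bs by auto
      show "((\<lambda>x. partials (fst z) f x * partials (snd z) g x) has_derivative
         (\<lambda>v. partials (fst z) f x * frechet_derivative (partials (snd z) g) (at x) v +
              frechet_derivative (partials (fst z) f) (at x) v * partials (snd z) g x)) (at x)"
        by (rule has_derivative_mult[OF smooth_has_derivative[OF assms(1) s(1)] smooth_has_derivative[OF assms(2) s(2)]])
    qed
    fix b
    show "(\<Sum>(p, q)\<leftarrow>splits bs. partials p f x * frechet_derivative (partials q g) (at x) b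
        + frechet_derivative (partials p f) (at x) b * partials q g x) = ?G (b # bs) x"
      by (simp add: split_def comp_def sum_list_addf add.commute)
  qed
  show "smooth (\<lambda>x. f x * g x)"
    by (rule smooth_family(1)[where G = ?G, OF _ *]) simp_all
  show "set bs \<subseteq> Basis \<Longrightarrow> partials bs (\<lambda>x. f x * g x) = ?G bs"
    by (rule smooth_family(2)[where G = ?G, OF _ *]) simp_all
qed

lemma fact_mult_le: "fact m * fact n \<le> (fact (m + n) :: real)"
proof -
  have "fact m * fact n \<le> (fact (m + n) :: nat)"
    by (intro dvd_imp_le fact_fact_dvd_fact) simp
  then show ?thesis by (metis of_nat_fact of_nat_le_iff of_nat_mult)
qed

text \<open>The \<open>2 ^ length bs\<close> Leibniz terms are paid for by doubling the rate, and
  \<open>fact m * fact n \<le> fact (m + n)\<close> recombines the factorials. Decay parameters add,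
  so a growing factor may be compensated by a decaying one.\<close>

lemma gsd_mult:
  assumes f: "gsd A h c f" and g: "gsd B h e g" and h: "0 \<le> h"
  shows "gsd (A * B) (2 * h) (c + e) (\<lambda>x. f x * g x)"
  unfolding gsd_def
proof (intro conjI allI impI)
  fix bs :: "'a list" and x :: 'a assume bs: "set bs \<subseteq> Basis"
  have "cmod (\<Sum>(p, q)\<leftarrow>splits bs. partials p f x * partials q g x)
    \<le> length (splits bs) * (A * B * h ^ length bs * sqrt (fact (length bs)) * exp (- (c + e) * (norm x)\<^sup>2))"
    unfolding split_def
  proof (rule norm_sum_list_le)
    fix z assume z: "z \<in> set (splits bs)"
    have s: "set (fst z) \<subseteq> Basis" "set (snd z) \<subseteq> Basis" and l: "length bs = length (fst z) + length (snd z)"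
      using splits_mem[of "fst z" "snd z" bs] z bs by auto
    let ?p = "length (fst z)" and ?q = "length (snd z)"
    have AB: "0 \<le> A" "0 \<le> B" using f g gsd_nonneg by auto
    have "cmod (partials (fst z) f x * partials (snd z) g x)
      \<le> (A * h ^ ?p * sqrt (fact ?p) * exp (- c * (norm x)\<^sup>2)) * (B * h ^ ?q * sqrt (fact ?q) * exp (- e * (norm x)\<^sup>2))"
      unfolding norm_mult using h AB by (intro mult_mono gsd_bound[OF f s(1)] gsd_bound[OF g s(2)]) auto
    also have "\<dots> = A * B * h ^ length bs * sqrt (fact ?p * fact ?q) * exp (- (c + e) * (norm x)\<^sup>2)"
      by (simp add: l power_add real_sqrt_mult ring_distribs exp_add flip: exp_minus)
        (simp add: exp_diff exp_minus field_simps)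
    also have "\<dots> \<le> A * B * h ^ length bs * sqrt (fact (length bs)) * exp (- (c + e) * (norm x)\<^sup>2)"
      using AB h fact_mult_le[of ?p ?q] unfolding l by (intro mult_left_mono mult_right_mono) auto
    finally show "cmod (partials (fst z) f x * partials (snd z) g x) \<le>
      A * B * h ^ length bs * sqrt (fact (length bs)) * exp (- (c + e) * (norm x)\<^sup>2)" .
  qed
  then show "cmod (partials bs (\<lambda>x. f x * g x) x)
    \<le> A * B * (2 * h) ^ length bs * sqrt (fact (length bs)) * exp (- (c + e) * (norm x)\<^sup>2)"
    using partials_mult(2)[OF f[THEN gsd_smooth] g[THEN gsd_smooth] bs]
    by (simp add: length_splits power_mult_distrib mult_ac)
qed (use assms in \<open>simp add: partials_mult gsd_smooth\<close>)

lemma gsd_mult':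
  assumes f: "gsd A h c f" and g: "gsd B k e g" and h: "0 \<le> h" "0 \<le> k"
  shows "gsd (A * B) (2 * max h k) (c + e) (\<lambda>x. f x * g x)"
  using h by (intro gsd_mult gsd_mono[OF f] gsd_mono[OF g]) auto

section \<open>Characters and differences of characters\<close>

fun basis_prod :: "'n::euclidean_space list \<Rightarrow> 'n \<Rightarrow> real" where
  "basis_prod [] v = 1"
| "basis_prod (b # bs) v = (v \<bullet> b) * basis_prod bs v"

lemma abs_basis_prod_le: "set bs \<subseteq> Basis \<Longrightarrow> \<bar>basis_prod bs v\<bar> \<le> norm v ^ length bs"
proof (induction bs)
  case (Cons b bs)
  then have "\<bar>v \<bullet> b\<bar> \<le> norm v" using Basis_le_norm by auto
  with Cons show ?case by (auto simp: abs_mult intro!: mult_mono)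
qed simp

lemma has_derivative_cis_inner:
  "((\<lambda>x. cis (v \<bullet> x)) has_derivative (\<lambda>w. \<i> * complex_of_real (v \<bullet> w) * cis (v \<bullet> x))) (at x)"
proof -
  have "((\<lambda>x. v \<bullet> x) has_derivative (\<lambda>w. v \<bullet> w)) (at x)"
    by (auto intro!: derivative_eq_intros)
  from has_derivative_cis[OF this] show ?thesis
    by (simp add: scaleR_conv_of_real mult_ac)
qed

lemma partials_cis:
  "smooth (\<lambda>x. cis (v \<bullet> x))"
  "set bs \<subseteq> Basis \<Longrightarrow> partials bs (\<lambda>x. cis (v \<bullet> x)) =
     (\<lambda>x. \<i> ^ length bs * complex_of_real (basis_prod bs v) * cis (v \<bullet> x))"
proof -
  let ?G = "\<lambda>bs x. \<i> ^ length bs * complex_of_real (basis_prod bs v) * cis (v \<bullet> x)"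
  have *: "\<exists>D. (?G bs has_derivative D) (at x) \<and> (\<forall>b\<in>Basis. D b = ?G (b # bs) x)" for bs x
    by (intro exI conjI, rule has_derivative_mult_right[OF has_derivative_cis_inner])
      (auto simp: inner_commute mult_ac)
  show "smooth (\<lambda>x. cis (v \<bullet> x))"
    by (rule smooth_family(1)[where G = ?G, OF _ *]) simp_all
  show "set bs \<subseteq> Basis \<Longrightarrow> partials bs (\<lambda>x. cis (v \<bullet> x)) = ?G bs"
    by (rule smooth_family(2)[where G = ?G, OF _ *]) simp_all
qed

text \<open>The monomial in \<open>v\<close> produced by differentiation is absorbed by a Gaussian
  in \<open>v\<close>. Since \<open>\<eta>\<close> is free, the growth in the frequency can be made
  slower than any prescribed Gaussian, at the cost of a larger rate.\<close>

lemma gsd_cis: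
  assumes "\<eta> > 0"
  shows "gsd (exp (\<eta>\<^sup>2 * (norm v)\<^sup>2 / 2)) (1 / \<eta>) 0 (\<lambda>x. cis (v \<bullet> x))"
  unfolding gsd_def
proof (intro conjI allI impI)
  fix bs :: "'a list" and x :: 'a assume bs: "set bs \<subseteq> Basis"
  have "\<bar>basis_prod bs v\<bar> \<le> sqrt (fact (length bs)) * (1 / \<eta>) ^ length bs * exp (\<eta>\<^sup>2 * (norm v)\<^sup>2 / 2)"
    using abs_basis_prod_le[OF bs, of v] power_le_gauss[of "norm v" \<eta> "length bs"] assms by simp
  then show "cmod (partials bs (\<lambda>x. cis (v \<bullet> x)) x) \<le>
    exp (\<eta>\<^sup>2 * (norm v)\<^sup>2 / 2) * (1 / \<eta>) ^ length bs * sqrt (fact (length bs)) * exp (- 0 * (norm x)\<^sup>2)"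
    by (simp add: partials_cis(2)[OF bs] norm_mult norm_power mult_ac)
qed (rule partials_cis)

lemma norm_cis_diff_le: "cmod (cis s - cis t) \<le> \<bar>s - t\<bar>"
proof -
  have "norm (cis s - cis t) \<le> 1 * norm (s - t)"
    by (rule differentiable_bound[of UNIV cis "\<lambda>x h. h *\<^sub>R (\<i> * cis x)"])
      (auto intro!: has_derivative_cis onorm_le simp: norm_mult)
  then show ?thesis by simp
qed

text \<open>The telescoping argument closes without a factor depending on the length:
  \<open>R * ((R + 1) ^ n - R ^ n) + R ^ n\<close> falls short of the next difference by
  \<open>(R + 1) ^ n - R ^ n\<close>, which is nonnegative.\<close>

lemma abs_basis_prod_diff_le:
  assumes "set bs \<subseteq> Basis" "norm v \<le> R" "norm w \<le> R"
  shows "\<bar>basis_prod bs v - basis_prod bs w\<bar> \<le> norm (v - w) * ((R + 1) ^ length bs - R ^ length bs)"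
  using assms(1)
proof (induction bs)
  case (Cons b bs)
  have R: "0 \<le> R" using assms(2) norm_ge_zero order_trans by blast
  let ?n = "length bs" and ?d = "norm (v - w)"
  have b: "\<bar>v \<bullet> b\<bar> \<le> R" "\<bar>(v - w) \<bullet> b\<bar> \<le> ?d"
    using Cons.prems assms(2) Basis_le_norm[of b v] Basis_le_norm[of b "v - w"] by auto
  have w: "\<bar>basis_prod bs w\<bar> \<le> R ^ ?n"
    using abs_basis_prod_le[of bs w] Cons.prems power_mono[OF assms(3), of ?n] by simp
  have "basis_prod (b # bs) v - basis_prod (b # bs) w =
      (v \<bullet> b) * (basis_prod bs v - basis_prod bs w) + ((v - w) \<bullet> b) * basis_prod bs w"
    by (simp add: algebra_simps)
  also have "\<bar>\<dots>\<bar> \<le> R * (?d * ((R + 1) ^ ?n - R ^ ?n)) + ?d * R ^ ?n"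
    using Cons R b w
    by (intro order_trans[OF abs_triangle_ineq] add_mono) (auto simp: abs_mult intro!: mult_mono)
  also have "\<dots> \<le> ?d * ((R + 1) ^ length (b # bs) - R ^ length (b # bs))"
  proof -
    have "0 \<le> ?d * ((R + 1) ^ ?n - R ^ ?n)" using R by (simp add: power_mono)
    then show ?thesis by (simp add: algebra_simps)
  qed
  finally show ?case .
qed simp

lemma partials_cis_diff_le:
  assumes bs: "set bs \<subseteq> Basis" and R: "norm v \<le> R" "norm w \<le> R"
  shows "cmod (partials bs (\<lambda>x. cis (v \<bullet> x)) x - partials bs (\<lambda>x. cis (w \<bullet> x)) x)
     \<le> norm (v - w) * (1 + norm x) * (R + 1) ^ length bs"
proof -
  let ?n = "length bs" and ?d = "norm (v - w)"
  have R0: "0 \<le> R" using R(1) norm_ge_zero order_trans by blast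
  have "partials bs (\<lambda>x. cis (v \<bullet> x)) x - partials bs (\<lambda>x. cis (w \<bullet> x)) x
     = \<i> ^ ?n * (complex_of_real (basis_prod bs v) * (cis (v \<bullet> x) - cis (w \<bullet> x))
       + complex_of_real (basis_prod bs v - basis_prod bs w) * cis (w \<bullet> x))"
    by (simp add: partials_cis(2)[OF bs] algebra_simps)
  also have "cmod \<dots> \<le> \<bar>basis_prod bs v\<bar> * cmod (cis (v \<bullet> x) - cis (w \<bullet> x)) + \<bar>basis_prod bs v - basis_prod bs w\<bar>"
    by (simp add: norm_mult norm_power del: of_real_diff)
      (rule order_trans[OF norm_triangle_ineq], simp add: norm_mult del: of_real_diff)
  also have "\<dots> \<le> R ^ ?n * (?d * norm x) + ?d * ((R + 1) ^ ?n - R ^ ?n)"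
  proof (intro add_mono mult_mono abs_basis_prod_diff_le[OF bs R])
    show "\<bar>basis_prod bs v\<bar> \<le> R ^ ?n"
      using abs_basis_prod_le[OF bs, of v] power_mono[OF R(1), of ?n] by simp
    show "cmod (cis (v \<bullet> x) - cis (w \<bullet> x)) \<le> ?d * norm x"
      using norm_cis_diff_le[of "v \<bullet> x" "w \<bullet> x"] Cauchy_Schwarz_ineq2[of "v - w" x]
      by (simp add: inner_diff_left)
  qed (use R0 in auto)
  also have "\<dots> \<le> (R + 1) ^ ?n * (?d * norm x) + ?d * (R + 1) ^ ?n"
    using R0 by (intro add_mono mult_right_mono mult_left_mono power_mono) auto
  finally show ?thesis by (simp add: algebra_simps)
qed

lemma one_plus_le_gauss:
  fixes t e :: real
  assumes "e > 0"
  shows "1 + t \<le> exp (1 / (4 * e)) * exp (e * t\<^sup>2)"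
proof -
  have "e * (t - 1 / (2 * e))\<^sup>2 = e * t\<^sup>2 - t + 1 / (4 * e)"
    using assms by (simp add: power2_eq_square field_simps)
  moreover have "0 \<le> e * (t - 1 / (2 * e))\<^sup>2" using assms by simp
  ultimately have "t \<le> e * t\<^sup>2 + 1 / (4 * e)" by linarith
  then have "exp t \<le> exp (1 / (4 * e) + e * t\<^sup>2)" by simp
  then show ?thesis using exp_ge_add_one_self[of t] by (simp only: exp_add)
qed

text \<open>Lipschitz dependence of a character on its frequency, measured in all derivatives. The
  unavoidable linear factor \<open>1 + norm x\<close> is converted into Gaussian growth with an
  arbitrarily small exponent \<open>e\<close>.\<close>

lemma gsd_cis_diff:
  assumes "\<eta> > 0" "e > 0" and R: "norm v \<le> R" "norm w \<le> R"
  shows "gsd (norm (v - w) * exp (1 / (4 * e)) * exp (\<eta>\<^sup>2 * (R + 1)\<^sup>2 / 2)) (1 / \<eta>) (- e)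
    (\<lambda>x. cis (v \<bullet> x) - cis (w \<bullet> x))"
  unfolding gsd_def
proof (intro conjI allI impI)
  have R0: "0 \<le> R" using R(1) norm_ge_zero order_trans by blast
  fix bs :: "'a list" and x :: 'a assume bs: "set bs \<subseteq> Basis"
  have "partials bs (\<lambda>x. cis (v \<bullet> x) - cis (w \<bullet> x)) = (\<lambda>x. partials bs (\<lambda>x. cis (v \<bullet> x)) x - partials bs (\<lambda>x. cis (w \<bullet> x)) x)"
    using partials_add(2)[OF partials_cis(1)[of v] partials_cmult(1)[OF partials_cis(1)[of w], of "-1"] bs]
      partials_cmult(2)[OF partials_cis(1)[of w] bs, of "-1"] by simp
  then have "cmod (partials bs (\<lambda>x. cis (v \<bullet> x) - cis (w \<bullet> x)) x) \<le> norm (v - w) * (1 + norm x) * (R + 1) ^ length bs"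
    using partials_cis_diff_le[OF bs R] by simp
  also have "\<dots> \<le> norm (v - w) * (exp (1 / (4 * e)) * exp (e * (norm x)\<^sup>2)) *
      (sqrt (fact (length bs)) * (1 / \<eta>) ^ length bs * exp (\<eta>\<^sup>2 * (R + 1)\<^sup>2 / 2))"
    using R0 assms by (intro mult_mono one_plus_le_gauss power_le_gauss) auto
  finally show "cmod (partials bs (\<lambda>x. cis (v \<bullet> x) - cis (w \<bullet> x)) x) \<le>
    norm (v - w) * exp (1 / (4 * e)) * exp (\<eta>\<^sup>2 * (R + 1)\<^sup>2 / 2) * (1 / \<eta>) ^ length bs *
      sqrt (fact (length bs)) * exp (- (- e) * (norm x)\<^sup>2)"
    by (simp add: mult_ac)
next
  show "smooth (\<lambda>x. cis (v \<bullet> x) - cis (w \<bullet> x))"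
    using partials_add(1)[OF partials_cis(1)[of v] partials_cmult(1)[OF partials_cis(1)[of w], of "-1"]] by simp
qed

section \<open>Multiplication by linear forms and monomials\<close>

fun drops :: "'a list \<Rightarrow> ('a \<times> 'a list) list" where
  "drops [] = []"
| "drops (b # bs) = (b, bs) # map (\<lambda>(a, q). (a, b # q)) (drops bs)"

lemma length_drops: "length (drops bs) = length bs"
  by (induction bs) auto

lemma drops_mem: "(a, q) \<in> set (drops bs) \<Longrightarrow> Suc (length q) = length bs \<and> a \<in> set bs \<and> set q \<subseteq> set bs"
  by (induction bs arbitrary: a q) fastforce+

text \<open>A linear form commutes with derivatives except for the terms in which exactly one
  derivative hits the form; \<open>drops\<close> runs through the choices of that
  derivative.\<close>

lemma partials_inner_mult:
  assumes "smooth g"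
  shows "smooth (\<lambda>x. complex_of_real (x \<bullet> v) * g x)"
    "set bs \<subseteq> Basis \<Longrightarrow> partials bs (\<lambda>x. complex_of_real (x \<bullet> v) * g x) =
      (\<lambda>x. complex_of_real (x \<bullet> v) * partials bs g x +
         (\<Sum>(b, q)\<leftarrow>drops bs. complex_of_real (b \<bullet> v) * partials q g x))"
proof -
  let ?G = "\<lambda>bs x. complex_of_real (x \<bullet> v) * partials bs g x +
         (\<Sum>(b, q)\<leftarrow>drops bs. complex_of_real (b \<bullet> v) * partials q g x)"
  have *: "\<exists>D. (?G bs has_derivative D) (at x) \<and> (\<forall>b\<in>Basis. D b = ?G (b # bs) x)"
    if bs: "set bs \<subseteq> Basis" for bs x
  proof (intro exI conjI ballI)
    have 1: "((\<lambda>x. complex_of_real (x \<bullet> v)) has_derivative (\<lambda>w. complex_of_real (w \<bullet> v))) (at x)"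
      by (auto intro!: derivative_eq_intros)
    have 2: "((\<lambda>x. \<Sum>(b, q)\<leftarrow>drops bs. complex_of_real (b \<bullet> v) * partials q g x) has_derivative
        (\<lambda>w. \<Sum>(b, q)\<leftarrow>drops bs. complex_of_real (b \<bullet> v) * frechet_derivative (partials q g) (at x) w)) (at x)"
      unfolding split_def
    proof (rule has_derivative_sum_list)
      fix z assume z: "z \<in> set (drops bs)"
      have s: "set (snd z) \<subseteq> Basis"
        using drops_mem[of "fst z" "snd z" bs] z bs by auto
      show "((\<lambda>x. complex_of_real (fst z \<bullet> v) * partials (snd z) g x) has_derivative
         (\<lambda>w. complex_of_real (fst z \<bullet> v) * frechet_derivative (partials (snd z) g) (at x) w)) (at x)"
        by (rule has_derivative_mult_right[OF smooth_has_derivative[OF assms s]])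
    qed
    show "(?G bs has_derivative (\<lambda>w. (complex_of_real (x \<bullet> v) * frechet_derivative (partials bs g) (at x) w
        + complex_of_real (w \<bullet> v) * partials bs g x) +
        (\<Sum>(b, q)\<leftarrow>drops bs. complex_of_real (b \<bullet> v) * frechet_derivative (partials q g) (at x) w))) (at x)"
      by (rule has_derivative_add[OF has_derivative_mult[OF 1 smooth_has_derivative[OF assms bs]] 2])
    fix b
    show "(complex_of_real (x \<bullet> v) * frechet_derivative (partials bs g) (at x) b
        + complex_of_real (b \<bullet> v) * partials bs g x) +
        (\<Sum>(a, q)\<leftarrow>drops bs. complex_of_real (a \<bullet> v) * frechet_derivative (partials q g) (at x) b) = ?G (b # bs) x"
      by (simp add: split_def comp_def)
  qed
  show "smooth (\<lambda>x. complex_of_real (x \<bullet> v) * g x)"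
    by (rule smooth_family(1)[where G = ?G, OF _ *]) simp_all
  show "set bs \<subseteq> Basis \<Longrightarrow> partials bs (\<lambda>x. complex_of_real (x \<bullet> v) * g x) = ?G bs"
    by (rule smooth_family(2)[where G = ?G, OF _ *]) simp_all
qed

lemma norm_partials_inner_mult_le:
  fixes B :: real
  assumes g: "smooth g" and bs: "set bs \<subseteq> Basis" and v: "norm v \<le> \<kappa>"
    and B: "\<And>q. set q \<subseteq> Basis \<Longrightarrow> Suc (length q) = length bs \<Longrightarrow> cmod (partials q g x) \<le> B"
  shows "cmod (partials bs (\<lambda>x. complex_of_real (x \<bullet> v) * g x) x)
    \<le> \<kappa> * (norm x * cmod (partials bs g x) + length bs * B)"
proof -
  have \<kappa>: "0 \<le> \<kappa>" using v norm_ge_zero order_trans by blast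
  have "cmod (\<Sum>(b, q)\<leftarrow>drops bs. complex_of_real (b \<bullet> v) * partials q g x) \<le> length (drops bs) * (\<kappa> * B)"
    unfolding split_def
  proof (rule norm_sum_list_le)
    fix z assume z: "z \<in> set (drops bs)"
    have s: "set (snd z) \<subseteq> Basis" "fst z \<in> Basis" "Suc (length (snd z)) = length bs"
      using drops_mem[of "fst z" "snd z" bs] z bs by auto
    have "\<bar>fst z \<bullet> v\<bar> \<le> \<kappa>" using Basis_le_norm[OF s(2), of v] v by (simp add: inner_commute)
    with \<kappa> B[OF s(1,3)] show "cmod (complex_of_real (fst z \<bullet> v) * partials (snd z) g x) \<le> \<kappa> * B"
      by (auto simp: norm_mult intro!: mult_mono)
  qed
  moreover have "\<bar>x \<bullet> v\<bar> * cmod (partials bs g x) \<le> (\<kappa> * norm x) * cmod (partials bs g x)"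
    using Cauchy_Schwarz_ineq2[of x v] mult_left_mono[OF v, of "norm x"]
    by (intro mult_right_mono) (auto simp: mult.commute)
  ultimately have "cmod (partials bs (\<lambda>x. complex_of_real (x \<bullet> v) * g x) x)
    \<le> (\<kappa> * norm x) * cmod (partials bs g x) + length bs * (\<kappa> * B)"
    unfolding partials_inner_mult(2)[OF g bs] length_drops
    by (intro order_trans[OF norm_triangle_ineq] add_mono) (simp_all add: norm_mult)
  then show ?thesis by (simp add: algebra_simps)
qed

text \<open>The directions are arbitrary vectors, because derivatives of a symplectic Fourier
  transform turn into multiplications by the forms \<open>x \<bullet> jj b\<close>.\<close>

fun mono_mult :: "'n::euclidean_space list \<Rightarrow> ('n \<Rightarrow> complex) \<Rightarrow> 'n \<Rightarrow> complex" where
  "mono_mult [] f = f"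
| "mono_mult (v # vs) f = (\<lambda>x. complex_of_real (x \<bullet> v) * mono_mult vs f x)"

lemma sqrt_fact_Suc: "sqrt (fact (Suc m)) = sqrt (real (Suc m)) * sqrt (fact m)"
  by (simp add: real_sqrt_mult)

text \<open>Leibniz' rule for monomials is avoided: the bound with \<open>(r + \<surd>m / h) ^ k\<close> is stable under the
  single commutator identity \<open>partials_inner_mult\<close>.\<close>

lemma mono_mult_bound:
  assumes f: "gsd A h c f" and h: "h > 0" and v: "\<And>v. v \<in> set vs \<Longrightarrow> norm v \<le> \<kappa>" and \<kappa>: "0 \<le> \<kappa>"
  shows "smooth (mono_mult vs f) \<and> (\<forall>bs x. set bs \<subseteq> Basis \<longrightarrow> cmod (partials bs (mono_mult vs f) x) \<le>
      A * exp (- c * (norm x)\<^sup>2) * h ^ length bs * sqrt (fact (length bs)) *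
      (\<kappa> * (norm x + sqrt (length bs) / h)) ^ length vs)"
  using v
proof (induction vs)
  case Nil
  show ?case using f gsd_bound[OF f] by (auto simp: gsd_smooth mult_ac)
next
  case (Cons v vs)
  let ?g = "mono_mult vs f"
  have g: "smooth ?g" and B: "\<And>bs x. set bs \<subseteq> Basis \<Longrightarrow> cmod (partials bs ?g x) \<le>
      A * exp (- c * (norm x)\<^sup>2) * h ^ length bs * sqrt (fact (length bs)) *
      (\<kappa> * (norm x + sqrt (length bs) / h)) ^ length vs"
    using Cons by auto
  have A: "0 \<le> A" using f by (rule gsd_nonneg)
  show ?case
  proof (intro conjI allI impI)
    show "smooth (mono_mult (v # vs) f)" using partials_inner_mult(1)[OF g] by simp
    fix bs :: "'a list" and x :: 'a assume bs: "set bs \<subseteq> Basis"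
    define E where "E = A * exp (- c * (norm x)\<^sup>2)"
    define m where "m = length bs"
    define S where "S = \<kappa> * (norm x + sqrt m / h)"
    have E: "0 \<le> E" using A by (simp add: E_def)
    have S: "0 \<le> S" using \<kappa> h by (simp add: S_def)
    have *: "cmod (partials q ?g x) \<le> E * h ^ (m - 1) * sqrt (fact (m - 1)) * S ^ length vs"
      if "set q \<subseteq> Basis" "Suc (length q) = length bs" for q
    proof -
      have l: "length q = m - 1" using that m_def by simp
      have "(\<kappa> * (norm x + sqrt (length q) / h)) ^ length vs \<le> S ^ length vs"
        unfolding S_def l using h \<kappa>
        by (intro power_mono mult_left_mono add_left_mono divide_right_mono) auto
      then have "E * h ^ (m - 1) * sqrt (fact (m - 1)) * (\<kappa> * (norm x + sqrt (length q) / h)) ^ length vs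
          \<le> E * h ^ (m - 1) * sqrt (fact (m - 1)) * S ^ length vs"
        using E h by (intro mult_left_mono) auto
      with B[OF that(1), of x] show ?thesis by (simp add: E_def l)
    qed
    have m1: "real m * (E * h ^ (m - 1) * sqrt (fact (m - 1)) * S ^ length vs) =
        E * h ^ m * sqrt (fact m) * S ^ length vs * (sqrt m / h)"
    proof (cases m)
      case (Suc k)
      then show ?thesis using h
        by (simp add: sqrt_fact_Suc del: fact_Suc of_nat_Suc)
    qed simp
    have "cmod (partials bs (mono_mult (v # vs) f) x) \<le> \<kappa> * (norm x * cmod (partials bs ?g x) + m *
        (E * h ^ (m - 1) * sqrt (fact (m - 1)) * S ^ length vs))"
      unfolding mono_mult.simps m_def
    proof (rule norm_partials_inner_mult_le[OF g bs])
      show "norm v \<le> \<kappa>" using Cons.prems by simp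
    qed (use * in \<open>simp only: m_def\<close>)
    also have "\<dots> \<le> \<kappa> * (norm x * (E * h ^ m * sqrt (fact m) * S ^ length vs) +
        E * h ^ m * sqrt (fact m) * S ^ length vs * (sqrt m / h))"
      unfolding m1 using B[OF bs, of x] \<kappa>
      by (intro mult_left_mono add_right_mono) (auto simp: E_def S_def m_def)
    also have "\<dots> = E * h ^ m * sqrt (fact m) * S ^ length (v # vs)"
      by (simp add: S_def algebra_simps)
    finally show "cmod (partials bs (mono_mult (v # vs) f) x) \<le>
      A * exp (- c * (norm x)\<^sup>2) * h ^ length bs * sqrt (fact (length bs)) *
      (\<kappa> * (norm x + sqrt (length bs) / h)) ^ length (v # vs)"
      by (simp add: E_def S_def m_def)
  qed
qed

text \<open>Half of the Gaussian decay pays for the power \<open>(r + sqrt m / h) ^ k\<close>. The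
  part of the exponent coming from \<open>sqrt m / h\<close> is
  \<open>m * c / (2 * h\<^sup>2)\<close>, linear in the order \<open>m\<close>, so it only enlarges
  the rate. The dependence on the number of linear forms is again geometric times the root of a
  factorial, as needed for the Fourier transform.\<close>

lemma gsd_mono_mult:
  assumes f: "gsd A h c f" and h: "h > 0" and v: "\<And>v. v \<in> set vs \<Longrightarrow> norm v \<le> \<kappa>" and \<kappa>: "0 \<le> \<kappa>" and c: "c > 0"
  shows "gsd (A * (\<kappa> * sqrt (2 / c)) ^ length vs * sqrt (fact (length vs))) (h * exp (c / (2 * h\<^sup>2))) (c / 2) (mono_mult vs f)"
  unfolding gsd_def
proof (intro conjI allI impI)
  note M = mono_mult_bound[OF f h v \<kappa>]
  show "smooth (mono_mult vs f)" using M by blast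
  fix bs :: "'a list" and x :: 'a assume bs: "set bs \<subseteq> Basis"
  let ?m = "length bs" and ?k = "length vs"
  let ?r = "norm x" and ?s = "sqrt (length bs) / h"
  have A: "0 \<le> A" using f by (rule gsd_nonneg)
  have "(?r + ?s) ^ ?k \<le> sqrt (fact ?k) * (1 / sqrt (c / 2)) ^ ?k * exp ((sqrt (c / 2))\<^sup>2 * (?r + ?s)\<^sup>2 / 2)"
    using c h by (intro power_le_gauss) auto
  also have "\<dots> \<le> sqrt (fact ?k) * (1 / sqrt (c / 2)) ^ ?k * (exp ((c / 2) * ?r\<^sup>2) * exp (c / (2 * h\<^sup>2)) ^ ?m)"
  proof -
    have "(?r + ?s)\<^sup>2 \<le> 2 * ?r\<^sup>2 + 2 * ?s\<^sup>2"
      using sum_squares_bound[of ?r ?s] by (simp add: power2_sum)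
    then have "c / 4 * (?r + ?s)\<^sup>2 \<le> c / 4 * (2 * ?r\<^sup>2 + 2 * ?s\<^sup>2)"
      using c by (intro mult_left_mono) auto
    also have "\<dots> = (c / 2) * ?r\<^sup>2 + ?m * (c / (2 * h\<^sup>2))"
      by (simp add: power_divide field_simps)
    finally have "(sqrt (c / 2))\<^sup>2 * (?r + ?s)\<^sup>2 / 2 \<le> (c / 2) * ?r\<^sup>2 + ?m * (c / (2 * h\<^sup>2))"
      using c by simp
    then show ?thesis
      using c by (intro mult_left_mono) (auto simp flip: exp_add exp_of_nat_mult)
  qed
  finally have 1: "(?r + ?s) ^ ?k \<le> sqrt (fact ?k) * (1 / sqrt (c / 2)) ^ ?k * (exp ((c / 2) * ?r\<^sup>2) * exp (c / (2 * h\<^sup>2)) ^ ?m)" .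
  have "cmod (partials bs (mono_mult vs f) x) \<le>
      A * exp (- c * ?r\<^sup>2) * h ^ ?m * sqrt (fact ?m) * (\<kappa> ^ ?k * (?r + ?s) ^ ?k)"
    using M bs by (simp add: power_mult_distrib)
  also have "\<dots> \<le> A * exp (- c * ?r\<^sup>2) * h ^ ?m * sqrt (fact ?m) * (\<kappa> ^ ?k *
      (sqrt (fact ?k) * (1 / sqrt (c / 2)) ^ ?k * (exp ((c / 2) * ?r\<^sup>2) * exp (c / (2 * h\<^sup>2)) ^ ?m)))"
    using A h \<kappa> by (intro mult_left_mono[OF 1] mult_left_mono) auto
  also have "\<dots> = A * (\<kappa> * sqrt (2 / c)) ^ ?k * sqrt (fact ?k) *
      (h * exp (c / (2 * h\<^sup>2))) ^ ?m * sqrt (fact ?m) * (exp (- c * ?r\<^sup>2) * exp ((c / 2) * ?r\<^sup>2))"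
    by (simp add: power_mult_distrib real_sqrt_divide power_divide mult_ac)
  also have "exp (- c * ?r\<^sup>2) * exp ((c / 2) * ?r\<^sup>2) = exp (- (c / 2) * ?r\<^sup>2)"
    by (simp flip: exp_add)
  finally show "cmod (partials bs (mono_mult vs f) x) \<le> A * (\<kappa> * sqrt (2 / c)) ^ ?k * sqrt (fact ?k) *
      (h * exp (c / (2 * h\<^sup>2))) ^ ?m * sqrt (fact ?m) * exp (- (c / 2) * ?r\<^sup>2)" .
qed

subsection \<open>Gaussians and the space \<open>\<S>\<^sub>1\<^sub>/\<^sub>2\<close>\<close>

definition gauss :: "real \<Rightarrow> 'n::euclidean_space \<Rightarrow> complex" where
  "gauss l x = complex_of_real (exp (- l * (norm x)\<^sup>2))"

lemma has_derivative_gauss: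
  "(gauss l has_derivative (\<lambda>w. complex_of_real (- 2 * l * (x \<bullet> w)) * gauss l x)) (at x)"
proof -
  have "((\<lambda>x. exp (- l * (norm x)\<^sup>2)) has_derivative (\<lambda>w. exp (- l * (norm x)\<^sup>2) * (- l * (2 * (x \<bullet> w))))) (at x)"
  proof -
    have "((\<lambda>x. - l * (x \<bullet> x)) has_derivative (\<lambda>w. - l * (2 * (x \<bullet> w)))) (at x)"
      by (auto intro!: derivative_eq_intros simp: inner_commute)
    from has_derivative_exp[OF this] show ?thesis
      by (simp add: power2_norm_eq_inner mult.commute)
  qed
  from has_derivative_of_real[OF this, where 'a = complex] show ?thesis
    by (simp add: gauss_def[abs_def] mult_ac)
qed

lemma smooth_coinduct:
  assumes "f \<in> S"
    and "\<And>g. g \<in> S \<Longrightarrow> (\<forall>x. g differentiable (at x)) \<and> (\<forall>b\<in>Basis. (\<lambda>x. frechet_derivative g (at x) b) \<in> S)"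
  shows "smooth f"
proof -
  have "set bs \<subseteq> Basis \<Longrightarrow> partials bs f \<in> S" for bs
    using assms by (induction bs) auto
  with assms(2) show ?thesis unfolding smooth_def by blast
qed

text \<open>Polynomial multiples of one Gaussian: a class closed under directional derivatives, as
  \<open>smooth_coinduct\<close> demands.\<close>

inductive_set poly_gauss :: "real \<Rightarrow> ('n::euclidean_space \<Rightarrow> complex) set" for l where
  base: "gauss l \<in> poly_gauss l"
| add: "f \<in> poly_gauss l \<Longrightarrow> g \<in> poly_gauss l \<Longrightarrow> (\<lambda>x. f x + g x) \<in> poly_gauss l"
| cmult: "f \<in> poly_gauss l \<Longrightarrow> (\<lambda>x. complex_of_real a * f x) \<in> poly_gauss l"
| inner: "f \<in> poly_gauss l \<Longrightarrow> (\<lambda>x. complex_of_real (x \<bullet> v) * f x) \<in> poly_gauss l"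

lemma smooth_gauss: "smooth (gauss l :: 'n::euclidean_space \<Rightarrow> complex)"
proof (rule smooth_coinduct[OF poly_gauss.base])
  fix g :: "'n \<Rightarrow> complex" assume "g \<in> poly_gauss l"
  then have "\<exists>D. (\<forall>x. (g has_derivative D x) (at x)) \<and> (\<forall>b. (\<lambda>x. D x b) \<in> poly_gauss l)"
  proof induction
    case base
    have "(\<lambda>x. complex_of_real (- 2 * l * (x \<bullet> b)) * gauss l x) \<in> poly_gauss l" for b :: 'n
      using poly_gauss.cmult[OF poly_gauss.inner[OF poly_gauss.base[of l], of b], of "- 2 * l"]
      by (simp add: mult.assoc)
    with has_derivative_gauss show ?case
      by (intro exI[of _ "\<lambda>x w. complex_of_real (- 2 * l * (x \<bullet> w)) * gauss l x"]) blast
  next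
    case (add f g)
    then obtain D E where D: "\<And>x. (f has_derivative D x) (at x)" "\<And>b. (\<lambda>x. D x b) \<in> poly_gauss l"
      and E: "\<And>x. (g has_derivative E x) (at x)" "\<And>b. (\<lambda>x. E x b) \<in> poly_gauss l" by blast
    show ?case
      using has_derivative_add[OF D(1) E(1)] poly_gauss.add[OF D(2) E(2)]
      by (intro exI[of _ "\<lambda>x b. D x b + E x b"]) blast
  next
    case (cmult f a)
    then obtain D where D: "\<And>x. (f has_derivative D x) (at x)" "\<And>b. (\<lambda>x. D x b) \<in> poly_gauss l" by blast
    show ?case
      using has_derivative_mult_right[OF D(1)] poly_gauss.cmult[OF D(2)]
      by (intro exI[of _ "\<lambda>x b. complex_of_real a * D x b"]) blast
  next
    case (inner f v)
    then obtain D where D: "\<And>x. (f has_derivative D x) (at x)" "\<And>b. (\<lambda>x. D x b) \<in> poly_gauss l" by blast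
    have 1: "((\<lambda>x. complex_of_real (x \<bullet> v)) has_derivative (\<lambda>w. complex_of_real (w \<bullet> v))) (at x)" for x
      by (auto intro!: derivative_eq_intros)
    show ?case
      using has_derivative_mult[OF 1 D(1)]
        poly_gauss.add[OF poly_gauss.inner[OF D(2)] poly_gauss.cmult[OF inner(1)]]
      by (intro exI[of _ "\<lambda>x b. complex_of_real (x \<bullet> v) * D x b + complex_of_real (b \<bullet> v) * f x"]) blast
  qed
  then obtain D where D: "\<And>x. (g has_derivative D x) (at x)" "\<And>b. (\<lambda>x. D x b) \<in> poly_gauss l" by blast
  have "frechet_derivative g (at x) = D x" for x
    using frechet_derivative_at[OF D(1)] by simp
  with D show "(\<forall>x. g differentiable (at x)) \<and> (\<forall>b\<in>Basis. (\<lambda>x. frechet_derivative g (at x) b) \<in> poly_gauss l)"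
    by (auto intro: differentiableI)
qed

text \<open>The innermost derivative produces the factor \<open>- 2 * l * (x \<bullet> b)\<close>,
  and commuting it past the others gives a Hermite type recursion with two lower orders. The shape
  with \<open>sqrt (length bs)\<close> is chosen because it is stable under this recursion.\<close>

lemma partials_gauss_bound:
  assumes l: "l > 0" and \<mu>: "\<mu> = max (2 * l) 1" and bs: "set bs \<subseteq> Basis"
  shows "cmod (partials bs (gauss l) x) \<le> (\<mu> * (norm x + sqrt (length bs))) ^ length bs * exp (- l * (norm x)\<^sup>2)"
  using bs
proof (induction "length bs" arbitrary: bs rule: less_induct)
  case less
  let ?E = "exp (- l * (norm x)\<^sup>2)" and ?r = "norm x"
  have \<mu>1: "\<mu> \<ge> 1" "\<mu> \<ge> 2 * l" using \<mu> by auto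
  show ?case
  proof (cases bs rule: rev_cases)
    case Nil
    then show ?thesis by (simp add: gauss_def)
  next
    case (snoc as b)
    define m where "m = length as"
    have as: "set as \<subseteq> Basis" "b \<in> Basis" using less.prems snoc by auto
    define T where "T = \<mu> * (?r + sqrt m)"
    have T: "T \<ge> 0" using \<mu>1 by (simp add: T_def)
    have 0: "partials as (partials [b] (gauss l)) = (\<lambda>x. complex_of_real (- 2 * l) * partials as (\<lambda>x. complex_of_real (x \<bullet> b) * gauss l x) x)"
    proof -
      have "partials [b] (gauss l) = (\<lambda>x. complex_of_real (- 2 * l) * (complex_of_real (x \<bullet> b) * gauss l x))"
      proof
        fix x :: 'a
        have "frechet_derivative (gauss l) (at x) = (\<lambda>w. complex_of_real (- 2 * l * (x \<bullet> w)) * gauss l x)"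
          using frechet_derivative_at[OF has_derivative_gauss[of l x]] by simp
        then show "partials [b] (gauss l) x = complex_of_real (- 2 * l) * (complex_of_real (x \<bullet> b) * gauss l x)"
          by simp
      qed
      then show ?thesis
        by (simp only: partials_cmult(2)[OF partials_inner_mult(1)[OF smooth_gauss] as(1)])
    qed
    have *: "cmod (partials q (gauss l) x) \<le> T ^ (m - 1) * ?E"
      if q: "set q \<subseteq> Basis" "Suc (length q) = length as" for q
    proof -
      have l: "length q = m - 1" using q m_def by simp
      have "cmod (partials q (gauss l) x) \<le> (\<mu> * (?r + sqrt (length q))) ^ length q * ?E"
        using q snoc by (intro less) auto
      also have "\<dots> \<le> T ^ (m - 1) * ?E"
        unfolding l T_def using \<mu>1
        by (intro mult_right_mono power_mono mult_left_mono add_left_mono) auto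
      finally show ?thesis .
    qed
    have "cmod (partials bs (gauss l) x) = 2 * l * cmod (partials as (\<lambda>x. complex_of_real (x \<bullet> b) * gauss l x) x)"
      unfolding snoc partials_append 0 using l by (simp add: norm_mult)
    also have "\<dots> \<le> 2 * l * (1 * (?r * cmod (partials as (gauss l) x) + length as * (T ^ (m - 1) * ?E)))"
      using l as by (intro mult_left_mono norm_partials_inner_mult_le smooth_gauss * ) auto
    also have "\<dots> \<le> 2 * l * (?r * (T ^ m * ?E) + m * (T ^ (m - 1) * ?E))"
    proof -
      have "cmod (partials as (gauss l) x) \<le> T ^ m * ?E"
        unfolding T_def m_def using as snoc by (intro less) auto
      then show ?thesis using l by (simp add: m_def mult_left_mono)
    qed
    also have "\<dots> \<le> T ^ m * (T * ?E)"
    proof (cases m)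
      case 0
      have "2 * l * ?r \<le> \<mu> * ?r" using \<mu>1 by (intro mult_right_mono) auto
      from mult_right_mono[OF this, of ?E] show ?thesis using 0 by (simp add: T_def flip: mult.assoc)
    next
      case (Suc k)
      \<comment> \<open>The recursion closes since \<open>\<mu> * ?r\<close> absorbs
        \<open>2 * l * ?r\<close>, while \<open>\<mu> * sqrt m * T\<close> absorbs
        \<open>2 * l * m\<close> thanks to \<open>T \<ge> sqrt m\<close>. This is where
        \<open>\<mu> \<ge> 2 * l\<close> and \<open>\<mu> \<ge> 1\<close> enter.\<close>
      have "2 * l * (?r * T + m) \<le> T * T"
      proof -
        have "2 * l * (?r * T) \<le> \<mu> * (?r * T)"
          using \<mu>1 T by (intro mult_right_mono) auto
        moreover have "2 * l * m \<le> (\<mu> * sqrt m) * T"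
        proof -
          have "2 * l * m \<le> \<mu> * m" using \<mu>1 by (intro mult_right_mono) auto
          also have "\<dots> = (\<mu> * sqrt m) * (1 * sqrt m)" by simp
          also have "\<dots> \<le> (\<mu> * sqrt m) * T"
            unfolding T_def using \<mu>1 by (intro mult_left_mono mult_mono) auto
          finally show ?thesis .
        qed
        moreover have "T * T = \<mu> * (?r * T) + (\<mu> * sqrt m) * T"
          by (simp add: T_def algebra_simps)
        ultimately show ?thesis by (simp add: algebra_simps)
      qed
      then have "(2 * l * (?r * T + m)) * (T ^ k * ?E) \<le> (T * T) * (T ^ k * ?E)"
        using T by (intro mult_right_mono) auto
      then show ?thesis using Suc by (simp add: algebra_simps)
    qed
    also have "\<dots> = T ^ Suc m * ?E" by simp
    also have "\<dots> \<le> (\<mu> * (norm x + sqrt (length bs))) ^ length bs * ?E"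
      unfolding T_def snoc m_def length_append_singleton using \<mu>1
      by (intro mult_right_mono power_mono mult_left_mono add_left_mono) auto
    finally show ?thesis .
  qed
qed

text \<open>Half of the decay is spent on the power in \<open>partials_gauss_bound\<close>; its
  \<open>sqrt m\<close> contributes \<open>exp (l / 2) ^ m\<close>, which is geometric in the order
  and goes into the rate.\<close>

lemma gsd_gauss:
  assumes "l > 0"
  obtains h where "h > 0" "gsd 1 h (l / 2) (gauss l :: 'n::euclidean_space \<Rightarrow> complex)"
proof -
  define \<mu> where "\<mu> = max (2 * l) 1"
  define \<eta> where "\<eta> = sqrt (l / 2)"
  have p: "\<mu> > 0" "\<eta> > 0" "\<eta>\<^sup>2 = l / 2" using assms by (auto simp: \<mu>_def \<eta>_def)
  define h where "h = \<mu> * (1 / \<eta>) * exp (l / 2)"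
  have "gsd 1 h (l / 2) (gauss l :: 'n \<Rightarrow> complex)"
    unfolding gsd_def
  proof (intro conjI allI impI smooth_gauss)
    fix bs :: "'n list" and x :: 'n assume bs: "set bs \<subseteq> Basis"
    let ?m = "length bs" and ?r = "norm x"
    have "(?r + sqrt ?m) ^ ?m \<le> sqrt (fact ?m) * (1 / \<eta>) ^ ?m * exp (\<eta>\<^sup>2 * (?r + sqrt ?m)\<^sup>2 / 2)"
      using p by (intro power_le_gauss) auto
    also have "\<dots> \<le> sqrt (fact ?m) * (1 / \<eta>) ^ ?m * (exp ((l / 2) * ?r\<^sup>2) * exp (l / 2) ^ ?m)"
    proof -
      have "(?r + sqrt ?m)\<^sup>2 \<le> 2 * ?r\<^sup>2 + 2 * ?m"
        using sum_squares_bound[of ?r "sqrt ?m"] by (simp add: power2_sum)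
      then have "\<eta>\<^sup>2 * (?r + sqrt ?m)\<^sup>2 / 2 \<le> \<eta>\<^sup>2 * (2 * ?r\<^sup>2 + 2 * ?m) / 2"
        using p by (intro divide_right_mono mult_left_mono) auto
      also have "\<dots> = (l / 2) * ?r\<^sup>2 + ?m * (l / 2)" unfolding p(3) by (simp add: algebra_simps)
      finally show ?thesis
        using p(1,2) by (intro mult_left_mono) (auto simp flip: exp_add exp_of_nat_mult)
    qed
    finally have "\<mu> ^ ?m * (?r + sqrt ?m) ^ ?m \<le> \<mu> ^ ?m * (sqrt (fact ?m) * (1 / \<eta>) ^ ?m * (exp ((l / 2) * ?r\<^sup>2) * exp (l / 2) ^ ?m))"
      using p by (intro mult_left_mono) auto
    then have "(\<mu> * (?r + sqrt ?m)) ^ ?m * exp (- l * ?r\<^sup>2) \<le>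
        (\<mu> ^ ?m * (sqrt (fact ?m) * (1 / \<eta>) ^ ?m * (exp ((l / 2) * ?r\<^sup>2) * exp (l / 2) ^ ?m))) * exp (- l * ?r\<^sup>2)"
      unfolding power_mult_distrib by (intro mult_right_mono) auto
    also have "\<dots> = 1 * h ^ ?m * sqrt (fact ?m) * (exp ((l / 2) * ?r\<^sup>2) * exp (- l * ?r\<^sup>2))"
      by (simp add: h_def power_mult_distrib power_divide mult_ac)
    also have "exp ((l / 2) * ?r\<^sup>2) * exp (- l * ?r\<^sup>2) = exp (- (l / 2) * ?r\<^sup>2)"
      by (simp flip: exp_add)
    finally show "cmod (partials bs (gauss l) x) \<le> 1 * h ^ ?m * sqrt (fact ?m) * exp (- (l / 2) * ?r\<^sup>2)"
      using partials_gauss_bound[OF assms \<mu>_def bs, of x] by linarith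
  qed
  moreover have "h > 0" using p by (simp add: h_def)
  ultimately show ?thesis using that by blast
qed

section \<open>Comparison of the Gaussian bounds with the Gelfand-Shilov norms\<close>

abbreviation mi_list :: "('n::euclidean_space \<Rightarrow> nat) \<Rightarrow> 'n list" where
  "mi_list \<alpha> \<equiv> concat (map (\<lambda>b. replicate (\<alpha> b) b) basis_list)"

lemma basis_list: "set (basis_list :: 'n::euclidean_space list) = Basis" "distinct (basis_list :: 'n list)"
proof -
  have "\<exists>bs :: 'n list. set bs = Basis \<and> distinct bs"
    using finite_distinct_list[OF finite_Basis] by blast
  from someI_ex[OF this] show "set (basis_list :: 'n list) = Basis" "distinct (basis_list :: 'n list)"
    unfolding basis_list_def by auto
qed

lemma set_mi_list: "set (mi_list \<alpha>) \<subseteq> (Basis :: 'n::euclidean_space set)"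
  by (auto simp: basis_list(1))

lemma length_mi_list: "length (mi_list (\<alpha> :: 'n::euclidean_space \<Rightarrow> nat)) = mi_abs \<alpha>"
  unfolding mi_abs_def length_concat
  using sum_list_distinct_conv_sum_set[OF basis_list(2), of \<alpha>] by (simp add: comp_def basis_list(1))

lemma mset_mi_list:
  fixes bs :: "'n::euclidean_space list"
  assumes "set bs \<subseteq> Basis"
  shows "mset (mi_list (count (mset bs))) = mset bs"
proof (rule multiset_eqI)
  fix x
  have *: "count (mset (concat (map (\<lambda>b. replicate (f b) b) xs))) x = (if x \<in> set xs then f x else 0)"
    if "distinct xs" for xs and f :: "'n \<Rightarrow> nat"
    using that by (induction xs) auto
  show "count (mset (mi_list (count (mset bs)))) x = count (mset bs) x"
    unfolding *[OF basis_list(2)] basis_list(1) using assms by (auto simp: count_eq_zero_iff)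
qed

lemma binomial_le_pow2_real: "real (n choose k) \<le> 2 ^ n"
  using of_nat_mono[OF binomial_le_pow2[of n k], where 'a = real] by simp

text \<open>The upper bound says that a multinomial coefficient is at most geometric in the order.
  Coordinates are added one at a time, each costing a binomial coefficient of size at most a power
  of 2.\<close>

lemma mi_fact_bounds:
  fixes \<alpha> :: "'n::euclidean_space \<Rightarrow> nat"
  shows "mi_fact \<alpha> \<le> fact (mi_abs \<alpha>)" "fact (mi_abs \<alpha>) \<le> (2 ^ DIM('n)) ^ mi_abs \<alpha> * mi_fact \<alpha>" "mi_fact \<alpha> \<ge> 1"
proof -
  have "(\<Prod>b\<in>S. fact (\<alpha> b) :: real) \<ge> 1 \<and> (\<Prod>b\<in>S. fact (\<alpha> b) :: real) \<le> fact (\<Sum>b\<in>S. \<alpha> b) \<and>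
      fact (\<Sum>b\<in>S. \<alpha> b) \<le> (2 ^ card S) ^ (\<Sum>b\<in>S. \<alpha> b) * (\<Prod>b\<in>S. fact (\<alpha> b) :: real)"
    if "finite S" for S
    using that
  proof (induction S)
    case (insert b S)
    let ?P = "\<Prod>b\<in>S. fact (\<alpha> b) :: real" and ?s = "\<Sum>b\<in>S. \<alpha> b" and ?a = "\<alpha> b"
    have f1: "(1::real) \<le> fact ?a" by (rule fact_ge_1)
    have "1 \<le> fact ?a * ?P" using insert.IH f1 mult_mono[of 1 "fact ?a" 1 ?P] by simp
    moreover have "fact ?a * ?P \<le> fact (?a + ?s)"
      using insert.IH f1 fact_mult_le[of ?a ?s] mult_left_mono[of ?P "fact ?s" "fact ?a"] by linarith
    moreover have "fact (?a + ?s) \<le> (2 ^ card (insert b S)) ^ (?a + ?s) * (fact ?a * ?P)"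
    proof -
      have "fact (?a + ?s) = (fact ?a * fact ?s) * real ((?a + ?s) choose ?a)"
      proof -
        have "(fact (?a + ?s) :: nat) = (fact ?a * fact ?s) * ((?a + ?s) choose ?a)"
          using binomial_fact_lemma[of ?a "?a + ?s"] by simp
        from arg_cong[OF this, of real] show ?thesis by (simp only: of_nat_fact of_nat_mult)
      qed
      also have "\<dots> \<le> (fact ?a * fact ?s) * 2 ^ (?a + ?s)"
        by (intro mult_left_mono binomial_le_pow2_real) simp
      also have "\<dots> \<le> (fact ?a * ((2 ^ card S) ^ (?a + ?s) * ?P)) * 2 ^ (?a + ?s)"
      proof (intro mult_right_mono mult_left_mono)
        have "fact ?s \<le> (2 ^ card S) ^ ?s * ?P" using insert.IH by simp
        also have "\<dots> \<le> (2 ^ card S) ^ (?a + ?s) * ?P"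
          using insert.IH by (intro mult_right_mono power_increasing) auto
        finally show "fact ?s \<le> (2 ^ card S) ^ (?a + ?s) * ?P" .
      qed auto
      also have "\<dots> = (2 ^ card (insert b S)) ^ (?a + ?s) * (fact ?a * ?P)"
        using insert.hyps by (simp add: power_mult_distrib mult_ac)
      finally show ?thesis .
    qed
    ultimately show ?case using insert.hyps by simp
  qed simp
  from this[OF finite_Basis] show "mi_fact \<alpha> \<le> fact (mi_abs \<alpha>)"
    "fact (mi_abs \<alpha>) \<le> (2 ^ DIM('n)) ^ mi_abs \<alpha> * mi_fact \<alpha>" "mi_fact \<alpha> \<ge> 1"
    unfolding mi_fact_def mi_abs_def by auto
qed

lemma sqrt_fact_mi_abs_le:
  fixes \<alpha> :: "'n::euclidean_space \<Rightarrow> nat"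
  shows "sqrt (fact (mi_abs \<alpha>)) \<le> sqrt (2 ^ DIM('n)) ^ mi_abs \<alpha> * mi_fact \<alpha> powr (1/2)"
  using real_sqrt_le_mono[OF mi_fact_bounds(2)[of \<alpha>]] mi_fact_bounds(3)[of \<alpha>]
  by (simp add: real_sqrt_mult real_sqrt_power powr_half_sqrt)

lemma abs_mi_power_le:
  fixes x :: "'n::euclidean_space"
  shows "\<bar>mi_power x \<beta>\<bar> \<le> norm x ^ mi_abs \<beta>"
  unfolding mi_power_def mi_abs_def abs_prod power_sum
  by (intro prod_mono) (auto simp: power_abs Basis_le_norm intro!: power_mono)

text \<open>The Gaussian decay is spent on the monomial, giving the rate
  \<open>1 / sqrt (2 * c)\<close>; the factor \<open>sqrt (2 ^ DIM('n))\<close> converts the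
  factorial of the order into \<open>mi_fact\<close>. The step \<open>H\<close> depends on
  \<open>h\<close> and \<open>c\<close> only and the norm is controlled by \<open>A\<close>, which
  later turns continuity into a linear bound.\<close>

lemma gsd_GS_norm_le:
  fixes f :: "'n::euclidean_space \<Rightarrow> complex"
  assumes f: "gsd A h c f" and h: "h > 0" and c: "c > 0"
    and H: "H = sqrt (2 ^ DIM('n)) * max h (1 / sqrt (2 * c))"
  shows "f \<in> GS_h (1/2) H" "GS_norm (1/2) H f \<le> ennreal A"
proof -
  have A: "A \<ge> 0" using f by (rule gsd_nonneg)
  show le: "GS_norm (1/2) H f \<le> ennreal A"
    unfolding GS_norm_def
  proof (rule SUP_least, clarify)
    fix x :: 'n and \<alpha> \<beta> :: "'n \<Rightarrow> nat"
    let ?a = "mi_abs \<alpha>" and ?b = "mi_abs \<beta>" and ?K = "sqrt (2 ^ DIM('n))" and ?t = "1 / sqrt (2 * c)"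
    let ?M = "max h ?t"
    have M: "?M > 0" using h by simp
    have "cmod (mi_deriv \<alpha> f x) \<le> A * h ^ ?a * sqrt (fact ?a) * exp (- c * (norm x)\<^sup>2)"
      unfolding mi_deriv_def using gsd_bound[OF f set_mi_list, of \<alpha> x] by (simp only: length_mi_list)
    moreover have "\<bar>mi_power x \<beta>\<bar> \<le> sqrt (fact ?b) * ?t ^ ?b * exp (c * (norm x)\<^sup>2)"
      using abs_mi_power_le[of x \<beta>] power_le_gauss[of "norm x" "sqrt (2 * c)" ?b] c by simp
    ultimately have "\<bar>mi_power x \<beta>\<bar> * cmod (mi_deriv \<alpha> f x) \<le>
        (sqrt (fact ?b) * ?t ^ ?b * exp (c * (norm x)\<^sup>2)) * (A * h ^ ?a * sqrt (fact ?a) * exp (- c * (norm x)\<^sup>2))"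
      using c by (intro mult_mono) auto
    also have "\<dots> = A * (?t ^ ?b * h ^ ?a) * (sqrt (fact ?a) * sqrt (fact ?b))"
      by (simp add: exp_minus)
    also have "\<dots> \<le> A * (?M ^ ?b * ?M ^ ?a) * ((?K ^ ?a * mi_fact \<alpha> powr (1/2)) * (?K ^ ?b * mi_fact \<beta> powr (1/2)))"
      using A h c by (intro mult_mono power_mono sqrt_fact_mi_abs_le) auto
    also have "\<dots> = A * (H ^ (?a + ?b) * mi_fact \<alpha> powr (1/2) * mi_fact \<beta> powr (1/2))"
      by (simp add: H power_mult_distrib power_add mult_ac)
    finally have "\<bar>mi_power x \<beta>\<bar> * cmod (mi_deriv \<alpha> f x) \<le> A * (H ^ (?a + ?b) * mi_fact \<alpha> powr (1/2) * mi_fact \<beta> powr (1/2))" .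
    moreover have "H ^ (?a + ?b) * mi_fact \<alpha> powr (1/2) * mi_fact \<beta> powr (1/2) > 0"
      using M mi_fact_bounds(3)[of \<alpha>] mi_fact_bounds(3)[of \<beta>] by (simp add: H)
    ultimately show "ennreal (cmod (complex_of_real (mi_power x \<beta>) * mi_deriv \<alpha> f x) /
       (H ^ (?a + ?b) * mi_fact \<alpha> powr (1/2) * mi_fact \<beta> powr (1/2))) \<le> ennreal A"
      by (intro ennreal_leI) (simp add: norm_mult divide_le_eq)
  qed
  show "f \<in> GS_h (1/2) H"
    unfolding GS_h_def using gsd_smooth[OF f] le_less_trans[OF le ennreal_less_top] by simp
qed

lemma gsd_GS_half:
  assumes "gsd A h c f" "h > 0" "c > 0"
  shows "f \<in> GS_half"
proof -
  have "sqrt (2 ^ DIM('a)) * max h (1 / sqrt (2 * c)) > 0"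
    using assms(2) by simp
  then show ?thesis
    unfolding GS_def using gsd_GS_norm_le(1)[OF assms refl] by blast
qed

text \<open>The converse passage from power bounds to a Gaussian: the largest coordinate controls
  the norm, and its even powers, divided by factorials and summed over \<open>k\<close>, form an
  exponential series. Only even powers along one axis are needed, so signs do not matter.\<close>

lemma gauss_decay:
  fixes x :: "'n::euclidean_space" and h D E :: real
  assumes h: "h > 0" and D: "D \<ge> 0"
    and bound: "\<And>b k. b \<in> Basis \<Longrightarrow> (x \<bullet> b) ^ (2 * k) * D \<le> E * h ^ (2 * k) * sqrt (fact (2 * k))"
  shows "D \<le> 2 * E * exp (- (1 / (4 * DIM('n) * h\<^sup>2)) * (norm x)\<^sup>2)"
proof -
  \<comment> \<open>Chosen so that \<open>c * DIM('n) * (2 * h\<^sup>2) = 1 / 2\<close>: the series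
    is then dominated by a geometric one with sum 2.\<close>
  define c where "c = 1 / (4 * DIM('n) * h\<^sup>2)"
  have c: "c > 0" using h by (simp add: c_def)
  obtain b where b: "b \<in> Basis" and bmax: "\<And>b'. b' \<in> Basis \<Longrightarrow> \<bar>x \<bullet> b'\<bar> \<le> \<bar>x \<bullet> b\<bar>"
  proof -
    have fin: "finite ((\<lambda>b. \<bar>x \<bullet> b\<bar>) ` (Basis :: 'n set))" by simp
    have "Max ((\<lambda>b. \<bar>x \<bullet> b\<bar>) ` (Basis :: 'n set)) \<in> (\<lambda>b. \<bar>x \<bullet> b\<bar>) ` Basis"
      by (rule Max_in) auto
    then obtain b where "b \<in> Basis" "Max ((\<lambda>b. \<bar>x \<bullet> b\<bar>) ` (Basis :: 'n set)) = \<bar>x \<bullet> b\<bar>"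
      by (elim imageE)
    then show ?thesis using that[of b] Max_ge[OF fin] by force
  qed
  define t where "t = (x \<bullet> b)\<^sup>2"
  have nx: "(norm x)\<^sup>2 \<le> DIM('n) * t"
  proof -
    have "(norm x)\<^sup>2 = (\<Sum>b'\<in>Basis. (x \<bullet> b')\<^sup>2)"
      unfolding power2_norm_eq_inner by (subst euclidean_inner) (simp add: power2_eq_square)
    also have "\<dots> \<le> (\<Sum>b'\<in>(Basis::'n set). t)"
      unfolding t_def using bmax by (intro sum_mono) (simp add: abs_le_square_iff)
    finally show ?thesis by simp
  qed

  have E: "E \<ge> 0" using bound[OF b, of 0] D by simp
  have tD: "t ^ k * D \<le> E * (2 * h\<^sup>2) ^ k * fact k" for k
  proof -
    have f2: "sqrt (fact (2 * k)) \<le> 2 ^ k * fact k"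
    proof (rule real_le_lsqrt)
      have "(fact (2 * k) :: nat) = (fact k * fact k) * ((2 * k) choose k)"
        using binomial_fact_lemma[of k "2 * k"] by (simp add: mult_2)
      from arg_cong[OF this, of real]
      have "(fact (2 * k) :: real) = (fact k * fact k) * real ((2 * k) choose k)"
        by (simp only: of_nat_fact of_nat_mult)
      also have "\<dots> \<le> (fact k * fact k) * 2 ^ (2 * k)"
        by (intro mult_left_mono binomial_le_pow2_real) simp
      finally show "fact (2 * k) \<le> (2 ^ k * fact k :: real)\<^sup>2"
        by (simp only: power_even_eq power_mult_distrib) (simp add: power2_eq_square mult_ac)
    qed auto
    have "t ^ k * D \<le> E * h ^ (2 * k) * sqrt (fact (2 * k))"
      using bound[OF b, of k] by (simp add: t_def power_mult)
    also have "\<dots> \<le> E * h ^ (2 * k) * (2 ^ k * fact k)"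
      using E h by (intro mult_left_mono f2) auto
    finally show ?thesis
      unfolding power_mult[of h 2 k] power_mult_distrib by (simp only: mult_ac)
  qed
  have terms: "D * ((c * DIM('n) * t) ^ k /\<^sub>R fact k) \<le> E * (1/2) ^ k" for k
  proof -
    have "(c * DIM('n)) ^ k * (t ^ k * D) \<le> (c * DIM('n)) ^ k * (E * (2 * h\<^sup>2) ^ k * fact k)"
      using c tD by (intro mult_left_mono) auto
    also have "\<dots> = E * (c * DIM('n) * (2 * h\<^sup>2)) ^ k * fact k" by (simp add: power_mult_distrib)
    also have "c * DIM('n) * (2 * h\<^sup>2) = 1 / 2" using h by (simp add: c_def)
    finally have "D * (c * DIM('n) * t) ^ k \<le> E * (1/2) ^ k * fact k"
      by (simp add: power_mult_distrib mult_ac)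
    then have "D * (c * DIM('n) * t) ^ k / fact k \<le> E * (1/2) ^ k"
      by (subst divide_le_eq) simp
    then show ?thesis by (simp only: divide_inverse real_scaleR_def mult_ac)
  qed
  have "D * exp (c * DIM('n) * t) = (\<Sum>k. D * ((c * DIM('n) * t) ^ k /\<^sub>R fact k))"
    unfolding exp_def by (rule suminf_mult[symmetric]) (rule summable_exp_generic)
  also have "\<dots> \<le> (\<Sum>k. E * (1/2) ^ k)"
    by (intro suminf_le terms summable_mult summable_exp_generic summable_geometric) auto
  also have "\<dots> = 2 * E" by (subst suminf_mult) (auto simp: suminf_geometric)
  finally have "D * exp (c * DIM('n) * t) \<le> 2 * E" .
  moreover have "D * exp (c * (norm x)\<^sup>2) \<le> D * exp (c * DIM('n) * t)"
    using nx c D by (intro mult_left_mono) (auto simp: mult.assoc)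
  ultimately have "D * exp (c * (norm x)\<^sup>2) \<le> 2 * E" by linarith
  then have "D \<le> 2 * E * exp (- c * (norm x)\<^sup>2)" by (simp add: exp_minus field_simps)
  then show ?thesis unfolding c_def .
qed

text \<open>Together with \<open>gsd_GS_half\<close> this replaces the Gelfand-Shilov norms by
  Gaussian bounds. Multi-indices \<open>\<beta>\<close> concentrated on one coordinate with value
  \<open>2 * k\<close> supply the hypothesis of \<open>gauss_decay\<close> for every
  derivative.\<close>

lemma GS_half_gsd:
  fixes f :: "'n::euclidean_space \<Rightarrow> complex"
  assumes "f \<in> GS_half"
  obtains A h c where "h > 0" "c > 0" "gsd A h c f"
proof -
  obtain h where h: "h > 0" and f: "smooth f" and fin: "GS_norm (1/2) h f < \<infinity>"
    using assms unfolding GS_def GS_h_def by auto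
  define A where "A = enn2real (GS_norm (1/2) h f)"
  define c where "c = 1 / (4 * DIM('n) * h\<^sup>2)"
  have n0: "real DIM('n) > 0" by simp
  have c: "c > 0" using h by (simp add: c_def)
  have bound: "cmod (complex_of_real (mi_power x \<beta>) * mi_deriv \<alpha> f x) \<le>
       A * (h ^ (mi_abs \<alpha> + mi_abs \<beta>) * mi_fact \<alpha> powr (1/2) * mi_fact \<beta> powr (1/2))" for x \<alpha> \<beta>
  proof -
    have "ennreal (cmod (complex_of_real (mi_power x \<beta>) * mi_deriv \<alpha> f x) /
       (h ^ (mi_abs \<alpha> + mi_abs \<beta>) * mi_fact \<alpha> powr (1/2) * mi_fact \<beta> powr (1/2))) \<le> GS_norm (1/2) h f"
      unfolding GS_norm_def by (rule SUP_upper2[of "(x, \<alpha>, \<beta>)"]) auto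
    also have "\<dots> = ennreal A" unfolding A_def using fin by simp
    finally have "cmod (complex_of_real (mi_power x \<beta>) * mi_deriv \<alpha> f x) /
       (h ^ (mi_abs \<alpha> + mi_abs \<beta>) * mi_fact \<alpha> powr (1/2) * mi_fact \<beta> powr (1/2)) \<le> A"
      by (subst (asm) ennreal_le_iff) (auto simp: A_def)
    moreover have "h ^ (mi_abs \<alpha> + mi_abs \<beta>) * mi_fact \<alpha> powr (1/2) * mi_fact \<beta> powr (1/2) > 0"
      using h mi_fact_bounds(3)[of \<alpha>] mi_fact_bounds(3)[of \<beta>] by simp
    ultimately show ?thesis by (simp add: divide_le_eq)
  qed
  have A0: "A \<ge> 0" by (simp add: A_def)
  have "gsd (2 * A) h c f"
    unfolding gsd_def
  proof (intro conjI allI impI f)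
    fix bs :: "'n list" and x :: 'n assume bs: "set bs \<subseteq> Basis"
    define \<alpha> where "\<alpha> = count (mset bs)"
    have p: "partials bs f = mi_deriv \<alpha> f"
      unfolding mi_deriv_def \<alpha>_def by (rule partials_perm[OF f _ bs]) (simp add: mset_mi_list[OF bs])
    have l: "mi_abs \<alpha> = length bs"
      using length_mi_list[of \<alpha>] mset_mi_list[OF bs] unfolding \<alpha>_def by (metis size_mset)
    show "cmod (partials bs f x) \<le> 2 * A * h ^ length bs * sqrt (fact (length bs)) * exp (- c * (norm x)\<^sup>2)"
    proof -
      have "cmod (partials bs f x) \<le> 2 * (A * h ^ length bs * sqrt (fact (length bs))) * exp (- c * (norm x)\<^sup>2)"
        unfolding c_def
      proof (rule gauss_decay[OF h norm_ge_zero])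
        fix b k assume b: "b \<in> (Basis :: 'n set)"
        define \<beta> :: "'n \<Rightarrow> nat" where "\<beta> = (\<lambda>b'. if b' = b then 2 * k else 0)"
        have 1: "mi_abs \<beta> = 2 * k" "mi_power x \<beta> = (x \<bullet> b) ^ (2 * k)" "mi_fact \<beta> = fact (2 * k)"
        proof -
          show "mi_abs \<beta> = 2 * k" using b by (simp add: mi_abs_def \<beta>_def)
          have "mi_power x \<beta> = (\<Prod>b'\<in>Basis. if b' = b then (x \<bullet> b) ^ (2 * k) else 1)"
            unfolding mi_power_def by (intro prod.cong) (auto simp: \<beta>_def)
          then show "mi_power x \<beta> = (x \<bullet> b) ^ (2 * k)" using b by simp
          have "mi_fact \<beta> = (\<Prod>b'\<in>Basis. if b' = b then fact (2 * k) else 1)"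
            unfolding mi_fact_def by (intro prod.cong) (auto simp: \<beta>_def)
          then show "mi_fact \<beta> = fact (2 * k)" using b by simp
        qed
        have "(x \<bullet> b) ^ (2 * k) * cmod (partials bs f x) \<le>
            A * (h ^ (length bs + 2 * k) * mi_fact \<alpha> powr (1/2) * fact (2 * k) powr (1/2))"
        proof -
          have "\<bar>(x \<bullet> b) ^ (2 * k)\<bar> = (x \<bullet> b) ^ (2 * k)" by (simp add: power_mult)
          with bound[of x \<beta> \<alpha>] show ?thesis by (simp only: p[symmetric] l 1 norm_mult norm_of_real)
        qed
        also have "\<dots> \<le> A * (h ^ (length bs + 2 * k) * sqrt (fact (length bs)) * sqrt (fact (2 * k)))"
          using A0 h mi_fact_bounds(1)[of \<alpha>] mi_fact_bounds(3)[of \<alpha>] unfolding l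
          by (intro mult_left_mono mult_mono) (auto simp: powr_half_sqrt)
        finally show "(x \<bullet> b) ^ (2 * k) * cmod (partials bs f x) \<le>
            A * h ^ length bs * sqrt (fact (length bs)) * h ^ (2 * k) * sqrt (fact (2 * k))"
          by (simp add: power_add mult_ac)
      qed
      then show ?thesis by (simp add: mult_ac)
    qed
  qed
  with h c that show ?thesis by blast
qed

lemma GS_half_iff: "f \<in> GS_half \<longleftrightarrow> (\<exists>A h c. h > 0 \<and> c > 0 \<and> gsd A h c f)"
  by (metis GS_half_gsd gsd_GS_half)

subsection \<open>Gaussian integrals\<close>

text \<open>A rescaling by \<open>sqrt (2 * l)\<close> of the characteristic function of the
  standard normal distribution.\<close>

lemma gauss_fourier_real:
  fixes l t :: real
  assumes l: "l > 0"
  shows "integrable lborel (\<lambda>x. complex_of_real (exp (- l * x\<^sup>2)) * cis (t * x))"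
    and "(LINT x|lborel. complex_of_real (exp (- l * x\<^sup>2)) * cis (t * x)) =
      complex_of_real (sqrt (pi / l) * exp (- t\<^sup>2 / (4 * l)))"
proof -
  define c where "c = sqrt (2 * l)"
  have c: "c > 0" "c\<^sup>2 = 2 * l" using l by (auto simp: c_def)
  define s where "s = t / c"
  define f where "f x = complex_of_real (exp (- x\<^sup>2 / 2)) * cis (s * x)" for x
  have dens: "std_normal_density x *\<^sub>R cis (s * x) = complex_of_real (1 / sqrt (2 * pi)) * f x" for x
    by (simp add: normal_density_def f_def scaleR_conv_of_real)
  have "integrable lborel (\<lambda>x. std_normal_density x *\<^sub>R cis (s * x))"
    using integrable_std_normal_moment[of 0]
    by (rule Bochner_Integration.integrable_bound) (auto simp: cis_conv_exp)
  then have fi: "integrable lborel f"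
    unfolding dens using integrable_mult_right[of "complex_of_real (sqrt (2 * pi))"] by fastforce
  have "char std_normal_distribution s = (LINT x|lborel. std_normal_density x *\<^sub>R cis (s * x))"
    unfolding char_def cis_conv_exp
    by (subst integral_density) auto
  also have "\<dots> = complex_of_real (1 / sqrt (2 * pi)) * (LINT x|lborel. f x)"
    unfolding dens by simp
  finally have "complex_of_real (1 / sqrt (2 * pi)) * (LINT x|lborel. f x) = complex_of_real (exp (- s\<^sup>2 / 2))"
    by (simp add: char_std_normal_distribution)
  then have F: "(LINT x|lborel. f x) = complex_of_real (sqrt (2 * pi) * exp (- s\<^sup>2 / 2))"
    by (simp add: field_simps)
  have fc: "f (0 + c * x) = complex_of_real (exp (- l * x\<^sup>2)) * cis (t * x)" for x
    using c by (simp add: f_def s_def power_mult_distrib)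
  show "integrable lborel (\<lambda>x. complex_of_real (exp (- l * x\<^sup>2)) * cis (t * x))"
    using lborel_integrable_real_affine[OF fi, of c 0] c unfolding fc by simp
  have "complex_of_real (sqrt (2 * pi) * exp (- s\<^sup>2 / 2)) = c *\<^sub>R (LINT x|lborel. complex_of_real (exp (- l * x\<^sup>2)) * cis (t * x))"
    using lborel_integral_real_affine[of c f 0] c unfolding F fc by simp
  then have "(LINT x|lborel. complex_of_real (exp (- l * x\<^sup>2)) * cis (t * x)) = complex_of_real (sqrt (2 * pi) / c * exp (- s\<^sup>2 / 2))"
    using c by (simp add: scaleR_conv_of_real field_simps)
  also have "sqrt (2 * pi) / c = sqrt (pi / l)"
    by (simp add: c_def real_sqrt_mult real_sqrt_divide)
  also have "- s\<^sup>2 / 2 = - t\<^sup>2 / (4 * l)" using c by (simp add: s_def power_divide)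
  finally show "(LINT x|lborel. complex_of_real (exp (- l * x\<^sup>2)) * cis (t * x)) =
      complex_of_real (sqrt (pi / l) * exp (- t\<^sup>2 / (4 * l)))" .
qed

lemma cis_sum: "finite S \<Longrightarrow> cis (\<Sum>i\<in>S. f i) = (\<Prod>i\<in>S. cis (f i))"
  by (induction S rule: finite_induct) (auto simp flip: cis_mult)

lemma gauss_fourier:
  fixes v :: "'n::euclidean_space"
  assumes l: "l > 0"
  shows "integrable lborel (\<lambda>x. gauss l x * cis (v \<bullet> x))"
    and "(LINT x|lborel. gauss l x * cis (v \<bullet> x)) =
      complex_of_real (sqrt (pi / l) ^ DIM('n) * exp (- (norm v)\<^sup>2 / (4 * l)))"
proof -
  interpret product_sigma_finite "\<lambda>_::'n. lborel :: real measure"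
    by standard
  define F where "F b x = complex_of_real (exp (- l * x\<^sup>2)) * cis ((v \<bullet> b) * x)" for b :: 'n and x
  let ?P = "\<Pi>\<^sub>M b\<in>Basis. lborel :: real measure" and ?T = "\<lambda>f. \<Sum>b\<in>Basis. f b *\<^sub>R b"
  have L: "(lborel :: 'n measure) = distr ?P borel ?T" by (rule lborel_eq)
  have T: "?T \<in> measurable ?P (borel :: 'n measure)" by measurable
  have g: "gauss l x * cis (v \<bullet> x) = (\<Prod>b\<in>Basis. F b (x \<bullet> b))" for x
  proof -
    have "(norm x)\<^sup>2 = (\<Sum>b\<in>Basis. (x \<bullet> b)\<^sup>2)"
      unfolding power2_norm_eq_inner by (subst euclidean_inner) (simp add: power2_eq_square)
    then have "exp (- l * (norm x)\<^sup>2) = (\<Prod>b\<in>Basis. exp (- l * (x \<bullet> b)\<^sup>2))"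
      by (simp add: exp_sum[symmetric] sum_distrib_left sum_negf)
    moreover have "cis (v \<bullet> x) = (\<Prod>b\<in>Basis. cis ((v \<bullet> b) * (x \<bullet> b)))"
      by (subst euclidean_inner) (rule cis_sum[OF finite_Basis])
    ultimately show ?thesis
      unfolding gauss_def F_def prod.distrib by simp
  qed
  have gT: "gauss l (?T f) * cis (v \<bullet> ?T f) = (\<Prod>b\<in>Basis. F b (f b))" for f
    unfolding g by (intro prod.cong refl) simp
  have Fi: "integrable lborel (F b)" for b
    unfolding F_def using gauss_fourier_real(1)[OF l] .
  have m: "(\<lambda>x. gauss l x * cis (v \<bullet> x)) \<in> borel_measurable (borel :: 'n measure)"
    unfolding gauss_def cis_conv_exp by measurable
  show "integrable lborel (\<lambda>x. gauss l x * cis (v \<bullet> x))"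
    unfolding L using m
    by (subst integrable_distr_eq[OF T]) (auto simp: gT intro!: product_integrable_prod Fi)
  have "(LINT x|lborel. gauss l x * cis (v \<bullet> x)) = integral\<^sup>L ?P (\<lambda>f. \<Prod>b\<in>Basis. F b (f b))"
    unfolding L using m by (subst integral_distr[OF T]) (auto simp: gT)
  also have "\<dots> = (\<Prod>b\<in>Basis. (LINT x|lborel. F b x))"
    by (rule product_integral_prod[OF finite_Basis Fi])
  also have "\<dots> = (\<Prod>b\<in>Basis. complex_of_real (sqrt (pi / l) * exp (- (v \<bullet> b)\<^sup>2 / (4 * l))))"
    unfolding F_def gauss_fourier_real(2)[OF l] ..
  also have "\<dots> = complex_of_real (sqrt (pi / l) ^ DIM('n) * exp (- (norm v)\<^sup>2 / (4 * l)))"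
  proof -
    have "(norm v)\<^sup>2 = (\<Sum>b\<in>Basis. (v \<bullet> b)\<^sup>2)"
      unfolding power2_norm_eq_inner by (subst euclidean_inner) (simp add: power2_eq_square)
    then have "(\<Prod>b\<in>Basis. exp (- (v \<bullet> b)\<^sup>2 / (4 * l))) = exp (- (norm v)\<^sup>2 / (4 * l))"
      by (simp add: exp_sum[symmetric] sum_divide_distrib sum_negf)
    then show ?thesis by (simp add: prod.distrib flip: of_real_prod)
  qed
  finally show "(LINT x|lborel. gauss l x * cis (v \<bullet> x)) =
      complex_of_real (sqrt (pi / l) ^ DIM('n) * exp (- (norm v)\<^sup>2 / (4 * l)))" .
qed

lemma gauss_integral:
  assumes "l > 0"
  shows "integrable lborel (\<lambda>x::'n::euclidean_space. exp (- l * (norm x)\<^sup>2))"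
    "(LINT x|lborel. exp (- l * (norm (x::'n))\<^sup>2)) = sqrt (pi / l) ^ DIM('n)"
proof -
  have 1: "integrable lborel (\<lambda>x::'n. complex_of_real (exp (- l * (norm x)\<^sup>2)))"
    "(LINT x|lborel. complex_of_real (exp (- l * (norm (x::'n))\<^sup>2))) = complex_of_real (sqrt (pi / l) ^ DIM('n))"
    using gauss_fourier[OF assms, of "0::'n"] by (simp_all add: gauss_def)
  show "integrable lborel (\<lambda>x::'n. exp (- l * (norm x)\<^sup>2))"
    using integrable_Re[OF 1(1)] by simp
  then show "(LINT x|lborel. exp (- l * (norm (x::'n))\<^sup>2)) = sqrt (pi / l) ^ DIM('n)"
    using 1(2) by (simp only: integral_complex_of_real of_real_eq_iff)
qed

lemma norm_integral_le:
  fixes f :: "'a \<Rightarrow> 'b::{banach, second_countable_topology}"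
  assumes "integrable M g" "\<And>x. norm (f x) \<le> g x"
  shows "norm (LINT x|M. f x) \<le> (LINT x|M. g x)"
proof -
  have "norm (LINT x|M. f x) \<le> (LINT x|M. norm (f x))" by simp
  also have "\<dots> \<le> (LINT x|M. g x)"
    using assms by (intro integral_mono') (auto intro: order_trans[OF norm_ge_zero])
  finally show ?thesis .
qed

lemma integrable_gauss_bound:
  fixes f :: "'n::euclidean_space \<Rightarrow> 'b::{banach, second_countable_topology}"
  assumes "f \<in> borel_measurable borel" "c > 0" "\<And>x. norm (f x) \<le> A * exp (- c * (norm x)\<^sup>2)"
  shows "integrable lborel f" "norm (LINT x|lborel. f x) \<le> A * sqrt (pi / c) ^ DIM('n)"
proof -
  have i: "integrable lborel (\<lambda>x::'n. A * exp (- c * (norm x)\<^sup>2))"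
    using gauss_integral(1)[OF assms(2)] by (rule integrable_mult_right)
  then show f: "integrable lborel f"
    using assms by (elim Bochner_Integration.integrable_bound) (auto intro: order_trans[OF _ abs_ge_self])
  have "norm (LINT x|lborel. f x) \<le> (LINT x|lborel. A * exp (- c * (norm (x::'n))\<^sup>2))"
    by (rule norm_integral_le[OF i assms(3)])
  then show "norm (LINT x|lborel. f x) \<le> A * sqrt (pi / c) ^ DIM('n)"
    by (simp only: integral_mult_right_zero gauss_integral(2)[OF assms(2)])
qed

lemma gsd_measurable: "gsd A h c f \<Longrightarrow> f \<in> borel_measurable borel"
  by (intro borel_measurable_continuous_onI gsd_continuous)

lemma gsd_integrable: "gsd A h c f \<Longrightarrow> c > 0 \<Longrightarrow> integrable lborel f"
  using integrable_gauss_bound(1) gsd_measurable gsd_bound0 by metis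

text \<open>Integrability is asked only after multiplication with one Gaussian, so \<open>g\<close>
  itself may grow. Near \<open>z\<close> continuity gives \<open>r / 2\<close>; away from
  \<open>z\<close> the additional \<open>k\<close> units of the exponent beat the normalising
  factor, which is polynomial in \<open>k\<close>.\<close>

lemma approx_identity:
  fixes g :: "'n::euclidean_space \<Rightarrow> complex"
  assumes m: "g \<in> borel_measurable borel" and cont: "isCont g z"
    and int: "integrable lborel (\<lambda>x. g x * gauss 1 (x - z))"
  shows "(\<lambda>k. complex_of_real (sqrt (real (Suc k) / pi) ^ DIM('n)) *
     (LINT x|lborel. g x * gauss (real (Suc k)) (x - z))) \<longlonglongrightarrow> g z"
proof -
  have gm: "gauss l \<in> borel_measurable (borel :: 'n measure)" for l
    unfolding gauss_def by measurable
  have gi: "integrable lborel (\<lambda>x. gauss l (x - z))" "(LINT x|lborel. gauss l (x - z)) = complex_of_real (sqrt (pi / l) ^ DIM('n))"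
    if "l > 0" for l
  proof -
    have *: "integrable lborel (gauss l :: 'n \<Rightarrow> complex)" "(LINT x|lborel. gauss l (x::'n)) = complex_of_real (sqrt (pi / l) ^ DIM('n))"
      using gauss_fourier[OF that, of "0::'n"] by simp_all
    have "integrable (distr lborel borel ((+) (- z))) (gauss l :: 'n \<Rightarrow> complex)"
      using *(1) by (simp add: lborel_distr_plus)
    then show "integrable lborel (\<lambda>x. gauss l (x - z))"
      by (subst (asm) integrable_distr_eq) (use gm in auto)
    have "(LINT x|distr lborel borel ((+) (- z)). gauss l (x::'n)) = (LINT x|lborel. gauss l (x - z))"
      by (subst integral_distr) (use gm in auto)
    then show "(LINT x|lborel. gauss l (x - z)) = complex_of_real (sqrt (pi / l) ^ DIM('n))"
      by (simp add: lborel_distr_plus *(2))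
  qed
  have ig: "integrable lborel (\<lambda>x. g x * gauss l (x - z))" if "l \<ge> 1" for l
    using int
  proof (rule Bochner_Integration.integrable_bound)
    show "AE x in lborel. norm (g x * gauss l (x - z)) \<le> norm (g x * gauss 1 (x - z))"
    proof (rule AE_I2)
      fix x
      have "exp (- l * (norm (x - z))\<^sup>2) \<le> exp (- 1 * (norm (x - z))\<^sup>2)"
        using mult_right_mono[OF that, of "(norm (x - z))\<^sup>2"] by simp
      then show "norm (g x * gauss l (x - z)) \<le> norm (g x * gauss 1 (x - z))"
        unfolding norm_mult gauss_def norm_of_real abs_exp_cancel by (rule mult_left_mono) simp
    qed
  qed (use m gm in measurable)
  define I where "I = (LINT x|lborel. cmod ((g x - g z) * gauss 1 (x - z)))"
  have ig1: "integrable lborel (\<lambda>x. (g x - g z) * gauss l (x - z))" if "l \<ge> 1" for l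
    using Bochner_Integration.integrable_diff[OF ig[OF that] integrable_mult_right[of "g z", OF gi(1)[of l]]] that
    by (simp add: algebra_simps)
  have I0: "I \<ge> 0" unfolding I_def by simp
  define S where "S k = sqrt (real (Suc k) / pi) ^ DIM('n)" for k
  have S: "S k > 0" for k by (simp add: S_def)
  have eq: "complex_of_real (S k) * (LINT x|lborel. g x * gauss (real (Suc k)) (x - z)) - g z
      = complex_of_real (S k) * (LINT x|lborel. (g x - g z) * gauss (real (Suc k)) (x - z))" for k
  proof -
    have "(LINT x|lborel. (g x - g z) * gauss (real (Suc k)) (x - z)) =
       (LINT x|lborel. g x * gauss (real (Suc k)) (x - z)) - g z * complex_of_real (sqrt (pi / real (Suc k)) ^ DIM('n))"
      using ig[of "real (Suc k)"] gi[of "real (Suc k)"] by (simp add: left_diff_distrib del: of_nat_Suc)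
    moreover have "S k * sqrt (pi / real (Suc k)) ^ DIM('n) = 1"
      unfolding S_def by (simp flip: power_mult_distrib real_sqrt_mult del: of_nat_Suc)
    then have "complex_of_real (S k) * (g z * complex_of_real (sqrt (pi / real (Suc k)) ^ DIM('n))) = g z"
      by (metis (no_types, lifting) mult.left_commute mult.right_neutral of_real_1 of_real_mult)
    ultimately show ?thesis by (simp add: right_diff_distrib)
  qed
  show ?thesis
    unfolding S_def[symmetric]
  proof (rule LIMSEQ_I)
    fix r :: real assume r: "r > 0"
    obtain d where d: "d > 0" "\<And>x. dist x z < d \<Longrightarrow> dist (g x) (g z) < r / 2"
      using cont r unfolding continuous_at_eps_delta by (meson half_gt_zero)
    have bound: "cmod (complex_of_real (S k) * (LINT x|lborel. (g x - g z) * gauss (real (Suc k)) (x - z)))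
        \<le> r / 2 + S k * exp (- real k * d\<^sup>2) * I" for k
    proof -
      let ?l = "real (Suc k)"
      have "cmod (LINT x|lborel. (g x - g z) * gauss ?l (x - z)) \<le>
          (LINT x|lborel. r / 2 * exp (- ?l * (norm (x - z))\<^sup>2) + exp (- real k * d\<^sup>2) * cmod ((g x - g z) * gauss 1 (x - z)))"
      proof (rule norm_integral_le)
        show "integrable lborel (\<lambda>x. r / 2 * exp (- ?l * (norm (x - z))\<^sup>2) + exp (- real k * d\<^sup>2) * cmod ((g x - g z) * gauss 1 (x - z)))"
          using integrable_Re[OF gi(1)[of ?l]] ig1[of 1]
          by (intro Bochner_Integration.integrable_add integrable_mult_right integrable_norm) (auto simp: gauss_def)
        fix x
        show "cmod ((g x - g z) * gauss ?l (x - z)) \<le> r / 2 * exp (- ?l * (norm (x - z))\<^sup>2) +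
            exp (- real k * d\<^sup>2) * cmod ((g x - g z) * gauss 1 (x - z))"
        proof (cases "dist x z < d")
          case True
          then have "cmod (g x - g z) \<le> r / 2" using d(2)[of x] by (simp add: dist_norm)
          then have "cmod (g x - g z) * exp (- ?l * (norm (x - z))\<^sup>2) \<le> r / 2 * exp (- ?l * (norm (x - z))\<^sup>2)"
            by (intro mult_right_mono) auto
          moreover have "0 \<le> exp (- real k * d\<^sup>2) * cmod ((g x - g z) * gauss 1 (x - z))" by simp
          ultimately show ?thesis unfolding norm_mult by (simp only: gauss_def norm_of_real abs_exp_cancel)
        next
          case False
          then have "d\<^sup>2 \<le> (norm (x - z))\<^sup>2" using d(1) by (intro power_mono) (auto simp: dist_norm)
          \<comment> \<open>Of the \<open>k + 1\<close> units in the exponent, one is kept for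
            integrability against \<open>gauss 1\<close>; the other \<open>k\<close> give the factor
            \<open>exp (- real k * d\<^sup>2)\<close>.\<close>
          then have "- ?l * (norm (x - z))\<^sup>2 \<le> - real k * d\<^sup>2 + - 1 * (norm (x - z))\<^sup>2"
            using mult_left_mono[of "d\<^sup>2" "(norm (x - z))\<^sup>2" "real k"] by (simp add: algebra_simps)
          then have "exp (- ?l * (norm (x - z))\<^sup>2) \<le> exp (- real k * d\<^sup>2) * exp (- 1 * (norm (x - z))\<^sup>2)"
            by (simp only: exp_le_cancel_iff flip: exp_add)
          then have "cmod (g x - g z) * exp (- ?l * (norm (x - z))\<^sup>2) \<le>
              cmod (g x - g z) * (exp (- real k * d\<^sup>2) * exp (- 1 * (norm (x - z))\<^sup>2))"
            by (intro mult_left_mono) auto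
          moreover have "0 \<le> r / 2 * exp (- ?l * (norm (x - z))\<^sup>2)" using r by simp
          ultimately show ?thesis unfolding norm_mult by (simp only: gauss_def norm_of_real abs_exp_cancel) argo
        qed
      qed
      also have "\<dots> = r / 2 * sqrt (pi / ?l) ^ DIM('n) + exp (- real k * d\<^sup>2) * I"
      proof -
        have 1: "integrable lborel (\<lambda>x. exp (- ?l * (norm (x - z))\<^sup>2))"
          using integrable_Re[OF gi(1)[of ?l]] by (simp add: gauss_def)
        have "complex_of_real (LINT x|lborel. exp (- ?l * (norm (x - z))\<^sup>2)) = complex_of_real (sqrt (pi / ?l) ^ DIM('n))"
          using gi(2)[of ?l] unfolding gauss_def integral_complex_of_real by simp
        then have "(LINT x|lborel. exp (- ?l * (norm (x - z))\<^sup>2)) = sqrt (pi / ?l) ^ DIM('n)"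
          by (simp only: of_real_eq_iff)
        with 1 ig1[of 1] show ?thesis
          unfolding I_def by (subst Bochner_Integration.integral_add) (auto intro!: integrable_mult_right)
      qed
      finally have "S k * cmod (LINT x|lborel. (g x - g z) * gauss ?l (x - z)) \<le>
          S k * (r / 2 * sqrt (pi / ?l) ^ DIM('n) + exp (- real k * d\<^sup>2) * I)"
        using S[of k] by (intro mult_left_mono) auto
      moreover have "S k * sqrt (pi / ?l) ^ DIM('n) = 1"
        unfolding S_def by (simp flip: power_mult_distrib real_sqrt_mult del: of_nat_Suc)
      ultimately show ?thesis using S[of k]
        by (simp add: norm_mult distrib_left mult.assoc mult.left_commute[of "S k" r])
    qed
    have "(\<lambda>k. S k * exp (- real k * d\<^sup>2)) \<longlonglongrightarrow> 0"
    proof -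
      define D where "D = d\<^sup>2"
      have D: "D > 0" using d by (simp add: D_def)
      have "(\<lambda>k. ((real k + 1) / pi) powr (DIM('n) / 2) * exp (- real k * D)) \<longlonglongrightarrow> 0"
        using D by real_asymp
      moreover have "S k = ((real k + 1) / pi) powr (DIM('n) / 2)" for k
      proof -
        have "S k = (sqrt (real (Suc k) / pi)) powr (DIM('n))"
          unfolding S_def by (subst powr_realpow) auto
        also have "sqrt (real (Suc k) / pi) = (real (Suc k) / pi) powr (1/2)" by (simp add: powr_half_sqrt)
        finally show ?thesis by (simp add: powr_powr add.commute)
      qed
      ultimately show ?thesis unfolding D_def by simp
    qed
    then have "(\<lambda>k. S k * exp (- real k * d\<^sup>2) * I) \<longlonglongrightarrow> 0" by (rule tendsto_mult_left_zero)
    from LIMSEQ_D[OF this half_gt_zero[OF r]] obtain no where no: "\<And>k. k \<ge> no \<Longrightarrow> norm (S k * exp (- real k * d\<^sup>2) * I - 0) < r / 2"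
      by blast
    show "\<exists>no. \<forall>k\<ge>no. norm (complex_of_real (S k) * (LINT x|lborel. g x * gauss (real (Suc k)) (x - z)) - g z) < r"
    proof (intro exI[of _ no] allI impI)
      fix k assume "no \<le> k"
      from no[OF this] have "S k * exp (- real k * d\<^sup>2) * I < r / 2" by simp
      with bound[of k] show "norm (complex_of_real (S k) * (LINT x|lborel. g x * gauss (real (Suc k)) (x - z)) - g z) < r"
        unfolding eq by linarith
    qed
  qed
qed

subsection \<open>The Fourier transform\<close>

lemma cis_remainder: "cmod (cis t - 1 - \<i> * complex_of_real t) \<le> t\<^sup>2 / 2"
  using iexp_approx1[of t 1] by (simp add: cis_conv_exp diff_diff_eq power2_eq_square)

text \<open>The second order Taylor remainder of \<open>cis\<close> bounds the error by the second
  moment of \<open>\<psi>\<close> times the square of the increment, so the derivative is obtained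
  from an explicit estimate.\<close>

lemma trig_integral_has_derivative:
  fixes \<psi> :: "'m::euclidean_space \<Rightarrow> complex" and a :: "'m \<Rightarrow> 'n::euclidean_space"
  assumes [measurable]: "\<psi> \<in> borel_measurable borel" "a \<in> borel_measurable borel"
    and i0: "integrable lborel \<psi>" and i2: "integrable lborel (\<lambda>Y. cmod (\<psi> Y) * (norm (a Y))\<^sup>2)"
  shows "((\<lambda>Z. LINT Y|lborel. \<psi> Y * cis (a Y \<bullet> Z)) has_derivative
     (\<lambda>w. LINT Y|lborel. \<psi> Y * (\<i> * complex_of_real (a Y \<bullet> w)) * cis (a Y \<bullet> Z))) (at Z)"
proof -
  have cm[measurable]: "(\<lambda>Y. cis (a Y \<bullet> Z)) \<in> borel_measurable borel" for Z
    unfolding cis_conv_exp by measurable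
  define C where "C = (LINT Y|lborel. cmod (\<psi> Y) * (norm (a Y))\<^sup>2)"
  have C: "C \<ge> 0" unfolding C_def by simp
  have i1: "integrable lborel (\<lambda>Y. cmod (\<psi> Y) * norm (a Y))"
  proof (rule Bochner_Integration.integrable_bound[OF Bochner_Integration.integrable_add[OF integrable_norm[OF i0] i2]])
    show "AE Y in lborel. norm (cmod (\<psi> Y) * norm (a Y)) \<le> norm (cmod (\<psi> Y) + cmod (\<psi> Y) * (norm (a Y))\<^sup>2)"
    proof (rule AE_I2)
      fix Y
      have "norm (a Y) \<le> 1 + (norm (a Y))\<^sup>2"
        using sum_squares_bound[of 1 "norm (a Y)"] norm_ge_zero[of "a Y"] unfolding one_power2 mult_1_right by linarith
      from mult_left_mono[OF this norm_ge_zero[of "\<psi> Y"]]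
      show "norm (cmod (\<psi> Y) * norm (a Y)) \<le> norm (cmod (\<psi> Y) + cmod (\<psi> Y) * (norm (a Y))\<^sup>2)"
        by (simp add: distrib_left)
    qed
  qed measurable
  have ic: "integrable lborel (\<lambda>Y. \<psi> Y * cis (a Y \<bullet> Z))" for Z
    by (rule Bochner_Integration.integrable_bound[OF i0]) (auto simp: norm_mult)
  have iD: "integrable lborel (\<lambda>Y. \<psi> Y * (\<i> * complex_of_real (a Y \<bullet> w)) * cis (a Y \<bullet> Z))" for w
  proof (rule Bochner_Integration.integrable_bound[OF integrable_mult_right[of "norm w", OF i1]])
    show "AE Y in lborel. norm (\<psi> Y * (\<i> * complex_of_real (a Y \<bullet> w)) * cis (a Y \<bullet> Z)) \<le> norm (norm w * (cmod (\<psi> Y) * norm (a Y)))"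
    proof (rule AE_I2)
      fix Y
      show "norm (\<psi> Y * (\<i> * complex_of_real (a Y \<bullet> w)) * cis (a Y \<bullet> Z)) \<le> norm (norm w * (cmod (\<psi> Y) * norm (a Y)))"
        using mult_left_mono[OF Cauchy_Schwarz_ineq2[of "a Y" w] norm_ge_zero[of "\<psi> Y"]]
        by (simp add: norm_mult abs_mult mult_ac)
    qed
  qed measurable
  show ?thesis
  proof (rule has_derivativeI_sandwich[where e = 1 and H = "\<lambda>y. C / 2 * norm (y - Z)"])
    show "bounded_linear (\<lambda>w. LINT Y|lborel. \<psi> Y * (\<i> * complex_of_real (a Y \<bullet> w)) * cis (a Y \<bullet> Z))"
    proof (rule bounded_linear_intro[where K = "LINT Y|lborel. cmod (\<psi> Y) * norm (a Y)"])
      fix x y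
      show "(LINT Y|lborel. \<psi> Y * (\<i> * complex_of_real (a Y \<bullet> (x + y))) * cis (a Y \<bullet> Z)) =
        (LINT Y|lborel. \<psi> Y * (\<i> * complex_of_real (a Y \<bullet> x)) * cis (a Y \<bullet> Z)) +
        (LINT Y|lborel. \<psi> Y * (\<i> * complex_of_real (a Y \<bullet> y)) * cis (a Y \<bullet> Z))"
      proof -
        have "\<psi> Y * (\<i> * complex_of_real (a Y \<bullet> (x + y))) * cis (a Y \<bullet> Z) =
            \<psi> Y * (\<i> * complex_of_real (a Y \<bullet> x)) * cis (a Y \<bullet> Z) + \<psi> Y * (\<i> * complex_of_real (a Y \<bullet> y)) * cis (a Y \<bullet> Z)" for Y
          by (simp add: inner_add_right distrib_left distrib_right)
        then show ?thesis by (simp only: Bochner_Integration.integral_add[OF iD iD])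
      qed
      fix r
      show "(LINT Y|lborel. \<psi> Y * (\<i> * complex_of_real (a Y \<bullet> (r *\<^sub>R x))) * cis (a Y \<bullet> Z)) =
        r *\<^sub>R (LINT Y|lborel. \<psi> Y * (\<i> * complex_of_real (a Y \<bullet> x)) * cis (a Y \<bullet> Z))"
      proof -
        have "\<psi> Y * (\<i> * complex_of_real (a Y \<bullet> (r *\<^sub>R x))) * cis (a Y \<bullet> Z) =
            r *\<^sub>R (\<psi> Y * (\<i> * complex_of_real (a Y \<bullet> x)) * cis (a Y \<bullet> Z))" for Y
          by (simp add: scaleR_conv_of_real mult_ac)
        then show ?thesis by (simp only: integral_scaleR_right)
      qed
      have "norm (LINT Y|lborel. \<psi> Y * (\<i> * complex_of_real (a Y \<bullet> x)) * cis (a Y \<bullet> Z)) \<le>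
          (LINT Y|lborel. norm x * (cmod (\<psi> Y) * norm (a Y)))"
      proof (rule norm_integral_le[OF integrable_mult_right[OF i1]])
        fix Y
        show "norm (\<psi> Y * (\<i> * complex_of_real (a Y \<bullet> x)) * cis (a Y \<bullet> Z)) \<le> norm x * (cmod (\<psi> Y) * norm (a Y))"
          using mult_left_mono[OF Cauchy_Schwarz_ineq2[of "a Y" x] norm_ge_zero[of "\<psi> Y"]]
          by (simp add: norm_mult mult_ac)
      qed
      then show "norm (LINT Y|lborel. \<psi> Y * (\<i> * complex_of_real (a Y \<bullet> x)) * cis (a Y \<bullet> Z)) \<le>
          norm x * (LINT Y|lborel. cmod (\<psi> Y) * norm (a Y))"
        by simp
    qed
    fix y assume y: "y \<noteq> Z"
    define w where "w = y - Z"
    have eq: "(LINT Y|lborel. \<psi> Y * cis (a Y \<bullet> y)) - (LINT Y|lborel. \<psi> Y * cis (a Y \<bullet> Z)) -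
        (LINT Y|lborel. \<psi> Y * (\<i> * complex_of_real (a Y \<bullet> w)) * cis (a Y \<bullet> Z)) =
        (LINT Y|lborel. \<psi> Y * cis (a Y \<bullet> Z) * (cis (a Y \<bullet> w) - 1 - \<i> * complex_of_real (a Y \<bullet> w)))"
    proof -
      have "cis (a Y \<bullet> y) = cis (a Y \<bullet> Z) * cis (a Y \<bullet> w)" for Y
        by (simp add: w_def cis_mult inner_diff_right)
      then have "\<psi> Y * cis (a Y \<bullet> Z) * (cis (a Y \<bullet> w) - 1 - \<i> * complex_of_real (a Y \<bullet> w)) =
          \<psi> Y * cis (a Y \<bullet> y) - \<psi> Y * cis (a Y \<bullet> Z) - \<psi> Y * (\<i> * complex_of_real (a Y \<bullet> w)) * cis (a Y \<bullet> Z)" for Y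
        by (simp add: algebra_simps)
      then show ?thesis
        using ic[of y] ic[of Z] iD[of w] by simp
    qed
    have "norm (LINT Y|lborel. \<psi> Y * cis (a Y \<bullet> Z) * (cis (a Y \<bullet> w) - 1 - \<i> * complex_of_real (a Y \<bullet> w)))
        \<le> (LINT Y|lborel. ((norm w)\<^sup>2 / 2) * (cmod (\<psi> Y) * (norm (a Y))\<^sup>2))"
    proof (rule norm_integral_le)
      fix Y
      have "(a Y \<bullet> w)\<^sup>2 \<le> (norm (a Y) * norm w)\<^sup>2"
        unfolding abs_le_square_iff[symmetric] using Cauchy_Schwarz_ineq2[of "a Y" w] by (simp add: abs_mult)
      then have "cmod (cis (a Y \<bullet> w) - 1 - \<i> * complex_of_real (a Y \<bullet> w)) \<le> (norm (a Y) * norm w)\<^sup>2 / 2"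
        using cis_remainder[of "a Y \<bullet> w"] by linarith
      from mult_left_mono[OF this norm_ge_zero[of "\<psi> Y"]]
      show "norm (\<psi> Y * cis (a Y \<bullet> Z) * (cis (a Y \<bullet> w) - 1 - \<i> * complex_of_real (a Y \<bullet> w)))
        \<le> ((norm w)\<^sup>2 / 2) * (cmod (\<psi> Y) * (norm (a Y))\<^sup>2)"
        by (simp add: norm_mult power_mult_distrib mult_ac)
    qed (intro integrable_mult_right i2)
    also have "\<dots> = C / 2 * norm w * norm w"
      by (simp add: C_def power2_eq_square)
    finally show "norm ((LINT Y|lborel. \<psi> Y * cis (a Y \<bullet> y)) - (LINT Y|lborel. \<psi> Y * cis (a Y \<bullet> Z)) -
        (LINT Y|lborel. \<psi> Y * (\<i> * complex_of_real (a Y \<bullet> (y - Z))) * cis (a Y \<bullet> Z))) / norm (y - Z) \<le> C / 2 * norm (y - Z)"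
      using y eq unfolding w_def by (simp add: divide_le_eq)
  next
    show "((\<lambda>y. C / 2 * norm (y - Z)) \<longlongrightarrow> 0) (at Z)"
    proof -
      have "((\<lambda>y. C / 2 * norm (y - Z)) \<longlongrightarrow> C / 2 * norm (Z - Z)) (at Z)"
        by (intro tendsto_intros)
      then show ?thesis by simp
    qed
  qed simp
qed

lemma power_gauss_le:
  assumes "c > 0" "r \<ge> (0::real)"
  shows "r ^ k * exp (- c * r\<^sup>2) \<le> sqrt (fact k) * (1 / sqrt c) ^ k * exp (- (c / 2) * r\<^sup>2)"
proof -
  have "r ^ k * exp (- c * r\<^sup>2) \<le> (sqrt (fact k) * (1 / sqrt c) ^ k * exp ((sqrt c)\<^sup>2 * r\<^sup>2 / 2)) * exp (- c * r\<^sup>2)"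
    using assms by (intro mult_right_mono power_le_gauss) auto
  also have "\<dots> = sqrt (fact k) * (1 / sqrt c) ^ k * (exp ((sqrt c)\<^sup>2 * r\<^sup>2 / 2) * exp (- c * r\<^sup>2))"
    by (simp only: mult.assoc)
  also have "exp ((sqrt c)\<^sup>2 * r\<^sup>2 / 2) * exp (- c * r\<^sup>2) = exp (- (c / 2) * r\<^sup>2)"
    using assms by (simp flip: exp_add)
  finally show ?thesis .
qed

text \<open>The frequency map \<open>a\<close> is merely measurable of linear growth, not linear,
  because it is also applied to \<open>jj\<close> composed with simple functions.\<close>

lemma partials_trig_integral:
  fixes \<phi> :: "'m::euclidean_space \<Rightarrow> complex" and a :: "'m \<Rightarrow> 'n::euclidean_space"
  assumes [measurable]: "\<phi> \<in> borel_measurable borel" "a \<in> borel_measurable borel"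
    and c: "c > 0" and \<phi>: "\<And>Y. cmod (\<phi> Y) \<le> A * exp (- c * (norm Y)\<^sup>2)"
    and a: "\<And>Y. norm (a Y) \<le> \<kappa> * norm Y"
  shows "smooth (\<lambda>Z. LINT Y|lborel. \<phi> Y * cis (a Y \<bullet> Z))"
    "set bs \<subseteq> Basis \<Longrightarrow> partials bs (\<lambda>Z. LINT Y|lborel. \<phi> Y * cis (a Y \<bullet> Z)) =
      (\<lambda>Z. LINT Y|lborel. \<phi> Y * (\<i> ^ length bs * complex_of_real (basis_prod bs (a Y))) * cis (a Y \<bullet> Z))"
proof -
  let ?\<psi> = "\<lambda>bs Y. \<phi> Y * (\<i> ^ length bs * complex_of_real (basis_prod bs (a Y)))"
  let ?G = "\<lambda>bs Z. LINT Y|lborel. ?\<psi> bs Y * cis (a Y \<bullet> Z)"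
  have bm[measurable]: "(\<lambda>Y. basis_prod bs (a Y)) \<in> borel_measurable borel" for bs
    by (induction bs) auto
  have A: "A \<ge> 0" using order_trans[OF norm_ge_zero \<phi>[of 0]] by simp
  have b: "cmod (?\<psi> bs Y) * norm (a Y) ^ j \<le>
      (A * \<kappa> ^ (length bs + j) * (sqrt (fact (length bs + j)) * (1 / sqrt c) ^ (length bs + j))) * exp (- (c / 2) * (norm Y)\<^sup>2)"
    if bs: "set bs \<subseteq> Basis" for bs Y j
  proof -
    let ?k = "length bs + j"
    have "cmod (?\<psi> bs Y) * norm (a Y) ^ j \<le> (A * exp (- c * (norm Y)\<^sup>2)) * (norm (a Y) ^ length bs) * norm (a Y) ^ j"
      unfolding norm_mult using \<phi>[of Y] abs_basis_prod_le[OF bs, of "a Y"] A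
      by (intro mult_right_mono mult_mono) (auto simp: norm_power)
    also have "\<dots> = (A * exp (- c * (norm Y)\<^sup>2)) * norm (a Y) ^ ?k"
      by (simp add: power_add)
    also have "\<dots> \<le> (A * exp (- c * (norm Y)\<^sup>2)) * (\<kappa> * norm Y) ^ ?k"
      using A a by (intro mult_left_mono power_mono) auto
    also have "\<dots> = A * \<kappa> ^ ?k * (norm Y ^ ?k * exp (- c * (norm Y)\<^sup>2))"
      by (simp add: power_mult_distrib)
    also have "\<dots> \<le> A * \<kappa> ^ ?k * (sqrt (fact ?k) * (1 / sqrt c) ^ ?k * exp (- (c / 2) * (norm Y)\<^sup>2))"
    proof (rule mult_left_mono[OF power_gauss_le[OF c norm_ge_zero]])
      \<comment> \<open>Testing the growth bound on a unit vector shows that \<open>\<kappa>\<close>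
        is nonnegative.\<close>
      obtain e :: 'm where e: "norm e = 1" using vector_choose_size[of 1] by auto
      have "0 \<le> \<kappa>" using order_trans[OF norm_ge_zero a[of e]] e by simp
      then show "0 \<le> A * \<kappa> ^ ?k" using A by simp
    qed
    finally show ?thesis by (simp only: mult.assoc)
  qed
  have nn: "norm (cmod (?\<psi> bs Y) * norm (a Y) ^ j) = cmod (?\<psi> bs Y) * norm (a Y) ^ j" for bs Y j
    unfolding real_norm_def by (rule abs_of_nonneg, rule mult_nonneg_nonneg) simp_all
  have *: "\<exists>D. (?G bs has_derivative D) (at Z) \<and> (\<forall>b\<in>Basis. D b = ?G (b # bs) Z)"
    if bs: "set bs \<subseteq> Basis" for bs Z
  proof (intro exI conjI ballI)
    show "(?G bs has_derivative (\<lambda>w. LINT Y|lborel. ?\<psi> bs Y * (\<i> * complex_of_real (a Y \<bullet> w)) * cis (a Y \<bullet> Z))) (at Z)"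
    proof (rule trig_integral_has_derivative)
      show "integrable lborel (?\<psi> bs)"
        using b[OF bs, of _ 0] c by (intro integrable_gauss_bound(1)[where c = "c / 2"]) auto
      show "integrable lborel (\<lambda>Y. cmod (?\<psi> bs Y) * (norm (a Y))\<^sup>2)"
        using c by (intro integrable_gauss_bound(1)[OF _ _ order_trans[OF eq_refl[OF nn] b[OF bs, of _ 2]]]) simp_all
    qed measurable
    fix b
    show "(LINT Y|lborel. ?\<psi> bs Y * (\<i> * complex_of_real (a Y \<bullet> b)) * cis (a Y \<bullet> Z)) = ?G (b # bs) Z"
      by (rule Bochner_Integration.integral_cong) (auto simp: mult_ac)
  qed
  show "smooth (\<lambda>Z. LINT Y|lborel. \<phi> Y * cis (a Y \<bullet> Z))"
    by (rule smooth_family(1)[where G = ?G, OF _ *]) simp_all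
  show "set bs \<subseteq> Basis \<Longrightarrow> partials bs (\<lambda>Z. LINT Y|lborel. \<phi> Y * cis (a Y \<bullet> Z)) = ?G bs"
    by (rule smooth_family(2)[where G = ?G, OF _ *]) simp_all
qed

lemma partials_measurable: "smooth f \<Longrightarrow> set bs \<subseteq> Basis \<Longrightarrow> partials bs f \<in> borel_measurable borel"
  by (intro borel_measurable_continuous_onI smooth_continuous)

lemma fact_add_le: "fact (m + n) \<le> 2 ^ (m + n) * (fact m * fact n :: real)"
proof -
  have "(fact (m + n) :: nat) = (fact m * fact n) * ((m + n) choose m)"
    using binomial_fact_lemma[of m "m + n"] by simp
  from arg_cong[OF this, of real] have "(fact (m + n) :: real) = (fact m * fact n) * real ((m + n) choose m)"
    by (simp only: of_nat_fact of_nat_mult)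
  also have "\<dots> \<le> (fact m * fact n) * 2 ^ (m + n)"
    by (intro mult_left_mono binomial_le_pow2_real) simp
  finally show ?thesis by (simp add: mult.commute)
qed

lemma gsd_partials:
  assumes f: "gsd A h c f" and h: "0 \<le> h" and bs: "set bs \<subseteq> Basis"
  shows "gsd (A * (sqrt 2 * h) ^ length bs * sqrt (fact (length bs))) (sqrt 2 * h) c (partials bs f)"
  unfolding gsd_def
proof (intro conjI allI impI)
  show "smooth (partials bs f)" using gsd_smooth[OF f] bs by (rule smooth_partials)
  fix cs :: "'a list" and x :: 'a assume cs: "set cs \<subseteq> Basis"
  let ?m = "length bs" and ?k = "length cs"
  have A: "A \<ge> 0" using f by (rule gsd_nonneg)
  have "sqrt (fact (?k + ?m)) \<le> sqrt (2 ^ (?k + ?m) * (fact ?k * fact ?m))"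
    by (rule real_sqrt_le_mono[OF fact_add_le])
  then have s: "sqrt (fact (?k + ?m)) \<le> sqrt 2 ^ (?k + ?m) * (sqrt (fact ?k) * sqrt (fact ?m))"
    by (simp add: real_sqrt_mult real_sqrt_power)
  have "cmod (partials cs (partials bs f) x) \<le> A * h ^ (?k + ?m) * sqrt (fact (?k + ?m)) * exp (- c * (norm x)\<^sup>2)"
    using gsd_bound[OF f, of "cs @ bs" x] bs cs by (simp add: partials_append)
  also have "\<dots> \<le> A * h ^ (?k + ?m) * (sqrt 2 ^ (?k + ?m) * (sqrt (fact ?k) * sqrt (fact ?m))) * exp (- c * (norm x)\<^sup>2)"
    using A h by (intro mult_right_mono mult_left_mono s) auto
  also have "\<dots> = A * (sqrt 2 * h) ^ ?m * sqrt (fact ?m) * (sqrt 2 * h) ^ ?k * sqrt (fact ?k) * exp (- c * (norm x)\<^sup>2)"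
    by (simp add: power_add power_mult_distrib)
  finally show "cmod (partials cs (partials bs f) x) \<le>
    A * (sqrt 2 * h) ^ ?m * sqrt (fact ?m) * (sqrt 2 * h) ^ ?k * sqrt (fact ?k) * exp (- c * (norm x)\<^sup>2)" .
qed

section \<open>Integration by parts and decay of Fourier transforms\<close>

lemma integral_translate:
  fixes f :: "'n::euclidean_space \<Rightarrow> 'b::{banach, second_countable_topology}"
  assumes "f \<in> borel_measurable borel"
  shows "(LINT x|lborel. f (x + y)) = (LINT x|lborel. f x)"
    "integrable lborel f \<Longrightarrow> integrable lborel (\<lambda>x. f (x + y))"
proof -
  have "(LINT x|distr lborel borel ((+) y). f x) = (LINT x|lborel. f (x + y))"
    using assms by (subst integral_distr) (auto simp: add.commute)
  then show "(LINT x|lborel. f (x + y)) = (LINT x|lborel. f x)"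
    by (simp add: lborel_distr_plus)
  assume "integrable lborel f"
  then have "integrable (distr lborel borel ((+) y)) f" by (simp add: lborel_distr_plus)
  then show "integrable lborel (\<lambda>x. f (x + y))"
    using assms by (subst (asm) integrable_distr_eq) (auto simp: add.commute)
qed

text \<open>Difference quotients have integral 0 by translation invariance, and they converge
  dominatedly to the derivative: steps of length at most 1 change the Gaussian bound only by the
  constant \<open>exp c\<close> and half of the decay.\<close>

lemma integral_partial_eq_0:
  fixes f :: "'n::euclidean_space \<Rightarrow> complex"
  assumes f: "gsd A h c f" and h: "0 \<le> h" and c: "c > 0" and b: "b \<in> Basis"
  shows "(LINT x|lborel. partials [b] f x) = 0"
proof -
  define s where "s k = inverse (real (Suc k))" for k
  have s: "0 < s k" "s k \<le> 1" for k by (auto simp: s_def field_simps)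
  define F where "F k x = (f (x + s k *\<^sub>R b) - f x) / complex_of_real (s k)" for k x
  have sm: "smooth f" using f by (rule gsd_smooth)
  have A: "A \<ge> 0" using f by (rule gsd_nonneg)
  have fm[measurable]: "f \<in> borel_measurable borel" using f by (rule gsd_measurable)
  have fi: "integrable lborel f" using f c by (rule gsd_integrable)
  have F0: "(LINT x|lborel. F k x) = 0" for k
    unfolding F_def using integral_translate[OF fm, of "s k *\<^sub>R b"] fi by simp
  note D = smooth_has_derivative[OF sm, of "[]", simplified]
  have "(\<lambda>k. LINT x|lborel. F k x) \<longlonglongrightarrow> (LINT x|lborel. partials [b] f x)"
  proof (rule integral_dominated_convergence)
    show "integrable lborel (\<lambda>x::'n. (A * h * exp c) * exp (- (c / 2) * (norm x)\<^sup>2))"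
      using c by (intro integrable_mult_right gauss_integral(1)) simp
    show "AE x in lborel. (\<lambda>k. F k x) \<longlonglongrightarrow> partials [b] f x"
    proof (rule AE_I2)
      fix x
      let ?D = "frechet_derivative f (at x)"
      interpret D: bounded_linear ?D using D by (rule has_derivative_bounded_linear)
      have "filterlim (\<lambda>k. s k *\<^sub>R b) (at 0) sequentially"
        unfolding filterlim_at
      proof (intro conjI)
        show "(\<lambda>k. s k *\<^sub>R b) \<longlonglongrightarrow> 0"
          unfolding s_def using tendsto_scaleR[OF LIMSEQ_inverse_real_of_nat tendsto_const, of b] by simp
        show "\<forall>\<^sub>F k in sequentially. s k *\<^sub>R b \<in> UNIV \<and> s k *\<^sub>R b \<noteq> 0"
          using s(1) b by (intro always_eventually allI) (auto simp: order_less_imp_not_eq2)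
      qed
      with D[of x, unfolded has_derivative_at] have
        "(\<lambda>k. norm (f (x + s k *\<^sub>R b) - f x - ?D (s k *\<^sub>R b)) / norm (s k *\<^sub>R b)) \<longlonglongrightarrow> 0"
        using filterlim_compose by blast
      moreover have "norm (f (x + s k *\<^sub>R b) - f x - ?D (s k *\<^sub>R b)) / norm (s k *\<^sub>R b) = norm (F k x - ?D b)" for k
      proof -
        have "F k x - ?D b = (f (x + s k *\<^sub>R b) - f x - ?D (s k *\<^sub>R b)) / complex_of_real (s k)"
          using s(1)[of k] by (simp add: F_def D.scaleR scaleR_conv_of_real field_simps)
        then show ?thesis using s(1)[of k] b by (simp add: norm_divide)
      qed
      ultimately show "(\<lambda>k. F k x) \<longlonglongrightarrow> partials [b] f x"
        by (simp add: tendsto_norm_zero_iff LIM_zero_iff)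
    qed
    fix k
    show "AE x in lborel. norm (F k x) \<le> (A * h * exp c) * exp (- (c / 2) * (norm x)\<^sup>2)"
    proof (rule AE_I2)
      fix x
      have "norm (f (x + s k *\<^sub>R b) - f (x + 0 *\<^sub>R b)) \<le> ((A * h * exp c) * exp (- (c / 2) * (norm x)\<^sup>2)) * norm (s k - 0)"
      proof (rule differentiable_bound[of "{0..s k}" "\<lambda>t. f (x + t *\<^sub>R b)" "\<lambda>t r. frechet_derivative f (at (x + t *\<^sub>R b)) (r *\<^sub>R b)"])
        fix t assume t: "t \<in> {0..s k}"
        show "((\<lambda>t. f (x + t *\<^sub>R b)) has_derivative (\<lambda>r. frechet_derivative f (at (x + t *\<^sub>R b)) (r *\<^sub>R b))) (at t within {0..s k})"
          by (rule has_derivative_compose[OF _ D]) (auto intro!: derivative_eq_intros)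
        have "cmod (partials [b] f (x + t *\<^sub>R b)) \<le> A * h * exp (- c * (norm (x + t *\<^sub>R b))\<^sup>2)"
          using gsd_bound[OF f, of "[b]" "x + t *\<^sub>R b"] b by simp
        also have "\<dots> \<le> A * h * (exp c * exp (- (c / 2) * (norm x)\<^sup>2))"
        proof -
          have "(norm (t *\<^sub>R b))\<^sup>2 \<le> 1"
            using t s(2)[of k] b by (simp add: power_mult_distrib abs_square_le_1)
          then have "(norm x)\<^sup>2 / 2 - 1 \<le> (norm (x + t *\<^sub>R b))\<^sup>2"
            using norm_diff_sq_ge[of x "- (t *\<^sub>R b)"] by simp
          from mult_left_mono[OF this, of c] c
          have "- c * (norm (x + t *\<^sub>R b))\<^sup>2 \<le> c + - (c / 2) * (norm x)\<^sup>2"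
            by (simp add: algebra_simps)
          then show ?thesis using A h by (intro mult_left_mono) (auto simp flip: exp_add)
        qed
        finally have "cmod (frechet_derivative f (at (x + t *\<^sub>R b)) b) \<le> (A * h * exp c) * exp (- (c / 2) * (norm x)\<^sup>2)"
          by simp
        then show "onorm (\<lambda>r. frechet_derivative f (at (x + t *\<^sub>R b)) (r *\<^sub>R b)) \<le> (A * h * exp c) * exp (- (c / 2) * (norm x)\<^sup>2)"
          using has_derivative_bounded_linear[OF D[of "x + t *\<^sub>R b"]] A h
          by (intro onorm_le) (auto simp: linear_simps mult.commute[of _ "\<bar>_\<bar>"] intro!: mult_left_mono)
      qed (use s in \<open>auto intro: less_imp_le\<close>)
      then show "norm (F k x) \<le> (A * h * exp c) * exp (- (c / 2) * (norm x)\<^sup>2)"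
        using s(1)[of k] by (simp add: F_def norm_divide divide_le_eq)
    qed
  next
    show "partials [b] f \<in> borel_measurable lborel"
      using partials_measurable[OF sm, of "[b]"] b by simp
  qed (auto simp: F_def)
  then show ?thesis unfolding F0 by (simp add: LIMSEQ_const_iff)
qed

text \<open>Integration by parts in the form that the derivative of
  \<open>f x * cis (v \<bullet> x)\<close> has integral 0.\<close>

lemma fourier_partial:
  fixes f :: "'n::euclidean_space \<Rightarrow> complex"
  assumes f: "gsd A h c f" and h: "0 \<le> h" and c: "c > 0" and b: "b \<in> Basis"
  shows "(LINT x|lborel. partials [b] f x * cis (v \<bullet> x)) =
    - (\<i> * complex_of_real (v \<bullet> b)) * (LINT x|lborel. f x * cis (v \<bullet> x))"
proof -
  note sm = gsd_smooth[OF f]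
  have g: "gsd (A * exp (1\<^sup>2 * (norm v)\<^sup>2 / 2)) (2 * max h (1 / 1)) (c + 0) (\<lambda>x. f x * cis (v \<bullet> x))"
    using h by (intro gsd_mult' f gsd_cis) auto
  have cm[measurable]: "(\<lambda>x. cis (v \<bullet> x)) \<in> borel_measurable borel"
    unfolding cis_conv_exp by measurable
  have [measurable]: "partials [b] f \<in> borel_measurable borel" using partials_measurable[OF sm, of "[b]"] b by simp
  have fm[measurable]: "f \<in> borel_measurable borel" using f by (rule gsd_measurable)
  have "partials [b] (\<lambda>x. f x * cis (v \<bullet> x)) =
      (\<lambda>x. partials [b] f x * cis (v \<bullet> x) + (\<i> * complex_of_real (v \<bullet> b)) * (f x * cis (v \<bullet> x)))"
    using partials_mult(2)[OF sm partials_cis(1)[of v], of "[b]"] partials_cis(2)[of "[b]" v] b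
    by (auto simp: fun_eq_iff mult_ac)
  with integral_partial_eq_0[OF g _ _ b] h c
  have "(LINT x|lborel. partials [b] f x * cis (v \<bullet> x) + (\<i> * complex_of_real (v \<bullet> b)) * (f x * cis (v \<bullet> x))) = 0"
    by (simp del: partials.simps)
  moreover have "integrable lborel (\<lambda>x. partials [b] f x * cis (v \<bullet> x))"
    using gsd_bound[OF f, of "[b]"] b c
    by (intro integrable_gauss_bound(1)[where c = c and A = "A * h"]) (auto simp: norm_mult simp del: partials.simps)
  moreover have "integrable lborel (\<lambda>x. f x * cis (v \<bullet> x))"
    using gsd_bound0[OF f] c by (intro integrable_gauss_bound(1)[where c = c and A = A]) (auto simp: norm_mult)
  ultimately have "(LINT x|lborel. partials [b] f x * cis (v \<bullet> x)) +
      (\<i> * complex_of_real (v \<bullet> b)) * (LINT x|lborel. f x * cis (v \<bullet> x)) = 0"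
    by (simp del: partials.simps)
  then show ?thesis by (simp only: eq_neg_iff_add_eq_0 mult_minus_left)
qed

lemma fourier_partials:
  fixes f :: "'n::euclidean_space \<Rightarrow> complex"
  assumes f: "gsd A h c f" and h: "0 \<le> h" and c: "c > 0" and bs: "set bs \<subseteq> Basis"
  shows "(LINT x|lborel. partials bs f x * cis (v \<bullet> x)) =
    (- \<i>) ^ length bs * complex_of_real (basis_prod bs v) * (LINT x|lborel. f x * cis (v \<bullet> x))"
  using bs
proof (induction bs)
  case (Cons b bs)
  then have "set bs \<subseteq> Basis" "b \<in> Basis" by auto
  with fourier_partial[OF gsd_partials[OF f h] _ c, of bs b v] h Cons.IH
  show ?case by (simp add: mult_ac)
qed simp

lemma basis_prod_replicate: "basis_prod (replicate m b) v = (v \<bullet> b) ^ m"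
  by (induction m) auto

text \<open>Even powers of \<open>v \<bullet> b\<close> are moved onto derivatives of
  \<open>f\<close>, whose integrals are controlled by \<open>gsd\<close>; \<open>gauss_decay\<close>
  then turns these power bounds into a Gaussian. The amplitude stays proportional to
  \<open>A\<close>.\<close>

lemma fourier_decay:
  fixes f :: "'n::euclidean_space \<Rightarrow> complex" and h :: real
  assumes f: "gsd A h c f" and h: "0 < h" and c: "c > 0"
  shows "cmod (LINT x|lborel. f x * cis (v \<bullet> x)) \<le>
     2 * (A * sqrt (pi / c) ^ DIM('n)) * exp (- (1 / (4 * DIM('n) * h\<^sup>2)) * (norm v)\<^sup>2)"
proof (rule gauss_decay)
  fix b k assume b: "b \<in> (Basis :: 'n set)"
  let ?bs = "replicate (2 * k) b"
  have bs: "set ?bs \<subseteq> Basis" using b by auto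
  have cm[measurable]: "(\<lambda>x. cis (v \<bullet> x)) \<in> borel_measurable borel"
    unfolding cis_conv_exp by measurable
  have [measurable]: "partials ?bs f \<in> borel_measurable borel"
    using partials_measurable[OF gsd_smooth[OF f] bs] .
  have "(v \<bullet> b) ^ (2 * k) * cmod (LINT x|lborel. f x * cis (v \<bullet> x)) = cmod (LINT x|lborel. partials ?bs f x * cis (v \<bullet> x))"
    unfolding fourier_partials[OF f less_imp_le[OF h] c bs] norm_mult basis_prod_replicate
    by (simp add: norm_power power_mult)
  also have "\<dots> \<le> (A * h ^ (2 * k) * sqrt (fact (2 * k))) * sqrt (pi / c) ^ DIM('n)"
    using gsd_bound[OF f bs] c by (intro integrable_gauss_bound(2)) (auto simp: norm_mult)
  finally show "(v \<bullet> b) ^ (2 * k) * cmod (LINT x|lborel. f x * cis (v \<bullet> x)) \<le>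
      A * sqrt (pi / c) ^ DIM('n) * h ^ (2 * k) * sqrt (fact (2 * k))"
    by (simp add: mult_ac)
qed (use h in simp_all)

lemma lborel_fubini:
  fixes f :: "'m::euclidean_space \<Rightarrow> 'n::euclidean_space \<Rightarrow> complex"
  assumes m: "(\<lambda>(x, y). f x y) \<in> borel_measurable (borel \<Otimes>\<^sub>M borel)"
    and p: "integrable lborel p" and q: "integrable lborel q"
    and bound: "\<And>x y. cmod (f x y) \<le> p x * q y"
  shows "integrable (lborel \<Otimes>\<^sub>M lborel) (\<lambda>(x, y). f x y)"
    "(LINT x|lborel. LINT y|lborel. f x y) = (LINT y|lborel. LINT x|lborel. f x y)"
proof -
  have m': "(\<lambda>(x, y). f x y) \<in> borel_measurable (lborel \<Otimes>\<^sub>M lborel)"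
    using m by (simp cong: measurable_cong_sets)
  have m2: "(\<lambda>y. f x y) \<in> borel_measurable borel" for x
    using measurable_compose[OF measurable_Pair1' m, of x] by simp
  have iy: "integrable lborel (\<lambda>y. f x y)" for x
    using m2 bound[of x] by (intro Bochner_Integration.integrable_bound[OF integrable_mult_right[of "p x", OF q]])
      (auto intro: order_trans[OF _ abs_ge_self])
  have "integrable lborel (\<lambda>x. LINT y|lborel. cmod (f x y))"
  proof (rule Bochner_Integration.integrable_bound[OF integrable_mult_left[of "LINT y|lborel. q y", OF p]])
    show "(\<lambda>x. LINT y|lborel. cmod (f x y)) \<in> borel_measurable lborel"
      using m' by (intro lborel.borel_measurable_lebesgue_integral) (simp add: split_def)
    show "AE x in lborel. norm (LINT y|lborel. cmod (f x y)) \<le> norm (p x * (LINT y|lborel. q y))"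
    proof (rule AE_I2)
      fix x
      have "norm (LINT y|lborel. cmod (f x y)) \<le> (LINT y|lborel. p x * q y)"
        using bound[of x] by (intro norm_integral_le integrable_mult_right q) auto
      then show "norm (LINT y|lborel. cmod (f x y)) \<le> norm (p x * (LINT y|lborel. q y))"
        by simp
    qed
  qed
  then show i: "integrable (lborel \<Otimes>\<^sub>M lborel) (\<lambda>(x, y). f x y)"
    using iy m' by (intro lborel_pair.Fubini_integrable) (auto simp: split_def)
  show "(LINT x|lborel. LINT y|lborel. f x y) = (LINT y|lborel. LINT x|lborel. f x y)"
    using lborel_pair.Fubini_integral[OF i] by simp
qed

text \<open>Here \<open>L\<close> is \<open>\<kappa>\<close> times an isometry with adjoint \<open>L'\<close>; the cases needed are the identity and
  the symplectic matrix times \<open>2\<close>.\<close>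

lemma fourier_regularized:
  fixes g :: "'n::euclidean_space \<Rightarrow> complex" and L L' :: "'n \<Rightarrow> 'n"
  assumes m[measurable]: "g \<in> borel_measurable borel" and cont: "isCont g z" and int: "integrable lborel g"
    and L[measurable]: "L \<in> borel_measurable borel" and adj: "\<And>X w. L X \<bullet> w = X \<bullet> L' w"
    and iso: "\<And>w. norm (L' w) = \<kappa> * norm w" and \<kappa>: "\<kappa> > 0"
  shows "(\<lambda>k. complex_of_real ((\<kappa> / (2 * pi)) ^ DIM('n)) * (LINT X|lborel. gauss (\<kappa>\<^sup>2 / (4 * real (Suc k))) X *
     (cis (- (L X \<bullet> z)) * (LINT x|lborel. g x * cis (L X \<bullet> x))))) \<longlonglongrightarrow> g z"
proof -
  have gm[measurable]: "gauss l \<in> borel_measurable (borel :: 'n measure)" for l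
    unfolding gauss_def by measurable
  have cm[measurable]: "cis \<in> borel_measurable borel"
    by (intro borel_measurable_continuous_onI continuous_intros)
  have "integrable lborel (\<lambda>x. g x * gauss 1 (x - z))"
    by (rule Bochner_Integration.integrable_bound[OF int])
      (auto simp: norm_mult gauss_def mult_left_le)
  note AI = approx_identity[OF m cont this]
  have "complex_of_real (sqrt (real (Suc k) / pi) ^ DIM('n)) * (LINT x|lborel. g x * gauss (real (Suc k)) (x - z)) =
    complex_of_real ((\<kappa> / (2 * pi)) ^ DIM('n)) * (LINT X|lborel. gauss (\<kappa>\<^sup>2 / (4 * real (Suc k))) X *
     (cis (- (L X \<bullet> z)) * (LINT x|lborel. g x * cis (L X \<bullet> x))))" for k
  proof -
    define t where "t = real (Suc k)"
    \<comment> \<open>With this choice the Fourier transform of \<open>gauss l\<close> at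
      \<open>L' (x - z)\<close> is a multiple of \<open>gauss t (x - z)\<close>, as
      \<open>\<kappa>\<^sup>2 / (4 * l) = t\<close>.\<close>
    define l where "l = \<kappa>\<^sup>2 / (4 * t)"
    have t: "t > 0" and l: "l > 0" using \<kappa> by (auto simp: t_def l_def)
    have e: "gauss t (x - z) = complex_of_real (sqrt (l / pi) ^ DIM('n)) * (LINT X|lborel. gauss l X * cis (L X \<bullet> (x - z)))" for x
    proof -
      have "(LINT X|lborel. gauss l X * cis (L X \<bullet> (x - z))) = complex_of_real (sqrt (pi / l) ^ DIM('n)) * gauss t (x - z)"
        using gauss_fourier(2)[OF l, of "L' (x - z)"] \<kappa> t
        by (simp add: adj iso inner_commute[of _ "L' _"] gauss_def l_def power_mult_distrib field_simps)
      moreover have "sqrt (l / pi) ^ DIM('n) * sqrt (pi / l) ^ DIM('n) = 1"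
        using l by (simp flip: power_mult_distrib real_sqrt_mult)
      then have "complex_of_real (sqrt (l / pi) ^ DIM('n)) * complex_of_real (sqrt (pi / l) ^ DIM('n)) = 1"
        by (metis of_real_1 of_real_mult)
      ultimately show ?thesis by (simp flip: mult.assoc)
    qed
    have "(LINT x|lborel. g x * (LINT X|lborel. gauss l X * cis (L X \<bullet> (x - z)))) =
        (LINT x|lborel. LINT X|lborel. g x * (gauss l X * cis (L X \<bullet> (x - z))))"
      by simp
    also have "\<dots> = (LINT X|lborel. LINT x|lborel. g x * (gauss l X * cis (L X \<bullet> (x - z))))"
    proof (rule lborel_fubini(2)[OF _ integrable_norm[OF int] gauss_integral(1)[OF l]])
      show "(\<lambda>(x, X). g x * (gauss l X * cis (L X \<bullet> (x - z)))) \<in> borel_measurable (borel \<Otimes>\<^sub>M borel)"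
        by measurable
    qed (simp add: norm_mult gauss_def)
    also have "\<dots> = (LINT X|lborel. gauss l X * (cis (- (L X \<bullet> z)) * (LINT x|lborel. g x * cis (L X \<bullet> x))))"
    proof (rule Bochner_Integration.integral_cong[OF refl])
      fix X
      have eq: "g x * (gauss l X * cis (L X \<bullet> (x - z))) = gauss l X * cis (- (L X \<bullet> z)) * (g x * cis (L X \<bullet> x))" for x
      proof -
        have "cis (L X \<bullet> (x - z)) = cis (- (L X \<bullet> z)) * cis (L X \<bullet> x)"
          by (simp add: inner_diff_right cis_mult)
        then show ?thesis by simp
      qed
      show "(LINT x|lborel. g x * (gauss l X * cis (L X \<bullet> (x - z)))) =
          gauss l X * (cis (- (L X \<bullet> z)) * (LINT x|lborel. g x * cis (L X \<bullet> x)))"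
        unfolding eq by (simp add: mult.assoc)
    qed
    finally have "(LINT x|lborel. g x * gauss t (x - z)) = complex_of_real (sqrt (l / pi) ^ DIM('n)) *
        (LINT X|lborel. gauss l X * (cis (- (L X \<bullet> z)) * (LINT x|lborel. g x * cis (L X \<bullet> x))))"
      unfolding e mult.left_commute[of "g _" "complex_of_real _"] by (simp only: integral_mult_right_zero)
    moreover have "sqrt (t / pi) ^ DIM('n) * sqrt (l / pi) ^ DIM('n) = (\<kappa> / (2 * pi)) ^ DIM('n)"
    proof -
      have "sqrt (t / pi) * sqrt (l / pi) = sqrt ((\<kappa> / (2 * pi))\<^sup>2)"
        unfolding real_sqrt_mult[symmetric] using t by (simp add: l_def power2_eq_square field_simps)
      then show ?thesis using \<kappa> by (simp flip: power_mult_distrib)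
    qed
    then have "complex_of_real (sqrt (t / pi) ^ DIM('n)) * complex_of_real (sqrt (l / pi) ^ DIM('n)) = complex_of_real ((\<kappa> / (2 * pi)) ^ DIM('n))"
      by (metis of_real_mult)
    ultimately show ?thesis unfolding t_def[symmetric] l_def[symmetric] by (simp flip: mult.assoc)
  qed
  with AI show ?thesis by (simp only:)
qed

lemma fourier_inj:
  fixes g :: "'n::euclidean_space \<Rightarrow> complex"
  assumes "continuous_on UNIV g" "integrable lborel g" "\<And>v. (LINT x|lborel. g x * cis (v \<bullet> x)) = 0"
  shows "g z = 0"
proof -
  have m: "g \<in> borel_measurable borel" using assms(1) by (rule borel_measurable_continuous_onI)
  have "isCont g z" using assms(1) by (simp add: continuous_on_eq_continuous_at)
  from fourier_regularized[OF m this assms(2), of "\<lambda>X. X" "\<lambda>X. X" 1] show ?thesis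
    by (simp add: assms(3) LIMSEQ_const_iff)
qed

subsection \<open>The symplectic Fourier transform\<close>

text \<open>Twice the symplectic matrix, so that the symplectic Fourier transform becomes an
  ordinary one evaluated at the frequency \<open>jj X\<close>.\<close>

definition jj :: "'a::euclidean_space \<times> 'a \<Rightarrow> 'a \<times> 'a" where
  "jj X = (2 *\<^sub>R snd X, - (2 *\<^sub>R fst X))"

lemma jj_inner: "jj X \<bullet> Y = 2 * symp X Y"
  by (simp add: jj_def symp_def inner_prod_def inner_commute right_diff_distrib)

lemma jj_antisym: "jj X \<bullet> Y = - (jj Y \<bullet> X)"
  by (simp add: jj_def inner_prod_def inner_commute)

lemma norm_jj: "norm (jj X) = 2 * norm X"
proof -
  have "norm (jj X) = sqrt (2\<^sup>2 * ((norm (fst X))\<^sup>2 + (norm (snd X))\<^sup>2))"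
    by (simp add: jj_def norm_Pair power_mult_distrib algebra_simps)
  also have "\<dots> = 2 * sqrt ((norm (fst X))\<^sup>2 + (norm (snd X))\<^sup>2)"
    by (simp only: real_sqrt_mult) simp
  finally show ?thesis by (simp add: norm_prod_def)
qed

lemma jj_diff: "jj (X - Y) = jj X - jj Y"
  and jj_minus: "jj (- X) = - jj X"
  and jj_zero [simp]: "jj 0 = 0"
  by (auto simp: jj_def algebra_simps zero_prod_def)

lemma jj_continuous: "continuous_on UNIV jj"
  unfolding jj_def by (intro continuous_intros)

lemma jj_measurable [measurable]: "jj \<in> borel_measurable borel"
  by (intro borel_measurable_continuous_onI jj_continuous)

lemma cis_measurable [measurable]: "cis \<in> borel_measurable borel"
  by (intro borel_measurable_continuous_onI continuous_intros)

lemma symp_fourier_eq: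
  fixes a :: "'a::euclidean_space \<times> 'a \<Rightarrow> complex"
  assumes [measurable]: "a \<in> borel_measurable borel"
  shows "symp_fourier a X = complex_of_real (1 / pi ^ DIM('a)) * (LINT Y|lborel. a Y * cis (jj X \<bullet> Y))"
proof -
  have "(LINT Y|lebesgue. a Y * cis (2 * symp X Y)) = (LINT Y|lborel. a Y * cis (jj X \<bullet> Y))"
    unfolding jj_inner[symmetric] by (rule integral_completion) measurable
  then show ?thesis by (simp add: symp_fourier_def)
qed

lemma basis_prod_jj:
  "mono_mult (map jj bs) f Y = complex_of_real (basis_prod bs (- jj Y)) * f Y"
proof (induction bs)
  case (Cons b bs)
  have "Y \<bullet> jj b = - (jj Y \<bullet> b)" using jj_antisym[of b Y] by (simp add: inner_commute)
  with Cons show ?case by simp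
qed simp

lemma partials_symp_fourier:
  fixes f :: "'a::euclidean_space \<times> 'a \<Rightarrow> complex"
  assumes f: "gsd A h c f" and c: "c > 0"
  shows "smooth (symp_fourier f)"
    "set bs \<subseteq> Basis \<Longrightarrow> partials bs (symp_fourier f) X =
      complex_of_real (1 / pi ^ DIM('a)) * (\<i> ^ length bs * (LINT Y|lborel. mono_mult (map jj bs) f Y * cis (jj X \<bullet> Y)))"
proof -
  have [measurable]: "f \<in> borel_measurable borel" using f by (rule gsd_measurable)
  let ?F = "\<lambda>Z. LINT Y|lborel. f Y * cis (- jj Y \<bullet> Z)"
  have eq: "symp_fourier f = (\<lambda>X. complex_of_real (1 / pi ^ DIM('a)) * ?F X)"
  proof -
    have "jj X \<bullet> Y = - jj Y \<bullet> X" for X Y :: "'a \<times> 'a" using jj_antisym[of X Y] by simp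
    then show ?thesis by (intro ext) (simp only: symp_fourier_eq[OF \<open>f \<in> borel_measurable borel\<close>])
  qed
  have F: "smooth ?F" "set bs \<subseteq> Basis \<Longrightarrow> partials bs ?F =
      (\<lambda>Z. LINT Y|lborel. f Y * (\<i> ^ length bs * complex_of_real (basis_prod bs (- jj Y))) * cis (- jj Y \<bullet> Z))"
    using partials_trig_integral[of f "\<lambda>Y. - jj Y" c A 2] gsd_bound0[OF f] c by (auto simp: norm_jj)
  show "smooth (symp_fourier f)" unfolding eq using F(1) by (rule partials_cmult(1))
  assume bs: "set bs \<subseteq> Basis"
  have "f Y * (\<i> ^ length bs * complex_of_real (basis_prod bs (- jj Y))) * cis (- jj Y \<bullet> X) =
      \<i> ^ length bs * (mono_mult (map jj bs) f Y * cis (jj X \<bullet> Y))" for Y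
    unfolding basis_prod_jj using jj_antisym[of X Y] by (simp add: mult_ac)
  then show "partials bs (symp_fourier f) X =
      complex_of_real (1 / pi ^ DIM('a)) * (\<i> ^ length bs * (LINT Y|lborel. mono_mult (map jj bs) f Y * cis (jj X \<bullet> Y)))"
    unfolding eq partials_cmult(2)[OF F(1) bs] F(2)[OF bs] by (simp only: integral_mult_right_zero)
qed

text \<open>Derivatives of the transform are transforms of monomial multiples, handled by
  \<open>gsd_mono_mult\<close>, and \<open>fourier_decay\<close> supplies the Gaussian. The order of
  quantifiers matters: \<open>C\<close>, \<open>h'\<close> and \<open>c'\<close> are fixed before
  \<open>A\<close> and \<open>f\<close>, so the transform maps one step into another with a linear
  bound.\<close>

lemma gsd_symp_fourier:
  fixes h c :: real
  assumes h: "h > 0" and c: "c > 0"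
  obtains C h' c' where "C \<ge> 0" "h' > 0" "c' > 0"
    "\<And>A (f :: 'a::euclidean_space \<times> 'a \<Rightarrow> complex). gsd A h c f \<Longrightarrow> gsd (C * A) h' c' (symp_fourier f)"
proof -
  define h1 where "h1 = h * exp (c / (2 * h\<^sup>2))"
  define n where "n = DIM('a \<times> 'a)"
  define S where "S = sqrt (pi / (c / 2)) ^ n"
  define C where "C = (1 / pi ^ DIM('a)) * (2 * S)"
  define h' where "h' = 2 * sqrt (2 / c)"
  \<comment> \<open>The factor 4 in the denominator of \<open>fourier_decay\<close> cancels against
    \<open>norm (jj X) = 2 * norm X\<close>.\<close>
  define c' where "c' = 1 / (n * h1\<^sup>2)"
  have h1: "h1 > 0" using h by (simp add: h1_def)
  have n: "n > 0" by (simp add: n_def)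
  have pos: "C \<ge> 0" "h' > 0" "c' > 0" using c h1 n by (auto simp: C_def S_def h'_def c'_def)
  have "gsd (C * A) h' c' (symp_fourier f)" if f: "gsd A h c f" for A and f :: "'a \<times> 'a \<Rightarrow> complex"
    unfolding gsd_def
  proof (intro conjI allI impI partials_symp_fourier(1)[OF f c])
    fix bs :: "('a \<times> 'a) list" and X :: "'a \<times> 'a" assume bs: "set bs \<subseteq> Basis"
    let ?k = "length bs" and ?g = "mono_mult (map jj bs) f"
    define D where "D = (LINT Y|lborel. ?g Y * cis (jj X \<bullet> Y))"
    have nb: "norm v \<le> 2" if "v \<in> set (map jj bs)" for v
      using that bs by (auto simp: norm_jj subset_iff)
    have g: "gsd (A * h' ^ ?k * sqrt (fact ?k)) h1 (c / 2) ?g"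
      unfolding h1_def h'_def
      by (rule gsd_mono_mult[OF f h _ _ c, of "map jj bs" 2, unfolded length_map]) (use nb in auto)
    have "cmod D \<le>
        2 * (A * h' ^ ?k * sqrt (fact ?k) * S) * exp (- (1 / (4 * n * h1\<^sup>2)) * (norm (jj X))\<^sup>2)"
      using fourier_decay[OF g h1, of "jj X"] c by (simp add: S_def n_def D_def)
    also have "- (1 / (4 * n * h1\<^sup>2)) * (norm (jj X))\<^sup>2 = - c' * (norm X)\<^sup>2"
      by (simp add: norm_jj c'_def power_mult_distrib)
    finally have "(1 / pi ^ DIM('a)) * cmod D \<le>
        (1 / pi ^ DIM('a)) * (2 * (A * h' ^ ?k * sqrt (fact ?k) * S) * exp (- c' * (norm X)\<^sup>2))"
      by (intro mult_left_mono) auto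
    then show "cmod (partials bs (symp_fourier f) X) \<le> C * A * h' ^ ?k * sqrt (fact ?k) * exp (- c' * (norm X)\<^sup>2)"
      unfolding partials_symp_fourier(2)[OF f c bs] D_def[symmetric] by (simp add: norm_mult norm_power norm_divide C_def mult_ac)
  qed
  with pos that show ?thesis by blast
qed

lemma GS_half_symp_fourier: "f \<in> GS_half \<Longrightarrow> symp_fourier f \<in> GS_half"
proof -
  assume "f \<in> GS_half"
  then obtain A h c where f: "h > 0" "c > 0" "gsd A h c f" by (rule GS_half_gsd)
  obtain C h' c' where "C \<ge> 0" "h' > 0" "c' > 0" "gsd (C * A) h' c' (symp_fourier f)"
    using gsd_symp_fourier[OF f(1,2)] f(3) by metis
  then show ?thesis by (intro gsd_GS_half)
qed

text \<open>Antisymmetry of the phase turns the inverse transform into the transform itself. The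
  Gaussian regularisation is removed by dominated convergence, since the transform is
  integrable.\<close>

lemma symp_fourier_symp_fourier:
  fixes f :: "'a::euclidean_space \<times> 'a \<Rightarrow> complex"
  assumes f: "f \<in> GS_half"
  shows "symp_fourier (symp_fourier f) = f"
proof
  fix z
  let ?F = "symp_fourier f"
  obtain A h c where fg: "h > 0" "c > 0" "gsd A h c f" using f by (rule GS_half_gsd)
  obtain B k e where Fg: "k > 0" "e > 0" "gsd B k e ?F" using GS_half_symp_fourier[OF f] by (rule GS_half_gsd)
  have m[measurable]: "f \<in> borel_measurable borel" using fg(3) by (rule gsd_measurable)
  have Fm[measurable]: "?F \<in> borel_measurable borel" using Fg(3) by (rule gsd_measurable)
  have gm[measurable]: "gauss l \<in> borel_measurable (borel :: ('a \<times> 'a) measure)" for l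
    unfolding gauss_def by measurable
  have Fi: "integrable lborel ?F" using Fg by (intro gsd_integrable)
  have cont: "isCont f z"
    using gsd_continuous[OF fg(3)] continuous_on_eq_continuous_at[OF open_UNIV, of f] by blast
  define p where "p = complex_of_real (pi ^ DIM('a))"
  have p: "p \<noteq> 0" by (simp add: p_def)
  have FF: "(LINT x|lborel. f x * cis (jj X \<bullet> x)) = p * ?F X" for X
    unfolding symp_fourier_eq[OF m] p_def by simp
  have lim: "(\<lambda>k. complex_of_real ((2 / (2 * pi)) ^ DIM('a \<times> 'a)) *
     (LINT X|lborel. gauss (2\<^sup>2 / (4 * real (Suc k))) X * (cis (- (jj X \<bullet> z)) * (p * ?F X)))) \<longlonglongrightarrow> f z"
    unfolding FF[symmetric]
  proof (rule fourier_regularized[where L' = "\<lambda>w. - jj w"])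
    show "jj X \<bullet> w = X \<bullet> - jj w" for X w :: "'a \<times> 'a"
      using jj_antisym[of X w] by (simp add: inner_commute)
  qed (use fg cont in \<open>auto simp: norm_jj intro: gsd_integrable\<close>)
  have "(\<lambda>k. LINT X|lborel. gauss (2\<^sup>2 / (4 * real (Suc k))) X * (cis (- (jj X \<bullet> z)) * (p * ?F X)))
      \<longlonglongrightarrow> (LINT X|lborel. 1 * (cis (- (jj X \<bullet> z)) * (p * ?F X)))"
  proof (rule integral_dominated_convergence[where w = "\<lambda>X. cmod (p * ?F X)"])
    show "AE X in lborel. (\<lambda>k. gauss (2\<^sup>2 / (4 * real (Suc k))) X * (cis (- (jj X \<bullet> z)) * (p * ?F X)))
        \<longlonglongrightarrow> 1 * (cis (- (jj X \<bullet> z)) * (p * ?F X))"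
    proof (intro AE_I2 tendsto_mult tendsto_const)
      fix X :: "'a \<times> 'a"
      have "(\<lambda>k. exp (- inverse (real (Suc k)) * (norm X)\<^sup>2)) \<longlonglongrightarrow> exp (- 0 * (norm X)\<^sup>2)"
        by (intro tendsto_intros LIMSEQ_inverse_real_of_nat)
      from tendsto_of_real[OF this, where 'a = complex]
      moreover have "2\<^sup>2 / (4 * real (Suc k)) = inverse (real (Suc k))" for k
        by (simp add: field_simps del: of_nat_Suc)
      ultimately show "(\<lambda>k. gauss (2\<^sup>2 / (4 * real (Suc k))) X) \<longlonglongrightarrow> 1"
        by (simp only: gauss_def) simp
    qed
    show "AE X in lborel. norm (gauss (2\<^sup>2 / (4 * real (Suc k))) X * (cis (- (jj X \<bullet> z)) * (p * ?F X))) \<le> cmod (p * ?F X)" for k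
      by (auto simp: norm_mult gauss_def mult_left_le_one_le)
  qed (use Fi in auto)
  from tendsto_mult_left[OF this] have
    "(\<lambda>k. complex_of_real ((2 / (2 * pi)) ^ DIM('a \<times> 'a)) *
     (LINT X|lborel. gauss (2\<^sup>2 / (4 * real (Suc k))) X * (cis (- (jj X \<bullet> z)) * (p * ?F X))))
     \<longlonglongrightarrow> complex_of_real ((2 / (2 * pi)) ^ DIM('a \<times> 'a)) * (LINT X|lborel. 1 * (cis (- (jj X \<bullet> z)) * (p * ?F X)))" .
  from LIMSEQ_unique[OF lim this]
  have "f z = complex_of_real ((2 / (2 * pi)) ^ DIM('a \<times> 'a)) * (LINT X|lborel. 1 * (cis (- (jj X \<bullet> z)) * (p * ?F X)))" .
  also have "(LINT X|lborel. 1 * (cis (- (jj X \<bullet> z)) * (p * ?F X))) = p * (LINT X|lborel. ?F X * cis (jj z \<bullet> X))"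
  proof -
    have "1 * (cis (- (jj X \<bullet> z)) * (p * ?F X)) = p * (?F X * cis (jj z \<bullet> X))" for X
      using jj_antisym[of z X] by simp
    then show ?thesis by (simp only: integral_mult_right_zero)
  qed
  also have "complex_of_real ((2 / (2 * pi)) ^ DIM('a \<times> 'a)) * (p * (LINT X|lborel. ?F X * cis (jj z \<bullet> X))) = symp_fourier ?F z"
  proof -
    \<comment> \<open>The inversion constant in dimension \<open>2 d\<close>, times the
      \<open>pi ^ d\<close> taken out of the first transform, is exactly the normalisation of the
      second one.\<close>
    have "(2 / (2 * pi)) ^ DIM('a \<times> 'a) * pi ^ DIM('a) = 1 / pi ^ DIM('a)"
      by (simp add: power_add power_divide)
    then have "complex_of_real ((2 / (2 * pi)) ^ DIM('a \<times> 'a)) * p = complex_of_real (1 / pi ^ DIM('a))"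
      unfolding p_def by (metis of_real_mult)
    then show ?thesis
      unfolding symp_fourier_eq[OF Fm] mult.assoc[symmetric] by (simp only:)
  qed
  finally show "symp_fourier ?F z = f z" by simp
qed

section \<open>Closure properties of the Gelfand-Shilov space\<close>

lemma gsd_const_zero: "gsd 0 h c (\<lambda>x. 0)"
proof (rule gsd_family[where G = "\<lambda>bs x. 0"])
  show "\<exists>D. ((\<lambda>x. 0) has_derivative D) (at x) \<and> (\<forall>b\<in>Basis. D b = 0)" for x :: 'a
    by (intro exI[of _ "\<lambda>v. 0"]) auto
qed auto

lemma GS_half_lincomb:
  assumes "f \<in> GS_half" "g \<in> GS_half"
  shows "(\<lambda>x. a * f x + b * g x) \<in> GS_half"
proof -
  obtain A h c where f: "h > 0" "c > 0" "gsd A h c f" using assms(1) by (rule GS_half_gsd)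
  obtain B k e where g: "k > 0" "e > 0" "gsd B k e g" using assms(2) by (rule GS_half_gsd)
  have "gsd (cmod a * A + cmod b * B) (max h k) (min c e) (\<lambda>x. a * f x + b * g x)"
    using f g by (intro gsd_add gsd_cmult gsd_mono[OF f(3)] gsd_mono[OF g(3)]) auto
  then show ?thesis by (rule gsd_GS_half) (use f g in auto)
qed

lemma GS_half_zero: "(\<lambda>x. 0) \<in> GS_half"
  using gsd_GS_half[OF gsd_const_zero, of 1 1] by simp

lemma GS_half_add: "f \<in> GS_half \<Longrightarrow> g \<in> GS_half \<Longrightarrow> (\<lambda>x. f x + g x) \<in> GS_half"
  using GS_half_lincomb[of f g 1 1] by simp

lemma GS_half_cmult: "f \<in> GS_half \<Longrightarrow> (\<lambda>x. a * f x) \<in> GS_half"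
  using GS_half_lincomb[of f f a 0] by simp

lemma GS_half_diff: "f \<in> GS_half \<Longrightarrow> g \<in> GS_half \<Longrightarrow> (\<lambda>x. f x - g x) \<in> GS_half"
  using GS_half_lincomb[of f g 1 "-1"] by simp

lemma GS_half_sum: "finite S \<Longrightarrow> (\<And>i. i \<in> S \<Longrightarrow> f i \<in> GS_half) \<Longrightarrow> (\<lambda>x. \<Sum>i\<in>S. f i x) \<in> GS_half"
  by (induction S rule: finite_induct) (auto intro: GS_half_zero GS_half_add)

lemma GS_half_mult: "f \<in> GS_half \<Longrightarrow> g \<in> GS_half \<Longrightarrow> (\<lambda>x. f x * g x) \<in> GS_half"
proof -
  assume "f \<in> GS_half" "g \<in> GS_half"
  obtain A h c where f: "h > 0" "c > 0" "gsd A h c f" using \<open>f \<in> GS_half\<close> by (rule GS_half_gsd)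
  obtain B k e where g: "k > 0" "e > 0" "gsd B k e g" using \<open>g \<in> GS_half\<close> by (rule GS_half_gsd)
  show ?thesis using gsd_GS_half[OF gsd_mult'[OF f(3) g(3)]] f g by simp
qed

lemma GS_half_cnj: "f \<in> GS_half \<Longrightarrow> (\<lambda>x. cnj (f x)) \<in> GS_half"
  unfolding GS_half_iff using gsd_cnj by blast

lemma GS_half_reflect: "f \<in> GS_half \<Longrightarrow> (\<lambda>x. f (- x)) \<in> GS_half"
  unfolding GS_half_iff using gsd_reflect by blast

lemma GS_half_translate: "f \<in> GS_half \<Longrightarrow> (\<lambda>x. f (x - X)) \<in> GS_half"
proof -
  assume "f \<in> GS_half"
  then obtain A h c where f: "h > 0" "c > 0" "gsd A h c f" by (rule GS_half_gsd)
  show ?thesis using gsd_GS_half[OF gsd_translate_decay[OF f(3)]] f by simp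
qed

lemma GS_half_cis: "f \<in> GS_half \<Longrightarrow> (\<lambda>x. f x * cis (v \<bullet> x)) \<in> GS_half"
proof -
  assume "f \<in> GS_half"
  then obtain A h c where f: "h > 0" "c > 0" "gsd A h c f" by (rule GS_half_gsd)
  show ?thesis using gsd_GS_half[OF gsd_mult'[OF f(3) gsd_cis[of 1 v]]] f by simp
qed

lemma GS_half_gauss: "l > 0 \<Longrightarrow> gauss l \<in> GS_half"
  by (rule gsd_gauss[of l]) (auto intro: gsd_GS_half)

lemma GS_half_measurable: "f \<in> GS_half \<Longrightarrow> f \<in> borel_measurable borel"
  unfolding GS_half_iff using gsd_measurable by blast

lemma GS_half_continuous: "f \<in> GS_half \<Longrightarrow> continuous_on UNIV f"
  unfolding GS_half_iff using gsd_continuous by blast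

lemma GS_half_integrable: "f \<in> GS_half \<Longrightarrow> integrable lborel f"
  unfolding GS_half_iff using gsd_integrable by blast

lemma GS_half_bounded: "f \<in> GS_half \<Longrightarrow> \<exists>B. \<forall>x. cmod (f x) \<le> B"
proof -
  assume "f \<in> GS_half"
  then obtain A h c where f: "h > 0" "c > 0" "gsd A h c f" by (rule GS_half_gsd)
  have "cmod (f x) \<le> A" for x
  proof -
    have "A * exp (- c * (norm x)\<^sup>2) \<le> A * 1"
      using f gsd_nonneg[OF f(3)] by (intro mult_left_mono) auto
    then show ?thesis using gsd_bound0[OF f(3), of x] by linarith
  qed
  then show ?thesis by blast
qed

subsection \<open>Gelfand--Shilov distributions\<close>

lemma GS_half_nhd0_UNIV: "GS_nhd0 (1/2) (GS_half :: ('n::euclidean_space \<Rightarrow> complex) set)"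
  unfolding GS_nhd0_def
proof (intro conjI allI impI ballI)
  fix h :: real assume h: "h > 0"
  show "\<exists>\<epsilon>>0. \<forall>f\<in>GS_h (1/2) h. GS_norm (1/2) h f < ennreal \<epsilon> \<longrightarrow> f \<in> (GS_half :: ('n \<Rightarrow> complex) set)"
    using h by (intro exI[of _ 1]) (auto simp: GS_def)
qed (auto intro: GS_half_lincomb)

lemma topspace_GS: "topspace (GS_topology (1/2)) = (GS_half :: ('n::euclidean_space \<Rightarrow> complex) set)"
proof
  show "topspace (GS_topology (1/2)) \<subseteq> (GS_half :: ('n \<Rightarrow> complex) set)"
    unfolding topspace_def openin_GS_topology GS_open_def by blast
  have "GS_open (1/2) (GS_half :: ('n \<Rightarrow> complex) set)"
    unfolding GS_open_def using GS_half_nhd0_UNIV GS_half_add by blast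
  then show "(GS_half :: ('n \<Rightarrow> complex) set) \<subseteq> topspace (GS_topology (1/2))"
    unfolding openin_GS_topology[symmetric] by (rule openin_subset)
qed

lemma dual_add: "u \<in> GS_half_dual \<Longrightarrow> f \<in> GS_half \<Longrightarrow> g \<in> GS_half \<Longrightarrow> u (\<lambda>x. f x + g x) = u f + u g"
  unfolding GS_dual_def by blast

lemma dual_cmult: "u \<in> GS_half_dual \<Longrightarrow> f \<in> GS_half \<Longrightarrow> u (\<lambda>x. a * f x) = a * u f"
  unfolding GS_dual_def by blast

lemma dual_diff: "u \<in> GS_half_dual \<Longrightarrow> f \<in> GS_half \<Longrightarrow> g \<in> GS_half \<Longrightarrow> u (\<lambda>x. f x - g x) = u f - u g"
  using dual_add[of u f "\<lambda>x. - 1 * g x"] dual_cmult[of u g "- 1"] GS_half_cmult[of g "- 1"] by simp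

lemma dual_zero: "u \<in> GS_half_dual \<Longrightarrow> u (\<lambda>x. 0) = 0"
  using dual_cmult[OF _ GS_half_zero, of u 0] by simp

lemma dual_sum:
  assumes "u \<in> GS_half_dual" "finite S" "\<And>i. i \<in> S \<Longrightarrow> f i \<in> GS_half"
  shows "u (\<lambda>x. \<Sum>i\<in>S. f i x) = (\<Sum>i\<in>S. u (f i))"
  using assms(2,3)
proof (induction S rule: finite_induct)
  case (insert i S)
  have "u (\<lambda>x. f i x + (\<Sum>i\<in>S. f i x)) = u (f i) + u (\<lambda>x. \<Sum>i\<in>S. f i x)"
    using insert by (intro dual_add[OF assms(1)] GS_half_sum) auto
  with insert show ?case by simp
qed (simp add: dual_zero assms(1))

lemma dual_outside: "u \<in> GS_half_dual \<Longrightarrow> f \<notin> GS_half \<Longrightarrow> u f = 0"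
  unfolding GS_dual_def by blast

text \<open>The preimage of the unit disc contains a neighbourhood of 0 whose trace on the step
  \<open>H\<close> contains a ball of radius \<open>e\<close>. All functions with the same
  \<open>h\<close> and \<open>c\<close> lie in this one step with norm at most \<open>A\<close>, so
  rescaling gives a bound linear in \<open>A\<close>.\<close>

lemma dual_bound:
  fixes u :: "('n::euclidean_space) distr" and h c :: real
  assumes u: "u \<in> GS_half_dual" and h: "h > 0" and c: "c > 0"
  obtains C where "C \<ge> 0" "\<And>A f. gsd A h c f \<Longrightarrow> cmod (u f) \<le> C * A"
proof -
  have "continuous_map (GS_topology (1/2)) euclidean u" using u unfolding GS_dual_def by blast
  then have "openin (GS_topology (1/2)) {f \<in> topspace (GS_topology (1/2)). u f \<in> ball 0 1}"
    by (rule openin_continuous_map_preimage) simp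
  then have "GS_open (1/2) {f \<in> GS_half. u f \<in> ball 0 1}"
    by (simp add: openin_GS_topology topspace_GS)
  moreover have "(\<lambda>x. 0) \<in> {f \<in> GS_half. u f \<in> ball 0 1}"
    using GS_half_zero dual_zero[OF u] by simp
  ultimately have "\<exists>V. GS_nhd0 (1/2) V \<and> (\<forall>v\<in>V. (\<lambda>x. 0 + v x) \<in> {f \<in> GS_half. u f \<in> ball 0 1})"
    unfolding GS_open_def by (elim conjE bspec)
  then obtain V where V: "GS_nhd0 (1/2) V" "\<And>v. v \<in> V \<Longrightarrow> (\<lambda>x. 0 + v x) \<in> {f \<in> GS_half. u f \<in> ball 0 1}"
    by blast
  define H where "H = sqrt (2 ^ DIM('n)) * max h (1 / sqrt (2 * c))"
  have H: "H > 0" using h by (simp add: H_def)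
  obtain e where e: "e > 0" "\<And>f. f \<in> GS_h (1/2) H \<Longrightarrow> GS_norm (1/2) H f < ennreal e \<Longrightarrow> f \<in> V"
    using V(1) H unfolding GS_nhd0_def by blast
  have "cmod (u f) \<le> (2 / e) * A" if f: "gsd A h c f" for A f
  proof (rule field_le_mult_one_interval)
    have A: "A \<ge> 0" using f by (rule gsd_nonneg)
    \<comment> \<open>Rescaling requires a positive amplitude; for \<open>A = 0\<close> the bounds
      for all \<open>A' > 0\<close> together force \<open>u f = 0\<close>.\<close>
    have *: "cmod (u f) \<le> (2 / e) * A'" if A': "A' \<ge> A" "A' > 0" for A'
    proof -
      define g where "g = (\<lambda>x. complex_of_real (e / (2 * A')) * f x)"
      have "gsd (e / (2 * A') * A') h c g"
        using gsd_cmult[OF gsd_mono[OF f A'(1) less_imp_le[OF h] order_refl order_refl], of "complex_of_real (e / (2 * A'))"] e A'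
        by (simp add: g_def norm_divide norm_mult)
      then have g: "gsd (e / 2) h c g" using A' by simp
      have "GS_norm (1/2) H g < ennreal e"
        by (rule le_less_trans[OF gsd_GS_norm_le(2)[OF g h c H_def]]) (use e(1) in \<open>simp add: ennreal_lessI\<close>)
      with gsd_GS_norm_le(1)[OF g h c H_def] have "g \<in> V" by (rule e(2))
      then have "cmod (u g) < 1" using V(2)[of g] by simp
      moreover have "u g = complex_of_real (e / (2 * A')) * u f"
        unfolding g_def using dual_cmult[OF u gsd_GS_half[OF f h c]] .
      ultimately show ?thesis using e A' by (simp add: norm_mult norm_divide field_simps)
    qed
    fix z :: real assume z: "0 < z" "z < 1"
    show "z * cmod (u f) \<le> (2 / e) * A"
    proof (cases "A > 0")
      case True
      then have "cmod (u f) \<le> (2 / e) * A" using * by simp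
      moreover have "z * cmod (u f) \<le> 1 * cmod (u f)" using z by (intro mult_right_mono) auto
      ultimately show ?thesis by simp
    next
      case False
      have "cmod (u f) \<le> 0 + d" if d: "d > 0" for d
        using *[of "d * e / 2"] d e A False by simp
      then have "cmod (u f) \<le> 0" by (rule field_le_epsilon)
      then show ?thesis using A e by simp
    qed
  qed
  then show ?thesis using that[of "2 / e"] e by simp
qed

lemma norm_le_GS_norm: "ennreal (cmod (f x)) \<le> GS_norm (1/2) h f"
proof -
  have m: "concat (map (\<lambda>b. []) bs) = ([] :: 'a list)" for bs :: "'a list" by simp
  have "ennreal (cmod (f x)) = ennreal (cmod (complex_of_real (mi_power x (\<lambda>_. 0)) * mi_deriv (\<lambda>_. 0) f x) /
       (h ^ (mi_abs (\<lambda>_::'a. 0) + mi_abs (\<lambda>_::'a. 0)) * mi_fact (\<lambda>_::'a. 0) powr (1/2) * mi_fact (\<lambda>_::'a. 0) powr (1/2)))"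
    by (simp add: mi_power_def mi_deriv_def m mi_abs_def mi_fact_def)
  also have "\<dots> \<le> GS_norm (1/2) h f"
    unfolding GS_norm_def by (rule SUP_upper2[of "(x, \<lambda>_. 0, \<lambda>_. 0)"]) auto
  finally show ?thesis .
qed

text \<open>The term of order zero in every \<open>GS_norm\<close> is the supremum norm, so pairing
  with an integrable function is bounded on each step.\<close>

lemma distr_of_dual:
  fixes f :: "'n::euclidean_space \<Rightarrow> complex"
  assumes m[measurable]: "f \<in> borel_measurable borel" and fi: "integrable lborel f"
  shows "distr_of f \<in> GS_half_dual"
proof -
  have i: "integrable lborel (\<lambda>x. f x * \<phi> x)" if \<phi>: "\<phi> \<in> GS_half" for \<phi>
  proof -
    obtain B where B: "\<And>x. cmod (\<phi> x) \<le> B" using GS_half_bounded[OF \<phi>] by blast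
    have [measurable]: "\<phi> \<in> borel_measurable borel" using \<phi> by (rule GS_half_measurable)
    show ?thesis
    proof (rule Bochner_Integration.integrable_bound[OF integrable_mult_left[of B, OF integrable_norm[OF fi]]])
      show "AE x in lborel. norm (f x * \<phi> x) \<le> norm (cmod (f x) * B)"
        using order_trans[OF norm_ge_zero B] by (intro AE_I2) (simp add: norm_mult mult_left_mono B)
    qed measurable
  qed
  have eq: "distr_of f \<phi> = (LINT x|lborel. f x * \<phi> x)" if "\<phi> \<in> GS_half" for \<phi>
  proof -
    have [measurable]: "\<phi> \<in> borel_measurable borel" using that by (rule GS_half_measurable)
    show ?thesis unfolding distr_of_def using that by (simp add: integral_completion)
  qed
  have add: "distr_of f (\<lambda>x. \<phi> x + \<psi> x) = distr_of f \<phi> + distr_of f \<psi>" if "\<phi> \<in> GS_half" "\<psi> \<in> GS_half" for \<phi> \<psi>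
    using that by (simp add: eq GS_half_add i distrib_left)
  have scale: "distr_of f (\<lambda>x. a * \<phi> x) = a * distr_of f \<phi>" if "\<phi> \<in> GS_half" for a \<phi>
    using that by (simp add: eq GS_half_cmult mult.left_commute)
  define I where "I = (LINT x|lborel. cmod (f x))"
  have I: "I \<ge> 0" unfolding I_def by simp
  have V: "GS_nhd0 (1/2) {v \<in> GS_half. cmod (distr_of f v) < e}" if e: "e > 0" for e
    unfolding GS_nhd0_def
  proof (intro conjI ballI allI impI)
    fix \<phi> \<psi> a b assume "\<phi> \<in> {v \<in> GS_half. cmod (distr_of f v) < e}" "\<psi> \<in> {v \<in> GS_half. cmod (distr_of f v) < e}"
      and ab: "cmod a + cmod b \<le> 1"
    then have s: "\<phi> \<in> GS_half" "\<psi> \<in> GS_half" and l: "cmod (distr_of f \<phi>) < e" "cmod (distr_of f \<psi>) < e" by auto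
    define m where "m = max (cmod (distr_of f \<phi>)) (cmod (distr_of f \<psi>))"
    have m: "m < e" "0 \<le> m" using l by (auto simp: m_def le_max_iff_disj)
    have "distr_of f (\<lambda>x. a * \<phi> x + b * \<psi> x) = a * distr_of f \<phi> + b * distr_of f \<psi>"
      using s by (simp add: add scale GS_half_cmult)
    also have "cmod \<dots> \<le> cmod a * m + cmod b * m"
      by (intro norm_triangle_le add_mono) (auto simp: norm_mult m_def intro!: mult_left_mono)
    also have "\<dots> = (cmod a + cmod b) * m" by (simp add: distrib_right)
    also have "\<dots> \<le> 1 * m" using ab m by (intro mult_right_mono) auto
    finally show "(\<lambda>x. a * \<phi> x + b * \<psi> x) \<in> {v \<in> GS_half. cmod (distr_of f v) < e}"
      using m s by (auto intro: GS_half_lincomb)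
  next
    fix h :: real assume h: "h > 0"
    show "\<exists>\<epsilon>>0. \<forall>\<phi>\<in>GS_h (1/2) h. GS_norm (1/2) h \<phi> < ennreal \<epsilon> \<longrightarrow> \<phi> \<in> {v \<in> GS_half. cmod (distr_of f v) < e}"
    proof (intro exI[of _ "e / (I + 1)"] conjI ballI impI)
      show "0 < e / (I + 1)" using e I by simp
      fix \<phi> :: "'n \<Rightarrow> complex" assume \<phi>: "\<phi> \<in> GS_h (1/2) h" "GS_norm (1/2) h \<phi> < ennreal (e / (I + 1))"
      then have G: "\<phi> \<in> GS_half" using h by (auto simp: GS_def)
      have "ennreal (cmod (\<phi> x)) < ennreal (e / (I + 1))" for x
        using norm_le_GS_norm[of \<phi> x h] \<phi>(2) by (rule le_less_trans)
      then have "cmod (\<phi> x) \<le> e / (I + 1)" for x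
        using e I by (subst (asm) ennreal_less_iff) (auto intro: less_imp_le)
      then have "norm (LINT x|lborel. f x * \<phi> x) \<le> (LINT x|lborel. cmod (f x) * (e / (I + 1)))"
        using fi by (intro norm_integral_le) (simp, simp only: norm_mult, intro mult_left_mono, auto)
      also have "\<dots> = I * (e / (I + 1))" by (simp add: I_def)
      also have "\<dots> < e" using e I by (simp add: field_simps)
      finally show "\<phi> \<in> {v \<in> GS_half. cmod (distr_of f v) < e}" using G by (simp add: eq)
    qed
  qed auto
  have "continuous_map (GS_topology (1/2)) euclidean (distr_of f)"
    unfolding continuous_map_def
  proof (intro conjI allI impI)
    fix S :: "complex set" assume "openin euclidean S"
    then have S: "open S" by simp
    show "openin (GS_topology (1/2)) {\<phi> \<in> topspace (GS_topology (1/2)). distr_of f \<phi> \<in> S}"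
      unfolding openin_GS_topology topspace_GS GS_open_def
    proof (intro conjI ballI)
      fix \<phi> assume "\<phi> \<in> {\<phi> \<in> GS_half. distr_of f \<phi> \<in> S}"
      then have \<phi>: "\<phi> \<in> GS_half" "distr_of f \<phi> \<in> S" by auto
      obtain e where e: "e > 0" "ball (distr_of f \<phi>) e \<subseteq> S" using S \<phi>(2) openE by blast
      have "\<forall>v\<in>{v \<in> GS_half. cmod (distr_of f v) < e}. (\<lambda>x. \<phi> x + v x) \<in> {\<phi> \<in> GS_half. distr_of f \<phi> \<in> S}"
      proof (intro ballI CollectI conjI)
        fix v assume v: "v \<in> {v \<in> GS_half. cmod (distr_of f v) < e}"
        then show "(\<lambda>x. \<phi> x + v x) \<in> GS_half" using \<phi> by (auto intro: GS_half_add)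
        have "distr_of f (\<lambda>x. \<phi> x + v x) \<in> ball (distr_of f \<phi>) e"
          using v \<phi> by (auto simp: add dist_norm)
        then show "distr_of f (\<lambda>x. \<phi> x + v x) \<in> S" using e by blast
      qed
      with V[OF e(1)] show "\<exists>V. GS_nhd0 (1/2) V \<and> (\<forall>v\<in>V. (\<lambda>x. \<phi> x + v x) \<in> {\<phi> \<in> GS_half. distr_of f \<phi> \<in> S})"
        by blast
    qed auto
  qed auto
  then show ?thesis
    unfolding GS_dual_def using add scale by (auto simp: distr_of_def)
qed

lemma distr_of_GS_dual: "f \<in> GS_half \<Longrightarrow> distr_of f \<in> GS_half_dual"
  by (intro distr_of_dual GS_half_measurable GS_half_integrable)

lemma distr_of_apply:
  assumes [measurable]: "f \<in> borel_measurable borel" and \<phi>: "\<phi> \<in> GS_half"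
  shows "distr_of f \<phi> = (LINT x|lborel. f x * \<phi> x)"
proof -
  have [measurable]: "\<phi> \<in> borel_measurable borel" using \<phi> by (rule GS_half_measurable)
  show ?thesis unfolding distr_of_def using \<phi> by (simp add: integral_completion)
qed

lemma dual_diff_mem:
  assumes "u \<in> GS_half_dual" "v \<in> GS_half_dual"
  shows "(\<lambda>\<phi>. u \<phi> - v \<phi>) \<in> GS_half_dual"
proof -
  have "continuous_map (GS_topology (1/2)) euclidean u" "continuous_map (GS_topology (1/2)) euclidean v"
    using assms unfolding GS_dual_def by blast+
  then have "continuous_map (GS_topology (1/2)) euclidean (\<lambda>\<phi>. u \<phi> - v \<phi>)"
    by (rule continuous_map_diff)
  then show ?thesis
    unfolding GS_dual_def
    using dual_add[OF assms(1)] dual_add[OF assms(2)] dual_cmult[OF assms(1)] dual_cmult[OF assms(2)]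
      dual_outside[OF assms(1)] dual_outside[OF assms(2)]
    by (simp add: right_diff_distrib)
qed

section \<open>Functionals applied to integrals over characters\<close>

lemma integral_simple_compose:
  fixes s :: "'p::euclidean_space \<Rightarrow> 'q" and \<phi> :: "'p \<Rightarrow> complex"
  assumes s: "simple_function lborel s" and \<phi>: "integrable lborel \<phi>"
  shows "(LINT Y|lborel. \<phi> Y * G (s Y)) = (\<Sum>y\<in>range s. (LINT Y|lborel. \<phi> Y * indicator (s -` {y}) Y) * G y)"
proof -
  have fin: "finite (range s)" using simple_functionD(1)[OF s] by simp
  have sets: "s -` {y} \<in> sets lborel" for y using simple_functionD(2)[OF s, of "{y}"] by simp
  have int: "integrable lborel (\<lambda>Y. \<phi> Y * indicator (s -` {y}) Y)" for y
  proof (rule Bochner_Integration.integrable_bound[OF \<phi>])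
    show "(\<lambda>Y. \<phi> Y * indicator (s -` {y}) Y) \<in> borel_measurable lborel"
      using sets borel_measurable_integrable[OF \<phi>] by measurable
  qed (auto simp: indicator_def)
  have "\<phi> Y * G (s Y) = (\<Sum>y\<in>range s. (\<phi> Y * indicator (s -` {y}) Y) * G y)" for Y
  proof -
    have "(\<Sum>y\<in>range s. (\<phi> Y * indicator (s -` {y}) Y) * G y) = (\<Sum>y\<in>range s. if y = s Y then \<phi> Y * G y else 0)"
      by (intro sum.cong) (auto simp: indicator_def)
    then show ?thesis using fin by simp
  qed
  then have "(LINT Y|lborel. \<phi> Y * G (s Y)) = (LINT Y|lborel. (\<Sum>y\<in>range s. (\<phi> Y * indicator (s -` {y}) Y) * G y))"
    by simp
  also have "\<dots> = (\<Sum>y\<in>range s. LINT Y|lborel. (\<phi> Y * indicator (s -` {y}) Y) * G y)"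
    by (rule Bochner_Integration.integral_sum) (intro integrable_mult_left int)
  finally show ?thesis by simp
qed

text \<open>The functional may grow in the frequency, but \<open>\<eta>\<close> is at the disposal
  of the caller: the growth stays below the decay of any given test function, which makes the
  pairing integrable.\<close>

lemma dual_cis_bound:
  fixes \<eta> :: real
  assumes u: "u \<in> GS_half_dual" and \<nu>: "gsd A h c \<nu>" and h: "h > 0" and c: "c > 0" and \<eta>: "\<eta> > 0"
  obtains C where "C \<ge> 0" "\<And>Y. cmod (u (\<lambda>Z. \<nu> Z * cis (jj Y \<bullet> Z))) \<le> C * exp (2 * \<eta>\<^sup>2 * (norm Y)\<^sup>2)"
proof -
  obtain C where C: "C \<ge> 0" "\<And>A f. gsd A (2 * max h (1 / \<eta>)) c f \<Longrightarrow> cmod (u f) \<le> C * A"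
    using dual_bound[OF u, of "2 * max h (1 / \<eta>)" c] h c by auto
  have "cmod (u (\<lambda>Z. \<nu> Z * cis (jj Y \<bullet> Z))) \<le> (C * A) * exp (2 * \<eta>\<^sup>2 * (norm Y)\<^sup>2)" for Y
  proof -
    have "gsd (A * exp (\<eta>\<^sup>2 * (norm (jj Y))\<^sup>2 / 2)) (2 * max h (1 / \<eta>)) (c + 0) (\<lambda>Z. \<nu> Z * cis (jj Y \<bullet> Z))"
      using h \<eta> by (intro gsd_mult' \<nu> gsd_cis) auto
    from C(2)[OF this[simplified]] show ?thesis
      by (simp add: norm_jj power_mult_distrib mult_ac)
  qed
  then show ?thesis using that[of "C * A"] C(1) gsd_nonneg[OF \<nu>] by simp
qed

text \<open>Half of the decay of \<open>\<nu>\<close> compensates the Gaussian growth allowed in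
  \<open>gsd_cis_diff\<close>. The explicit dependence on the radius \<open>R\<close> leaves the
  growth in the frequency controlled by \<open>\<eta>\<close>.\<close>

lemma dual_cis_lipschitz:
  fixes \<eta> :: real
  assumes u: "u \<in> GS_half_dual" and \<nu>: "gsd A h c \<nu>" and h: "h > 0" and c: "c > 0" and \<eta>: "\<eta> > 0"
  obtains C where "C \<ge> 0" "\<And>Y Y' R. norm Y \<le> R \<Longrightarrow> norm Y' \<le> R \<Longrightarrow>
    cmod (u (\<lambda>Z. \<nu> Z * (cis (jj Y \<bullet> Z) - cis (jj Y' \<bullet> Z)))) \<le> C * norm (Y - Y') * exp (\<eta>\<^sup>2 * (2 * R + 1)\<^sup>2 / 2)"
proof -
  obtain C where C: "C \<ge> 0" "\<And>A f. gsd A (2 * max h (1 / \<eta>)) (c / 2) f \<Longrightarrow> cmod (u f) \<le> C * A"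
    using dual_bound[OF u, of "2 * max h (1 / \<eta>)" "c / 2"] h c by auto
  have "cmod (u (\<lambda>Z. \<nu> Z * (cis (jj Y \<bullet> Z) - cis (jj Y' \<bullet> Z)))) \<le>
     (C * A * 2 * exp (1 / (4 * (c / 2)))) * norm (Y - Y') * exp (\<eta>\<^sup>2 * (2 * R + 1)\<^sup>2 / 2)"
    if R: "norm Y \<le> R" "norm Y' \<le> R" for Y Y' R
  proof -
    have "gsd (A * (norm (jj Y - jj Y') * exp (1 / (4 * (c / 2))) * exp (\<eta>\<^sup>2 * (2 * R + 1)\<^sup>2 / 2)))
        (2 * max h (1 / \<eta>)) (c + - (c / 2)) (\<lambda>Z. \<nu> Z * (cis (jj Y \<bullet> Z) - cis (jj Y' \<bullet> Z)))"
      using h \<eta> c R by (intro gsd_mult' \<nu> gsd_cis_diff) (auto simp: norm_jj)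
    then have "gsd (A * (2 * norm (Y - Y') * exp (1 / (4 * (c / 2))) * exp (\<eta>\<^sup>2 * (2 * R + 1)\<^sup>2 / 2)))
        (2 * max h (1 / \<eta>)) (c / 2) (\<lambda>Z. \<nu> Z * (cis (jj Y \<bullet> Z) - cis (jj Y' \<bullet> Z)))"
      unfolding jj_diff[symmetric] norm_jj by (simp only: field_sum_of_halves add_uminus_conv_diff) simp
    from C(2)[OF this] show ?thesis by (simp add: mult_ac)
  qed
  then show ?thesis using that[of "C * A * 2 * exp (1 / (4 * (c / 2)))"] C(1) gsd_nonneg[OF \<nu>] by simp
qed

lemma dual_cis_diff:
  assumes u: "u \<in> GS_half_dual" and \<nu>: "\<nu> \<in> GS_half"
  shows "u (\<lambda>Z. \<nu> Z * (cis (v \<bullet> Z) - cis (w \<bullet> Z))) = u (\<lambda>Z. \<nu> Z * cis (v \<bullet> Z)) - u (\<lambda>Z. \<nu> Z * cis (w \<bullet> Z))"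
  unfolding right_diff_distrib by (rule dual_diff[OF u GS_half_cis[OF \<nu>] GS_half_cis[OF \<nu>]])

lemma dual_cis_continuous:
  assumes u: "u \<in> GS_half_dual" and \<nu>: "\<nu> \<in> GS_half"
  shows "continuous_on UNIV (\<lambda>Y. u (\<lambda>Z. \<nu> Z * cis (jj Y \<bullet> Z)))"
proof -
  obtain A h c where g: "h > 0" "c > 0" "gsd A h c \<nu>" using \<nu> by (rule GS_half_gsd)
  obtain C where C: "C \<ge> 0" "\<And>Y Y' R. norm Y \<le> R \<Longrightarrow> norm Y' \<le> R \<Longrightarrow>
    cmod (u (\<lambda>Z. \<nu> Z * (cis (jj Y \<bullet> Z) - cis (jj Y' \<bullet> Z)))) \<le> C * norm (Y - Y') * exp (1\<^sup>2 * (2 * R + 1)\<^sup>2 / 2)"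
    by (rule dual_cis_lipschitz[OF u g(3,1,2), of 1]) auto
  have "((\<lambda>Y. u (\<lambda>Z. \<nu> Z * cis (jj Y \<bullet> Z))) \<longlongrightarrow> u (\<lambda>Z. \<nu> Z * cis (jj Y0 \<bullet> Z))) (at Y0)" for Y0
  proof (rule LIM_zero_cancel, rule Lim_null_comparison)
    let ?K = "C * exp (1\<^sup>2 * (2 * (norm Y0 + 1) + 1)\<^sup>2 / 2)"
    have "\<forall>\<^sub>F Y in at Y0. dist Y Y0 < 1" unfolding eventually_at by (intro exI[of _ 1]) auto
    then show "\<forall>\<^sub>F Y in at Y0. norm (u (\<lambda>Z. \<nu> Z * cis (jj Y \<bullet> Z)) - u (\<lambda>Z. \<nu> Z * cis (jj Y0 \<bullet> Z))) \<le> ?K * norm (Y - Y0)"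
    proof eventually_elim
      case (elim Y)
      have "norm Y \<le> norm Y0 + 1" using elim norm_triangle_sub[of Y Y0] by (simp add: dist_norm)
      from C(2)[OF this, of Y0] show ?case
        by (simp add: dual_cis_diff[OF u \<nu>] mult_ac)
    qed
    have "((\<lambda>Y. ?K * norm (Y - Y0)) \<longlongrightarrow> ?K * norm (Y0 - Y0)) (at Y0)" by (intro tendsto_intros)
    then show "((\<lambda>Y. ?K * norm (Y - Y0)) \<longlongrightarrow> 0) (at Y0)" by simp
  qed
  then show ?thesis by (simp add: continuous_on_def)
qed

lemma gauss_weight_integrable:
  fixes \<phi> :: "'p::euclidean_space \<Rightarrow> complex"
  assumes \<phi>: "gsd B k e \<phi>" and e: "e > 0" and m: "w \<in> borel_measurable borel"
    and w: "\<And>Y. \<bar>w Y\<bar> \<le> K * exp (e / 2 * (norm Y)\<^sup>2)"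
  shows "integrable lborel (\<lambda>Y. cmod (\<phi> Y) * w Y)"
proof (rule integrable_gauss_bound(1)[where c = "e / 2" and A = "B * K"])
  show "(\<lambda>Y. cmod (\<phi> Y) * w Y) \<in> borel_measurable borel"
    using m gsd_measurable[OF \<phi>] by measurable
  fix Y
  have B: "B \<ge> 0" using \<phi> by (rule gsd_nonneg)
  have "norm (cmod (\<phi> Y) * w Y) \<le> (B * exp (- e * (norm Y)\<^sup>2)) * (K * exp (e / 2 * (norm Y)\<^sup>2))"
    unfolding norm_mult using gsd_bound0[OF \<phi>, of Y] w[of Y] B by (intro mult_mono) auto
  also have "\<dots> = B * K * (exp (- e * (norm Y)\<^sup>2) * exp (e / 2 * (norm Y)\<^sup>2))" by (simp only: mult_ac)
  also have "exp (- e * (norm Y)\<^sup>2) * exp (e / 2 * (norm Y)\<^sup>2) = exp (- (e / 2) * (norm Y)\<^sup>2)"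
    by (simp flip: exp_add)
  finally show "norm (cmod (\<phi> Y) * w Y) \<le> B * K * exp (- (e / 2) * (norm Y)\<^sup>2)" .
qed (use e in simp)

text \<open>A continuous functional commutes with the integral over characters: the integral is approximated
  in some \<open>GS_h\<close> by finite sums, obtained by composing the parameter with simple functions.\<close>

theorem dual_exchange:
  fixes \<phi> :: "'a::euclidean_space \<times> 'a \<Rightarrow> complex"
  assumes u: "u \<in> GS_half_dual" and \<nu>: "\<nu> \<in> GS_half" and \<phi>: "\<phi> \<in> GS_half"
  shows "integrable lborel (\<lambda>Y. \<phi> Y * u (\<lambda>Z. \<nu> Z * cis (jj Y \<bullet> Z)))"
    "u (\<lambda>Z. \<nu> Z * (LINT Y|lborel. \<phi> Y * cis (jj Y \<bullet> Z))) = (LINT Y|lborel. \<phi> Y * u (\<lambda>Z. \<nu> Z * cis (jj Y \<bullet> Z)))"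
proof -
  obtain A h c where g: "h > 0" "c > 0" "gsd A h c \<nu>" using \<nu> by (rule GS_half_gsd)
  obtain B k e where p: "k > 0" "e > 0" "gsd B k e \<phi>" using \<phi> by (rule GS_half_gsd)
  have B: "B \<ge> 0" using p(3) by (rule gsd_nonneg)
  \<comment> \<open>The growth exponents that occur are \<open>2 * \<eta>\<^sup>2\<close>, then
    \<open>8 * \<eta>\<^sup>2\<close> because the simple functions may double the norm, and
    \<open>16 * \<eta>\<^sup>2\<close> from the radius \<open>4 * norm Y\<close>. With
    \<open>\<eta>\<^sup>2 = e / 64\<close> and a further \<open>e / 8\<close> for a linear factor,
    the total \<open>3 * e / 8\<close> stays below \<open>e / 2\<close>.\<close>
  define \<eta> where "\<eta> = sqrt (e / 64)"
  have \<eta>: "\<eta> > 0" "\<eta>\<^sup>2 = e / 64" using p by (auto simp: \<eta>_def)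
  let ?U = "\<lambda>Y. u (\<lambda>Z. \<nu> Z * cis (jj Y \<bullet> Z))"
  have [measurable]: "\<phi> \<in> borel_measurable borel" using \<phi> by (rule GS_half_measurable)
  have U: "continuous_on UNIV ?U" by (rule dual_cis_continuous[OF u \<nu>])
  have Um[measurable]: "?U \<in> borel_measurable borel" using U by (rule borel_measurable_continuous_onI)
  have \<phi>i: "integrable lborel \<phi>" using \<phi> by (rule GS_half_integrable)
  obtain C where C: "C \<ge> 0" "\<And>Y. cmod (?U Y) \<le> C * exp (2 * \<eta>\<^sup>2 * (norm Y)\<^sup>2)"
    by (rule dual_cis_bound[OF u g(3,1,2) \<eta>(1)]) auto
  have expm: "exp (r * (norm Y)\<^sup>2) \<le> exp (e / 2 * (norm Y)\<^sup>2)" if "r \<le> e / 2" for r and Y :: "'a \<times> 'a"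
    unfolding exp_le_cancel_iff by (rule mult_right_mono[OF that]) simp
  show "integrable lborel (\<lambda>Y. \<phi> Y * ?U Y)"
  proof (rule Bochner_Integration.integrable_bound)
    show "integrable lborel (\<lambda>Y. cmod (\<phi> Y) * (C * exp (2 * \<eta>\<^sup>2 * (norm Y)\<^sup>2)))"
      using p C(1) \<eta> by (intro gauss_weight_integrable[OF p(3), of _ C] mult_left_mono expm)
        (auto simp: abs_mult intro!: mult_left_mono expm mult_right_mono)
    show "AE Y in lborel. norm (\<phi> Y * ?U Y) \<le> norm (cmod (\<phi> Y) * (C * exp (2 * \<eta>\<^sup>2 * (norm Y)\<^sup>2)))"
      using C by (intro AE_I2) (simp add: norm_mult mult_left_mono)
  qed measurable
  obtain s where s: "\<And>i. simple_function lborel (s i)" "\<And>Y. (\<lambda>i. s i Y) \<longlonglongrightarrow> (Y :: 'a \<times> 'a)"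
    "\<And>i Y. norm (s i Y) \<le> 2 * norm Y"
  proof -
    have "(\<lambda>Y::'a \<times> 'a. Y) \<in> borel_measurable lborel" by measurable
    from borel_measurable_implies_sequence_metric[OF this, of 0] that show ?thesis
      by (auto simp: dist_norm)
  qed
  have sm[measurable]: "s i \<in> borel_measurable borel" for i
    using borel_measurable_simple_function[OF s(1), of i] by simp
  let ?M = "\<lambda>i Z. LINT Y|lborel. \<phi> Y * cis (jj (s i Y) \<bullet> Z)"
  let ?L = "\<lambda>Z. LINT Y|lborel. \<phi> Y * cis (jj Y \<bullet> Z)"
  have fin: "finite (range (s i))" for i using simple_functionD(1)[OF s(1), of i] by simp
  \<comment> \<open>As \<open>s i\<close> has finite range, the integral over characters is a finite
    sum, and linearity of \<open>u\<close> suffices.\<close>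
  have M1: "u (\<lambda>Z. \<nu> Z * ?M i Z) = (LINT Y|lborel. \<phi> Y * ?U (s i Y))" for i
  proof -
    let ?P = "\<lambda>y. LINT Y|lborel. \<phi> Y * indicator (s i -` {y}) Y"
    have "(\<lambda>Z. \<nu> Z * ?M i Z) = (\<lambda>Z. \<Sum>y\<in>range (s i). ?P y * (\<nu> Z * cis (jj y \<bullet> Z)))"
    proof
      fix Z
      show "\<nu> Z * ?M i Z = (\<Sum>y\<in>range (s i). (LINT Y|lborel. \<phi> Y * indicator (s i -` {y}) Y) * (\<nu> Z * cis (jj y \<bullet> Z)))"
        using integral_simple_compose[OF s(1)[of i] \<phi>i, of "\<lambda>y. cis (jj y \<bullet> Z)"]
        by (simp add: sum_distrib_left mult.left_commute)
    qed
    then have "u (\<lambda>Z. \<nu> Z * ?M i Z) = (\<Sum>y\<in>range (s i). u (\<lambda>Z. ?P y * (\<nu> Z * cis (jj y \<bullet> Z))))"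
      by (simp only:) (intro dual_sum[OF u fin] GS_half_cmult GS_half_cis \<nu>)
    also have "\<dots> = (\<Sum>y\<in>range (s i). ?P y * ?U y)"
      by (intro sum.cong refl dual_cmult[OF u GS_half_cis[OF \<nu>]])
    also have "\<dots> = (LINT Y|lborel. \<phi> Y * ?U (s i Y))"
      by (rule integral_simple_compose[OF s(1) \<phi>i, symmetric])
    finally show ?thesis .
  qed
  have lim1: "(\<lambda>i. LINT Y|lborel. \<phi> Y * ?U (s i Y)) \<longlonglongrightarrow> (LINT Y|lborel. \<phi> Y * ?U Y)"
  proof (rule integral_dominated_convergence)
    show "integrable lborel (\<lambda>Y. cmod (\<phi> Y) * (C * exp (8 * \<eta>\<^sup>2 * (norm Y)\<^sup>2)))"
      using p C(1) \<eta> by (intro gauss_weight_integrable[OF p(3), of _ C] mult_left_mono expm)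
        (auto simp: abs_mult intro!: mult_left_mono expm mult_right_mono)
    show "AE Y in lborel. (\<lambda>i. \<phi> Y * ?U (s i Y)) \<longlonglongrightarrow> \<phi> Y * ?U Y"
    proof (intro AE_I2 tendsto_mult tendsto_const)
      fix Y
      have "isCont ?U Y" using U continuous_on_eq_continuous_at[OF open_UNIV, of ?U] by blast
      then show "(\<lambda>i. ?U (s i Y)) \<longlonglongrightarrow> ?U Y" using s(2) by (rule isCont_tendsto_compose)
    qed
    show "AE Y in lborel. norm (\<phi> Y * ?U (s i Y)) \<le> cmod (\<phi> Y) * (C * exp (8 * \<eta>\<^sup>2 * (norm Y)\<^sup>2))" for i
    proof (rule AE_I2)
      fix Y
      have "(norm (s i Y))\<^sup>2 \<le> 4 * (norm Y)\<^sup>2"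
        using power_mono[OF s(3)[of i Y], of 2] by (simp add: power_mult_distrib)
      then have "exp (2 * \<eta>\<^sup>2 * (norm (s i Y))\<^sup>2) \<le> exp (8 * \<eta>\<^sup>2 * (norm Y)\<^sup>2)"
        using mult_left_mono[of "(norm (s i Y))\<^sup>2" "4 * (norm Y)\<^sup>2" "2 * \<eta>\<^sup>2"] by simp
      then have "cmod (?U (s i Y)) \<le> C * exp (8 * \<eta>\<^sup>2 * (norm Y)\<^sup>2)"
        using C(2)[of "s i Y"] mult_left_mono[OF _ C(1)] order_trans by blast
      then show "norm (\<phi> Y * ?U (s i Y)) \<le> cmod (\<phi> Y) * (C * exp (8 * \<eta>\<^sup>2 * (norm Y)\<^sup>2))"
        unfolding norm_mult by (rule mult_left_mono) simp
    qed
  qed measurable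
  \<comment> \<open>A weighted mean of the approximation error \<open>s i Y - Y\<close>. It bounds
    the amplitude of \<open>?M i - ?L\<close> in all derivatives at once and tends to 0.\<close>
  define \<delta> where "\<delta> i = (LINT Y|lborel. cmod (\<phi> Y) * (norm (jj (s i Y) - jj Y) * exp (\<eta>\<^sup>2 * (4 * norm Y + 1)\<^sup>2 / 2)))" for i
  have wb: "norm (jj (s i Y) - jj Y) * exp (\<eta>\<^sup>2 * (4 * norm Y + 1)\<^sup>2 / 2) \<le> (6 * exp (2 / e + \<eta>\<^sup>2)) * exp (e / 2 * (norm Y)\<^sup>2)" for i Y
  proof -
    have "norm (jj (s i Y) - jj Y) \<le> 2 * norm (s i Y) + 2 * norm Y"
      using norm_triangle_ineq4[of "jj (s i Y)" "jj Y"] by (simp add: norm_jj)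
    also have "\<dots> \<le> 6 * (1 + norm Y)" using s(3)[of i Y] by simp
    also have "\<dots> \<le> 6 * (exp (1 / (4 * (e / 8))) * exp (e / 8 * (norm Y)\<^sup>2))"
      using p by (intro mult_left_mono one_plus_le_gauss) auto
    finally have 1: "norm (jj (s i Y) - jj Y) \<le> 6 * (exp (2 / e) * exp (e / 8 * (norm Y)\<^sup>2))"
      by simp
    have "(4 * norm Y + 1)\<^sup>2 \<le> 32 * (norm Y)\<^sup>2 + 2"
      using sum_squares_bound[of "4 * norm Y" 1] by (simp add: power2_sum power_mult_distrib)
    then have "\<eta>\<^sup>2 * (4 * norm Y + 1)\<^sup>2 / 2 \<le> \<eta>\<^sup>2 * (32 * (norm Y)\<^sup>2 + 2) / 2"
      by (intro divide_right_mono mult_left_mono) auto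
    also have "\<dots> = \<eta>\<^sup>2 + e / 4 * (norm Y)\<^sup>2" unfolding \<eta>(2) by (simp add: algebra_simps)
    finally have 2: "exp (\<eta>\<^sup>2 * (4 * norm Y + 1)\<^sup>2 / 2) \<le> exp (\<eta>\<^sup>2) * exp (e / 4 * (norm Y)\<^sup>2)"
      by (simp flip: exp_add)
    have "norm (jj (s i Y) - jj Y) * exp (\<eta>\<^sup>2 * (4 * norm Y + 1)\<^sup>2 / 2) \<le>
        (6 * (exp (2 / e) * exp (e / 8 * (norm Y)\<^sup>2))) * (exp (\<eta>\<^sup>2) * exp (e / 4 * (norm Y)\<^sup>2))"
      using 1 2 by (intro mult_mono) auto
    also have "\<dots> = 6 * exp (2 / e + \<eta>\<^sup>2) * exp (3 * e / 8 * (norm Y)\<^sup>2)"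
      by (simp add: mult_ac flip: exp_add)
    also have "\<dots> \<le> (6 * exp (2 / e + \<eta>\<^sup>2)) * exp (e / 2 * (norm Y)\<^sup>2)"
      using p by (intro mult_left_mono expm) auto
    finally show ?thesis .
  qed
  have wi: "integrable lborel (\<lambda>Y. cmod (\<phi> Y) * (norm (jj (s i Y) - jj Y) * exp (\<eta>\<^sup>2 * (4 * norm Y + 1)\<^sup>2 / 2)))" for i
    using wb[of i] by (intro gauss_weight_integrable[OF p(3,2)]) auto
  have \<delta>0: "\<delta> \<longlonglongrightarrow> (LINT Y|lborel. cmod (\<phi> Y) * (norm (jj Y - jj Y) * exp (\<eta>\<^sup>2 * (4 * norm Y + 1)\<^sup>2 / 2)))"
    unfolding \<delta>_def
  proof (rule integral_dominated_convergence)
    show "integrable lborel (\<lambda>Y. cmod (\<phi> Y) * ((6 * exp (2 / e + \<eta>\<^sup>2)) * exp (e / 2 * (norm Y)\<^sup>2)))"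
      by (intro gauss_weight_integrable[OF p(3,2)]) auto
    show "AE Y in lborel. (\<lambda>i. cmod (\<phi> Y) * (norm (jj (s i Y) - jj Y) * exp (\<eta>\<^sup>2 * (4 * norm Y + 1)\<^sup>2 / 2)))
        \<longlonglongrightarrow> cmod (\<phi> Y) * (norm (jj Y - jj Y) * exp (\<eta>\<^sup>2 * (4 * norm Y + 1)\<^sup>2 / 2))"
    proof (rule AE_I2)
      fix Y :: "'a \<times> 'a"
      have "isCont jj Y" using jj_continuous continuous_on_eq_continuous_at[OF open_UNIV, of "jj :: 'a \<times> 'a \<Rightarrow> _"] by blast
      then have "(\<lambda>i. jj (s i Y)) \<longlonglongrightarrow> jj Y" using s(2) by (rule isCont_tendsto_compose)
      then show "(\<lambda>i. cmod (\<phi> Y) * (norm (jj (s i Y) - jj Y) * exp (\<eta>\<^sup>2 * (4 * norm Y + 1)\<^sup>2 / 2)))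
        \<longlonglongrightarrow> cmod (\<phi> Y) * (norm (jj Y - jj Y) * exp (\<eta>\<^sup>2 * (4 * norm Y + 1)\<^sup>2 / 2))"
        by (intro tendsto_intros)
    qed
    show "AE Y in lborel. norm (cmod (\<phi> Y) * (norm (jj (s i Y) - jj Y) * exp (\<eta>\<^sup>2 * (4 * norm Y + 1)\<^sup>2 / 2)))
        \<le> cmod (\<phi> Y) * ((6 * exp (2 / e + \<eta>\<^sup>2)) * exp (e / 2 * (norm Y)\<^sup>2))" for i
      using wb[of i] by (intro AE_I2) (simp add: abs_mult mult_left_mono)
  qed measurable
  define h' where "h' = 2 * max h (1 / \<eta>)"
  obtain C' where C': "C' \<ge> 0" "\<And>A f. gsd A h' (c / 2) f \<Longrightarrow> cmod (u f) \<le> C' * A"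
    using dual_bound[OF u, of h' "c / 2"] g by (auto simp: h'_def)
  \<comment> \<open>The difference of the two integrals is only bounded up to Gaussian growth of
    exponent \<open>c / 2\<close>; multiplication by \<open>\<nu>\<close>, which decays with
    \<open>c\<close>, brings it back into a fixed step.\<close>
  have D: "gsd (\<delta> i * exp (1 / (4 * (c / 2)))) (1 / \<eta>) (- (c / 2)) (\<lambda>Z. ?M i Z - ?L Z)" for i
    unfolding gsd_def
  proof (intro conjI allI impI)
    have jn: "norm (jj (s i Y)) \<le> 4 * norm Y" "norm (jj Y) \<le> 4 * norm Y" for Y
      using s(3)[of i Y] by (auto simp: norm_jj)
    note pM = partials_trig_integral[of \<phi> "\<lambda>Y. jj (s i Y)" e B 4, OF _ _ p(2) gsd_bound0[OF p(3)] jn(1)]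
    note pL = partials_trig_integral[of \<phi> jj e B 4, OF _ _ p(2) gsd_bound0[OF p(3)] jn(2)]
    have sM: "smooth (?M i)" by (rule pM(1)) measurable
    have sL: "smooth ?L" by (rule pL(1)) measurable
    show "smooth (\<lambda>Z. ?M i Z - ?L Z)"
      using partials_add(1)[OF sM partials_cmult(1)[OF sL, of "-1"]] by simp
    fix bs :: "('a \<times> 'a) list" and Z :: "'a \<times> 'a" assume bs: "set bs \<subseteq> Basis"
    have eq: "\<phi> Y * (\<i> ^ length bs * complex_of_real (basis_prod bs a)) * cis (a \<bullet> Z) = \<phi> Y * partials bs (\<lambda>x. cis (a \<bullet> x)) Z" for a Y
      by (simp add: partials_cis(2)[OF bs] mult.assoc)
    have M': "partials bs (?M i) Z = (LINT Y|lborel. \<phi> Y * partials bs (\<lambda>x. cis (jj (s i Y) \<bullet> x)) Z)"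
      by (subst pM(2)[OF _ _ bs]) (simp_all add: eq)
    have L': "partials bs ?L Z = (LINT Y|lborel. \<phi> Y * partials bs (\<lambda>x. cis (jj Y \<bullet> x)) Z)"
      by (subst pL(2)[OF _ _ bs]) (simp_all add: eq)
    have bpm: "(\<lambda>Y. partials bs (\<lambda>x. cis (a Y \<bullet> x)) Z) \<in> borel_measurable borel"
      if [measurable]: "a \<in> borel_measurable borel" for a :: "'a \<times> 'a \<Rightarrow> 'a \<times> 'a"
    proof -
      have [measurable]: "(\<lambda>Y. basis_prod bs (a Y)) \<in> borel_measurable borel" for bs
        by (induction bs) auto
      show ?thesis unfolding partials_cis(2)[OF bs] by measurable
    qed
    have int: "integrable lborel (\<lambda>Y. \<phi> Y * partials bs (\<lambda>x. cis (a Y \<bullet> x)) Z)"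
      if [measurable]: "a \<in> borel_measurable borel" and a: "\<And>Y. norm (a Y) \<le> 4 * norm Y" for a :: "'a \<times> 'a \<Rightarrow> 'a \<times> 'a"
    proof (rule integrable_gauss_bound(1))
      show "(\<lambda>Y. \<phi> Y * partials bs (\<lambda>x. cis (a Y \<bullet> x)) Z) \<in> borel_measurable borel"
        using bpm[of a] by measurable
      fix Y
      have "cmod (\<phi> Y * partials bs (\<lambda>x. cis (a Y \<bullet> x)) Z) \<le> (B * exp (- e * (norm Y)\<^sup>2)) * (4 * norm Y) ^ length bs"
        unfolding norm_mult partials_cis(2)[OF bs]
        using gsd_bound0[OF p(3), of Y] abs_basis_prod_le[OF bs, of "a Y"] power_mono[OF a[of Y], of "length bs"] B
        by (intro mult_mono) (auto simp: norm_power norm_mult)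
      also have "\<dots> = B * 4 ^ length bs * (norm Y ^ length bs * exp (- e * (norm Y)\<^sup>2))"
        by (simp add: power_mult_distrib)
      also have "\<dots> \<le> B * 4 ^ length bs * (sqrt (fact (length bs)) * (1 / sqrt e) ^ length bs * exp (- (e / 2) * (norm Y)\<^sup>2))"
        using B p by (intro mult_left_mono power_gauss_le) auto
      finally show "cmod (\<phi> Y * partials bs (\<lambda>x. cis (a Y \<bullet> x)) Z) \<le>
          (B * 4 ^ length bs * (sqrt (fact (length bs)) * (1 / sqrt e) ^ length bs)) * exp (- (e / 2) * (norm Y)\<^sup>2)"
        by (simp only: mult.assoc)
    qed (use p in auto)
    have "partials bs (\<lambda>Z. ?M i Z - ?L Z) Z = partials bs (?M i) Z - partials bs ?L Z"
      using partials_add(2)[OF sM partials_cmult(1)[OF sL, of "-1"] bs] partials_cmult(2)[OF sL bs, of "-1"] by simp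
    also have "\<dots> = (LINT Y|lborel. \<phi> Y * (partials bs (\<lambda>x. cis (jj (s i Y) \<bullet> x)) Z - partials bs (\<lambda>x. cis (jj Y \<bullet> x)) Z))"
      unfolding M' L' right_diff_distrib
      by (rule Bochner_Integration.integral_diff[symmetric]) (intro int jn; measurable)+
    also have "cmod \<dots> \<le> (LINT Y|lborel. cmod (\<phi> Y) * (norm (jj (s i Y) - jj Y) * exp (\<eta>\<^sup>2 * (4 * norm Y + 1)\<^sup>2 / 2))
        * ((1 + norm Z) * (sqrt (fact (length bs)) * (1 / \<eta>) ^ length bs)))"
    proof (rule norm_integral_le[OF integrable_mult_left[OF wi]])
      fix Y
      have "cmod (partials bs (\<lambda>x. cis (jj (s i Y) \<bullet> x)) Z - partials bs (\<lambda>x. cis (jj Y \<bullet> x)) Z) \<le>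
          norm (jj (s i Y) - jj Y) * (1 + norm Z) * (4 * norm Y + 1) ^ length bs"
        by (rule partials_cis_diff_le[OF bs jn])
      also have "\<dots> \<le> norm (jj (s i Y) - jj Y) * (1 + norm Z) *
          (sqrt (fact (length bs)) * (1 / \<eta>) ^ length bs * exp (\<eta>\<^sup>2 * (4 * norm Y + 1)\<^sup>2 / 2))"
        using \<eta> by (intro mult_left_mono power_le_gauss) auto
      finally have "cmod (\<phi> Y) * cmod (partials bs (\<lambda>x. cis (jj (s i Y) \<bullet> x)) Z - partials bs (\<lambda>x. cis (jj Y \<bullet> x)) Z) \<le>
          cmod (\<phi> Y) * (norm (jj (s i Y) - jj Y) * (1 + norm Z) *
          (sqrt (fact (length bs)) * (1 / \<eta>) ^ length bs * exp (\<eta>\<^sup>2 * (4 * norm Y + 1)\<^sup>2 / 2)))"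
        by (rule mult_left_mono) simp
      then show "cmod (\<phi> Y * (partials bs (\<lambda>x. cis (jj (s i Y) \<bullet> x)) Z - partials bs (\<lambda>x. cis (jj Y \<bullet> x)) Z)) \<le>
          cmod (\<phi> Y) * (norm (jj (s i Y) - jj Y) * exp (\<eta>\<^sup>2 * (4 * norm Y + 1)\<^sup>2 / 2))
        * ((1 + norm Z) * (sqrt (fact (length bs)) * (1 / \<eta>) ^ length bs))"
        by (simp only: norm_mult mult_ac)
    qed
    also have "\<dots> = \<delta> i * ((1 + norm Z) * (sqrt (fact (length bs)) * (1 / \<eta>) ^ length bs))"
      by (simp only: \<delta>_def integral_mult_left_zero)
    also have "\<dots> \<le> \<delta> i * ((exp (1 / (4 * (c / 2))) * exp (c / 2 * (norm Z)\<^sup>2)) * (sqrt (fact (length bs)) * (1 / \<eta>) ^ length bs))"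
      using g \<eta> by (intro mult_left_mono mult_right_mono one_plus_le_gauss) (auto simp: \<delta>_def intro!: integral_nonneg_AE)
    finally show "cmod (partials bs (\<lambda>Z. ?M i Z - ?L Z) Z) \<le>
       \<delta> i * exp (1 / (4 * (c / 2))) * (1 / \<eta>) ^ length bs * sqrt (fact (length bs)) * exp (- (- (c / 2)) * (norm Z)\<^sup>2)"
      by (simp only: mult_ac minus_minus)
  qed
  have Dg: "gsd (A * (\<delta> i * exp (1 / (4 * (c / 2))))) h' (c / 2) (\<lambda>Z. \<nu> Z * (?M i Z - ?L Z))" for i
    using gsd_mult'[OF g(3) D[of i]] g \<eta> by (simp add: h'_def)
  have MG: "(\<lambda>Z. \<nu> Z * ?M i Z) \<in> GS_half" for i
  proof -
    have "(\<lambda>Z. \<nu> Z * ?M i Z) = (\<lambda>Z. \<Sum>y\<in>range (s i). (LINT Y|lborel. \<phi> Y * indicator (s i -` {y}) Y) * (\<nu> Z * cis (jj y \<bullet> Z)))"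
    proof
      fix Z
      show "\<nu> Z * ?M i Z = (\<Sum>y\<in>range (s i). (LINT Y|lborel. \<phi> Y * indicator (s i -` {y}) Y) * (\<nu> Z * cis (jj y \<bullet> Z)))"
        using integral_simple_compose[OF s(1)[of i] \<phi>i, of "\<lambda>y. cis (jj y \<bullet> Z)"]
        by (simp add: sum_distrib_left mult.left_commute)
    qed
    then show ?thesis by (simp only:) (intro GS_half_sum fin GS_half_cmult GS_half_cis \<nu>)
  qed
  have DG: "(\<lambda>Z. \<nu> Z * (?M i Z - ?L Z)) \<in> GS_half" for i
    using gsd_GS_half[OF Dg] g by (simp add: h'_def)
  have e0: "u (\<lambda>Z. \<nu> Z * ?L Z) = u (\<lambda>Z. \<nu> Z * ?M i Z) - u (\<lambda>Z. \<nu> Z * (?M i Z - ?L Z))" for i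
    using dual_diff[OF u MG[of i] DG[of i]] by (simp add: algebra_simps)
  have d: "cmod (u (\<lambda>Z. \<nu> Z * ?M i Z) - u (\<lambda>Z. \<nu> Z * ?L Z)) \<le> (C' * (A * exp (1 / (4 * (c / 2))))) * \<delta> i" for i
  proof -
    have "u (\<lambda>Z. \<nu> Z * ?M i Z) - u (\<lambda>Z. \<nu> Z * ?L Z) = u (\<lambda>Z. \<nu> Z * (?M i Z - ?L Z))"
      by (subst e0[of i]) simp
    then show ?thesis using C'(2)[OF Dg[of i]] by (simp add: mult_ac)
  qed
  have "(\<lambda>i. (C' * (A * exp (1 / (4 * (c / 2))))) * \<delta> i) \<longlonglongrightarrow> 0"
    using tendsto_mult_left[OF \<delta>0] by simp
  then have "(\<lambda>i. u (\<lambda>Z. \<nu> Z * ?M i Z) - u (\<lambda>Z. \<nu> Z * ?L Z)) \<longlonglongrightarrow> 0"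
    by (rule Lim_null_comparison[OF always_eventually, rotated]) (use d in auto)
  then have "(\<lambda>i. u (\<lambda>Z. \<nu> Z * ?M i Z)) \<longlonglongrightarrow> u (\<lambda>Z. \<nu> Z * ?L Z)"
    by (rule LIM_zero_cancel)
  with lim1 show "u (\<lambda>Z. \<nu> Z * ?L Z) = (LINT Y|lborel. \<phi> Y * ?U Y)"
    unfolding M1 using LIMSEQ_unique by blast
qed

text \<open>If the integral vanished, \<open>g\<close> would be 0 almost everywhere, while averaging
  against narrow Gaussians recovers the nonzero value at \<open>z\<close>.\<close>

lemma integral_continuous_nonneg_pos:
  fixes g :: "'n::euclidean_space \<Rightarrow> real"
  assumes cont: "continuous_on UNIV g" and int: "integrable lborel g" and nn: "\<And>x. g x \<ge> 0" and z: "g z \<noteq> 0"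
  shows "(LINT x|lborel. g x) > 0"
proof (rule ccontr)
  assume "\<not> (LINT x|lborel. g x) > 0"
  moreover have "(LINT x|lborel. g x) \<ge> 0"
    by (rule Bochner_Integration.integral_nonneg) (rule nn)
  ultimately have "(LINT x|lborel. g x) = 0" by linarith
  then have AE: "AE x in lborel. g x = 0"
    using integral_nonneg_eq_0_iff_AE[OF int] nn by simp
  let ?g = "\<lambda>x. complex_of_real (g x)"
  have m: "?g \<in> borel_measurable borel" using cont by (intro borel_measurable_continuous_onI continuous_intros)
  have c: "isCont ?g z"
    using cont by (intro continuous_intros) (simp add: continuous_on_eq_continuous_at)
  have "integrable lborel (\<lambda>x. ?g x * gauss 1 (x - z))"
  proof (rule Bochner_Integration.integrable_bound[OF int])
    show "(\<lambda>x. ?g x * gauss 1 (x - z)) \<in> borel_measurable lborel"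
      using m unfolding gauss_def by measurable
    show "AE x in lborel. norm (?g x * gauss 1 (x - z)) \<le> norm (g x)"
      using AE by eventually_elim simp
  qed
  from approx_identity[OF m c this] have "(\<lambda>k. complex_of_real (sqrt (real (Suc k) / pi) ^ DIM('n)) *
     (LINT x|lborel. ?g x * gauss (real (Suc k)) (x - z))) \<longlonglongrightarrow> ?g z" .
  moreover have "(LINT x|lborel. ?g x * gauss (real (Suc k)) (x - z)) = 0" for k
  proof (rule integral_eq_zero_AE)
    show "AE x in lborel. ?g x * gauss (real (Suc k)) (x - z) = 0" using AE by eventually_elim simp
  qed
  ultimately show False using z by (simp add: LIMSEQ_const_iff)
qed

text \<open>Evaluates the definite description. Two candidates have equal integrals against every
  translated Gaussian, and \<open>approx_identity\<close> recovers their values from these.\<close>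

lemma fun_of_distr_eq:
  fixes g :: "'n::euclidean_space \<Rightarrow> complex"
  assumes g: "continuous_on UNIV g" "\<And>\<phi>. \<phi> \<in> GS_half \<Longrightarrow> integrable lborel (\<lambda>x. g x * \<phi> x)" "distr_of g = v"
  shows "fun_of_distr v = g"
  unfolding fun_of_distr_def
proof (rule the_equality)
  have gm: "g \<in> borel_measurable borel" using g(1) by (rule borel_measurable_continuous_onI)
  show "continuous_on UNIV g \<and> (\<forall>\<phi>\<in>GS_half. integrable lebesgue (\<lambda>x. g x * \<phi> x)) \<and> distr_of g = v"
    using g gm GS_half_measurable by (auto simp: integrable_completion)
  fix f assume f: "continuous_on UNIV f \<and> (\<forall>\<phi>\<in>GS_half. integrable lebesgue (\<lambda>x. f x * \<phi> x)) \<and> distr_of f = v"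
  then have fm: "f \<in> borel_measurable borel" by (intro borel_measurable_continuous_onI) simp
  have fi: "integrable lborel (\<lambda>x. f x * \<phi> x)" if \<phi>: "\<phi> \<in> GS_half" for \<phi>
  proof -
    have "(\<lambda>x. f x * \<phi> x) \<in> borel_measurable lborel" using fm GS_half_measurable[OF \<phi>] by measurable
    then show ?thesis using f \<phi> integrable_completion by blast
  qed
  show "f = g"
  proof
    fix z :: 'n
    let ?d = "\<lambda>x. f x - g x"
    have G: "(\<lambda>x. gauss l (x - z)) \<in> GS_half" if "l > 0" for l :: real
      by (intro GS_half_translate GS_half_gauss that)
    have m: "?d \<in> borel_measurable borel" using fm gm by measurable
    have c: "isCont ?d z"
      using f g(1) continuous_on_eq_continuous_at[OF open_UNIV, of f] continuous_on_eq_continuous_at[OF open_UNIV, of g]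
      by (intro continuous_intros) blast+
    have i: "integrable lborel (\<lambda>x. ?d x * gauss l (x - z))" "(LINT x|lborel. ?d x * gauss l (x - z)) = 0" if "l > 0" for l
    proof -
      show "integrable lborel (\<lambda>x. ?d x * gauss l (x - z))"
        unfolding left_diff_distrib using fi[OF G[OF that]] g(2)[OF G[OF that]] by simp
      have "(LINT x|lborel. f x * gauss l (x - z)) = (LINT x|lborel. g x * gauss l (x - z))"
        using distr_of_apply[OF fm G[OF that]] distr_of_apply[OF gm G[OF that]] f g(3) by simp
      then show "(LINT x|lborel. ?d x * gauss l (x - z)) = 0"
        unfolding left_diff_distrib using fi[OF G[OF that]] g(2)[OF G[OF that]] by simp
    qed
    from approx_identity[OF m c i(1)[of 1]] have "?d z = 0"
      by (simp add: i(2) LIMSEQ_const_iff)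
    then show "f z = g z" by simp
  qed
qed

section \<open>The short-time Fourier transform of a distribution\<close>

definition stft :: "('a::euclidean_space \<times> 'a \<Rightarrow> complex) \<Rightarrow> ('a \<times> 'a) distr \<Rightarrow> 'a \<times> 'a \<Rightarrow> 'a \<times> 'a \<Rightarrow> complex" where
  "stft \<Phi> u X Y = u (\<lambda>Z. cnj (\<Phi> (Z - X)) * cis (jj Y \<bullet> Z))"

lemma window_GS: "\<Phi> \<in> GS_half \<Longrightarrow> (\<lambda>Z. cnj (\<Phi> (Z - X))) \<in> GS_half"
  by (rule GS_half_cnj[OF GS_half_translate])

text \<open>By transposition the defining distribution sends \<open>\<phi>\<close> to
  \<open>u\<close> applied to the window times a transform of \<open>\<phi>\<close>. Pulling
  \<open>u\<close> through that integral with \<open>dual_exchange\<close> exhibits a continuous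
  representative, namely \<open>u\<close> applied to the modulated window.\<close>

lemma symp_stft_eq:
  fixes \<Phi> :: "'a::euclidean_space \<times> 'a \<Rightarrow> complex"
  assumes \<Phi>: "\<Phi> \<in> GS_half" and u: "u \<in> GS_half_dual"
  shows "symp_stft \<Phi> u X Y = complex_of_real (1 / pi ^ DIM('a)) * stft \<Phi> u X Y"
proof -
  let ?\<nu> = "\<lambda>Z. cnj (\<Phi> (Z - X))" and ?p = "complex_of_real (1 / pi ^ DIM('a))"
  have \<nu>: "?\<nu> \<in> GS_half" using \<Phi> by (rule window_GS)
  have "fun_of_distr (symp_fourier_distr (distr_mult u ?\<nu>)) = (\<lambda>Y. ?p * stft \<Phi> u X Y)"
  proof (rule fun_of_distr_eq)
    show c: "continuous_on UNIV (\<lambda>Y. ?p * stft \<Phi> u X Y)"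
      unfolding stft_def using dual_cis_continuous[OF u \<nu>] by (intro continuous_intros)
    then have m: "(\<lambda>Y. ?p * stft \<Phi> u X Y) \<in> borel_measurable borel" by (rule borel_measurable_continuous_onI)
    show "integrable lborel (\<lambda>Y. ?p * stft \<Phi> u X Y * \<phi> Y)" if "\<phi> \<in> GS_half" for \<phi>
      using integrable_mult_right[of ?p, OF dual_exchange(1)[OF u \<nu> that]]
      by (simp add: stft_def mult_ac)
    show "distr_of (\<lambda>Y. ?p * stft \<Phi> u X Y) = symp_fourier_distr (distr_mult u ?\<nu>)"
    proof
      fix \<phi> :: "'a \<times> 'a \<Rightarrow> complex"
      show "distr_of (\<lambda>Y. ?p * stft \<Phi> u X Y) \<phi> = symp_fourier_distr (distr_mult u ?\<nu>) \<phi>"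
      proof (cases "\<phi> \<in> GS_half")
        case True
        have R: "(\<lambda>Z. symp_fourier \<phi> (- Z)) \<in> GS_half"
          by (intro GS_half_reflect GS_half_symp_fourier True)
        have L: "(\<lambda>Z. LINT Y|lborel. \<phi> Y * cis (jj Y \<bullet> Z)) = (\<lambda>Z. complex_of_real (pi ^ DIM('a)) * symp_fourier \<phi> (- Z))"
        proof
          fix Z :: "'a \<times> 'a"
          have "jj (- Z) \<bullet> Y = jj Y \<bullet> Z" for Y using jj_antisym[of Z Y] by (simp add: jj_minus)
          then show "(LINT Y|lborel. \<phi> Y * cis (jj Y \<bullet> Z)) = complex_of_real (pi ^ DIM('a)) * symp_fourier \<phi> (- Z)"
            unfolding symp_fourier_eq[OF GS_half_measurable[OF True]] by simp
        qed
        have "symp_fourier_distr (distr_mult u ?\<nu>) \<phi> = u (\<lambda>Z. ?\<nu> Z * symp_fourier \<phi> (- Z))"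
          using True R by (simp add: symp_fourier_distr_def distr_mult_def)
        also have "(\<lambda>Z. ?\<nu> Z * symp_fourier \<phi> (- Z)) = (\<lambda>Z. ?p * (?\<nu> Z * (LINT Y|lborel. \<phi> Y * cis (jj Y \<bullet> Z))))"
          unfolding fun_cong[OF L] by simp
        also have "u \<dots> = ?p * u (\<lambda>Z. ?\<nu> Z * (LINT Y|lborel. \<phi> Y * cis (jj Y \<bullet> Z)))"
          unfolding fun_cong[OF L] by (intro dual_cmult[OF u] GS_half_mult \<nu> GS_half_cmult R)
        also have "\<dots> = ?p * (LINT Y|lborel. \<phi> Y * u (\<lambda>Z. ?\<nu> Z * cis (jj Y \<bullet> Z)))"
          unfolding dual_exchange(2)[OF u \<nu> True] ..
        also have "\<dots> = (LINT Y|lborel. ?p * (\<phi> Y * u (\<lambda>Z. ?\<nu> Z * cis (jj Y \<bullet> Z))))"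
          by (simp only: integral_mult_right_zero)
        also have "\<dots> = distr_of (\<lambda>Y. ?p * stft \<Phi> u X Y) \<phi>"
          by (subst distr_of_apply[OF m True]) (simp only: stft_def mult_ac)
        finally show ?thesis by simp
      next
        case False
        then show ?thesis by (simp add: distr_of_def symp_fourier_distr_def)
      qed
    qed
  qed
  then show ?thesis by (simp add: symp_stft_def)
qed

lemma stft_diff:
  assumes "\<Phi> \<in> GS_half" "u \<in> GS_half_dual" "v \<in> GS_half_dual"
  shows "symp_stft \<Phi> (\<lambda>\<phi>. u \<phi> - v \<phi>) X Y = symp_stft \<Phi> u X Y - symp_stft \<Phi> v X Y"
  using assms by (simp add: symp_stft_eq dual_diff_mem stft_def diff_divide_distrib)

lemma symp_stft_distr_of:
  fixes \<Phi> :: "'a::euclidean_space \<times> 'a \<Rightarrow> complex"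
  assumes \<Phi>: "\<Phi> \<in> GS_half" and f: "f \<in> GS_half"
  shows "symp_stft \<Phi> (distr_of f) X = symp_fourier (\<lambda>Z. f Z * cnj (\<Phi> (Z - X)))"
proof
  fix Y
  have fm: "f \<in> borel_measurable borel" using f by (rule GS_half_measurable)
  have "stft \<Phi> (distr_of f) X Y = (LINT Z|lborel. f Z * (cnj (\<Phi> (Z - X)) * cis (jj Y \<bullet> Z)))"
    unfolding stft_def by (rule distr_of_apply[OF fm GS_half_cis[OF window_GS[OF \<Phi>]]])
  then show "symp_stft \<Phi> (distr_of f) X Y = symp_fourier (\<lambda>Z. f Z * cnj (\<Phi> (Z - X))) Y"
    unfolding symp_stft_eq[OF \<Phi> distr_of_GS_dual[OF f]]
    by (subst symp_fourier_eq) (auto intro!: GS_half_measurable GS_half_mult f window_GS \<Phi> simp: mult.assoc)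
qed

text \<open>Makes the dependence on translations accessible to \<open>gsd_cis_diff\<close>: a
  difference of translates is the transform of a difference of characters.\<close>

lemma translate_as_modulation:
  fixes f :: "'a::euclidean_space \<times> 'a \<Rightarrow> complex"
  assumes f: "f \<in> GS_half"
  shows "f (Z - X) = symp_fourier (\<lambda>W. symp_fourier f W * cis (jj (- X) \<bullet> W)) Z"
proof -
  have F: "symp_fourier f \<in> GS_half" using f by (rule GS_half_symp_fourier)
  have "f (Z - X) = symp_fourier (symp_fourier f) (Z - X)"
    by (simp add: symp_fourier_symp_fourier[OF f])
  also have "\<dots> = symp_fourier (\<lambda>W. symp_fourier f W * cis (jj (- X) \<bullet> W)) Z"
    unfolding symp_fourier_eq[OF GS_half_measurable[OF F]] symp_fourier_eq[OF GS_half_measurable[OF GS_half_cis[OF F]]]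
    by (simp add: jj_diff jj_minus inner_diff_left cis_mult mult.assoc)
  finally show ?thesis .
qed

text \<open>Joint continuity combines a Lipschitz estimate in \<open>X\<close>, uniform for bounded
  \<open>Y\<close>, with continuity in \<open>Y\<close> for fixed \<open>X\<close>. The first goes
  through the Fourier transform of the window, where translations are characters.\<close>

lemma stft_continuous:
  fixes \<Phi> :: "'a::euclidean_space \<times> 'a \<Rightarrow> complex"
  assumes \<Phi>: "\<Phi> \<in> GS_half" and u: "u \<in> GS_half_dual"
  shows "continuous_on UNIV (\<lambda>(X, Y). stft \<Phi> u X Y)"
proof -
  let ?\<nu> = "\<lambda>Z. cnj (\<Phi> Z)"
  have \<nu>: "?\<nu> \<in> GS_half" using \<Phi> by (rule GS_half_cnj)
  define \<Psi> where "\<Psi> = symp_fourier ?\<nu>"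
  have \<Psi>: "\<Psi> \<in> GS_half" unfolding \<Psi>_def using \<nu> by (rule GS_half_symp_fourier)
  obtain B k e where p: "k > 0" "e > 0" "gsd B k e \<Psi>" using \<Psi> by (rule GS_half_gsd)
  obtain C h c where C: "C \<ge> 0" "h > 0" "c > 0"
    "\<And>A (f :: 'a \<times> 'a \<Rightarrow> complex). gsd A (2 * max k 1) (e / 2) f \<Longrightarrow> gsd (C * A) h c (symp_fourier f)"
    by (rule gsd_symp_fourier[of "2 * max k 1" "e / 2"]) (use p in auto)
  obtain D where D: "D \<ge> 0" "\<And>A f. gsd A (2 * max h 1) c f \<Longrightarrow> cmod (u f) \<le> D * A"
    using dual_bound[OF u, of "2 * max h 1" c] C by auto
  define K where "K R = D * (C * (B * (2 * exp (1 / (4 * (e / 2))) * exp ((2 * R + 1)\<^sup>2 / 2))) * exp (2 * R\<^sup>2))" for R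
  have step: "cmod (stft \<Phi> u X Y - stft \<Phi> u X0 Y) \<le> K R * norm (X - X0)"
    if R: "norm X \<le> R" "norm X0 \<le> R" "norm Y \<le> R" for X X0 Y R
  proof -
    have R0: "0 \<le> R" using R(1) norm_ge_zero order_trans by blast
    let ?g = "\<lambda>W. \<Psi> W * (cis (jj (- X) \<bullet> W) - cis (jj (- X0) \<bullet> W))"
    have "gsd (B * (norm (jj (- X) - jj (- X0)) * exp (1 / (4 * (e / 2))) * exp (1\<^sup>2 * (2 * R + 1)\<^sup>2 / 2)))
        (2 * max k (1 / 1)) (e + - (e / 2)) ?g"
      using p R by (intro gsd_mult' gsd_cis_diff) (auto simp: norm_jj)
    moreover have "norm (jj (- X) - jj (- X0)) = 2 * norm (X - X0)"
      unfolding jj_diff[symmetric] norm_jj by (simp add: norm_minus_commute)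
    moreover have "e + - (e / 2) = e / 2" by simp
    ultimately have "gsd (B * (2 * norm (X - X0) * exp (1 / (4 * (e / 2))) * exp ((2 * R + 1)\<^sup>2 / 2))) (2 * max k 1) (e / 2) ?g"
      by (simp only: power_one div_by_1 mult_1)
    from C(4)[OF this] have "gsd (C * (B * (2 * norm (X - X0) * exp (1 / (4 * (e / 2))) * exp ((2 * R + 1)\<^sup>2 / 2)))) h c (symp_fourier ?g)" .
    also have "symp_fourier ?g = (\<lambda>Z. ?\<nu> (Z - X) - ?\<nu> (Z - X0))"
    proof
      fix Z
      have i: "integrable lborel (\<lambda>W. \<Psi> W * cis (v \<bullet> W) * cis (jj Z \<bullet> W))" for v
        by (intro GS_half_integrable GS_half_cis \<Psi>)
      have "?g \<in> borel_measurable borel"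
        unfolding right_diff_distrib by (intro GS_half_measurable GS_half_diff GS_half_cis \<Psi>)
      then have "symp_fourier ?g Z = symp_fourier (\<lambda>W. \<Psi> W * cis (jj (- X) \<bullet> W)) Z - symp_fourier (\<lambda>W. \<Psi> W * cis (jj (- X0) \<bullet> W)) Z"
        unfolding symp_fourier_eq[OF GS_half_measurable[OF GS_half_cis[OF \<Psi>]]]
        by (subst symp_fourier_eq) (auto simp: right_diff_distrib left_diff_distrib i diff_divide_distrib)
      then show "symp_fourier ?g Z = ?\<nu> (Z - X) - ?\<nu> (Z - X0)"
        unfolding \<Psi>_def translate_as_modulation[OF \<nu>, symmetric] .
    qed
    finally have "gsd (C * (B * (2 * norm (X - X0) * exp (1 / (4 * (e / 2))) * exp ((2 * R + 1)\<^sup>2 / 2))) * exp (1\<^sup>2 * (norm (jj Y))\<^sup>2 / 2))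
        (2 * max h (1 / 1)) (c + 0) (\<lambda>Z. (?\<nu> (Z - X) - ?\<nu> (Z - X0)) * cis (jj Y \<bullet> Z))"
      using C by (intro gsd_mult' gsd_cis) auto
    then have "cmod (u (\<lambda>Z. (?\<nu> (Z - X) - ?\<nu> (Z - X0)) * cis (jj Y \<bullet> Z))) \<le>
        D * (C * (B * (2 * norm (X - X0) * exp (1 / (4 * (e / 2))) * exp ((2 * R + 1)\<^sup>2 / 2))) * exp ((norm (jj Y))\<^sup>2 / 2))"
      using D(2) by simp
    also have "\<dots> \<le> D * (C * (B * (2 * norm (X - X0) * exp (1 / (4 * (e / 2))) * exp ((2 * R + 1)\<^sup>2 / 2))) * exp (2 * R\<^sup>2))"
    proof -
      have "(norm Y)\<^sup>2 \<le> R\<^sup>2" using R by (intro power_mono) auto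
      then have "exp ((norm (jj Y))\<^sup>2 / 2) \<le> exp (2 * R\<^sup>2)" by (simp add: norm_jj power_mult_distrib)
      then show ?thesis using C D gsd_nonneg[OF p(3)] by (intro mult_left_mono) auto
    qed
    also have "\<dots> = K R * norm (X - X0)" by (simp add: K_def)
    finally show ?thesis
      unfolding stft_def left_diff_distrib
      by (subst dual_diff[OF u, symmetric]) (auto intro!: GS_half_cis window_GS \<Phi>)
  qed
  have "((\<lambda>p. stft \<Phi> u (fst p) (snd p)) \<longlongrightarrow> stft \<Phi> u (fst q) (snd q)) (at q)" for q
  proof (rule LIM_zero_cancel, rule Lim_null_comparison)
    define R where "R = norm (fst q) + norm (snd q) + 1"
    have "\<forall>\<^sub>F p in at q. dist p q < 1" unfolding eventually_at by (intro exI[of _ 1]) auto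
    then show "\<forall>\<^sub>F p in at q. norm (stft \<Phi> u (fst p) (snd p) - stft \<Phi> u (fst q) (snd q)) \<le>
        K R * norm (fst p - fst q) + norm (stft \<Phi> u (fst q) (snd p) - stft \<Phi> u (fst q) (snd q))"
    proof eventually_elim
      case (elim p)
      have "norm (fst p - fst q) < 1" "norm (snd p - snd q) < 1"
        using elim dist_fst_le[of p q] dist_snd_le[of p q] by (auto simp: dist_norm)
      then have "norm (fst p) \<le> R" "norm (fst q) \<le> R" "norm (snd p) \<le> R"
        using norm_triangle_sub[of "fst p" "fst q"] norm_triangle_sub[of "snd p" "snd q"]
          norm_ge_zero[of "fst q"] norm_ge_zero[of "snd q"]
        unfolding R_def by linarith+
      from step[OF this] have "norm (stft \<Phi> u (fst p) (snd p) - stft \<Phi> u (fst q) (snd p)) \<le> K R * norm (fst p - fst q)" .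
      then show ?case
        using norm_triangle_ineq[of "stft \<Phi> u (fst p) (snd p) - stft \<Phi> u (fst q) (snd p)" "stft \<Phi> u (fst q) (snd p) - stft \<Phi> u (fst q) (snd q)"]
        by simp
    qed
    have c: "isCont (\<lambda>Y. stft \<Phi> u (fst q) Y) (snd q)"
      using dual_cis_continuous[OF u window_GS[OF \<Phi>, of "fst q"]]
        continuous_on_eq_continuous_at[OF open_UNIV, of "\<lambda>Y. stft \<Phi> u (fst q) Y"]
      unfolding stft_def by blast
    have "((\<lambda>p. stft \<Phi> u (fst q) (snd p)) \<longlongrightarrow> stft \<Phi> u (fst q) (snd q)) (at q)"
      by (rule isCont_tendsto_compose[OF c]) (intro tendsto_intros)
    then have "((\<lambda>p. K R * norm (fst p - fst q) + norm (stft \<Phi> u (fst q) (snd p) - stft \<Phi> u (fst q) (snd q)))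
      \<longlongrightarrow> K R * norm (fst q - fst q) + norm (stft \<Phi> u (fst q) (snd q) - stft \<Phi> u (fst q) (snd q))) (at q)"
      by (intro tendsto_intros)
    then show "((\<lambda>p. K R * norm (fst p - fst q) + norm (stft \<Phi> u (fst q) (snd p) - stft \<Phi> u (fst q) (snd q))) \<longlongrightarrow> 0) (at q)"
      by simp
  qed
  then show ?thesis by (simp add: continuous_on_def split_def)
qed

lemma symp_stft_continuous:
  fixes \<Phi> :: "'a::euclidean_space \<times> 'a \<Rightarrow> complex"
  assumes \<Phi>: "\<Phi> \<in> GS_half" and u: "u \<in> GS_half_dual"
  shows "continuous_on UNIV (\<lambda>(X, Y). symp_stft \<Phi> u X Y)"
  unfolding symp_stft_eq[OF assms] split_def
  using stft_continuous[OF assms] by (intro continuous_intros) (simp add: split_def)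

text \<open>The value of \<open>\<phi>\<close> at 0 is recorded because it is a multiple of the
  integral of \<open>\<psi>\<close>, hence nonzero for the squared modulus of a nonzero
  window.\<close>

lemma fourier_representation:
  fixes \<psi> :: "'a::euclidean_space \<times> 'a \<Rightarrow> complex"
  assumes \<psi>: "\<psi> \<in> GS_half"
  obtains \<phi> where "\<phi> \<in> GS_half" "\<psi> = (\<lambda>Z. LINT Y|lborel. \<phi> Y * cis (jj Y \<bullet> Z))"
    "\<phi> 0 = complex_of_real (1 / pi ^ DIM('a)) * (complex_of_real (1 / pi ^ DIM('a)) * (LINT Z|lborel. \<psi> (- Z)))"
proof -
  define r where "r Z = \<psi> (- Z)" for Z
  have r: "r \<in> GS_half" unfolding r_def using \<psi> by (rule GS_half_reflect)
  define \<phi> where "\<phi> Y = complex_of_real (1 / pi ^ DIM('a)) * symp_fourier r Y" for Y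
  have F: "symp_fourier r \<in> GS_half" using r by (rule GS_half_symp_fourier)
  have \<phi>: "\<phi> \<in> GS_half" unfolding \<phi>_def using F by (rule GS_half_cmult)
  have "\<psi> Z = (LINT Y|lborel. \<phi> Y * cis (jj Y \<bullet> Z))" for Z
  proof -
    have "\<psi> Z = symp_fourier (symp_fourier r) (- Z)"
      by (simp add: symp_fourier_symp_fourier[OF r] r_def)
    also have "\<dots> = (LINT Y|lborel. complex_of_real (1 / pi ^ DIM('a)) * (symp_fourier r Y * cis (jj (- Z) \<bullet> Y)))"
      unfolding symp_fourier_eq[OF GS_half_measurable[OF F]] by simp
    also have "\<dots> = (LINT Y|lborel. \<phi> Y * cis (jj Y \<bullet> Z))"
    proof -
      have "jj (- Z) \<bullet> Y = jj Y \<bullet> Z" for Y using jj_antisym[of Z Y] by (simp add: jj_minus)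
      then show ?thesis by (simp only: \<phi>_def mult.assoc)
    qed
    finally show ?thesis .
  qed
  moreover have "\<phi> 0 = complex_of_real (1 / pi ^ DIM('a)) * (complex_of_real (1 / pi ^ DIM('a)) * (LINT Z|lborel. \<psi> (- Z)))"
    unfolding \<phi>_def symp_fourier_eq[OF GS_half_measurable[OF r]] by (simp add: r_def)
  ultimately show ?thesis using \<phi> that by blast
qed

lemma window_mass_pos:
  fixes \<Phi> :: "'n::euclidean_space \<Rightarrow> complex"
  assumes "\<Phi> \<in> GS_half" "\<Phi> \<noteq> (\<lambda>_. 0)"
  shows "(LINT Z|lborel. (cmod (\<Phi> (- Z)))\<^sup>2) > 0" "integrable lborel (\<lambda>Z. (cmod (\<Phi> (- Z)))\<^sup>2)"
proof -
  obtain z where z: "\<Phi> z \<noteq> 0" using assms(2) by blast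
  have r: "(\<lambda>Z. \<Phi> (- Z)) \<in> GS_half" using assms(1) by (rule GS_half_reflect)
  have "(\<lambda>Z. \<Phi> (- Z) * cnj (\<Phi> (- Z))) \<in> GS_half"
    by (intro GS_half_mult GS_half_cnj r)
  then have "integrable lborel (\<lambda>Z. \<Phi> (- Z) * cnj (\<Phi> (- Z)))" by (rule GS_half_integrable)
  from integrable_Re[OF this[folded complex_norm_square]] show i: "integrable lborel (\<lambda>Z. (cmod (\<Phi> (- Z)))\<^sup>2)"
    by simp
  show "(LINT Z|lborel. (cmod (\<Phi> (- Z)))\<^sup>2) > 0"
    using z GS_half_continuous[OF r]
    by (intro integral_continuous_nonneg_pos[OF _ i, of "- z"]) (auto intro!: continuous_intros)
qed

text \<open>Vanishing on the modulated windows extends by superposition to the window times any test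
  function, so \<open>u\<close> annihilates \<open>f\<close> times every translate of the squared
  modulus of the window. As a function of the translation this is a Fourier integral of a continuous
  integrable function; that function therefore vanishes, and its value at 0 is a nonzero multiple of
  \<open>u f\<close>.\<close>

lemma stft_inj:
  fixes \<Phi> :: "'a::euclidean_space \<times> 'a \<Rightarrow> complex"
  assumes \<Phi>: "\<Phi> \<in> GS_half" "\<Phi> \<noteq> (\<lambda>_. 0)" and u: "u \<in> GS_half_dual"
    and zero: "\<And>X Y. symp_stft \<Phi> u X Y = 0"
  shows "u f = 0"
proof (cases "f \<in> GS_half")
  case f: True
  have 0: "u (\<lambda>Z. cnj (\<Phi> (Z - X)) * cis (jj Y \<bullet> Z)) = 0" for X Y
    using zero[of X Y] unfolding symp_stft_eq[OF \<Phi>(1) u] stft_def by simp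
  have 1: "u (\<lambda>Z. cnj (\<Phi> (Z - X)) * \<psi> Z) = 0" if \<psi>: "\<psi> \<in> GS_half" for \<psi> X
  proof -
    obtain \<phi> where \<phi>: "\<phi> \<in> GS_half" "\<psi> = (\<lambda>Z. LINT Y|lborel. \<phi> Y * cis (jj Y \<bullet> Z))"
      by (rule fourier_representation[OF \<psi>]) blast
    show ?thesis unfolding \<phi>(2) dual_exchange(2)[OF u window_GS[OF \<Phi>(1)] \<phi>(1)] 0 by simp
  qed
  define K where "K Z = \<Phi> Z * cnj (\<Phi> Z)" for Z
  have K: "K \<in> GS_half" unfolding K_def by (intro GS_half_mult GS_half_cnj \<Phi>(1))
  obtain \<phi> where \<phi>: "\<phi> \<in> GS_half" "K = (\<lambda>Z. LINT Y|lborel. \<phi> Y * cis (jj Y \<bullet> Z))"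
    "\<phi> 0 = complex_of_real (1 / pi ^ DIM('a)) * (complex_of_real (1 / pi ^ DIM('a)) * (LINT Z|lborel. K (- Z)))"
    using K by (rule fourier_representation)
  let ?g = "\<lambda>Y. \<phi> Y * u (\<lambda>Z. f Z * cis (jj Y \<bullet> Z))"
  have 2: "(LINT Y|lborel. ?g Y * cis (jj X \<bullet> Y)) = 0" for X
  proof -
    have "K (Z - X) = (LINT Y|lborel. (\<phi> Y * cis (jj X \<bullet> Y)) * cis (jj Y \<bullet> Z))" for Z
    proof -
      have "cis (jj Y \<bullet> (Z - X)) = cis (jj X \<bullet> Y) * cis (jj Y \<bullet> Z)" for Y
        using jj_antisym[of X Y] by (simp add: cis_mult inner_diff_right)
      then show ?thesis unfolding \<phi>(2) by (simp only: mult.assoc)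
    qed
    then have "(LINT Y|lborel. (\<phi> Y * cis (jj X \<bullet> Y)) * u (\<lambda>Z. f Z * cis (jj Y \<bullet> Z))) = u (\<lambda>Z. f Z * K (Z - X))"
      using dual_exchange(2)[OF u f GS_half_cis[OF \<phi>(1), of "jj X"]] by simp
    also have "\<dots> = u (\<lambda>Z. cnj (\<Phi> (Z - X)) * (\<Phi> (Z - X) * f Z))"
      by (simp add: K_def mult_ac)
    also have "\<dots> = 0"
      by (intro 1 GS_half_mult GS_half_translate \<Phi>(1) f)
    finally show ?thesis by (simp only: mult_ac)
  qed
  have "?g 0 = 0"
  proof (rule fourier_inj[where g = ?g and z = 0])
    show "continuous_on UNIV ?g"
      by (intro continuous_intros GS_half_continuous \<phi>(1) dual_cis_continuous[OF u f])
    show "integrable lborel ?g" by (rule dual_exchange(1)[OF u f \<phi>(1)])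
    fix v :: "'a \<times> 'a"
    \<comment> \<open>Every frequency \<open>v\<close> is a value of \<open>jj\<close>, so the
      symplectic integrals cover all ordinary Fourier integrals.\<close>
    have "jj (- ((1/2) *\<^sub>R snd v), (1/2) *\<^sub>R fst v) = v" by (simp add: jj_def)
    from 2[of "(- ((1/2) *\<^sub>R snd v), (1/2) *\<^sub>R fst v)"] show "(LINT Y|lborel. ?g Y * cis (v \<bullet> Y)) = 0"
      by (simp only: \<open>jj _ = v\<close>)
  qed
  moreover have "\<phi> 0 \<noteq> 0"
  proof -
    have "(LINT Z|lborel. K (- Z)) = complex_of_real (LINT Z|lborel. (cmod (\<Phi> (- Z)))\<^sup>2)"
      unfolding K_def complex_norm_square[symmetric] integral_complex_of_real by simp
    then show ?thesis using window_mass_pos(1)[OF \<Phi>] unfolding \<phi>(3) by simp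
  qed
  ultimately show "u f = 0" by simp
qed (use dual_outside[OF u] in blast)

section \<open>Parseval's identity and the orthogonality relation\<close>

lemma cnj_measurable [measurable]: "cnj \<in> borel_measurable borel"
  by (intro borel_measurable_continuous_onI continuous_intros)

lemma parseval:
  fixes f g :: "'a::euclidean_space \<times> 'a \<Rightarrow> complex"
  assumes f: "f \<in> GS_half" and g: "g \<in> GS_half"
  shows "(LINT Y|lborel. symp_fourier f Y * cnj (symp_fourier g Y)) = (LINT Z|lborel. f Z * cnj (g Z))"
proof -
  let ?p = "complex_of_real (1 / pi ^ DIM('a))"
  have G: "symp_fourier g \<in> GS_half" using g by (rule GS_half_symp_fourier)
  have [measurable]: "f \<in> borel_measurable borel" "symp_fourier g \<in> borel_measurable borel"
    using f G by (auto intro: GS_half_measurable)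
  have "(LINT Y|lborel. symp_fourier f Y * cnj (symp_fourier g Y)) =
      ?p * (LINT Y|lborel. LINT Z|lborel. f Z * cis (jj Y \<bullet> Z) * cnj (symp_fourier g Y))"
  proof -
    have "symp_fourier f Y * cnj (symp_fourier g Y) = ?p * (LINT Z|lborel. f Z * cis (jj Y \<bullet> Z) * cnj (symp_fourier g Y))" for Y
      unfolding symp_fourier_eq[OF GS_half_measurable[OF f], of Y] integral_mult_left_zero by (simp only: mult.assoc)
    then show ?thesis by (simp only: integral_mult_right_zero)
  qed
  also have "(LINT Y|lborel. LINT Z|lborel. f Z * cis (jj Y \<bullet> Z) * cnj (symp_fourier g Y)) =
      (LINT Z|lborel. LINT Y|lborel. f Z * cis (jj Y \<bullet> Z) * cnj (symp_fourier g Y))"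
  proof (rule lborel_fubini(2)[where p = "\<lambda>Y. cmod (symp_fourier g Y)" and q = "\<lambda>Z. cmod (f Z)"])
    show "(\<lambda>(Y, Z). f Z * cis (jj Y \<bullet> Z) * cnj (symp_fourier g Y)) \<in> borel_measurable (borel \<Otimes>\<^sub>M borel)"
      by measurable
  qed (auto simp: norm_mult intro!: integrable_norm GS_half_integrable f G)
  also have "?p * \<dots> = (LINT Z|lborel. f Z * cnj (g Z))"
  proof -
    have "?p * (LINT Y|lborel. f Z * cis (jj Y \<bullet> Z) * cnj (symp_fourier g Y)) = f Z * cnj (g Z)" for Z
    proof -
      have "cnj (g Z) = cnj (symp_fourier (symp_fourier g) Z)" by (simp add: symp_fourier_symp_fourier[OF g])
      also have "\<dots> = ?p * (LINT Y|lborel. cnj (symp_fourier g Y * cis (jj Z \<bullet> Y)))"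
      proof -
        have "integrable lborel (\<lambda>Y. symp_fourier g Y * cis (jj Z \<bullet> Y))"
          by (intro GS_half_integrable GS_half_cis G)
        from integral_bounded_linear[OF bounded_linear_cnj this]
        show ?thesis unfolding symp_fourier_eq[OF GS_half_measurable[OF G], of Z] by simp
      qed
      also have "\<dots> = ?p * (LINT Y|lborel. cis (jj Y \<bullet> Z) * cnj (symp_fourier g Y))"
      proof -
        have "cnj (cis (jj Z \<bullet> Y)) = cis (jj Y \<bullet> Z)" for Y
          using jj_antisym[of Y Z] by (simp add: cis_cnj)
        then show ?thesis by (simp only: complex_cnj_mult mult.commute)
      qed
      finally show ?thesis by (simp add: mult.assoc)
    qed
    then show ?thesis by (simp flip: integral_mult_right_zero)
  qed
  finally show ?thesis .
qed

text \<open>Parseval in \<open>Y\<close> for each fixed \<open>X\<close>, followed by integration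
  over \<open>X\<close>, where the translated squared window has constant mass. The reflection in
  that mass comes from substituting for \<open>Z - X\<close>. An inequality between extended
  integrals is the form in which Hoelder applies afterwards.\<close>

lemma stft_pairing:
  fixes \<Phi> f b :: "'a::euclidean_space \<times> 'a \<Rightarrow> complex"
  assumes \<Phi>: "\<Phi> \<in> GS_half" "\<Phi> \<noteq> (\<lambda>_. 0)" and f: "f \<in> GS_half" and b: "b \<in> GS_half"
  shows "ennreal ((LINT Z|lborel. (cmod (\<Phi> (- Z)))\<^sup>2) * cmod (LINT Z|lborel. f Z * cnj (b Z))) \<le>
    (\<integral>\<^sup>+X. (\<integral>\<^sup>+Y. ennreal (cmod (symp_stft \<Phi> (distr_of f) X Y) * cmod (symp_stft \<Phi> (distr_of b) X Y)) \<partial>lborel) \<partial>lborel)"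
proof -
  let ?V = "\<lambda>f. symp_stft \<Phi> (distr_of f)"
  have fm[measurable]: "f \<in> borel_measurable borel" "b \<in> borel_measurable borel" "\<Phi> \<in> borel_measurable borel"
    using f b \<Phi>(1) by (auto intro: GS_half_measurable)
  have fG: "(\<lambda>Z. f Z * cnj (\<Phi> (Z - X))) \<in> GS_half" "(\<lambda>Z. b Z * cnj (\<Phi> (Z - X))) \<in> GS_half" for X
    using f b \<Phi>(1) by (auto intro!: GS_half_mult window_GS)
  define I where "I X = (LINT Y|lborel. ?V f X Y * cnj (?V b X Y))" for X
  have I: "I X = (LINT Z|lborel. (f Z * cnj (b Z)) * complex_of_real ((cmod (\<Phi> (Z - X)))\<^sup>2))" for X
  proof -
    have eq: "f Z * cnj (\<Phi> (Z - X)) * cnj (b Z * cnj (\<Phi> (Z - X))) = (f Z * cnj (b Z)) * complex_of_real ((cmod (\<Phi> (Z - X)))\<^sup>2)" for Z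
      unfolding complex_norm_square by (simp add: mult_ac)
    show ?thesis
      unfolding I_def symp_stft_distr_of[OF \<Phi>(1) f] symp_stft_distr_of[OF \<Phi>(1) b] parseval[OF fG] eq ..
  qed
  obtain B k e where p: "k > 0" "e > 0" "gsd B k e (\<lambda>Z. f Z * cnj (b Z))"
    using GS_half_mult[OF f GS_half_cnj[OF b]] by (rule GS_half_gsd)
  obtain A h c0 where g: "h > 0" "c0 > 0" "gsd A h c0 \<Phi>" using \<Phi>(1) by (rule GS_half_gsd)
  \<comment> \<open>The decay of the window is lowered so that the growth
    \<open>2 * c * (norm Z)\<^sup>2\<close>, which arises when the decay is moved to
    \<open>X\<close>, costs at most half of the decay of the product of \<open>f\<close> and
    \<open>b\<close>. This yields a majorant of product form for Fubini.\<close>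
  define c where "c = min c0 (e / 4)"
  have c: "c > 0" "c \<le> e / 4" using g p by (auto simp: c_def)
  have gc: "gsd A h c \<Phi>" using g by (intro gsd_mono[OF g(3)]) (auto simp: c_def)
  have A: "A \<ge> 0" "B \<ge> 0" using gc p(3) by (auto dest: gsd_nonneg)
  have bound: "cmod (f Z * cnj (b Z) * complex_of_real ((cmod (\<Phi> (Z - X)))\<^sup>2)) \<le> exp (- c * (norm X)\<^sup>2) * ((B * A\<^sup>2) * exp (- (e / 2) * (norm Z)\<^sup>2))" for X Z
  proof -
    have "(cmod (\<Phi> (Z - X)))\<^sup>2 \<le> (A * exp (- c * (norm (Z - X))\<^sup>2))\<^sup>2"
      using gsd_bound0[OF gc, of "Z - X"] by (intro power_mono) auto
    also have "\<dots> = A\<^sup>2 * exp (2 * (- c * (norm (Z - X))\<^sup>2))"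
      by (simp only: power_mult_distrib exp_double)
    also have "\<dots> \<le> A\<^sup>2 * exp (- c * (norm X)\<^sup>2 + (e / 2) * (norm Z)\<^sup>2)"
    proof -
      have "c * (norm X)\<^sup>2 - 2 * c * (norm Z)\<^sup>2 \<le> 2 * c * (norm (Z - X))\<^sup>2"
        using mult_left_mono[OF norm_diff_sq_ge[of X Z], of "2 * c"] c by (simp add: norm_minus_commute algebra_simps)
      moreover have "2 * c * (norm Z)\<^sup>2 \<le> (e / 2) * (norm Z)\<^sup>2" using c by (intro mult_right_mono) auto
      ultimately show ?thesis by (intro mult_left_mono) auto
    qed
    finally have 1: "(cmod (\<Phi> (Z - X)))\<^sup>2 \<le> A\<^sup>2 * exp (- c * (norm X)\<^sup>2 + (e / 2) * (norm Z)\<^sup>2)" .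
    have "cmod (f Z * cnj (b Z) * complex_of_real ((cmod (\<Phi> (Z - X)))\<^sup>2)) \<le>
        (B * exp (- e * (norm Z)\<^sup>2)) * (A\<^sup>2 * exp (- c * (norm X)\<^sup>2 + (e / 2) * (norm Z)\<^sup>2))"
      unfolding norm_mult[of "f Z * cnj (b Z)"] unfolding norm_of_real
      using 1 gsd_bound0[OF p(3), of Z] A by (intro mult_mono) auto
    also have "\<dots> = (B * A\<^sup>2) * (exp (- e * (norm Z)\<^sup>2) * exp (- c * (norm X)\<^sup>2 + (e / 2) * (norm Z)\<^sup>2))"
      by (simp only: mult_ac)
    also have "exp (- e * (norm Z)\<^sup>2) * exp (- c * (norm X)\<^sup>2 + (e / 2) * (norm Z)\<^sup>2) = exp (- c * (norm X)\<^sup>2) * exp (- (e / 2) * (norm Z)\<^sup>2)"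
      by (simp flip: exp_add)
    finally show ?thesis by (simp only: mult_ac)
  qed
  define \<kappa> where "\<kappa> = (LINT Z|lborel. (cmod (\<Phi> (- Z)))\<^sup>2)"
  have \<kappa>: "\<kappa> > 0" unfolding \<kappa>_def by (rule window_mass_pos(1)[OF \<Phi>])
  have "(LINT X|lborel. I X) = (LINT Z|lborel. LINT X|lborel. f Z * cnj (b Z) * complex_of_real ((cmod (\<Phi> (Z - X)))\<^sup>2))"
    unfolding I
  proof (rule lborel_fubini(2)[OF _ gauss_integral(1)[OF c(1)] integrable_mult_right[OF gauss_integral(1)[of "e / 2"]] bound])
    show "(\<lambda>(X, Z). f Z * cnj (b Z) * complex_of_real ((cmod (\<Phi> (Z - X)))\<^sup>2)) \<in> borel_measurable (borel \<Otimes>\<^sub>M borel)"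
      by measurable
  qed (use p in simp)
  also have "\<dots> = (LINT Z|lborel. f Z * cnj (b Z) * complex_of_real \<kappa>)"
  proof -
    have "(LINT X|lborel. complex_of_real ((cmod (\<Phi> (Z - X)))\<^sup>2)) = complex_of_real \<kappa>" for Z
    proof -
      have "(LINT X|lborel. complex_of_real ((cmod (\<Phi> (- (X + - Z))))\<^sup>2)) = (LINT X|lborel. complex_of_real ((cmod (\<Phi> (- X)))\<^sup>2))"
        by (rule integral_translate(1)[of "\<lambda>X. complex_of_real ((cmod (\<Phi> (- X)))\<^sup>2)"]) measurable
      then show ?thesis unfolding \<kappa>_def integral_complex_of_real[symmetric] by simp
    qed
    then show ?thesis by simp
  qed
  finally have "(LINT X|lborel. I X) = complex_of_real \<kappa> * (LINT Z|lborel. f Z * cnj (b Z))" by simp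
  then have "\<kappa> * cmod (LINT Z|lborel. f Z * cnj (b Z)) = cmod (LINT X|lborel. I X)"
    using \<kappa> by (simp add: norm_mult)
  also have "ennreal \<dots> \<le> (\<integral>\<^sup>+X. norm (I X) \<partial>lborel)"
    by (cases "integrable lborel I") (simp_all add: integral_norm_bound_ennreal not_integrable_integral_eq)
  also have "\<dots> \<le> (\<integral>\<^sup>+X. (\<integral>\<^sup>+Y. ennreal (cmod (?V f X Y) * cmod (?V b X Y)) \<partial>lborel) \<partial>lborel)"
  proof (rule nn_integral_mono)
    fix X
    have i: "integrable lborel (\<lambda>Y. ?V f X Y * cnj (?V b X Y))"
      unfolding symp_stft_distr_of[OF \<Phi>(1) f] symp_stft_distr_of[OF \<Phi>(1) b]
      by (intro GS_half_integrable GS_half_mult GS_half_cnj GS_half_symp_fourier fG)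
    show "ennreal (norm (I X)) \<le> (\<integral>\<^sup>+Y. ennreal (cmod (?V f X Y) * cmod (?V b X Y)) \<partial>lborel)"
      unfolding I_def using integral_norm_bound_ennreal[OF i] by (simp add: norm_mult)
  qed
  finally show ?thesis by (simp add: \<kappa>_def)
qed

text \<open>The translated window is allowed to grow in \<open>Z\<close> in exchange for decay in
  \<open>X\<close>; the decay of \<open>f\<close> beats that growth, and the Fourier transform
  supplies the decay in \<open>Y\<close>.\<close>

lemma stft_decay:
  fixes \<Phi> f :: "'a::euclidean_space \<times> 'a \<Rightarrow> complex"
  assumes \<Phi>: "\<Phi> \<in> GS_half" and f: "f \<in> GS_half"
  obtains C c where "C \<ge> 0" "c > 0" "\<And>X Y. cmod (symp_stft \<Phi> (distr_of f) X Y) \<le> C * exp (- c * ((norm X)\<^sup>2 + (norm Y)\<^sup>2))"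
proof -
  obtain B k e where p: "k > 0" "e > 0" "gsd B k e f" using f by (rule GS_half_gsd)
  obtain A h c0 where g: "h > 0" "c0 > 0" "gsd A h c0 (\<lambda>Z. cnj (\<Phi> Z))"
    using GS_half_cnj[OF \<Phi>] by (rule GS_half_gsd)
  define c where "c = min c0 (e / 2)"
  have c: "c > 0" "c \<le> e / 2" using g p by (auto simp: c_def)
  have gc: "gsd A h c (\<lambda>Z. cnj (\<Phi> Z))" using g by (intro gsd_mono[OF g(3)]) (auto simp: c_def)
  have A: "A \<ge> 0" "B \<ge> 0" using gc p(3) by (auto dest: gsd_nonneg)
  obtain C h' c' where C: "C \<ge> 0" "h' > 0" "c' > 0"
    "\<And>A (f :: 'a \<times> 'a \<Rightarrow> complex). gsd A (2 * max k h) (e - c) f \<Longrightarrow> gsd (C * A) h' c' (symp_fourier f)"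
    by (rule gsd_symp_fourier[of "2 * max k h" "e - c"]) (use p c in auto)
  define r where "r = min (c / 2) c'"
  have r: "r > 0" "r \<le> c / 2" "r \<le> c'" using c C by (auto simp: r_def)
  have er: "exp (- t * (norm X)\<^sup>2) \<le> exp (- r * (norm X)\<^sup>2)" if "r \<le> t" for t and X :: "'a \<times> 'a"
    unfolding exp_le_cancel_iff using that by (intro mult_right_mono) auto
  have "cmod (symp_stft \<Phi> (distr_of f) X Y) \<le> (C * (B * A)) * exp (- r * ((norm X)\<^sup>2 + (norm Y)\<^sup>2))" for X Y
  proof -
    have "gsd (A * exp (- (c / 2) * (norm X)\<^sup>2)) h (- c) (\<lambda>Z. cnj (\<Phi> (Z - X)))"
      using gsd_translate_growth[OF gc, of X] g c by simp
    from gsd_mult'[OF p(3) this] have "gsd (B * (A * exp (- (c / 2) * (norm X)\<^sup>2))) (2 * max k h) (e - c) (\<lambda>Z. f Z * cnj (\<Phi> (Z - X)))"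
      using p g by simp
    from gsd_bound0[OF C(4)[OF this], of Y]
    have "cmod (symp_stft \<Phi> (distr_of f) X Y) \<le> C * (B * (A * exp (- (c / 2) * (norm X)\<^sup>2))) * exp (- c' * (norm Y)\<^sup>2)"
      unfolding symp_stft_distr_of[OF \<Phi> f] .
    also have "\<dots> = (C * (B * A)) * (exp (- (c / 2) * (norm X)\<^sup>2) * exp (- c' * (norm Y)\<^sup>2))"
      by (simp only: mult_ac)
    also have "\<dots> \<le> (C * (B * A)) * (exp (- r * (norm X)\<^sup>2) * exp (- r * (norm Y)\<^sup>2))"
      using A C r by (intro mult_left_mono mult_mono er) auto
    also have "exp (- r * (norm X)\<^sup>2) * exp (- r * (norm Y)\<^sup>2) = exp (- r * ((norm X)\<^sup>2 + (norm Y)\<^sup>2))"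
      by (simp add: distrib_left flip: exp_add)
    finally show ?thesis .
  qed
  then show ?thesis using that[of "C * (B * A)" r] r C A by simp
qed

subsection \<open>Mixed Lebesgue norms\<close>

lemma ennreal_powr_ennreal: "c \<ge> 0 \<Longrightarrow> ennreal_powr (ennreal c) r = ennreal (c powr r)"
  by (simp add: ennreal_powr_def)

lemma ennreal_powr_top [simp]: "ennreal_powr top r = top"
  by (simp add: ennreal_powr_def)

lemma ennreal_powr_0 [simp]: "ennreal_powr 0 r = 0"
  by (simp add: ennreal_powr_def)

lemma ennreal_powr_mono: "x \<le> y \<Longrightarrow> 0 \<le> r \<Longrightarrow> ennreal_powr x r \<le> ennreal_powr y r"
  by (cases x; cases y) (auto simp: ennreal_powr_ennreal top_unique intro!: ennreal_leI powr_mono2)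

lemma ennreal_powr_eq_0_iff: "ennreal_powr x r = 0 \<longleftrightarrow> x = 0"
  by (cases x) (auto simp: ennreal_powr_ennreal)

lemma ennreal_powr_inverse: "r > 0 \<Longrightarrow> ennreal_powr (ennreal_powr x r) (1 / r) = x"
  by (cases x) (auto simp: ennreal_powr_ennreal powr_powr)

lemma ennreal_powr_inverse': "r > 0 \<Longrightarrow> ennreal_powr (ennreal_powr x (1 / r)) r = x"
  by (cases x) (auto simp: ennreal_powr_ennreal powr_powr)

lemma ennreal_powr_1: "ennreal_powr x 1 = x"
  using ennreal_powr_inverse[of 1 "ennreal_powr x 1"] by (cases x) (auto simp: ennreal_powr_ennreal)

lemma ennreal_powr_measurable [measurable]: "(\<lambda>x. ennreal_powr x r) \<in> borel_measurable borel"
  unfolding ennreal_powr_def by measurable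

lemma AE_lebesgue_open:
  fixes B :: "'n::euclidean_space set"
  assumes "AE x in lebesgue. P x" "open B" "B \<noteq> {}"
  shows "\<exists>x\<in>B. P x"
proof (rule ccontr)
  assume *: "\<not> (\<exists>x\<in>B. P x)"
  obtain N where N: "{x \<in> space lebesgue. \<not> P x} \<subseteq> N" "N \<in> null_sets lebesgue"
    using assms(1) unfolding eventually_ae_filter by blast
  then have "B \<subseteq> N" using * by auto
  moreover have "negligible N" using N(2) by (simp add: negligible_iff_null_sets)
  ultimately have "negligible B" by (rule negligible_subset[rotated])
  then show False using open_not_negligible assms(2,3) by blast
qed

lemma esssup_le_iff:
  "f \<in> borel_measurable M \<Longrightarrow> esssup M f \<le> t \<longleftrightarrow> (AE x in M. f x \<le> t)"
proof
  assume "f \<in> borel_measurable M" "esssup M f \<le> t"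
  with esssup_AE[of f M] show "AE x in M. f x \<le> t" by (auto elim: eventually_mono)
qed auto

lemma Lp_norm_cong_AE:
  assumes "f \<in> borel_measurable lebesgue" "g \<in> borel_measurable lebesgue" "AE x in lebesgue. f x = g x"
  shows "Lp_norm p f = Lp_norm p g"
proof -
  have "(\<integral>\<^sup>+x. ennreal_powr (f x) r \<partial>lebesgue) = (\<integral>\<^sup>+x. ennreal_powr (g x) r \<partial>lebesgue)" for r
    using assms(3) by (intro nn_integral_cong_AE) (auto elim: eventually_mono)
  then show ?thesis unfolding Lp_norm_def using esssup_AE_cong[OF assms] by simp
qed

lemma Lp_norm_mono:
  assumes "1 \<le> p" "f \<in> borel_measurable lebesgue" "\<And>x. f x \<le> g x"
  shows "Lp_norm p f \<le> Lp_norm p g"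
  unfolding Lp_norm_def using assms esssup_mono[OF assms(2,3)]
  by (auto intro!: ennreal_powr_mono nn_integral_mono)

lemma exponent_cases:
  fixes p :: ennreal
  assumes "1 \<le> p"
  obtains "p = \<infinity>" | r where "r \<ge> 1" "p = ennreal r"
  using assms by (cases p) (auto simp: infinity_ennreal_def ennreal_ge_1)

lemma Lp_norm_zero: "1 \<le> p \<Longrightarrow> Lp_norm p (\<lambda>x::'n::euclidean_space. 0) = 0"
  by (erule exponent_cases) (auto simp: Lp_norm_def esssup_const le_zero_eq[symmetric] simp del: le_zero_eq intro!: esssup_I)

lemma Lp_norm_real:
  assumes "r \<ge> 1"
  shows "Lp_norm (ennreal r) f = ennreal_powr (\<integral>\<^sup>+x. ennreal_powr (f x) r \<partial>lebesgue) (1 / r)"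
  using assms by (simp add: Lp_norm_def)

lemma Lp_norm_1: "Lp_norm 1 f = (\<integral>\<^sup>+x. f x \<partial>lebesgue)"
  using Lp_norm_real[of 1 f] by (simp add: ennreal_powr_1)

lemma Lp_norm_power:
  assumes "r \<ge> 1"
  shows "(\<integral>\<^sup>+x. ennreal_powr (f x) r \<partial>lebesgue) = ennreal_powr (Lp_norm (ennreal r) f) r"
  using assms by (simp add: Lp_norm_real ennreal_powr_inverse')

lemma Lp_norm_0_AE:
  assumes p: "1 \<le> p" and m: "f \<in> borel_measurable lebesgue" and 0: "Lp_norm p f = 0"
  shows "AE x in lebesgue. f x = 0"
  using p
proof (cases rule: exponent_cases)
  case 1
  then show ?thesis using esssup_AE[of f lebesgue] 0 by (simp add: Lp_norm_def)
next
  case (2 r)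
  then have "(\<integral>\<^sup>+x. ennreal_powr (f x) r \<partial>lebesgue) = 0"
    using 0 Lp_norm_power[OF 2(1), of f] by simp
  moreover have "(\<lambda>x. ennreal_powr (f x) r) \<in> borel_measurable lebesgue" using m by measurable
  ultimately show ?thesis
    by (subst (asm) nn_integral_0_iff_AE) (auto simp: ennreal_powr_eq_0_iff)
qed

lemma Lp_norm_finite_AE:
  assumes r: "1 \<le> r" and m: "f \<in> borel_measurable lebesgue" and fin: "Lp_norm (ennreal r) f < \<infinity>"
  shows "AE x in lebesgue. f x < \<infinity>"
proof -
  have "(\<integral>\<^sup>+x. ennreal_powr (f x) r \<partial>lebesgue) \<noteq> \<infinity>"
    unfolding Lp_norm_power[OF r] using fin by (auto simp: ennreal_powr_def)
  moreover have "(\<lambda>x. ennreal_powr (f x) r) \<in> borel_measurable lebesgue" using m by measurable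
  ultimately have "AE x in lebesgue. ennreal_powr (f x) r \<noteq> \<infinity>"
    by (intro nn_integral_PInf_AE) auto
  then show ?thesis
  proof eventually_elim
    case (elim x)
    then show ?case by (cases "f x") auto
  qed
qed

text \<open>When one argument is 0 the claim reduces to \<open>m powr r \<le> m\<close> for weights
  in the unit interval; otherwise it is convexity on the positive axis.\<close>

lemma powr_convex_nonneg:
  fixes s t \<mu> r :: real
  assumes "r \<ge> 1" "s \<ge> 0" "t \<ge> 0" "0 \<le> \<mu>" "\<mu> \<le> 1"
  shows "(\<mu> * s + (1 - \<mu>) * t) powr r \<le> \<mu> * s powr r + (1 - \<mu>) * t powr r"
proof -
  have le: "(m * u) powr r \<le> m * u powr r" if "0 \<le> m" "m \<le> 1" "0 \<le> u" for m u :: real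
  proof -
    have "m powr r \<le> m"
    proof (cases "m = 0")
      case False
      then have "m powr r \<le> m powr 1" using that assms(1) by (intro powr_mono') auto
      then show ?thesis using that by simp
    qed simp
    then show ?thesis using that by (simp add: powr_mult mult_right_mono)
  qed
  consider "s = 0" | "t = 0" | "s > 0" "t > 0" using assms by linarith
  then show ?thesis
  proof cases
    case 1
    then show ?thesis using le[of "1 - \<mu>" t] assms by simp
  next
    case 2
    then show ?thesis using le[of \<mu> s] assms by simp
  next
    case 3
    then show ?thesis
      using convex_onD[OF powr_convex[OF assms(1)], of "1 - \<mu>" s t] assms by simp
  qed
qed

text \<open>For finite exponents the functions are normalised by their norms \<open>a\<close> and
  \<open>b\<close>, and convexity is applied pointwise with weights \<open>a / (a + b)\<close> and
  \<open>b / (a + b)\<close>. Norms equal to 0 or infinity are separated beforehand.\<close>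

lemma Lp_norm_minkowski:
  fixes f g :: "'n::euclidean_space \<Rightarrow> ennreal"
  assumes p: "1 \<le> p" and m[measurable]: "f \<in> borel_measurable lebesgue" "g \<in> borel_measurable lebesgue"
  shows "Lp_norm p (\<lambda>x. f x + g x) \<le> Lp_norm p f + Lp_norm p g"
  using p
proof (cases rule: exponent_cases)
  case 1
  have "AE x in lebesgue. f x + g x \<le> esssup lebesgue f + esssup lebesgue g"
    using esssup_AE[of f lebesgue] esssup_AE[of g lebesgue] by eventually_elim (rule add_mono)
  then show ?thesis using 1 by (auto simp: Lp_norm_def)
next
  case (2 r)
  note r = 2(1)
  let ?A = "Lp_norm p f" and ?B = "Lp_norm p g"
  have zero: "Lp_norm p (\<lambda>x. f x + g x) \<le> ?A + ?B" if "?A = 0 \<or> ?B = 0"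
    using that
  proof
    assume "?A = 0"
    then have "AE x in lebesgue. f x + g x = g x"
      using Lp_norm_0_AE[OF p m(1)] by (auto elim: eventually_mono)
    then have "Lp_norm p (\<lambda>x. f x + g x) = ?B" by (intro Lp_norm_cong_AE) measurable
    then show ?thesis by simp
  next
    assume "?B = 0"
    then have "AE x in lebesgue. f x + g x = f x"
      using Lp_norm_0_AE[OF p m(2)] by (auto elim: eventually_mono)
    then have "Lp_norm p (\<lambda>x. f x + g x) = ?A" by (intro Lp_norm_cong_AE) measurable
    then show ?thesis by simp
  qed
  consider "?A = \<infinity> \<or> ?B = \<infinity>" | "?A = 0 \<or> ?B = 0" | "0 < ?A" "0 < ?B" "?A < \<infinity>" "?B < \<infinity>"
    using less_top not_gr_zero by (metis infinity_ennreal_def)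
  then show ?thesis
  proof cases
    case 3
    obtain a where a: "a > 0" "?A = ennreal a" using 3 by (cases ?A) auto
    obtain b where b: "b > 0" "?B = ennreal b" using 3 by (cases ?B) auto
    define \<mu> where "\<mu> = a / (a + b)"
    have \<mu>: "0 \<le> \<mu>" "\<mu> \<le> 1" "1 - \<mu> = b / (a + b)" using a b by (auto simp: \<mu>_def field_simps)
    define ca where "ca = (a + b) powr r * (\<mu> / a powr r)"
    define cb where "cb = (a + b) powr r * ((1 - \<mu>) / b powr r)"
    have c0: "ca \<ge> 0" "cb \<ge> 0" using \<mu>(1,2) by (simp_all add: ca_def cb_def)
    have pt: "AE x in lebesgue. ennreal_powr (f x + g x) r \<le> ennreal ca * ennreal_powr (f x) r + ennreal cb * ennreal_powr (g x) r"
      using Lp_norm_finite_AE[OF r m(1) 3(3)[unfolded 2(2)]] Lp_norm_finite_AE[OF r m(2) 3(4)[unfolded 2(2)]]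
    proof eventually_elim
      case (elim x)
      obtain s where s: "s \<ge> 0" "f x = ennreal s" using elim by (cases "f x") auto
      obtain t where t: "t \<ge> 0" "g x = ennreal t" using elim by (cases "g x") auto
      have "(s + t) / (a + b) = \<mu> * (s / a) + (1 - \<mu>) * (t / b)"
        unfolding \<mu>(3) using a b by (simp add: \<mu>_def add_divide_distrib)
      then have "((s + t) / (a + b)) powr r \<le> \<mu> * (s / a) powr r + (1 - \<mu>) * (t / b) powr r"
        using powr_convex_nonneg[OF r, of "s / a" "t / b" \<mu>] s t a b \<mu> by simp
      then have "(a + b) powr r * ((s + t) / (a + b)) powr r \<le> (a + b) powr r * (\<mu> * (s / a) powr r + (1 - \<mu>) * (t / b) powr r)"
        by (intro mult_left_mono) auto
      also have "(a + b) powr r * ((s + t) / (a + b)) powr r = (s + t) powr r"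
        using s t a b by (simp add: powr_divide)
      also have "(a + b) powr r * (\<mu> * (s / a) powr r + (1 - \<mu>) * (t / b) powr r) = ca * s powr r + cb * t powr r"
        using s t a b by (simp add: ca_def cb_def powr_divide algebra_simps)
      finally have "(s + t) powr r \<le> ca * s powr r + cb * t powr r" .
      then show ?case
        using s t c0 by (simp add: ennreal_powr_ennreal flip: ennreal_plus ennreal_mult)
    qed
    have "(\<integral>\<^sup>+x. ennreal_powr (f x + g x) r \<partial>lebesgue) \<le> (\<integral>\<^sup>+x. ennreal ca * ennreal_powr (f x) r + ennreal cb * ennreal_powr (g x) r \<partial>lebesgue)"
      by (rule nn_integral_mono_AE[OF pt])
    also have "\<dots> = ennreal ca * (\<integral>\<^sup>+x. ennreal_powr (f x) r \<partial>lebesgue) + ennreal cb * (\<integral>\<^sup>+x. ennreal_powr (g x) r \<partial>lebesgue)"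
      by (subst nn_integral_add, measurable) (subst nn_integral_cmult, measurable)+
    also have "\<dots> = ennreal ((a + b) powr r)"
    proof -
      have "ca * a powr r + cb * b powr r = (a + b) powr r"
        using a b by (simp add: ca_def cb_def flip: distrib_left)
      then show ?thesis
        unfolding Lp_norm_power[OF r] using a b c0 2(2)
        by (simp add: ennreal_powr_ennreal flip: ennreal_plus ennreal_mult)
    qed
    finally have "Lp_norm p (\<lambda>x. f x + g x) \<le> ennreal_powr (ennreal ((a + b) powr r)) (1 / r)"
      unfolding 2(2) Lp_norm_real[OF r] using r by (intro ennreal_powr_mono) auto
    also have "\<dots> = ?A + ?B"
      using a b r by (simp add: ennreal_powr_ennreal powr_powr flip: ennreal_plus)
    finally show ?thesis .
  qed (use zero in auto)
qed

lemma conj_exponent_cases: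
  assumes "1 \<le> p"
  obtains "p = 1" "conj_exponent p = \<infinity>" | "p = \<infinity>" "conj_exponent p = 1"
  | r s where "r > 1" "s > 1" "1 / r + 1 / s = 1" "p = ennreal r" "conj_exponent p = ennreal s"
  using assms
proof (cases rule: exponent_cases)
  case 1
  then show ?thesis using that(2) by (simp add: conj_exponent_def)
next
  case (2 r)
  show ?thesis
  proof (cases "r = 1")
    case True
    then show ?thesis using that(1) 2 by (simp add: conj_exponent_def)
  next
    case False
    then have r: "r > 1" using 2 by simp
    define s where "s = 1 / (1 - 1 / r)"
    have s: "s > 1" "1 / r + 1 / s = 1" using r by (auto simp: s_def field_simps)
    have "1 / p = ennreal (1 / r)" using r 2(2) by (simp add: divide_ennreal flip: ennreal_1)
    then have "1 - 1 / p = ennreal (1 - 1 / r)" using r by (simp add: ennreal_minus flip: ennreal_1)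
    then have "conj_exponent p = ennreal s" unfolding conj_exponent_def s_def using r
      by (simp add: divide_ennreal flip: ennreal_1)
    with that(3) r s 2(2) show ?thesis by blast
  qed
qed

lemma conj_exponent_ge_1: "1 \<le> p \<Longrightarrow> 1 \<le> conj_exponent p"
  by (erule conj_exponent_cases) (auto simp: ennreal_ge_1)

text \<open>Young's inequality after normalising both functions. The constants \<open>ca\<close> and
  \<open>cb\<close> undo the normalisation, and their contributions add up to \<open>a * b\<close>
  because the reciprocal exponents sum to 1.\<close>

lemma Lp_norm_hoelder:
  fixes f g :: "'n::euclidean_space \<Rightarrow> ennreal"
  assumes p: "1 \<le> p" and m[measurable]: "f \<in> borel_measurable lebesgue" "g \<in> borel_measurable lebesgue"
  shows "(\<integral>\<^sup>+x. f x * g x \<partial>lebesgue) \<le> Lp_norm p f * Lp_norm (conj_exponent p) g"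
proof -
  have sup: "(\<integral>\<^sup>+x. u x * v x \<partial>lebesgue) \<le> Lp_norm 1 u * Lp_norm \<infinity> v"
    if [measurable]: "u \<in> borel_measurable lebesgue" "v \<in> borel_measurable lebesgue" for u v :: "'n \<Rightarrow> ennreal"
  proof -
    have "(\<integral>\<^sup>+x. u x * v x \<partial>lebesgue) \<le> (\<integral>\<^sup>+x. u x * esssup lebesgue v \<partial>lebesgue)"
      using esssup_AE[of v lebesgue] by (intro nn_integral_mono_AE) (auto elim!: eventually_mono intro!: mult_left_mono)
    also have "\<dots> = Lp_norm 1 u * Lp_norm \<infinity> v"
      by (subst nn_integral_multc) (auto simp: Lp_norm_1, simp add: Lp_norm_def)
    finally show ?thesis .
  qed
  show ?thesis
    using p
  proof (cases rule: conj_exponent_cases)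
    case 1
    then show ?thesis using sup[OF m] by simp
  next
    case 2
    then show ?thesis using sup[OF m(2,1)] by (simp add: mult.commute)
  next
    case (3 r s)
    let ?A = "Lp_norm p f" and ?B = "Lp_norm (conj_exponent p) g"
    have rs: "r \<ge> 1" "s \<ge> 1" using 3 by auto
    have zero: ?thesis if "?A = 0 \<or> ?B = 0"
    proof -
      have "AE x in lebesgue. f x * g x = 0"
        using that Lp_norm_0_AE[OF p m(1)] Lp_norm_0_AE[OF conj_exponent_ge_1[OF p] m(2)]
        by (auto elim: eventually_mono)
      then have "(\<integral>\<^sup>+x. f x * g x \<partial>lebesgue) = 0"
        by (subst nn_integral_0_iff_AE) auto
      then show ?thesis by simp
    qed
    consider "?A = 0 \<or> ?B = 0" | "?A = \<infinity>" "?B \<noteq> 0" | "?A \<noteq> 0" "?B = \<infinity>" | "0 < ?A" "0 < ?B" "?A < \<infinity>" "?B < \<infinity>"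
      using less_top not_gr_zero by (metis infinity_ennreal_def)
    then show ?thesis
    proof cases
      case 4
      obtain a where a: "a > 0" "?A = ennreal a" using 4 by (cases ?A) auto
      obtain b where b: "b > 0" "?B = ennreal b" using 4 by (cases ?B) auto
      define ca where "ca = a * b * (1 / (r * a powr r))"
      define cb where "cb = a * b * (1 / (s * b powr s))"
      have c0: "ca \<ge> 0" "cb \<ge> 0" using a b rs by (auto simp: ca_def cb_def)
      have fin: "AE x in lebesgue. f x < \<infinity>" "AE x in lebesgue. g x < \<infinity>"
        using Lp_norm_finite_AE[OF rs(1) m(1)] Lp_norm_finite_AE[OF rs(2) m(2)] 4 3 by auto
      have pt: "AE x in lebesgue. f x * g x \<le> ennreal ca * ennreal_powr (f x) r + ennreal cb * ennreal_powr (g x) s"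
        using fin
      proof eventually_elim
        case (elim x)
        obtain u where u: "u \<ge> 0" "f x = ennreal u" using elim by (cases "f x") auto
        obtain v where v: "v \<ge> 0" "g x = ennreal v" using elim by (cases "g x") auto
        have "(u / a) * (v / b) \<le> (u / a) powr r / r + (v / b) powr s / s"
          using Youngs_inequality[of r s "u / a" "v / b"] 3 u v a b by simp
        then have "a * b * ((u / a) * (v / b)) \<le> a * b * ((u / a) powr r / r + (v / b) powr s / s)"
          using a b by (intro mult_left_mono) auto
        also have "a * b * ((u / a) * (v / b)) = u * v" using a b by simp
        also have "a * b * ((u / a) powr r / r + (v / b) powr s / s) = ca * u powr r + cb * v powr s"
          using u v a b by (simp add: ca_def cb_def powr_divide algebra_simps)
        finally have "u * v \<le> ca * u powr r + cb * v powr s" .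
        then show ?case
          using u v c0 by (simp add: ennreal_powr_ennreal flip: ennreal_plus ennreal_mult)
      qed
      have "(\<integral>\<^sup>+x. f x * g x \<partial>lebesgue) \<le> (\<integral>\<^sup>+x. ennreal ca * ennreal_powr (f x) r + ennreal cb * ennreal_powr (g x) s \<partial>lebesgue)"
        by (rule nn_integral_mono_AE[OF pt])
      also have "\<dots> = ennreal ca * (\<integral>\<^sup>+x. ennreal_powr (f x) r \<partial>lebesgue) + ennreal cb * (\<integral>\<^sup>+x. ennreal_powr (g x) s \<partial>lebesgue)"
        by (subst nn_integral_add, measurable) (subst nn_integral_cmult, measurable)+
      also have "\<dots> = ennreal (a * b)"
      proof -
        have "ca * a powr r + cb * b powr s = a * b * (1 / r + 1 / s)"
          using a b by (simp add: ca_def cb_def distrib_left)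
        then have "ca * a powr r + cb * b powr s = a * b" using 3(3) by simp
        then show ?thesis
          unfolding Lp_norm_power[OF rs(1)] Lp_norm_power[OF rs(2)] 3(4,5)[symmetric] using a b c0
          by (simp add: ennreal_powr_ennreal flip: ennreal_plus ennreal_mult)
      qed
      also have "\<dots> = ?A * ?B" using a b by (simp add: ennreal_mult)
      finally show ?thesis .
    qed (use zero in \<open>auto simp: ennreal_top_mult ennreal_mult_top infinity_ennreal_def\<close>)
  qed
qed

lemma recip_real: "r \<ge> 1 \<Longrightarrow> recip (ennreal r) = 1 / r"
  by (simp add: recip_def divide_ennreal flip: ennreal_1)

lemma recip_top: "recip top = 0"
  by (simp add: recip_def)

text \<open>For finite exponents the pointwise bound
  \<open>f powr r \<le> c powr (r - 1) * f\<close> reduces everything to the supremum and the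
  integral. Applied once in position and once in frequency, this produces the powers of
  \<open>A\<close> and \<open>B\<close> in the norms of lattice sums.\<close>

lemma Lp_norm_interpolate:
  assumes p: "1 \<le> p" and m[measurable]: "f \<in> borel_measurable lebesgue" and c: "c > 0" and M: "M \<ge> 1"
    and sup: "\<And>x. f x \<le> ennreal c" and int: "(\<integral>\<^sup>+x. f x \<partial>lebesgue) \<le> ennreal (c * M)"
  shows "Lp_norm p f \<le> ennreal (c * M powr recip p)"
  using p
proof (cases rule: exponent_cases)
  case 1
  then show ?thesis using sup M by (auto simp: Lp_norm_def recip_top intro!: esssup_I)
next
  case (2 r)
  have "ennreal_powr (f x) r \<le> ennreal (c powr (r - 1)) * f x" for x
  proof -
    obtain s where s: "s \<ge> 0" "f x = ennreal s" using sup[of x] by (cases "f x") (auto simp: top_unique)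
    then have "s \<le> c" using sup[of x] c by simp
    then have "s powr r \<le> c powr (r - 1) * s"
      using powr_mono2[of "r - 1" s c] s 2 powr_add[of s "r - 1" 1] by (cases "s = 0") (auto simp: mult_right_mono)
    then show ?thesis using s by (simp add: ennreal_powr_ennreal flip: ennreal_mult)
  qed
  then have "(\<integral>\<^sup>+x. ennreal_powr (f x) r \<partial>lebesgue) \<le> (\<integral>\<^sup>+x. ennreal (c powr (r - 1)) * f x \<partial>lebesgue)"
    by (rule nn_integral_mono)
  also have "\<dots> = ennreal (c powr (r - 1)) * (\<integral>\<^sup>+x. f x \<partial>lebesgue)"
    by (rule nn_integral_cmult) measurable
  also have "\<dots> \<le> ennreal (c powr (r - 1)) * ennreal (c * M)"
    by (rule mult_left_mono[OF int]) simp
  also have "\<dots> = ennreal (c powr r * M)"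
    using c M powr_add[of c "r - 1" 1] by (simp flip: ennreal_mult add: mult.assoc)
  finally have "Lp_norm p f \<le> ennreal_powr (ennreal (c powr r * M)) (1 / r)"
    unfolding 2(2) Lp_norm_real[OF 2(1)] using 2(1) by (intro ennreal_powr_mono) auto
  also have "\<dots> = ennreal (c * M powr recip p)"
    using c M 2 by (simp add: ennreal_powr_ennreal powr_mult powr_powr recip_real)
  finally show ?thesis .
qed

text \<open>For the exponent infinity, the essential supremum of a section is at most
  \<open>t\<close> exactly when the section of the set where \<open>k > t\<close> has measure 0, and
  measures of sections depend measurably on the parameter.\<close>

lemma Lp_norm_section_measurable:
  fixes k :: "'m::euclidean_space \<times> 'n::euclidean_space \<Rightarrow> ennreal"
  assumes k: "k \<in> borel_measurable borel" and p: "1 \<le> p"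
  shows "(\<lambda>Y. Lp_norm p (\<lambda>X. k (X, Y))) \<in> borel_measurable borel"
proof -
  have k'[measurable]: "k \<in> borel_measurable (borel \<Otimes>\<^sub>M borel)" using k by (simp add: borel_prod)
  have sec: "(\<lambda>X. k (X, Y)) \<in> borel_measurable borel" for Y by measurable
  have ksw: "(\<lambda>(Y, X). k (X, Y)) \<in> borel_measurable (borel \<Otimes>\<^sub>M lborel)" by measurable
  show ?thesis
    using p
  proof (cases rule: exponent_cases)
    case 1
    have "{Y \<in> space borel. esssup lebesgue (\<lambda>X. k (X, Y)) \<le> t} \<in> sets borel" for t
    proof -
      have [measurable]: "{q \<in> space (borel \<Otimes>\<^sub>M lborel). k (snd q, fst q) > t} \<in> sets (borel \<Otimes>\<^sub>M lborel)" by measurable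
      have "esssup lebesgue (\<lambda>X. k (X, Y)) \<le> t \<longleftrightarrow>
          emeasure lborel (Pair Y -` {q \<in> space (borel \<Otimes>\<^sub>M lborel). k (snd q, fst q) > t}) = 0" for Y
      proof -
        have s: "{X. k (X, Y) > t} \<in> sets lborel" using sec[of Y] by measurable
        have "esssup lebesgue (\<lambda>X. k (X, Y)) \<le> t \<longleftrightarrow> (AE X in lborel. k (X, Y) \<le> t)"
          using sec[of Y] by (subst esssup_le_iff) (auto intro: measurable_completion simp: AE_completion_iff)
        also have "\<dots> \<longleftrightarrow> emeasure lborel {X. k (X, Y) > t} = 0"
          using s by (subst AE_iff_measurable[OF _ refl]) (auto simp: not_le)
        also have "{X. k (X, Y) > t} = Pair Y -` {q \<in> space (borel \<Otimes>\<^sub>M lborel). k (snd q, fst q) > t}"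
          by (auto simp: space_pair_measure)
        finally show ?thesis .
      qed
      moreover have "(\<lambda>Y. emeasure lborel (Pair Y -` {q \<in> space (borel \<Otimes>\<^sub>M lborel). k (snd q, fst q) > t})) \<in> borel_measurable borel"
        by (rule lborel.measurable_emeasure_Pair) measurable
      ultimately show ?thesis by simp
    qed
    then have "(\<lambda>Y. esssup lebesgue (\<lambda>X. k (X, Y))) \<in> borel_measurable borel" by (rule borel_measurableI_le)
    then show ?thesis using 1 by (simp add: Lp_norm_def)
  next
    case (2 r)
    have "(\<lambda>Y. \<integral>\<^sup>+X. ennreal_powr (k (X, Y)) r \<partial>lborel) \<in> borel_measurable borel"
      by (rule lborel.borel_measurable_nn_integral) measurable
    then show ?thesis
      unfolding 2(2) Lp_norm_real[OF 2(1)] nn_integral_completion by measurable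
  qed
qed

lemma lebesgue_measurable_cong_AE:
  fixes f g :: "'n::euclidean_space \<Rightarrow> 'b::topological_space"
  assumes g: "g \<in> borel_measurable lebesgue" and ae: "AE x in lebesgue. f x = g x"
  shows "f \<in> borel_measurable lebesgue"
proof (rule measurableI)
  fix A :: "'b set" assume A: "A \<in> sets borel"
  have 1: "g -` A \<inter> space lebesgue \<in> sets lebesgue" using g A by (rule measurable_sets)
  show "f -` A \<inter> space lebesgue \<in> sets lebesgue"
    by (rule completion.in_sets_AE[OF _ 1]) (use ae in \<open>auto elim!: eventually_mono\<close>)
qed simp

subsection \<open>Weights and the modulation spaces as metric spaces\<close>

text \<open>Stable under reciprocals, which the dual side of the argument needs: the reciprocal of a
  quotient of weights is again such a quotient.\<close>

definition mod_weight :: "('n::euclidean_space \<Rightarrow> real) \<Rightarrow> bool" where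
  "mod_weight \<eta> \<longleftrightarrow> (\<forall>x. \<eta> x > 0) \<and> \<eta> \<in> borel_measurable lebesgue \<and>
     (\<exists>C>0. \<exists>s\<ge>0. \<forall>x y. \<eta> (x + y) \<le> C * \<eta> x * (1 + (norm y)\<^sup>2) powr (s / 2))"

lemma poly_moderate_mod_weight: "poly_moderate \<eta> \<Longrightarrow> mod_weight \<eta>"
  unfolding poly_moderate_def mod_weight_def by blast

lemma mod_weight_inverse:
  assumes "mod_weight \<eta>" shows "mod_weight (\<lambda>x. 1 / \<eta> x)"
proof -
  obtain C s where C: "C > 0" "s \<ge> 0" "\<And>x y. \<eta> (x + y) \<le> C * \<eta> x * (1 + (norm y)\<^sup>2) powr (s / 2)"
    using assms unfolding mod_weight_def by blast
  have pos: "\<And>x. \<eta> x > 0" using assms unfolding mod_weight_def by blast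
  have "1 / \<eta> (x + y) \<le> C * (1 / \<eta> x) * (1 + (norm y)\<^sup>2) powr (s / 2)" for x y
    using C(3)[of "x + y" "- y"] pos[of x] pos[of "x + y"] by (simp add: field_simps)
  moreover have "(\<lambda>x. 1 / \<eta> x) \<in> borel_measurable lebesgue"
    using assms unfolding mod_weight_def by (intro borel_measurable_divide) auto
  ultimately show ?thesis unfolding mod_weight_def using C pos by auto
qed

lemma AE_lborel_translate:
  fixes a :: "'n::euclidean_space"
  assumes "AE x in lborel. P x"
  shows "AE x in lborel. P (x + a)"
proof -
  obtain N where N: "{x \<in> space lborel. \<not> P x} \<subseteq> N" "emeasure lborel N = 0" "N \<in> sets lborel"
    using assms by (rule AE_E)
  have m: "(+) a \<in> measurable lborel borel" by measurable
  have s: "(+) a -` N \<inter> space lborel \<in> sets lborel" using measurable_sets[OF m] N(3) by simp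
  have "emeasure lborel ((+) a -` N \<inter> space lborel) = emeasure (distr lborel borel ((+) a)) N"
    using N(3) m by (subst emeasure_distr) auto
  then have "emeasure lborel ((+) a -` N \<inter> space lborel) = 0"
    using N(2) by (simp add: lborel_distr_plus)
  then show ?thesis
    using N(1) s by (intro AE_I[of _ _ "(+) a -` N \<inter> space lborel"]) (auto simp: add.commute)
qed

text \<open>The weights are only Lebesgue measurable, so joint measurability of the quotient in
  \<open>(X, Y)\<close> is obtained from Borel representatives. For every single \<open>Y\<close>
  the exceptional set in \<open>X\<close> is a union of translates of null sets, which leaves all
  inner norms unchanged.\<close>

lemma weight_borel:
  fixes \<eta> \<zeta> :: "'p::euclidean_space \<Rightarrow> real"
  assumes \<eta>: "mod_weight \<eta>" and \<zeta>: "mod_weight \<zeta>"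
  obtains W where "W \<in> borel_measurable borel" "\<And>p. W p \<ge> 0"
    "\<And>Y. AE X in lebesgue. W (X, Y) = \<eta> (X - Y) / \<zeta> (X + Y)"
proof -
  obtain \<eta>' where e: "\<eta>' \<in> borel_measurable lborel" "AE x in lborel. \<eta> x = \<eta>' x"
    using completion_ex_borel_measurable_real[of \<eta> lborel] \<eta> unfolding mod_weight_def by blast
  obtain \<zeta>' where z: "\<zeta>' \<in> borel_measurable lborel" "AE x in lborel. \<zeta> x = \<zeta>' x"
    using completion_ex_borel_measurable_real[of \<zeta> lborel] \<zeta> unfolding mod_weight_def by blast
  have [measurable]: "\<eta>' \<in> borel_measurable borel" "\<zeta>' \<in> borel_measurable borel" using e z by auto
  \<comment> \<open>A Borel representative may be negative on a null set; the absolute value makes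
    \<open>W\<close> nonnegative everywhere.\<close>
  define W where "W p = \<bar>\<eta>' (fst p - snd p) / \<zeta>' (fst p + snd p)\<bar>" for p
  have "W \<in> borel_measurable (borel \<Otimes>\<^sub>M borel)" unfolding W_def by measurable
  then have "W \<in> borel_measurable borel" by (simp add: borel_prod)
  moreover have "AE X in lebesgue. W (X, Y) = \<eta> (X - Y) / \<zeta> (X + Y)" for Y
  proof -
    have "AE X in lborel. W (X, Y) = \<eta> (X - Y) / \<zeta> (X + Y)"
      using AE_lborel_translate[OF e(2), of "- Y"] AE_lborel_translate[OF z(2), of Y]
    proof eventually_elim
      case (elim X)
      have "\<eta> (X - Y) > 0" "\<zeta> (X + Y) > 0" using \<eta> \<zeta> unfolding mod_weight_def by auto
      with elim show ?case by (simp add: W_def)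
    qed
    then show ?thesis by (simp add: AE_completion)
  qed
  moreover have "W p \<ge> 0" for p by (simp add: W_def)
  ultimately show ?thesis using that by blast
qed

section \<open>Mixed norms with Borel weights and the metric axioms\<close>

lemma section_measurable:
  assumes "(\<lambda>(X, Y). k X Y) \<in> borel_measurable (borel :: ('m::euclidean_space \<times> 'n::euclidean_space) measure)"
  shows "(\<lambda>X. k X Y) \<in> borel_measurable lebesgue"
proof -
  have "(\<lambda>(X, Y). k X Y) \<in> borel_measurable (borel \<Otimes>\<^sub>M borel)" using assms by (simp add: borel_prod)
  from measurable_compose[OF measurable_Pair2' this, of Y] show ?thesis
    by (intro measurable_completion) simp
qed

lemma modulation_norm_borel:
  fixes \<eta> \<zeta> :: "'a::euclidean_space \<times> 'a \<Rightarrow> real"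
  assumes \<Phi>: "\<Phi> \<in> GS_half" and u: "u \<in> GS_half_dual"
    and W: "W \<in> borel_measurable borel" "\<And>p. W p \<ge> 0" "\<And>Y. AE X in lebesgue. W (X, Y) = \<omega> (X, Y)"
  shows "modulation_norm \<Phi> p q \<omega> u = Lp_norm q (\<lambda>Y. Lp_norm p (\<lambda>X. ennreal (cmod (symp_stft \<Phi> u X Y) * W (X, Y))))"
    "(\<lambda>(X, Y). ennreal (cmod (symp_stft \<Phi> u X Y) * W (X, Y))) \<in> borel_measurable borel"
proof -
  have V: "(\<lambda>(X, Y). symp_stft \<Phi> u X Y) \<in> borel_measurable borel"
    using symp_stft_continuous[OF \<Phi> u] by (rule borel_measurable_continuous_onI)
  then show k: "(\<lambda>(X, Y). ennreal (cmod (symp_stft \<Phi> u X Y) * W (X, Y))) \<in> borel_measurable borel"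
    using W(1) by (simp add: split_def) measurable
  have "Lp_norm p (\<lambda>X. ennreal (cmod (symp_stft \<Phi> u X Y * complex_of_real (\<omega> (X, Y))))) =
      Lp_norm p (\<lambda>X. ennreal (cmod (symp_stft \<Phi> u X Y) * W (X, Y)))" for Y
  proof -
    have ae: "AE X in lebesgue. ennreal (cmod (symp_stft \<Phi> u X Y * complex_of_real (\<omega> (X, Y)))) =
        ennreal (cmod (symp_stft \<Phi> u X Y) * W (X, Y))"
      using W(3)[of Y]
    proof eventually_elim
      case (elim X)
      then have "\<bar>\<omega> (X, Y)\<bar> = W (X, Y)" using W(2)[of "(X, Y)"] by simp
      then show ?case by (simp add: norm_mult)
    qed
    have m: "(\<lambda>X. ennreal (cmod (symp_stft \<Phi> u X Y) * W (X, Y))) \<in> borel_measurable lebesgue"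
      by (rule section_measurable[OF k])
    show ?thesis by (rule Lp_norm_cong_AE[OF lebesgue_measurable_cong_AE[OF m ae] m ae])
  qed
  then show "modulation_norm \<Phi> p q \<omega> u = Lp_norm q (\<lambda>Y. Lp_norm p (\<lambda>X. ennreal (cmod (symp_stft \<Phi> u X Y) * W (X, Y))))"
    unfolding modulation_norm_def by simp
qed

lemma Lp_norm_section_measurable':
  fixes k :: "'m::euclidean_space \<Rightarrow> 'n::euclidean_space \<Rightarrow> ennreal"
  assumes "(\<lambda>(X, Y). k X Y) \<in> borel_measurable borel" "1 \<le> p"
  shows "(\<lambda>Y. Lp_norm p (\<lambda>X. k X Y)) \<in> borel_measurable lebesgue"
  using Lp_norm_section_measurable[OF assms] by (intro measurable_completion) simp

lemma mixed_norm_minkowski: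
  fixes f g k :: "'m::euclidean_space \<Rightarrow> 'n::euclidean_space \<Rightarrow> ennreal"
  assumes p: "1 \<le> p" and q: "1 \<le> q"
    and f: "(\<lambda>(X, Y). f X Y) \<in> borel_measurable borel" and g: "(\<lambda>(X, Y). g X Y) \<in> borel_measurable borel"
    and k: "(\<lambda>(X, Y). k X Y) \<in> borel_measurable borel"
    and le: "\<And>X Y. k X Y \<le> f X Y + g X Y"
  shows "Lp_norm q (\<lambda>Y. Lp_norm p (\<lambda>X. k X Y)) \<le> Lp_norm q (\<lambda>Y. Lp_norm p (\<lambda>X. f X Y)) + Lp_norm q (\<lambda>Y. Lp_norm p (\<lambda>X. g X Y))"
proof -
  have "Lp_norm q (\<lambda>Y. Lp_norm p (\<lambda>X. k X Y)) \<le> Lp_norm q (\<lambda>Y. Lp_norm p (\<lambda>X. f X Y) + Lp_norm p (\<lambda>X. g X Y))"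
  proof (rule Lp_norm_mono[OF q Lp_norm_section_measurable'[OF k p]])
    fix Y
    have "Lp_norm p (\<lambda>X. k X Y) \<le> Lp_norm p (\<lambda>X. f X Y + g X Y)"
      by (rule Lp_norm_mono[OF p section_measurable[OF k] le])
    also have "\<dots> \<le> Lp_norm p (\<lambda>X. f X Y) + Lp_norm p (\<lambda>X. g X Y)"
      by (rule Lp_norm_minkowski[OF p section_measurable[OF f] section_measurable[OF g]])
    finally show "Lp_norm p (\<lambda>X. k X Y) \<le> Lp_norm p (\<lambda>X. f X Y) + Lp_norm p (\<lambda>X. g X Y)" .
  qed
  also have "\<dots> \<le> Lp_norm q (\<lambda>Y. Lp_norm p (\<lambda>X. f X Y)) + Lp_norm q (\<lambda>Y. Lp_norm p (\<lambda>X. g X Y))"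
    by (rule Lp_norm_minkowski[OF q Lp_norm_section_measurable'[OF f p] Lp_norm_section_measurable'[OF g p]])
  finally show ?thesis .
qed

text \<open>\<open>Metric_space\<close> requires symmetry of the distance for arbitrary arguments,
  hence also for functionals outside the space, where a continuous representative may fail to
  exist.\<close>

lemma cmod_fun_of_distr_minus:
  fixes v :: "('n::euclidean_space) distr"
  shows "cmod (fun_of_distr (\<lambda>\<phi>. - v \<phi>) y) = cmod (fun_of_distr v y)"
proof -
  let ?P = "\<lambda>v g. continuous_on UNIV g \<and> (\<forall>\<phi>\<in>GS_half. integrable lebesgue (\<lambda>x. g x * \<phi> x)) \<and> distr_of g = v"
  have eq: "fun_of_distr v = g" if P: "?P v g" for v :: "'n distr" and g
  proof (rule fun_of_distr_eq)
    fix \<phi> :: "'n \<Rightarrow> complex" assume \<phi>: "\<phi> \<in> GS_half"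
    have [measurable]: "g \<in> borel_measurable borel" "\<phi> \<in> borel_measurable borel"
      using P GS_half_measurable[OF \<phi>] by (auto intro: borel_measurable_continuous_onI)
    have "(\<lambda>x. g x * \<phi> x) \<in> borel_measurable lborel" by measurable
    then show "integrable lborel (\<lambda>x. g x * \<phi> x)" using P \<phi> integrable_completion by blast
  qed (use P in auto)
  have minus: "?P (\<lambda>\<phi>. - v \<phi>) (\<lambda>x. - g x)" if "?P v g" for v :: "'n distr" and g
  proof -
    have "distr_of (\<lambda>x. - g x) = (\<lambda>\<phi>. - distr_of g \<phi>)" by (auto simp: distr_of_def fun_eq_iff)
    then show ?thesis using that by (auto intro!: continuous_intros)
  qed
  show ?thesis
  proof (cases "\<exists>g. ?P v g")
    case True
    then obtain g where g: "?P v g" by blast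
    show ?thesis unfolding eq[OF g] eq[OF minus[OF g]] by simp
  next
    case False
    have "\<not> ?P (\<lambda>\<phi>. - v \<phi>) g" for g
    proof
      assume "?P (\<lambda>\<phi>. - v \<phi>) g"
      from minus[OF this] have "?P v (\<lambda>x. - g x)" by simp
      with False show False by blast
    qed
    \<comment> \<open>Without a representative both predicates are identically false, so the two
      definite descriptions denote the same default value.\<close>
    then have "?P (\<lambda>\<phi>. - v \<phi>) = ?P v" using False by (intro ext) blast
    then show ?thesis unfolding fun_of_distr_def by simp
  qed
qed

lemma cmod_symp_stft_commute:
  "cmod (symp_stft \<Phi> (\<lambda>\<phi>. a \<phi> - b \<phi>) X Y) = cmod (symp_stft \<Phi> (\<lambda>\<phi>. b \<phi> - a \<phi>) X Y)"
proof -
  let ?v = "\<lambda>a b. symp_fourier_distr (distr_mult (\<lambda>\<phi>. a \<phi> - b \<phi>) (\<lambda>Z. cnj (\<Phi> (Z - X))))"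
  have "?v a b = (\<lambda>\<phi>. - ?v b a \<phi>)"
    by (auto simp: symp_fourier_distr_def distr_mult_def fun_eq_iff)
  then show ?thesis unfolding symp_stft_def using cmod_fun_of_distr_minus[of "?v b a" Y] by simp
qed

text \<open>Only with these axioms do the balls of \<open>mtopology\<close> describe the topology.
  Positivity is the substantial one: a vanishing norm gives a transform that is 0 almost everywhere,
  by continuity everywhere, and \<open>stft_inj\<close> concludes.\<close>

lemma modulation_metric:
  fixes \<Phi> :: "'a::euclidean_space \<times> 'a \<Rightarrow> complex" and \<eta> \<zeta> :: "'a \<times> 'a \<Rightarrow> real"
  assumes \<Phi>: "\<Phi> \<in> GS_half" "\<Phi> \<noteq> (\<lambda>_. 0)" and p: "1 \<le> p" and q: "1 \<le> q"
    and \<eta>: "mod_weight \<eta>" and \<zeta>: "mod_weight \<zeta>"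
    and \<omega>: "\<And>X Y. \<omega> (X, Y) = \<eta> (X - Y) / \<zeta> (X + Y)"
  shows "Metric_space (modulation_space \<Phi> p q \<omega>) (\<lambda>a b. enn2real (modulation_norm \<Phi> p q \<omega> (\<lambda>\<phi>. a \<phi> - b \<phi>)))"
proof -
  obtain W where W: "W \<in> borel_measurable borel" "\<And>p. W p \<ge> 0"
    "\<And>Y. AE X in lebesgue. W (X, Y) = \<eta> (X - Y) / \<zeta> (X + Y)"
    by (rule weight_borel[OF \<eta> \<zeta>]) blast
  have W3: "AE X in lebesgue. W (X, Y) = \<omega> (X, Y)" for Y using W(3) by (simp add: \<omega>)
  let ?N = "modulation_norm \<Phi> p q \<omega>"
  let ?k = "\<lambda>u X Y. ennreal (cmod (symp_stft \<Phi> u X Y) * W (X, Y))"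
  note N = modulation_norm_borel(1)[OF \<Phi>(1) _ W(1,2) W3, of _ p q]
  note km = modulation_norm_borel(2)[OF \<Phi>(1) _ W(1,2) W3]
  let ?S = "modulation_space \<Phi> p q \<omega>"
  have S: "u \<in> GS_half_dual" "?N u < \<infinity>" if "u \<in> ?S" for u
    using that by (auto simp: modulation_space_def)
  have tri: "?N (\<lambda>\<phi>. a \<phi> - c \<phi>) \<le> ?N (\<lambda>\<phi>. a \<phi> - b \<phi>) + ?N (\<lambda>\<phi>. b \<phi> - c \<phi>)"
    if "a \<in> GS_half_dual" "b \<in> GS_half_dual" "c \<in> GS_half_dual" for a b c
  proof -
    note d = dual_diff_mem[OF that(1,3)] dual_diff_mem[OF that(1,2)] dual_diff_mem[OF that(2,3)]
    show ?thesis
      unfolding N[OF d(1)] N[OF d(2)] N[OF d(3)]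
    proof (rule mixed_norm_minkowski[OF p q km[OF d(2)] km[OF d(3)] km[OF d(1)]])
      fix X Y
      have "cmod (symp_stft \<Phi> (\<lambda>\<phi>. a \<phi> - c \<phi>) X Y) \<le> cmod (symp_stft \<Phi> (\<lambda>\<phi>. a \<phi> - b \<phi>) X Y) + cmod (symp_stft \<Phi> (\<lambda>\<phi>. b \<phi> - c \<phi>) X Y)"
        unfolding stft_diff[OF \<Phi>(1) that(1,3)] stft_diff[OF \<Phi>(1) that(1,2)] stft_diff[OF \<Phi>(1) that(2,3)]
        using norm_triangle_ineq[of "symp_stft \<Phi> a X Y - symp_stft \<Phi> b X Y" "symp_stft \<Phi> b X Y - symp_stft \<Phi> c X Y"] by simp
      from mult_right_mono[OF this W(2)[of "(X, Y)"]]
      show "?k (\<lambda>\<phi>. a \<phi> - c \<phi>) X Y \<le> ?k (\<lambda>\<phi>. a \<phi> - b \<phi>) X Y + ?k (\<lambda>\<phi>. b \<phi> - c \<phi>) X Y"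
        using W(2)[of "(X, Y)"] by (simp add: distrib_right flip: ennreal_plus)
    qed
  qed
  have comm: "?N (\<lambda>\<phi>. a \<phi> - b \<phi>) = ?N (\<lambda>\<phi>. b \<phi> - a \<phi>)" for a b
    unfolding modulation_norm_def norm_mult by (subst cmod_symp_stft_commute) simp
  have zero_dual: "(\<lambda>\<phi>. 0) \<in> GS_half_dual"
    unfolding GS_dual_def by (auto simp: topspace_GS)
  have minus: "?N (\<lambda>\<phi>. 0 - b \<phi>) = ?N b" if "b \<in> GS_half_dual" for b
    using comm[of "\<lambda>_. 0" b] by simp
  have fin: "?N (\<lambda>\<phi>. a \<phi> - b \<phi>) < \<infinity>" if "a \<in> ?S" "b \<in> ?S" for a b
  proof -
    have "?N (\<lambda>\<phi>. a \<phi> - b \<phi>) \<le> ?N (\<lambda>\<phi>. a \<phi> - 0) + ?N (\<lambda>\<phi>. 0 - b \<phi>)"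
      by (rule tri[OF S(1)[OF that(1)] zero_dual S(1)[OF that(2)]])
    also have "\<dots> = ?N a + ?N b" using minus[OF S(1)[OF that(2)]] by simp
    also have "\<dots> < \<infinity>" using S(2)[OF that(1)] S(2)[OF that(2)] by simp
    finally show ?thesis .
  qed
  show ?thesis
  proof
    fix a b
    show "0 \<le> enn2real (?N (\<lambda>\<phi>. a \<phi> - b \<phi>))" by simp
    show "enn2real (?N (\<lambda>\<phi>. a \<phi> - b \<phi>)) = enn2real (?N (\<lambda>\<phi>. b \<phi> - a \<phi>))"
      using comm[of a b] by simp
  next
    fix a b assume ab: "a \<in> ?S" "b \<in> ?S"
    let ?d = "\<lambda>\<phi>. a \<phi> - b \<phi>"
    have d: "?d \<in> GS_half_dual" using ab S by (intro dual_diff_mem) auto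
    show "enn2real (?N ?d) = 0 \<longleftrightarrow> a = b"
    proof
      assume "a = b"
      have "?k ?d X Y = 0" for X Y
        using stft_diff[OF \<Phi>(1) S(1)[OF ab(1)] S(1)[OF ab(2)], of X Y] \<open>a = b\<close> by simp
      then show "enn2real (?N ?d) = 0" unfolding N[OF d] using p q by (simp add: Lp_norm_zero)
    next
      assume "enn2real (?N ?d) = 0"
      then have "?N ?d = 0" using fin[OF ab] by (auto simp: enn2real_eq_0_iff)
      then have "Lp_norm q (\<lambda>Y. Lp_norm p (\<lambda>X. ?k ?d X Y)) = 0" unfolding N[OF d] .
      from Lp_norm_0_AE[OF q Lp_norm_section_measurable'[OF km[OF d] p] this]
      have 1: "AE Y in lebesgue. Lp_norm p (\<lambda>X. ?k ?d X Y) = 0" .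
      have "symp_stft \<Phi> ?d X Y = 0" for X Y
      proof (rule ccontr)
        assume nz: "symp_stft \<Phi> ?d X Y \<noteq> 0"
        \<comment> \<open>A nonzero value would persist on an open rectangle. Since a property
          holding almost everywhere is met in every nonempty open set, a suitable \<open>Y'\<close>
          and then a suitable \<open>X'\<close> contradict this.\<close>
        have "open ((\<lambda>(X, Y). symp_stft \<Phi> ?d X Y) -` (- {0}))"
          using symp_stft_continuous[OF \<Phi>(1) d] by (intro open_vimage) auto
        then obtain A B where AB: "open A" "open B" "X \<in> A" "Y \<in> B" "A \<times> B \<subseteq> (\<lambda>(X, Y). symp_stft \<Phi> ?d X Y) -` (- {0})"
          using nz by (elim open_prod_elim[where x = "(X, Y)"]) auto
        obtain Y' where Y': "Y' \<in> B" "Lp_norm p (\<lambda>X. ?k ?d X Y') = 0"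
          using AE_lebesgue_open[OF 1 AB(2)] AB(4) by blast
        have "AE X in lebesgue. ?k ?d X Y' = 0"
          by (rule Lp_norm_0_AE[OF p section_measurable[OF km[OF d]] Y'(2)])
        with W3[of Y'] have "AE X in lebesgue. symp_stft \<Phi> ?d X Y' = 0"
        proof eventually_elim
          case (elim X)
          have "\<eta> (X - Y') > 0" "\<zeta> (X + Y') > 0" using \<eta> \<zeta> unfolding mod_weight_def by blast+
          then have "\<omega> (X, Y') > 0" unfolding \<omega> by simp
          with elim have "W (X, Y') > 0" by simp
          with elim(2) show ?case by (simp add: ennreal_eq_0_iff mult_le_0_iff)
        qed
        from AE_lebesgue_open[OF this AB(1)] obtain X' where "X' \<in> A" "symp_stft \<Phi> ?d X' Y' = 0"
          using AB(3) by blast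
        with AB(5) Y'(1) show False by auto
      qed
      from stft_inj[OF \<Phi> d this] have "a \<phi> - b \<phi> = 0" for \<phi> .
      then show "a = b" by (simp add: fun_eq_iff)
    qed
  next
    fix a b c assume abc: "a \<in> ?S" "b \<in> ?S" "c \<in> ?S"
    have "enn2real (?N (\<lambda>\<phi>. a \<phi> - c \<phi>)) \<le> enn2real (?N (\<lambda>\<phi>. a \<phi> - b \<phi>) + ?N (\<lambda>\<phi>. b \<phi> - c \<phi>))"
      using tri[OF S(1)[OF abc(1)] S(1)[OF abc(2)] S(1)[OF abc(3)]] fin[OF abc(1,2)] fin[OF abc(2,3)]
      by (intro enn2real_mono) auto
    also have "\<dots> = enn2real (?N (\<lambda>\<phi>. a \<phi> - b \<phi>)) + enn2real (?N (\<lambda>\<phi>. b \<phi> - c \<phi>))"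
      using fin[OF abc(1,2)] fin[OF abc(2,3)] by (intro enn2real_plus) auto
    finally show "enn2real (?N (\<lambda>\<phi>. a \<phi> - c \<phi>)) \<le> enn2real (?N (\<lambda>\<phi>. a \<phi> - b \<phi>)) + enn2real (?N (\<lambda>\<phi>. b \<phi> - c \<phi>))" .
  qed
qed

subsection \<open>Weyl products of cross-Wigner distributions of Gaussians\<close>

definition weyl_kernel :: "('a::euclidean_space \<times> 'a \<Rightarrow> complex) \<Rightarrow> 'a \<Rightarrow> 'a \<Rightarrow> complex" where
  "weyl_kernel a x y = (LINT \<xi>|lborel. a ((1 / 2) *\<^sub>R (x + y), \<xi>) * cis ((x - y) \<bullet> \<xi>))"

lemma weyl_op_kernel:
  fixes a :: "'a::euclidean_space \<times> 'a \<Rightarrow> complex"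
  assumes a: "a \<in> GS_half" and f[measurable]: "f \<in> borel_measurable borel" and B: "\<And>y. cmod (f y) \<le> B"
  shows "integrable lborel (\<lambda>(y, \<xi>). a ((1 / 2) *\<^sub>R (x + y), \<xi>) * f y * cis ((x - y) \<bullet> \<xi>))"
    and "weyl_op a f x = complex_of_real (1 / (2 * pi) ^ DIM('a)) * (LINT y|lborel. weyl_kernel a x y * f y)"
proof -
  let ?F = "\<lambda>y \<xi>. a ((1 / 2) *\<^sub>R (x + y), \<xi>) * f y * cis ((x - y) \<bullet> \<xi>)"
  obtain A h c where g: "h > 0" "c > 0" "gsd A h c a" using a by (rule GS_half_gsd)
  have B0: "B \<ge> 0" using order_trans[OF norm_ge_zero B] by blast
  have A0: "A \<ge> 0" by (rule gsd_nonneg[OF g(3)])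
  have [measurable]: "a \<in> borel_measurable (borel \<Otimes>\<^sub>M borel)"
    using GS_half_measurable[OF a] by (simp add: borel_prod)
  have m: "(\<lambda>(y, \<xi>). ?F y \<xi>) \<in> borel_measurable (borel \<Otimes>\<^sub>M borel)" by measurable
  have ig: "integrable lborel (\<lambda>y::'a. exp (- r * (norm y)\<^sup>2))" if "r > 0" for r
    by (rule gauss_integral(1)[OF that])
  have p: "integrable lborel (\<lambda>y::'a. A * B * exp (- (c / 4) * (norm (y + x))\<^sup>2))"
    using integral_translate(2)[OF _ ig[of "c / 4"], of x] g(2) by (intro integrable_mult_right) auto
  have b: "cmod (?F y \<xi>) \<le> (A * B * exp (- (c / 4) * (norm (y + x))\<^sup>2)) * exp (- c * (norm \<xi>)\<^sup>2)" for y \<xi>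
  proof -
    have "cmod (?F y \<xi>) \<le> (A * exp (- c * (norm ((1 / 2) *\<^sub>R (x + y), \<xi>))\<^sup>2)) * B"
      unfolding norm_mult norm_cis mult_1_right
      using A0 by (intro mult_mono gsd_bound0[OF g(3)] B) auto
    also have "exp (- c * (norm ((1 / 2) *\<^sub>R (x + y), \<xi>))\<^sup>2) = exp (- (c / 4) * (norm (y + x))\<^sup>2) * exp (- c * (norm \<xi>)\<^sup>2)"
    proof -
      have "(norm ((1 / 2) *\<^sub>R (x + y), \<xi>))\<^sup>2 = (1 / 4) * (norm (y + x))\<^sup>2 + (norm \<xi>)\<^sup>2"
        by (simp only: norm_Pair norm_scaleR power_mult_distrib add.commute[of y x]) (simp add: power_divide)
      then show ?thesis unfolding exp_add[symmetric] by (simp add: algebra_simps)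
    qed
    finally show ?thesis by (simp only: mult_ac)
  qed
  note fub = lborel_fubini[OF m p ig[OF g(2)] b]
  show i: "integrable lborel (\<lambda>(y, \<xi>). ?F y \<xi>)" using fub(1) unfolding lborel_prod .
  have "(LINT z|lebesgue. (case z of (y, \<xi>) \<Rightarrow> ?F y \<xi>)) = (LINT z|(lborel \<Otimes>\<^sub>M lborel). (case z of (y, \<xi>) \<Rightarrow> ?F y \<xi>))"
    unfolding lborel_prod by (rule integral_completion[OF borel_measurable_integrable[OF i]])
  also have "\<dots> = (LINT y|lborel. LINT \<xi>|lborel. ?F y \<xi>)"
    using lborel_pair.integral_fst'[OF fub(1)] unfolding case_prod_conv by (rule sym)
  also have "\<dots> = (LINT y|lborel. weyl_kernel a x y * f y)"
  proof (rule Bochner_Integration.integral_cong[OF refl])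
    fix y
    have "(LINT \<xi>|lborel. ?F y \<xi>) = (LINT \<xi>|lborel. f y * (a ((1 / 2) *\<^sub>R (x + y), \<xi>) * cis ((x - y) \<bullet> \<xi>)))"
      by (rule Bochner_Integration.integral_cong) (simp_all only: mult_ac)
    then show "(LINT \<xi>|lborel. ?F y \<xi>) = weyl_kernel a x y * f y"
      unfolding weyl_kernel_def by (simp add: mult.commute)
  qed
  finally show "weyl_op a f x = complex_of_real (1 / (2 * pi) ^ DIM('a)) * (LINT y|lborel. weyl_kernel a x y * f y)"
    unfolding weyl_op_def by simp
qed

lemma weyl_op_lincomb:
  fixes a b :: "'a::euclidean_space \<times> 'a \<Rightarrow> complex"
  assumes a: "a \<in> GS_half" and b: "b \<in> GS_half" and f: "f \<in> borel_measurable borel" "\<And>y. cmod (f y) \<le> B"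
  shows "weyl_op (\<lambda>Z. c * a Z + b Z) f x = c * weyl_op a f x + weyl_op b f x"
proof -
  let ?F = "\<lambda>a z. case z of (y, \<xi>) \<Rightarrow> a ((1 / 2) *\<^sub>R (x + y), \<xi>) * f y * cis ((x - y) \<bullet> \<xi>)"
  have i: "integrable lebesgue (?F a)" if "a \<in> GS_half" for a
    using weyl_op_kernel(1)[OF that f] by (subst integrable_completion) (auto intro: borel_measurable_integrable)
  have "(LINT z|lebesgue. ?F (\<lambda>Z. c * a Z + b Z) z) = (LINT z|lebesgue. c * ?F a z + ?F b z)"
    by (rule Bochner_Integration.integral_cong) (auto simp: algebra_simps)
  also have "\<dots> = c * (LINT z|lebesgue. ?F a z) + (LINT z|lebesgue. ?F b z)"
    by (subst Bochner_Integration.integral_add[OF integrable_mult_right[OF i[OF a]] i[OF b]]) simp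
  finally show ?thesis unfolding weyl_op_def by (simp add: algebra_simps)
qed

lemma weyl_op_sum:
  fixes a :: "'s \<Rightarrow> 'a::euclidean_space \<times> 'a \<Rightarrow> complex"
  assumes "finite S" and a: "\<And>s. s \<in> S \<Longrightarrow> a s \<in> GS_half" and f: "f \<in> borel_measurable borel" "\<And>y. cmod (f y) \<le> B"
  shows "weyl_op (\<lambda>Z. \<Sum>s\<in>S. c s * a s Z) f x = (\<Sum>s\<in>S. c s * weyl_op (a s) f x)"
  using assms(1,2)
proof (induction S rule: finite_induct)
  case empty
  show ?case by (simp add: weyl_op_def case_prod_unfold)
next
  case (insert s S)
  have "(\<lambda>Z. \<Sum>s\<in>S. c s * a s Z) \<in> GS_half"
    using insert by (intro GS_half_sum GS_half_cmult) auto
  then show ?case using insert weyl_op_lincomb[OF _ _ f, of "a s" "\<lambda>Z. \<Sum>s\<in>S. c s * a s Z" "c s" x] by simp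
qed

text \<open>The kernel of a Weyl operator is a partial Fourier transform of its symbol.\<close>

lemma weyl_op_inj:
  fixes a b :: "'a::euclidean_space \<times> 'a \<Rightarrow> complex"
  assumes a: "a \<in> GS_half" and b: "b \<in> GS_half" and eq: "\<And>f. f \<in> GS_half \<Longrightarrow> weyl_op a f = weyl_op b f"
  shows "a = b"
proof -
  define D where "D = (\<lambda>Z. - 1 * a Z + b Z)"
  have D: "D \<in> GS_half" unfolding D_def by (intro GS_half_add GS_half_cmult a b)
  obtain A h c where g: "h > 0" "c > 0" "gsd A h c D" using D by (rule GS_half_gsd)
  have Dm: "D \<in> borel_measurable (borel \<Otimes>\<^sub>M borel)"
    using GS_half_measurable[OF D] by (simp add: borel_prod)
  have Dc: "continuous_on UNIV D" using D by (rule GS_half_continuous)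
  have sec: "(\<lambda>\<xi>. D (z, \<xi>)) \<in> borel_measurable borel" for z using Dm by measurable
  have Db: "cmod (D (z, \<xi>)) \<le> A * exp (- c * (norm \<xi>)\<^sup>2)" for z \<xi>
  proof -
    have "exp (- c * (norm (z, \<xi>))\<^sup>2) \<le> exp (- c * (norm \<xi>)\<^sup>2)" using g(2) by (simp add: norm_Pair)
    then show ?thesis
      using gsd_bound0[OF g(3), of "(z, \<xi>)"] gsd_nonneg[OF g(3)] by (meson mult_left_mono order_trans)
  qed
  have k0: "weyl_kernel D x y = 0" for x y
  proof -
    let ?k = "weyl_kernel D x"
    have cont: "continuous_on UNIV ?k"
    proof (rule continuous_at_imp_continuous_on, intro ballI)
      fix y
      show "isCont ?k y"
        unfolding continuous_at_sequentially comp_def weyl_kernel_def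
      proof (intro allI impI)
        fix s :: "nat \<Rightarrow> 'a" assume s: "s \<longlonglongrightarrow> y"
        show "(\<lambda>n. LINT \<xi>|lborel. D ((1 / 2) *\<^sub>R (x + s n), \<xi>) * cis ((x - s n) \<bullet> \<xi>))
          \<longlonglongrightarrow> (LINT \<xi>|lborel. D ((1 / 2) *\<^sub>R (x + y), \<xi>) * cis ((x - y) \<bullet> \<xi>))"
        proof (rule integral_dominated_convergence[where w = "\<lambda>\<xi>. A * exp (- c * (norm \<xi>)\<^sup>2)"])
          show "AE \<xi> in lborel. (\<lambda>n. D ((1 / 2) *\<^sub>R (x + s n), \<xi>) * cis ((x - s n) \<bullet> \<xi>))
              \<longlonglongrightarrow> D ((1 / 2) *\<^sub>R (x + y), \<xi>) * cis ((x - y) \<bullet> \<xi>)"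
          proof (intro AE_I2 tendsto_mult)
            fix \<xi>
            show "(\<lambda>n. D ((1 / 2) *\<^sub>R (x + s n), \<xi>)) \<longlonglongrightarrow> D ((1 / 2) *\<^sub>R (x + y), \<xi>)"
              by (rule continuous_on_tendsto_compose[OF Dc]) (auto intro!: tendsto_intros s)
            show "(\<lambda>n. cis ((x - s n) \<bullet> \<xi>)) \<longlonglongrightarrow> cis ((x - y) \<bullet> \<xi>)"
              by (rule continuous_on_tendsto_compose[of UNIV cis]) (auto intro!: tendsto_intros continuous_intros s)
          qed
          show "integrable lborel (\<lambda>\<xi>::'a. A * exp (- c * (norm \<xi>)\<^sup>2))"
            by (intro integrable_mult_right gauss_integral(1) g(2))
        qed (use sec Db in \<open>auto simp: norm_mult\<close>)
      qed
    qed
    have km: "?k \<in> borel_measurable borel" using cont by (rule borel_measurable_continuous_onI)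
    have kb: "cmod (?k y) \<le> (LINT \<xi>|lborel. A * exp (- c * (norm (\<xi>::'a))\<^sup>2))" for y
      unfolding weyl_kernel_def
    proof (rule norm_integral_le)
      show "integrable lborel (\<lambda>\<xi>::'a. A * exp (- c * (norm \<xi>)\<^sup>2))"
        by (intro integrable_mult_right gauss_integral(1) g(2))
    qed (use Db in \<open>auto simp: norm_mult\<close>)
    have int: "integrable lborel (\<lambda>y. ?k y * f y)" if f: "f \<in> GS_half" for f
    proof (rule Bochner_Integration.integrable_bound[OF integrable_mult_right[OF integrable_norm[OF GS_half_integrable[OF f]]]])
      show "(\<lambda>y. ?k y * f y) \<in> borel_measurable lborel" using km GS_half_measurable[OF f] by measurable
      show "AE y in lborel. norm (?k y * f y) \<le> norm ((LINT \<xi>|lborel. A * exp (- c * (norm (\<xi>::'a))\<^sup>2)) * norm (f y))"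
        unfolding norm_mult real_norm_def abs_mult abs_norm_cancel by (intro AE_I2 mult_right_mono order_trans[OF kb abs_ge_self]) auto
    qed
    have "distr_of ?k = (\<lambda>_. 0)"
    proof
      fix f :: "'a \<Rightarrow> complex"
      show "distr_of ?k f = 0"
      proof (cases "f \<in> GS_half")
        case True
        obtain B where B: "\<And>x. cmod (f x) \<le> B" using GS_half_bounded[OF True] by blast
        have "weyl_op D f x = 0"
          unfolding D_def weyl_op_lincomb[OF a b GS_half_measurable[OF True] B] eq[OF True] by simp
        then show ?thesis
          unfolding weyl_op_kernel(2)[OF D GS_half_measurable[OF True] B] distr_of_apply[OF km True] by simp
      qed (simp add: distr_of_def)
    qed
    \<comment> \<open>The zero distribution is represented both by the kernel and by the constant 0;
      uniqueness of continuous representatives makes the kernel vanish pointwise.\<close>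
    then have "fun_of_distr (\<lambda>_. 0) = ?k" by (intro fun_of_distr_eq cont int) auto
    moreover have "fun_of_distr (\<lambda>_. 0) = (\<lambda>_::'a. 0)" by (rule fun_of_distr_eq) (auto simp: distr_of_def)
    ultimately show ?thesis by metis
  qed
  have "D (z, \<xi>) = 0" for z \<xi>
  proof (rule fourier_inj[of "\<lambda>\<xi>. D (z, \<xi>)"])
    show "continuous_on UNIV (\<lambda>\<xi>. D (z, \<xi>))"
      by (rule continuous_on_compose2[OF Dc]) (auto intro!: continuous_intros)
    show "integrable lborel (\<lambda>\<xi>. D (z, \<xi>))" by (rule integrable_gauss_bound(1)[OF sec g(2) Db])
    fix v
    \<comment> \<open>The points are chosen with midpoint \<open>z\<close> and difference
      \<open>v\<close>, so that the kernel at this pair is the Fourier transform of the section of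
      \<open>D\<close> over \<open>z\<close>.\<close>
    have e: "(1 / 2) *\<^sub>R ((z + (1 / 2) *\<^sub>R v) + (z - (1 / 2) *\<^sub>R v)) = z"
      "(z + (1 / 2) *\<^sub>R v) - (z - (1 / 2) *\<^sub>R v) = v"
      by (simp_all flip: scaleR_add_left add: scaleR_2[symmetric])
    show "(LINT \<xi>|lborel. D (z, \<xi>) * cis (v \<bullet> \<xi>)) = 0"
      using k0[of "z + (1 / 2) *\<^sub>R v" "z - (1 / 2) *\<^sub>R v"] unfolding weyl_kernel_def e .
  qed
  then have "D Z = 0" for Z by (cases Z) simp
  then show ?thesis unfolding D_def by (simp add: fun_eq_iff)
qed

lemma weyl_prod_eq:
  assumes "c \<in> GS_half" "\<And>f. f \<in> GS_half \<Longrightarrow> weyl_op c f = weyl_op a (weyl_op b f)"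
  shows "weyl_prod a b = c"
  unfolding weyl_prod_def using assms by (intro the_equality) (auto intro: weyl_op_inj)

section \<open>Gaussian overlaps and rank one symbols\<close>

lemma gauss_mult_translate:
  fixes x a b :: "'n::euclidean_space"
  shows "gauss l (x - a) * gauss l (x - b) =
    complex_of_real (exp (- (l / 2) * (norm (a - b))\<^sup>2)) * gauss (2 * l) (x - (1 / 2) *\<^sub>R (a + b))"
proof -
  have E: "(norm (x - a))\<^sup>2 + (norm (x - b))\<^sup>2 = (1 / 2) * (norm (a - b))\<^sup>2 + 2 * (norm (x - (1 / 2) *\<^sub>R (a + b)))\<^sup>2"
    by (simp add: power2_norm_eq_inner algebra_simps inner_commute)
  have "- l * (norm (x - a))\<^sup>2 + - l * (norm (x - b))\<^sup>2 = - l * ((norm (x - a))\<^sup>2 + (norm (x - b))\<^sup>2)"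
    by (simp only: distrib_left)
  also have "\<dots> = - (l / 2) * (norm (a - b))\<^sup>2 + - (2 * l) * (norm (x - (1 / 2) *\<^sub>R (a + b)))\<^sup>2"
    unfolding E distrib_left by simp
  finally show ?thesis unfolding gauss_def of_real_mult[symmetric] exp_add[symmetric] by simp
qed

lemma gauss_overlap:
  fixes a b :: "'n::euclidean_space"
  shows "(LINT y|lborel. gauss (1/2) (y - a) * gauss (1/2) (y - b)) =
    complex_of_real (sqrt pi ^ DIM('n) * exp (- (1/4) * (norm (a - b))\<^sup>2))"
proof -
  have m: "(gauss 1 :: 'n \<Rightarrow> complex) \<in> borel_measurable borel" by (intro GS_half_measurable GS_half_gauss) simp
  have "(LINT y|lborel. gauss 1 (y - (1 / 2) *\<^sub>R (a + b))) = (LINT y|lborel. gauss 1 (y::'n))"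
    using integral_translate(1)[OF m, of "- ((1 / 2) *\<^sub>R (a + b))"] by simp
  also have "\<dots> = complex_of_real (sqrt pi ^ DIM('n))"
    using gauss_fourier(2)[of 1 "0::'n"] by simp
  finally show ?thesis unfolding gauss_mult_translate by simp
qed

text \<open>The operator with Weyl symbol \<open>wig u v\<close> is, up to a constant, \<open>f \<mapsto> \<langle>f, g\<^sub>v\<rangle> g\<^sub>u\<close>, where \<open>g\<^sub>u\<close> is
  the Gaussian centred at \<open>u\<close>.\<close>

definition wig :: "'a::euclidean_space \<Rightarrow> 'a \<Rightarrow> 'a \<times> 'a \<Rightarrow> complex" where
  "wig u v Z = gauss 1 (Z - ((1 / 2) *\<^sub>R (u + v), 0)) * cis ((0, v - u) \<bullet> Z)"

lemma wig_GS_half: "wig u v \<in> GS_half"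
  unfolding wig_def[abs_def] by (intro GS_half_cis GS_half_translate GS_half_gauss) simp

lemma gauss_Pair: "gauss l (x, \<xi>) = gauss l x * gauss l \<xi>"
  unfolding gauss_def of_real_mult[symmetric] exp_add[symmetric] by (simp add: norm_Pair algebra_simps)

text \<open>The kernel factorises by the parallelogram law: the squared mean of \<open>x - u\<close>
  and \<open>y - v\<close>, plus a quarter of their squared difference, equals half the sum of their
  squares.\<close>

lemma weyl_kernel_wig:
  fixes u v :: "'a::euclidean_space"
  shows "weyl_kernel (wig u v) x y = complex_of_real (sqrt pi ^ DIM('a)) * gauss (1/2) (x - u) * gauss (1/2) (y - v)"
proof -
  let ?w = "(1 / 2) *\<^sub>R (x + y) - (1 / 2) *\<^sub>R (u + v)"
  have "weyl_kernel (wig u v) x y = (LINT \<xi>|lborel. gauss 1 ?w * (gauss 1 \<xi> * cis ((v - u + (x - y)) \<bullet> \<xi>)))"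
    unfolding weyl_kernel_def wig_def
    by (rule Bochner_Integration.integral_cong) (auto simp: gauss_Pair inner_add_left mult.assoc simp flip: cis_mult)
  also have "\<dots> = gauss 1 ?w * complex_of_real (sqrt pi ^ DIM('a) * exp (- (norm (v - u + (x - y)))\<^sup>2 / 4))"
    using gauss_fourier(2)[of 1 "v - u + (x - y)"] by simp
  also have "\<dots> = complex_of_real (sqrt pi ^ DIM('a)) * complex_of_real (exp (- (norm ?w)\<^sup>2 - (norm (v - u + (x - y)))\<^sup>2 / 4))"
    unfolding gauss_def of_real_mult[symmetric] mult.left_commute[of "exp _" "sqrt pi ^ _"] exp_add[symmetric] by simp
  also have "- (norm ?w)\<^sup>2 - (norm (v - u + (x - y)))\<^sup>2 / 4 = - (1/2) * (norm (x - u))\<^sup>2 + - (1/2) * (norm (y - v))\<^sup>2"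
    by (simp add: power2_norm_eq_inner algebra_simps inner_commute add_divide_distrib diff_divide_distrib)
  finally show ?thesis by (simp only: exp_add gauss_def of_real_mult mult.assoc)
qed

definition wig_const :: "'a::euclidean_space itself \<Rightarrow> real" where
  "wig_const _ = sqrt pi ^ DIM('a) / (2 * pi) ^ DIM('a)"

lemma wig_const_pos: "wig_const TYPE('a::euclidean_space) > 0"
  by (simp add: wig_const_def)

lemma weyl_op_wig:
  fixes u v :: "'a::euclidean_space"
  assumes "f \<in> borel_measurable borel" "\<And>y. cmod (f y) \<le> B"
  shows "weyl_op (wig u v) f x = complex_of_real (wig_const TYPE('a)) * (gauss (1/2) (x - u) * (LINT y|lborel. gauss (1/2) (y - v) * f y))"
  unfolding weyl_op_kernel(2)[OF wig_GS_half assms] weyl_kernel_wig wig_const_def by (simp add: mult.assoc)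

definition wig_sum :: "'s set \<Rightarrow> ('s \<Rightarrow> real) \<Rightarrow> ('s \<Rightarrow> 'a::euclidean_space) \<Rightarrow> ('s \<Rightarrow> 'a) \<Rightarrow> 'a \<times> 'a \<Rightarrow> complex" where
  "wig_sum S c u v Z = (\<Sum>s\<in>S. complex_of_real (c s) * wig (u s) (v s) Z)"

lemma wig_sum_GS_half: "finite S \<Longrightarrow> wig_sum S c u v \<in> GS_half"
  unfolding wig_sum_def[abs_def] by (intro GS_half_sum GS_half_cmult wig_GS_half)

lemma weyl_op_wig_sum:
  fixes u v :: "'s \<Rightarrow> 'a::euclidean_space"
  assumes "finite S" and f: "f \<in> borel_measurable borel" "\<And>y. cmod (f y) \<le> B"
  shows "weyl_op (wig_sum S c u v) f x = (\<Sum>s\<in>S. complex_of_real (c s * wig_const TYPE('a)) *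
     (gauss (1/2) (x - u s) * (LINT y|lborel. gauss (1/2) (y - v s) * f y)))"
  unfolding wig_sum_def[abs_def] weyl_op_sum[OF assms(1) wig_GS_half f] weyl_op_wig[OF f] by (simp add: mult.assoc)

text \<open>Composing two rank one operators leaves the inner product of the two middle Gaussians as
  a scalar. It equals a fixed constant when the middle points agree and is positive in general, so
  no cancellation can occur later.\<close>

lemma weyl_prod_wig_sum:
  fixes u v :: "'s \<Rightarrow> 'a::euclidean_space" and u' v' :: "'t \<Rightarrow> 'a"
  assumes S: "finite S" and T: "finite T"
  shows "weyl_prod (wig_sum S c u v) (wig_sum T c' u' v') =
    wig_sum (S \<times> T) (\<lambda>(s, t). c s * c' t * (wig_const TYPE('a) * sqrt pi ^ DIM('a) * exp (- (1/4) * (norm (v s - u' t))\<^sup>2)))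
      (\<lambda>(s, t). u s) (\<lambda>(s, t). v' t)"
proof (rule weyl_prod_eq[OF wig_sum_GS_half[OF finite_cartesian_product[OF S T]]])
  fix f :: "'a \<Rightarrow> complex" assume f: "f \<in> GS_half"
  obtain B where B: "\<And>x. cmod (f x) \<le> B" using GS_half_bounded[OF f] by blast
  note fm = GS_half_measurable[OF f]
  let ?I = "\<lambda>t. (LINT y|lborel. gauss (1/2) (y - v' t) * f y)" and ?\<kappa> = "complex_of_real (wig_const TYPE('a))"
  let ?G = "\<lambda>s x. (gauss (1/2) (x - s) :: complex)"
  have G: "?G s \<in> GS_half" for s :: 'a by (intro GS_half_translate GS_half_gauss) simp
  define g where "g = weyl_op (wig_sum T c' u' v') f"
  have g: "g = (\<lambda>x. \<Sum>t\<in>T. complex_of_real (c' t) * ?\<kappa> * ?I t * ?G (u' t) x)"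
    unfolding g_def by (rule ext) (simp add: weyl_op_wig_sum[OF T fm B] mult_ac)
  have gG: "g \<in> GS_half" unfolding g by (intro GS_half_sum T GS_half_cmult G)
  obtain B' where B': "\<And>x. cmod (g x) \<le> B'" using GS_half_bounded[OF gG] by blast
  have ov: "(LINT y|lborel. ?G (v s) y * g y) = (\<Sum>t\<in>T. complex_of_real (c' t) * ?\<kappa> * ?I t *
      complex_of_real (sqrt pi ^ DIM('a) * exp (- (1/4) * (norm (v s - u' t))\<^sup>2)))" for s
  proof -
    have "(LINT y|lborel. ?G (v s) y * g y) = (LINT y|lborel. (\<Sum>t\<in>T. complex_of_real (c' t) * ?\<kappa> * ?I t * (?G (v s) y * ?G (u' t) y)))"
      unfolding g sum_distrib_left by (rule Bochner_Integration.integral_cong) (auto intro!: sum.cong simp: mult_ac)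
    also have "\<dots> = (\<Sum>t\<in>T. LINT y|lborel. complex_of_real (c' t) * ?\<kappa> * ?I t * (?G (v s) y * ?G (u' t) y))"
      by (rule Bochner_Integration.integral_sum) (intro integrable_mult_right GS_half_integrable GS_half_mult G)
    finally show ?thesis unfolding integral_mult_right_zero gauss_overlap .
  qed
  show "weyl_op (wig_sum (S \<times> T) (\<lambda>(s, t). c s * c' t * (wig_const TYPE('a) * sqrt pi ^ DIM('a) * exp (- (1/4) * (norm (v s - u' t))\<^sup>2)))
      (\<lambda>(s, t). u s) (\<lambda>(s, t). v' t)) f = weyl_op (wig_sum S c u v) (weyl_op (wig_sum T c' u' v') f)"
  proof
    fix x
    have "weyl_op (wig_sum S c u v) g x = (\<Sum>s\<in>S. \<Sum>t\<in>T. complex_of_real (c s * wig_const TYPE('a)) *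
      (?G (u s) x * (complex_of_real (c' t) * ?\<kappa> * ?I t *
      complex_of_real (sqrt pi ^ DIM('a) * exp (- (1/4) * (norm (v s - u' t))\<^sup>2)))))"
      unfolding weyl_op_wig_sum[OF S GS_half_measurable[OF gG] B'] ov sum_distrib_left by simp
    also have "\<dots> = weyl_op (wig_sum (S \<times> T) (\<lambda>(s, t). c s * c' t * (wig_const TYPE('a) * sqrt pi ^ DIM('a) * exp (- (1/4) * (norm (v s - u' t))\<^sup>2)))
      (\<lambda>(s, t). u s) (\<lambda>(s, t). v' t)) f x"
      unfolding weyl_op_wig_sum[OF finite_cartesian_product[OF S T] fm B] sum.cartesian_product
      by (rule sum.cong) (auto simp: mult_ac)
    finally show "weyl_op (wig_sum (S \<times> T) (\<lambda>(s, t). c s * c' t * (wig_const TYPE('a) * sqrt pi ^ DIM('a) * exp (- (1/4) * (norm (v s - u' t))\<^sup>2)))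
      (\<lambda>(s, t). u s) (\<lambda>(s, t). v' t)) f x = weyl_op (wig_sum S c u v) (weyl_op (wig_sum T c' u' v') f) x"
      unfolding g_def by simp
  qed
qed

lemma wig_pairing:
  fixes u v u' v' :: "'a::euclidean_space"
  shows "(LINT Z|lborel. wig u v Z * cnj (wig u' v' Z)) = complex_of_real (sqrt (pi / 2) ^ DIM('a \<times> 'a) *
    (exp (- (1/2) * (norm ((1 / 2) *\<^sub>R (u + v) - (1 / 2) *\<^sub>R (u' + v')))\<^sup>2) * exp (- (norm (v - u - (v' - u')))\<^sup>2 / 8)))"
proof -
  let ?M = "((1 / 2) *\<^sub>R (u + v), 0) :: 'a \<times> 'a" and ?M' = "((1 / 2) *\<^sub>R (u' + v'), 0) :: 'a \<times> 'a"
  let ?V = "(0, v - u - (v' - u')) :: 'a \<times> 'a" and ?N = "(1 / 2) *\<^sub>R (((1 / 2) *\<^sub>R (u + v), 0) + ((1 / 2) *\<^sub>R (u' + v'), 0)) :: 'a \<times> 'a"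
  let ?e = "complex_of_real (exp (- (1/2) * (norm (?M - ?M'))\<^sup>2))"
  have m: "(\<lambda>Z. gauss 2 Z * cis (?V \<bullet> Z)) \<in> borel_measurable borel"
    by (intro GS_half_measurable GS_half_cis GS_half_gauss) simp
  have N: "?V \<bullet> (Z + - ?N) = ?V \<bullet> Z" for Z by (simp add: inner_prod_def)
  have "wig u v Z * cnj (wig u' v' Z) = ?e * (gauss 2 (Z + - ?N) * cis (?V \<bullet> (Z + - ?N)))" for Z
  proof -
    have c: "cnj (gauss 1 (Z - ?M')) = gauss 1 (Z - ?M')" by (simp add: gauss_def)
    have "wig u v Z * cnj (wig u' v' Z) = (gauss 1 (Z - ?M) * gauss 1 (Z - ?M')) * (cis ((0, v - u) \<bullet> Z) * cis (- ((0, v' - u') \<bullet> Z)))"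
      unfolding wig_def complex_cnj_mult c by (simp add: cis_cnj mult_ac)
    also have "cis ((0, v - u) \<bullet> Z) * cis (- ((0, v' - u') \<bullet> Z)) = cis (?V \<bullet> Z)"
      unfolding cis_mult by (simp add: inner_prod_def inner_diff_left algebra_simps)
    finally show ?thesis unfolding gauss_mult_translate N by (simp only: mult.assoc add_uminus_conv_diff mult_1_right)
  qed
  then have "(LINT Z|lborel. wig u v Z * cnj (wig u' v' Z)) = ?e * (LINT Z|lborel. gauss 2 (Z + - ?N) * cis (?V \<bullet> (Z + - ?N)))"
    by (simp only: integral_mult_right_zero)
  also have "(LINT Z|lborel. gauss 2 (Z + - ?N) * cis (?V \<bullet> (Z + - ?N))) = complex_of_real (sqrt (pi / 2) ^ DIM('a \<times> 'a) * exp (- (norm ?V)\<^sup>2 / 8))"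
    using integral_translate(1)[OF m, of "- ?N"] gauss_fourier(2)[of 2 ?V] by simp
  finally show ?thesis by (simp add: norm_Pair)
qed

text \<open>All pairings of the symbols are positive real numbers and the coefficients are
  nonnegative, so the double sum only decreases when it is restricted to pairs with coinciding
  centres, where the pairing is \<open>sqrt (pi / 2) ^ DIM('a \<times> 'a)\<close>.\<close>

lemma wig_sum_pairing:
  fixes u v :: "'s \<Rightarrow> 'a::euclidean_space" and u' v' :: "'t \<Rightarrow> 'a"
  assumes S: "finite S" and T: "finite T"
    and c: "\<And>s. s \<in> S \<Longrightarrow> c s \<ge> 0" and c': "\<And>t. t \<in> T \<Longrightarrow> c' t \<ge> 0"
    and R: "R \<subseteq> S \<times> T" "\<And>s t. (s, t) \<in> R \<Longrightarrow> u s = u' t \<and> v s = v' t"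
  shows "(\<Sum>(s, t)\<in>R. c s * c' t) * sqrt (pi / 2) ^ DIM('a \<times> 'a) \<le>
    cmod (LINT Z|lborel. wig_sum S c u v Z * cnj (wig_sum T c' u' v' Z))"
proof -
  define P where "P s t = sqrt (pi / 2) ^ DIM('a \<times> 'a) *
    (exp (- (1/2) * (norm ((1 / 2) *\<^sub>R (u s + v s) - (1 / 2) *\<^sub>R (u' t + v' t)))\<^sup>2) * exp (- (norm (v s - u s - (v' t - u' t)))\<^sup>2 / 8))" for s t
  have "(LINT Z|lborel. wig_sum S c u v Z * cnj (wig_sum T c' u' v' Z)) =
      (LINT Z|lborel. (\<Sum>(s, t)\<in>S \<times> T. complex_of_real (c s * c' t) * (wig (u s) (v s) Z * cnj (wig (u' t) (v' t) Z))))"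
    unfolding wig_sum_def cnj_sum sum_product sum.cartesian_product
    by (rule Bochner_Integration.integral_cong) (auto intro!: sum.cong simp: mult_ac)
  also have "\<dots> = (\<Sum>(s, t)\<in>S \<times> T. LINT Z|lborel. complex_of_real (c s * c' t) * (wig (u s) (v s) Z * cnj (wig (u' t) (v' t) Z)))"
    unfolding split_def
    by (rule Bochner_Integration.integral_sum) (intro integrable_mult_right GS_half_integrable GS_half_mult GS_half_cnj wig_GS_half)
  also have "\<dots> = complex_of_real (\<Sum>(s, t)\<in>S \<times> T. c s * c' t * P s t)"
    unfolding integral_mult_right_zero wig_pairing P_def of_real_sum by (rule sum.cong) auto
  finally have eq: "(LINT Z|lborel. wig_sum S c u v Z * cnj (wig_sum T c' u' v' Z)) = complex_of_real (\<Sum>(s, t)\<in>S \<times> T. c s * c' t * P s t)" .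
  have nn: "c s * c' t * P s t \<ge> 0" if "s \<in> S" "t \<in> T" for s t using c c' that by (simp add: P_def)
  have "(\<Sum>(s, t)\<in>R. c s * c' t) * sqrt (pi / 2) ^ DIM('a \<times> 'a) = (\<Sum>(s, t)\<in>R. c s * c' t * P s t)"
    unfolding sum_distrib_right by (rule sum.cong) (use R(2) in \<open>auto simp: P_def\<close>)
  also have "\<dots> \<le> (\<Sum>(s, t)\<in>S \<times> T. c s * c' t * P s t)"
    using S T nn by (intro sum_mono2 R(1)) auto
  also have "\<dots> \<le> cmod (complex_of_real (\<Sum>(s, t)\<in>S \<times> T. c s * c' t * P s t))" by (simp only: norm_of_real abs_ge_self)
  finally show ?thesis unfolding eq .
qed

subsection \<open>Modulation norms of lattice sums\<close>

lemma sum_power_abs_int_le: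
  fixes r :: real and D :: "int set"
  assumes r: "0 < r" "r < 1" and D: "finite D"
  shows "(\<Sum>n\<in>D. r ^ nat \<bar>n\<bar>) \<le> 2 / (1 - r)"
proof -
  have half: "(\<Sum>n\<in>E. r ^ nat \<bar>n\<bar>) \<le> 1 / (1 - r)" if E: "E \<subseteq> D" "inj_on (\<lambda>n. nat \<bar>n\<bar>) E" for E
  proof -
    have fin: "finite ((\<lambda>n. nat \<bar>n\<bar>) ` E)" using E(1) D by (auto intro: finite_subset)
    have "(\<Sum>n\<in>E. r ^ nat \<bar>n\<bar>) = (\<Sum>m\<in>(\<lambda>n. nat \<bar>n\<bar>) ` E. r ^ m)"
      using E(2) by (simp add: sum.reindex)
    also have "\<dots> \<le> (\<Sum>m. r ^ m)"
      using r by (intro sum_le_suminf fin summable_geometric) auto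
    also have "\<dots> = 1 / (1 - r)" using r by (intro suminf_geometric) auto
    finally show ?thesis .
  qed
  have "D = {n \<in> D. n \<ge> 0} \<union> {n \<in> D. n < 0}" by auto
  then have "(\<Sum>n\<in>D. r ^ nat \<bar>n\<bar>) = (\<Sum>n\<in>{n \<in> D. n \<ge> 0}. r ^ nat \<bar>n\<bar>) + (\<Sum>n\<in>{n \<in> D. n < 0}. r ^ nat \<bar>n\<bar>)"
    using D by (subst sum.union_disjoint[symmetric]) auto
  also have "\<dots> \<le> 1 / (1 - r) + 1 / (1 - r)"
    by (intro add_mono half) (auto simp: inj_on_def)
  finally show ?thesis by simp
qed

text \<open>Projection to the \<open>e\<close> axis and rounding of the coordinate to
  \<open>h * m\<close> reduce the sum to integers: with offset \<open>a = m - k\<close> and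
  fractional part \<open>f\<close>, the estimate
  \<open>(a + f)\<^sup>2 \<ge> \<bar>a\<bar> / 2 - 1\<close> replaces Gaussians by a two-sided
  geometric series. The bound is uniform in the point and in the finite index set.\<close>

lemma lattice_gauss_sum_bounded:
  fixes c h :: real and e :: "'n::euclidean_space"
  assumes c: "c > 0" and h: "h > 0" and e: "e \<in> Basis"
  obtains K where "K > 0"
    "\<And>D x. finite D \<Longrightarrow> (\<Sum>k\<in>D. exp (- c * (norm (x - (h * of_int k) *\<^sub>R e))\<^sup>2)) \<le> K"
proof -
  define r where "r = exp (- (c * h\<^sup>2 / 2))"
  have r: "0 < r" "r < 1" using c h by (simp_all add: r_def)
  define K where "K = exp (c * h\<^sup>2) * (2 / (1 - r))"
  have "(\<Sum>k\<in>D. exp (- c * (norm (x - (h * of_int k) *\<^sub>R e))\<^sup>2)) \<le> K" if D: "finite D" for D :: "int set" and x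
  proof -
    define s where "s = x \<bullet> e"
    define m where "m = \<lfloor>s / h\<rfloor>"
    define f where "f = s / h - of_int m"
    have f: "0 \<le> f" "f \<le> 1" unfolding f_def m_def by linarith+
    have sm: "s = h * (of_int m + f)" using h by (simp add: f_def)
    have le: "exp (- c * (norm (x - (h * of_int k) *\<^sub>R e))\<^sup>2) \<le> exp (c * h\<^sup>2) * r ^ nat \<bar>m - k\<bar>" for k
    proof -
      define a :: real where "a = of_int (m - k)"
      have "\<bar>(x - (h * of_int k) *\<^sub>R e) \<bullet> e\<bar> \<le> norm (x - (h * of_int k) *\<^sub>R e)"
        by (rule Basis_le_norm[OF e])
      then have "\<bar>h * (a + f)\<bar> \<le> norm (x - (h * of_int k) *\<^sub>R e)"
        using e sm by (simp add: s_def[symmetric] inner_diff_left a_def algebra_simps inner_same_Basis)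
      then have "(h * (a + f))\<^sup>2 \<le> (norm (x - (h * of_int k) *\<^sub>R e))\<^sup>2"
        using power_mono[of "\<bar>h * (a + f)\<bar>" _ 2] by simp
      moreover have "h\<^sup>2 * (\<bar>a\<bar> / 2 - 1) \<le> (h * (a + f))\<^sup>2"
      proof -
        have "\<bar>a\<bar> \<le> a\<^sup>2"
        proof (cases "m = k")
          case False
          then have "\<bar>a\<bar> \<ge> 1" unfolding a_def by linarith
          then show ?thesis using mult_right_mono[of 1 "\<bar>a\<bar>" "\<bar>a\<bar>"] by (simp add: power2_eq_square flip: abs_mult)
        qed (simp add: a_def)
        moreover have "0 \<le> (a + 2 * f)\<^sup>2" by simp
        then have "a\<^sup>2 / 2 - f\<^sup>2 \<le> (a + f)\<^sup>2" by (simp add: power2_eq_square algebra_simps)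
        moreover have "f\<^sup>2 \<le> 1" using f by (simp add: power_le_one)
        ultimately have "\<bar>a\<bar> / 2 - 1 \<le> (a + f)\<^sup>2" by simp
        then show ?thesis unfolding power_mult_distrib by (intro mult_left_mono) auto
      qed
      ultimately have "c * (h\<^sup>2 * (\<bar>a\<bar> / 2 - 1)) \<le> c * (norm (x - (h * of_int k) *\<^sub>R e))\<^sup>2"
        using c by (intro mult_left_mono) auto
      then have "exp (- c * (norm (x - (h * of_int k) *\<^sub>R e))\<^sup>2) \<le> exp (c * h\<^sup>2 + \<bar>a\<bar> * (- (c * h\<^sup>2 / 2)))"
        by (simp add: algebra_simps)
      also have "\<bar>a\<bar> = real (nat \<bar>m - k\<bar>)" by (simp add: a_def)
      finally show ?thesis unfolding exp_add r_def exp_of_nat_mult .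
    qed
    have "(\<Sum>k\<in>D. exp (- c * (norm (x - (h * of_int k) *\<^sub>R e))\<^sup>2)) \<le> (\<Sum>k\<in>D. exp (c * h\<^sup>2) * r ^ nat \<bar>m - k\<bar>)"
      by (rule sum_mono) (rule le)
    also have "\<dots> = exp (c * h\<^sup>2) * (\<Sum>n\<in>(\<lambda>k. m - k) ` D. r ^ nat \<bar>n\<bar>)"
      by (subst sum.reindex) (auto simp: inj_on_def sum_distrib_left)
    also have "\<dots> \<le> K"
      unfolding K_def using D by (intro mult_left_mono sum_power_abs_int_le r) auto
    finally show ?thesis .
  qed
  moreover have "K > 0" using r by (simp add: K_def)
  ultimately show ?thesis using that by blast
qed

lemma gauss_nn_integral:
  fixes y :: "'n::euclidean_space"
  assumes c: "c > 0"
  shows "(\<integral>\<^sup>+x. ennreal (exp (- c * (norm (x - y))\<^sup>2)) \<partial>lebesgue) = ennreal (sqrt (pi / c) ^ DIM('n))"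
proof -
  have i: "integrable lborel (\<lambda>x::'n. exp (- c * (norm x)\<^sup>2))" by (rule gauss_integral(1)[OF c])
  have m: "(\<lambda>x::'n. exp (- c * (norm x)\<^sup>2)) \<in> borel_measurable borel" by measurable
  have "(\<integral>\<^sup>+x. ennreal (exp (- c * (norm (x + - y))\<^sup>2)) \<partial>lborel) = ennreal (LINT x|lborel. exp (- c * (norm (x + - y))\<^sup>2))"
    using integral_translate(2)[OF m i, of "- y"] by (intro nn_integral_eq_integral) auto
  also have "(LINT x|lborel. exp (- c * (norm (x + - y))\<^sup>2)) = sqrt (pi / c) ^ DIM('n)"
    using integral_translate(1)[OF m, of "- y"] gauss_integral(2)[OF c, where 'n='n] by simp
  finally show ?thesis by (simp add: nn_integral_completion)
qed

text \<open>On each diagonal \<open>j - i = d\<close> the frequency centre is constant while the position centres are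
  separated, and the frequency centres of different diagonals are separated as well.\<close>

lemma lattice_mixed_norm:
  fixes e :: "'n::euclidean_space" and c :: real
  assumes e: "e \<in> Basis" and c: "c > 0" and p: "1 \<le> p" and q: "1 \<le> q"
  obtains K where "K > 0" "\<And>S A B T. finite S \<Longrightarrow> S \<noteq> {} \<Longrightarrow> A \<ge> 1 \<Longrightarrow> B \<ge> 1 \<Longrightarrow> T > 0 \<Longrightarrow>
      (\<And>d. real (card {s \<in> S. snd s - fst s = d}) \<le> A) \<Longrightarrow> real (card ((\<lambda>s. snd s - fst s) ` S)) \<le> B \<Longrightarrow>
      Lp_norm q (\<lambda>Y::'n. Lp_norm p (\<lambda>X::'n. ennreal (T * (\<Sum>s\<in>S.
        exp (- c * (norm (X - (of_int (fst s + snd s) / 2) *\<^sub>R e))\<^sup>2) *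
        exp (- c * (norm (Y - (of_int (snd s - fst s) / 2) *\<^sub>R e))\<^sup>2)))))
      \<le> ennreal (T * K * A powr recip p * B powr recip q)"
proof -
  obtain K1 where K1: "K1 > 0" "\<And>D x. finite D \<Longrightarrow> (\<Sum>k\<in>D. exp (- c * (norm (x - (1 * of_int k) *\<^sub>R e))\<^sup>2)) \<le> K1"
    by (rule lattice_gauss_sum_bounded[OF c zero_less_one e]) blast
  obtain K2 where K2: "K2 > 0" "\<And>D x. finite D \<Longrightarrow> (\<Sum>k\<in>D. exp (- c * (norm (x - (1/2 * of_int k) *\<^sub>R e))\<^sup>2)) \<le> K2"
    by (rule lattice_gauss_sum_bounded[OF c _ e, of "1/2"]) auto
  define I where "I = sqrt (pi / c) ^ DIM('n)"
  have I: "I > 0" using c by (simp add: I_def)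
  define L where "L = K1 + K2 + I"
  have L: "L > 0" "K1 \<le> L" "K2 \<le> L" "I \<le> L" using K1 K2 I by (auto simp: L_def)
  let ?E = "\<lambda>x::'n. exp (- c * (norm x)\<^sup>2)"
  have "Lp_norm q (\<lambda>Y::'n. Lp_norm p (\<lambda>X::'n. ennreal (T * (\<Sum>s\<in>S.
        ?E (X - (of_int (fst s + snd s) / 2) *\<^sub>R e) * ?E (Y - (of_int (snd s - fst s) / 2) *\<^sub>R e)))))
      \<le> ennreal (T * (L * L) * A powr recip p * B powr recip q)"
    if S: "finite S" "S \<noteq> {}" and A: "A \<ge> 1" and B: "B \<ge> 1" and T: "T > 0"
      and cA: "\<And>d. real (card {s \<in> S. snd s - fst s = d}) \<le> A"
      and cB: "real (card ((\<lambda>s. snd s - fst s) ` S)) \<le> B" for S :: "(int \<times> int) set" and A B T :: real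
  proof -
    define D where "D = (\<lambda>s. snd s - fst s) ` S"
    have D: "finite D" "D \<noteq> {}" using S by (auto simp: D_def)
    define F where "F d = {s \<in> S. snd s - fst s = d}" for d
    have F: "finite (F d)" for d using S by (simp add: F_def)
    define G where "G d X = (\<Sum>s\<in>F d. ?E (X - (of_int (fst s + snd s) / 2) *\<^sub>R e))" for d X
    define H where "H Y = (\<Sum>d\<in>D. ?E (Y - (of_int d / 2) *\<^sub>R e))" for Y
    have Hpos: "H Y > 0" for Y unfolding H_def using D by (intro sum_pos) auto
    have Gm[measurable]: "G d \<in> borel_measurable borel" for d unfolding G_def by measurable
    have Hm[measurable]: "H \<in> borel_measurable borel" unfolding H_def by measurable
    have Gnn: "G d X \<ge> 0" for d X unfolding G_def by (intro sum_nonneg) auto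
    have split: "(\<Sum>s\<in>S. ?E (X - (of_int (fst s + snd s) / 2) *\<^sub>R e) * ?E (Y - (of_int (snd s - fst s) / 2) *\<^sub>R e)) =
        (\<Sum>d\<in>D. ?E (Y - (of_int d / 2) *\<^sub>R e) * G d X)" for X Y
      unfolding D_def sum.image_gen[OF S(1), of _ "\<lambda>s. snd s - fst s"] G_def F_def sum_distrib_left
      by (intro sum.cong refl) (auto simp: mult.commute)
    \<comment> \<open>On the diagonal \<open>snd s = fst s + d\<close> the position centres are
      \<open>fst s + d / 2\<close>, integers up to a common shift, hence the spacing 1 behind
      \<open>K1\<close>. The frequency centres \<open>d / 2\<close> have spacing 1/2, which is the
      case \<open>K2\<close>.\<close>
    have Gsup: "G d X \<le> L" for d X
    proof -
      have inj: "inj_on fst (F d)" by (auto simp: inj_on_def F_def)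
      have "G d X = (\<Sum>s\<in>F d. ?E ((X - (of_int d / 2) *\<^sub>R e) - (1 * of_int (fst s)) *\<^sub>R e))"
        unfolding G_def
      proof (rule sum.cong[OF refl])
        fix s assume "s \<in> F d"
        then have "snd s = fst s + d" by (simp add: F_def)
        then have "(of_int (fst s + snd s) / 2) *\<^sub>R e = (of_int d / 2) *\<^sub>R e + (1 * of_int (fst s)) *\<^sub>R e"
          by (simp add: add_divide_distrib flip: scaleR_add_left)
        then show "?E (X - (of_int (fst s + snd s) / 2) *\<^sub>R e) = ?E ((X - (of_int d / 2) *\<^sub>R e) - (1 * of_int (fst s)) *\<^sub>R e)"
          by (simp only: diff_diff_eq)
      qed
      also have "\<dots> = (\<Sum>k\<in>fst ` F d. ?E ((X - (of_int d / 2) *\<^sub>R e) - (1 * of_int k) *\<^sub>R e))"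
        by (simp only: sum.reindex[OF inj] comp_def)
      also have "\<dots> \<le> K1" using F by (intro K1(2)) auto
      finally show ?thesis using L by simp
    qed
    have Gint: "(\<integral>\<^sup>+X. ennreal (G d X) \<partial>lebesgue) \<le> ennreal (L * A)" for d
    proof -
      have "(\<integral>\<^sup>+X. ennreal (G d X) \<partial>lebesgue) = (\<Sum>s\<in>F d. \<integral>\<^sup>+X. ennreal (?E (X - (of_int (fst s + snd s) / 2) *\<^sub>R e)) \<partial>lebesgue)"
        unfolding G_def by (subst sum_ennreal[symmetric], simp, intro nn_integral_sum measurable_completion) measurable
      also have "\<dots> = ennreal (I * real (card (F d)))"
        unfolding gauss_nn_integral[OF c] I_def[symmetric] using I
        by (simp add: ennreal_mult ennreal_of_nat_eq_real_of_nat mult.commute)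
      also have "\<dots> \<le> ennreal (L * A)"
        using cA[of d] L A I by (intro ennreal_leI mult_mono) (auto simp: F_def)
      finally show ?thesis .
    qed
    \<comment> \<open>The frequency profile \<open>H Y\<close> comes out of the inner norm as a
      factor, so the outer norm is again an instance of interpolation between supremum and
      integral.\<close>
    have inner: "Lp_norm p (\<lambda>X. ennreal (T * (\<Sum>d\<in>D. ?E (Y - (of_int d / 2) *\<^sub>R e) * G d X))) \<le> ennreal (T * L * A powr recip p * H Y)" for Y
    proof -
      have "Lp_norm p (\<lambda>X. ennreal (T * (\<Sum>d\<in>D. ?E (Y - (of_int d / 2) *\<^sub>R e) * G d X))) \<le> ennreal (T * L * H Y * A powr recip p)"
      proof (rule Lp_norm_interpolate[OF p _ _ A])
        show "(\<lambda>X. ennreal (T * (\<Sum>d\<in>D. ?E (Y - (of_int d / 2) *\<^sub>R e) * G d X))) \<in> borel_measurable lebesgue"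
          by (intro measurable_completion) measurable
        show "0 < T * L * H Y" using T L Hpos[of Y] by simp
        show "ennreal (T * (\<Sum>d\<in>D. ?E (Y - (of_int d / 2) *\<^sub>R e) * G d X)) \<le> ennreal (T * L * H Y)" for X
        proof -
          have "(\<Sum>d\<in>D. ?E (Y - (of_int d / 2) *\<^sub>R e) * G d X) \<le> (\<Sum>d\<in>D. ?E (Y - (of_int d / 2) *\<^sub>R e) * L)"
            by (intro sum_mono mult_left_mono Gsup) auto
          then have "T * (\<Sum>d\<in>D. ?E (Y - (of_int d / 2) *\<^sub>R e) * G d X) \<le> T * (H Y * L)"
            using T unfolding H_def sum_distrib_right by (intro mult_left_mono) auto
          then show ?thesis by (intro ennreal_leI) (simp add: mult_ac)
        qed
        have "(\<integral>\<^sup>+X. ennreal (T * (\<Sum>d\<in>D. ?E (Y - (of_int d / 2) *\<^sub>R e) * G d X)) \<partial>lebesgue) =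
            (\<integral>\<^sup>+X. (\<Sum>d\<in>D. ennreal (T * ?E (Y - (of_int d / 2) *\<^sub>R e)) * ennreal (G d X)) \<partial>lebesgue)"
          using T Gnn by (intro nn_integral_cong) (simp add: sum_distrib_left mult.assoc flip: ennreal_mult)
        also have "\<dots> = (\<Sum>d\<in>D. \<integral>\<^sup>+X. ennreal (T * ?E (Y - (of_int d / 2) *\<^sub>R e)) * ennreal (G d X) \<partial>lebesgue)"
          by (intro nn_integral_sum measurable_completion) measurable
        also have "\<dots> = (\<Sum>d\<in>D. ennreal (T * ?E (Y - (of_int d / 2) *\<^sub>R e)) * (\<integral>\<^sup>+X. ennreal (G d X) \<partial>lebesgue))"
          by (intro sum.cong refl nn_integral_cmult measurable_completion) measurable
        also have "\<dots> \<le> (\<Sum>d\<in>D. ennreal (T * ?E (Y - (of_int d / 2) *\<^sub>R e)) * ennreal (L * A))"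
          by (intro sum_mono mult_left_mono Gint) auto
        also have "\<dots> = ennreal (T * L * H Y * A)"
          using T L A by (simp add: H_def sum_distrib_left sum_distrib_right mult_ac flip: ennreal_mult)
        finally show "(\<integral>\<^sup>+X. ennreal (T * (\<Sum>d\<in>D. ?E (Y - (of_int d / 2) *\<^sub>R e) * G d X)) \<partial>lebesgue) \<le> ennreal (T * L * H Y * A)" .
      qed
      then show ?thesis by (simp add: mult_ac)
    qed
    have "Lp_norm q (\<lambda>Y. Lp_norm p (\<lambda>X. ennreal (T * (\<Sum>d\<in>D. ?E (Y - (of_int d / 2) *\<^sub>R e) * G d X)))) \<le>
        Lp_norm q (\<lambda>Y. ennreal (T * L * A powr recip p * H Y))"
    proof (rule Lp_norm_mono[OF q _ inner])
      show "(\<lambda>Y. Lp_norm p (\<lambda>X. ennreal (T * (\<Sum>d\<in>D. ?E (Y - (of_int d / 2) *\<^sub>R e) * G d X)))) \<in> borel_measurable lebesgue"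
      proof (rule Lp_norm_section_measurable'[OF _ p])
        have "(\<lambda>(X, Y). ennreal (T * (\<Sum>d\<in>D. ?E (Y - (of_int d / 2) *\<^sub>R e) * G d X))) \<in> borel_measurable (borel \<Otimes>\<^sub>M borel)" by measurable
        then show "(\<lambda>(X, Y). ennreal (T * (\<Sum>d\<in>D. ?E (Y - (of_int d / 2) *\<^sub>R e) * G d X))) \<in> borel_measurable borel"
          by (simp add: borel_prod)
      qed
    qed
    also have "\<dots> \<le> ennreal (T * L * A powr recip p * L * B powr recip q)"
    proof (rule Lp_norm_interpolate[OF q _ _ B])
      show "(\<lambda>Y. ennreal (T * L * A powr recip p * H Y)) \<in> borel_measurable lebesgue"
        by (intro measurable_completion) measurable
      show "0 < T * L * A powr recip p * L" using T L A by simp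
      show "ennreal (T * L * A powr recip p * H Y) \<le> ennreal (T * L * A powr recip p * L)" for Y
      proof -
        have "H Y \<le> K2" using K2(2)[OF D(1), of Y] by (simp add: H_def)
        then show ?thesis using T L A by (intro ennreal_leI mult_left_mono) auto
      qed
      have "(\<integral>\<^sup>+Y. ennreal (T * L * A powr recip p * H Y) \<partial>lebesgue) =
          (\<integral>\<^sup>+Y. ennreal (T * L * A powr recip p) * (\<Sum>d\<in>D. ennreal (?E (Y - (of_int d / 2) *\<^sub>R e))) \<partial>lebesgue)"
        unfolding H_def using T L A by (intro nn_integral_cong) (simp add: sum_nonneg flip: ennreal_mult)
      also have "\<dots> = ennreal (T * L * A powr recip p) * (\<Sum>d\<in>D. \<integral>\<^sup>+Y. ennreal (?E (Y - (of_int d / 2) *\<^sub>R e)) \<partial>lebesgue)"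
        by (subst nn_integral_cmult, intro measurable_completion, measurable)
           (subst nn_integral_sum, intro measurable_completion, measurable)
      also have "\<dots> = ennreal (T * L * A powr recip p) * ennreal (I * real (card D))"
        unfolding gauss_nn_integral[OF c] I_def[symmetric] using I
        by (simp add: ennreal_mult ennreal_of_nat_eq_real_of_nat mult.commute)
      also have "\<dots> \<le> ennreal (T * L * A powr recip p) * ennreal (L * B)"
        using cB L B I by (intro mult_left_mono ennreal_leI mult_mono) (auto simp: D_def)
      also have "\<dots> = ennreal (T * L * A powr recip p * L * B)"
        using T L A B by (simp add: mult.assoc flip: ennreal_mult)
      finally show "(\<integral>\<^sup>+Y. ennreal (T * L * A powr recip p * H Y) \<partial>lebesgue) \<le> ennreal (T * L * A powr recip p * L * B)" .
    qed
    finally show ?thesis unfolding split by (simp add: mult_ac)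
  qed
  with L(1) show ?thesis using that[of "L * L"] by auto
qed

section \<open>Lattice sums under moderate weights\<close>

lemma powr_le_exp:
  fixes r c :: real
  assumes "r \<ge> 0" "c > 0"
  obtains K where "K > 0" "\<And>t. t \<ge> 0 \<Longrightarrow> (1 + 2 * t) powr r \<le> K * exp (c * t)"
proof -
  \<comment> \<open>Small enough that the inequality \<open>ln y \<le> y - 1\<close> at
    \<open>y = \<delta> * (1 + 2 * t)\<close> gives the slope
    \<open>2 * r * \<delta> \<le> c\<close>.\<close>
  define \<delta> where "\<delta> = c / (2 * (r + 1))"
  have \<delta>: "\<delta> > 0" using assms by (simp add: \<delta>_def)
  have r\<delta>: "2 * (r * \<delta>) \<le> c"
  proof -
    have "2 * (r * \<delta>) = c * (r / (r + 1))" using assms by (simp add: \<delta>_def field_simps)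
    also have "\<dots> \<le> c * 1" using assms by (intro mult_left_mono) auto
    finally show ?thesis by simp
  qed
  have "(1 + 2 * t) powr r \<le> exp (r * (\<delta> - ln \<delta>)) * exp (c * t)" if t: "t \<ge> 0" for t
  proof -
    have "ln (\<delta> * (1 + 2 * t)) \<le> \<delta> * (1 + 2 * t) - 1" using \<delta> t by (intro ln_le_minus_one) simp
    then have "ln (1 + 2 * t) \<le> \<delta> * (1 + 2 * t) - ln \<delta>" using \<delta> t by (simp add: ln_mult)
    then have "r * ln (1 + 2 * t) \<le> r * (\<delta> * (1 + 2 * t) - ln \<delta>)" using assms by (intro mult_left_mono) auto
    also have "\<dots> = r * (\<delta> - ln \<delta>) + 2 * (r * \<delta>) * t" by (simp add: algebra_simps)
    also have "\<dots> \<le> r * (\<delta> - ln \<delta>) + c * t" using r\<delta> t by (intro add_left_mono mult_right_mono) auto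
    finally show ?thesis using t by (simp add: powr_def flip: exp_add)
  qed
  then show ?thesis using that[of "exp (r * (\<delta> - ln \<delta>))"] by simp
qed

text \<open>Compares the weight at \<open>(X, Y)\<close> with its value at the centre
  \<open>(M, N)\<close>. Moderateness costs polynomial factors in the displacements along
  \<open>X - Y\<close> and \<open>X + Y\<close>; by the parallelogram law both are controlled by one
  quantity \<open>t\<close>, and an arbitrarily weak Gaussian growth absorbs them.\<close>

lemma mod_weight_shift_bound:
  fixes \<eta> \<zeta> :: "'n::euclidean_space \<Rightarrow> real" and c :: real
  assumes \<eta>: "mod_weight \<eta>" and \<zeta>: "mod_weight \<zeta>" and c: "c > 0"
  obtains K where "K > 0" "\<And>M N X Y. \<eta> (X - Y) / \<zeta> (X + Y) * (\<zeta> (M + N) / \<eta> (M - N)) \<le>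
      K * exp (c * ((norm (X - M))\<^sup>2 + (norm (Y - N))\<^sup>2))"
proof -
  obtain C s where C: "C > 0" "s \<ge> 0" "\<And>x y. \<eta> (x + y) \<le> C * \<eta> x * (1 + (norm y)\<^sup>2) powr (s / 2)"
    using \<eta> unfolding mod_weight_def by blast
  obtain C' s' where C': "C' > 0" "s' \<ge> 0" "\<And>x y. \<zeta> (x + y) \<le> C' * \<zeta> x * (1 + (norm y)\<^sup>2) powr (s' / 2)"
    using \<zeta> unfolding mod_weight_def by blast
  have pos: "\<eta> x > 0" "\<zeta> x > 0" for x using \<eta> \<zeta> unfolding mod_weight_def by blast+
  obtain K where K: "K > 0" "\<And>t. t \<ge> 0 \<Longrightarrow> (1 + 2 * t) powr (s / 2 + s' / 2) \<le> K * exp (c * t)"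
    by (rule powr_le_exp[of "s / 2 + s' / 2" c]) (use C C' c in auto)
  have "\<eta> (X - Y) / \<zeta> (X + Y) * (\<zeta> (M + N) / \<eta> (M - N)) \<le> C * C' * K * exp (c * ((norm (X - M))\<^sup>2 + (norm (Y - N))\<^sup>2))" for M N X Y
  proof -
    define Z V where "Z = X - M" and "V = Y - N"
    define t where "t = (norm Z)\<^sup>2 + (norm V)\<^sup>2"
    have t0: "t \<ge> 0" by (simp add: t_def)
    have par: "(norm (Z - V))\<^sup>2 + (norm (Z + V))\<^sup>2 = 2 * t"
      by (simp add: t_def power2_norm_eq_inner algebra_simps inner_commute)
    have "(norm (Z - V))\<^sup>2 \<le> 2 * t" "(norm (- (Z + V)))\<^sup>2 \<le> 2 * t"
      using par zero_le_power2[of "norm (Z + V)"] zero_le_power2[of "norm (Z - V)"] unfolding norm_minus_cancel by linarith+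
    then have pw: "(1 + (norm (Z - V))\<^sup>2) powr (s / 2) \<le> (1 + 2 * t) powr (s / 2)"
      "(1 + (norm (- (Z + V)))\<^sup>2) powr (s' / 2) \<le> (1 + 2 * t) powr (s' / 2)"
      using C C' by (auto intro!: powr_mono2)
    have e: "X - Y = (M - N) + (Z - V)" "M + N = (X + Y) + - (Z + V)" by (simp_all add: Z_def V_def)
    have 1: "\<eta> (X - Y) \<le> C * \<eta> (M - N) * (1 + 2 * t) powr (s / 2)"
      unfolding e(1) by (rule order_trans[OF C(3) mult_left_mono[OF pw(1)]]) (use C(1) pos(1)[of "M - N"] in simp)
    have 2: "\<zeta> (M + N) \<le> C' * \<zeta> (X + Y) * (1 + 2 * t) powr (s' / 2)"
      unfolding e(2) by (rule order_trans[OF C'(3) mult_left_mono[OF pw(2)]]) (use C'(1) pos(2)[of "X + Y"] in simp)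
    have "\<eta> (X - Y) * \<zeta> (M + N) \<le> (C * \<eta> (M - N) * (1 + 2 * t) powr (s / 2)) * (C' * \<zeta> (X + Y) * (1 + 2 * t) powr (s' / 2))"
      using less_imp_le[OF pos(1)[of "M - N"]] less_imp_le[OF pos(2)[of "M + N"]] C(1) C'(1) by (intro mult_mono 1 2) auto
    also have "\<dots> = C * C' * (1 + 2 * t) powr (s / 2 + s' / 2) * (\<zeta> (X + Y) * \<eta> (M - N))"
      by (simp add: powr_add mult_ac)
    also have "\<dots> \<le> C * C' * (K * exp (c * t)) * (\<zeta> (X + Y) * \<eta> (M - N))"
      using K(2)[OF t0] C(1) C'(1) pos(2)[of "X + Y"] pos(1)[of "M - N"] by (intro mult_right_mono mult_left_mono) auto
    finally have "\<eta> (X - Y) * \<zeta> (M + N) / (\<zeta> (X + Y) * \<eta> (M - N)) \<le> C * C' * (K * exp (c * t))"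
      using pos(2)[of "X + Y"] pos(1)[of "M - N"] by (subst pos_divide_le_eq) auto
    then show ?thesis by (simp add: t_def Z_def V_def mult.assoc)
  qed
  with K(1) C(1) C'(1) show ?thesis using that[of "C * C' * K"] by simp
qed

text \<open>Covariance: \<open>wig u v\<close> is the centred Gaussian, shifted in position and
  modulated, so its transform is shifted to a centre \<open>(M, N)\<close> up to a phase. Here
  \<open>M - N = (u, 0)\<close> and \<open>M + N = (v, 0)\<close>, which is why quotients of weights
  at \<open>u\<close> and \<open>v\<close> are the right coefficients.\<close>

lemma stft_wig:
  fixes u v :: "'a::euclidean_space"
  assumes \<Phi>: "\<Phi> \<in> GS_half"
  shows "cmod (symp_stft \<Phi> (distr_of (wig u v)) X Y) =
    cmod (symp_stft \<Phi> (distr_of (gauss 1)) (X - ((1/2) *\<^sub>R (u + v), 0)) (Y - ((1/2) *\<^sub>R (v - u), 0)))"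
proof -
  let ?M = "((1/2) *\<^sub>R (u + v), 0) :: 'a \<times> 'a" and ?N = "((1/2) *\<^sub>R (v - u), 0) :: 'a \<times> 'a"
  have G: "gauss 1 \<in> (GS_half :: ('a \<times> 'a \<Rightarrow> complex) set)" by (rule GS_half_gauss) simp
  note win = window_GS[OF \<Phi>]
  have m: "(\<lambda>Z. wig u v Z * cnj (\<Phi> (Z - X))) \<in> borel_measurable borel"
    by (intro GS_half_measurable GS_half_mult wig_GS_half win)
  have mc: "(\<lambda>Z. wig u v Z * cnj (\<Phi> (Z - X)) * cis (jj Y \<bullet> Z)) \<in> borel_measurable borel"
    by (intro GS_half_measurable GS_half_cis GS_half_mult wig_GS_half win)
  have m': "(\<lambda>Z. gauss 1 Z * cnj (\<Phi> (Z - (X - ?M)))) \<in> borel_measurable borel"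
    by (intro GS_half_measurable GS_half_mult G win)
  let ?J = "jj (Y - ?N)"
  have J: "?J = jj Y + (0, v - u)" by (simp add: jj_def prod_eq_iff algebra_simps)
  have "wig u v (Z + ?M) * cnj (\<Phi> (Z + ?M - X)) * cis (jj Y \<bullet> (Z + ?M)) =
      cis (?J \<bullet> ?M) * (gauss 1 Z * cnj (\<Phi> (Z - (X - ?M))) * cis (?J \<bullet> Z))" for Z
  proof -
    have w: "wig u v (Z + ?M) = gauss 1 Z * cis ((0, v - u) \<bullet> (Z + ?M))" "Z + ?M - X = Z - (X - ?M)"
      by (simp_all add: wig_def)
    have "cis ((0, v - u) \<bullet> (Z + ?M)) * cis (jj Y \<bullet> (Z + ?M)) = cis (?J \<bullet> ?M) * cis (?J \<bullet> Z)"
      unfolding cis_mult J inner_add_left inner_add_right by (rule arg_cong[of _ _ cis]) (simp only: add_ac)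
    then have "gauss 1 Z * cnj (\<Phi> (Z - (X - ?M))) * (cis ((0, v - u) \<bullet> (Z + ?M)) * cis (jj Y \<bullet> (Z + ?M))) =
        gauss 1 Z * cnj (\<Phi> (Z - (X - ?M))) * (cis (?J \<bullet> ?M) * cis (?J \<bullet> Z))" by (rule arg_cong)
    then show ?thesis unfolding w by (simp only: mult_ac)
  qed
  then have "(LINT Z|lborel. wig u v Z * cnj (\<Phi> (Z - X)) * cis (jj Y \<bullet> Z)) =
      cis (?J \<bullet> ?M) * (LINT Z|lborel. gauss 1 Z * cnj (\<Phi> (Z - (X - ?M))) * cis (?J \<bullet> Z))"
    using integral_translate(1)[OF mc, of ?M] by (simp only: integral_mult_right_zero)
  then show ?thesis
    unfolding symp_stft_distr_of[OF \<Phi> wig_GS_half] symp_stft_distr_of[OF \<Phi> G] symp_fourier_eq[OF m] symp_fourier_eq[OF m']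
    by (simp only: norm_mult norm_cis mult_1_left)
qed

lemma stft_wig_sum:
  fixes u v :: "'s \<Rightarrow> 'a::euclidean_space"
  assumes \<Phi>: "\<Phi> \<in> GS_half" and S: "finite S" and c: "\<And>s. s \<in> S \<Longrightarrow> c s \<ge> 0"
  shows "cmod (symp_stft \<Phi> (distr_of (wig_sum S c u v)) X Y) \<le>
    (\<Sum>s\<in>S. c s * cmod (symp_stft \<Phi> (distr_of (wig (u s) (v s))) X Y))"
proof -
  note win = window_GS[OF \<Phi>]
  have m: "(\<lambda>Z. a Z * cnj (\<Phi> (Z - X))) \<in> borel_measurable borel" if "a \<in> GS_half" for a
    by (intro GS_half_measurable GS_half_mult that win)
  have "(LINT Z|lborel. wig_sum S c u v Z * cnj (\<Phi> (Z - X)) * cis (jj Y \<bullet> Z)) =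
      (LINT Z|lborel. (\<Sum>s\<in>S. complex_of_real (c s) * (wig (u s) (v s) Z * cnj (\<Phi> (Z - X)) * cis (jj Y \<bullet> Z))))"
    unfolding wig_sum_def sum_distrib_right by (simp only: mult.assoc)
  also have "\<dots> = (\<Sum>s\<in>S. LINT Z|lborel. complex_of_real (c s) * (wig (u s) (v s) Z * cnj (\<Phi> (Z - X)) * cis (jj Y \<bullet> Z)))"
    by (rule Bochner_Integration.integral_sum) (intro integrable_mult_right GS_half_integrable GS_half_cis GS_half_mult wig_GS_half win)
  finally have "symp_stft \<Phi> (distr_of (wig_sum S c u v)) X Y = (\<Sum>s\<in>S. complex_of_real (c s) * symp_stft \<Phi> (distr_of (wig (u s) (v s))) X Y)"
    unfolding symp_stft_distr_of[OF \<Phi> wig_GS_half] symp_stft_distr_of[OF \<Phi> wig_sum_GS_half[OF S]]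
      symp_fourier_eq[OF m[OF wig_GS_half]] symp_fourier_eq[OF m[OF wig_sum_GS_half[OF S]]] integral_mult_right_zero
    by (simp add: sum_distrib_left mult_ac)
  also have "cmod \<dots> \<le> (\<Sum>s\<in>S. cmod (complex_of_real (c s) * symp_stft \<Phi> (distr_of (wig (u s) (v s))) X Y))"
    by (rule norm_sum)
  also have "\<dots> = (\<Sum>s\<in>S. c s * cmod (symp_stft \<Phi> (distr_of (wig (u s) (v s))) X Y))"
    using c by (intro sum.cong) (auto simp: norm_mult)
  finally show ?thesis .
qed

lemma Lp_norm_mono_AE:
  assumes "1 \<le> p" "f \<in> borel_measurable lebesgue" "g \<in> borel_measurable lebesgue" "AE x in lebesgue. f x \<le> g x"
  shows "Lp_norm p f \<le> Lp_norm p g"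
proof -
  have m: "(\<lambda>x. min (f x) (g x)) \<in> borel_measurable lebesgue" using assms(2,3) by measurable
  have "Lp_norm p f = Lp_norm p (\<lambda>x. min (f x) (g x))"
    using assms(4) by (intro Lp_norm_cong_AE assms(2) m) (auto elim!: eventually_mono simp: min_def)
  also have "\<dots> \<le> Lp_norm p g" by (rule Lp_norm_mono[OF assms(1) m]) simp
  finally show ?thesis .
qed

definition lattice_pt :: "'a::euclidean_space \<Rightarrow> int \<Rightarrow> 'a" where
  "lattice_pt b i = of_int i *\<^sub>R b"

abbreviation lattice_sum :: "'a::euclidean_space \<Rightarrow> (int \<times> int) set \<Rightarrow> (int \<times> int \<Rightarrow> real) \<Rightarrow> 'a \<times> 'a \<Rightarrow> complex" where
  "lattice_sum b S c \<equiv> wig_sum S c (\<lambda>s. lattice_pt b (fst s)) (\<lambda>s. lattice_pt b (snd s))"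

text \<open>Of the Gaussian decay \<open>c\<close> of the transform, half pays for the weight
  quotient relative to each centre; the remaining half leaves an unweighted lattice sum for
  \<open>lattice_mixed_norm\<close>. The constant does not depend on the index set.\<close>

lemma modulation_norm_lattice_sum:
  fixes \<Phi> :: "'a::euclidean_space \<times> 'a \<Rightarrow> complex" and \<eta> \<zeta> :: "'a \<times> 'a \<Rightarrow> real" and b :: 'a
  assumes \<Phi>: "\<Phi> \<in> GS_half" and p: "1 \<le> p" and q: "1 \<le> q" and b: "b \<in> Basis"
    and \<eta>: "mod_weight \<eta>" and \<zeta>: "mod_weight \<zeta>"
    and \<omega>: "\<And>X Y. \<omega> (X, Y) = \<eta> (X - Y) / \<zeta> (X + Y)"
  obtains K where "K > 0" "\<And>S A B t. finite S \<Longrightarrow> S \<noteq> {} \<Longrightarrow> A \<ge> 1 \<Longrightarrow> B \<ge> 1 \<Longrightarrow> t > 0 \<Longrightarrow>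
      (\<And>d. real (card {s \<in> S. snd s - fst s = d}) \<le> A) \<Longrightarrow> real (card ((\<lambda>s. snd s - fst s) ` S)) \<le> B \<Longrightarrow>
      modulation_norm \<Phi> p q \<omega> (distr_of (lattice_sum b S (\<lambda>s. t * (\<zeta> (lattice_pt b (snd s), 0) / \<eta> (lattice_pt b (fst s), 0)))))
      \<le> ennreal (t * K * A powr recip p * B powr recip q)"
proof -
  have G: "gauss 1 \<in> (GS_half :: ('a \<times> 'a \<Rightarrow> complex) set)" by (rule GS_half_gauss) simp
  obtain C c where C: "C \<ge> 0" "c > 0" "\<And>X Y. cmod (symp_stft \<Phi> (distr_of (gauss 1)) X Y) \<le> C * exp (- c * ((norm X)\<^sup>2 + (norm Y)\<^sup>2))"
    by (rule stft_decay[OF \<Phi> G]) blast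
  have c2: "c / 2 > 0" using C(2) by simp
  obtain K1 where K1: "K1 > 0" "\<And>M N X Y. \<eta> (X - Y) / \<zeta> (X + Y) * (\<zeta> (M + N) / \<eta> (M - N)) \<le>
      K1 * exp (c / 2 * ((norm (X - M))\<^sup>2 + (norm (Y - N))\<^sup>2))"
    by (rule mod_weight_shift_bound[OF \<eta> \<zeta> c2]) blast
  let ?e = "(b, 0) :: 'a \<times> 'a"
  have e: "?e \<in> Basis" using b by (simp add: Basis_prod_def)
  let ?E = "\<lambda>x::'a \<times> 'a. exp (- (c / 2) * (norm x)\<^sup>2)"
  obtain K where K: "K > 0" "\<And>S A B T. finite S \<Longrightarrow> S \<noteq> {} \<Longrightarrow> A \<ge> 1 \<Longrightarrow> B \<ge> 1 \<Longrightarrow> T > 0 \<Longrightarrow>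
      (\<And>d. real (card {s \<in> S. snd s - fst s = d}) \<le> A) \<Longrightarrow> real (card ((\<lambda>s. snd s - fst s) ` S)) \<le> B \<Longrightarrow>
      Lp_norm q (\<lambda>Y. Lp_norm p (\<lambda>X. ennreal (T * (\<Sum>s\<in>S.
        ?E (X - (of_int (fst s + snd s) / 2) *\<^sub>R ?e) * ?E (Y - (of_int (snd s - fst s) / 2) *\<^sub>R ?e)))))
      \<le> ennreal (T * K * A powr recip p * B powr recip q)"
    by (rule lattice_mixed_norm[OF e c2 p q]) blast
  obtain W where W: "W \<in> borel_measurable borel" "\<And>p. W p \<ge> 0"
    "\<And>Y. AE X in lebesgue. W (X, Y) = \<eta> (X - Y) / \<zeta> (X + Y)"
    by (rule weight_borel[OF \<eta> \<zeta>]) blast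
  have W3: "AE X in lebesgue. W (X, Y) = \<omega> (X, Y)" for Y using W(3) by (simp add: \<omega>)
  have pos: "\<eta> x > 0" "\<zeta> x > 0" for x using \<eta> \<zeta> unfolding mod_weight_def by blast+
  have nn: "\<eta> x / \<zeta> y \<ge> 0" "\<zeta> y / \<eta> x \<ge> 0" for x y
    using less_imp_le[OF pos(1)] less_imp_le[OF pos(2)] by (intro divide_nonneg_nonneg; blast)+
  let ?P = "\<lambda>i. (lattice_pt b i, 0) :: 'a \<times> 'a"
  have "modulation_norm \<Phi> p q \<omega> (distr_of (lattice_sum b S (\<lambda>s. t * (\<zeta> (?P (snd s)) / \<eta> (?P (fst s))))))
      \<le> ennreal (t * ((C + 1) * K1 * K) * A powr recip p * B powr recip q)"
    if S: "finite S" "S \<noteq> {}" and A: "A \<ge> 1" and B: "B \<ge> 1" and t: "t > 0"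
      and cA: "\<And>d. real (card {s \<in> S. snd s - fst s = d}) \<le> A"
      and cB: "real (card ((\<lambda>s. snd s - fst s) ` S)) \<le> B" for S :: "(int \<times> int) set" and A B t :: real
  proof -
    define a where "a = lattice_sum b S (\<lambda>s. t * (\<zeta> (?P (snd s)) / \<eta> (?P (fst s))))"
    have aG: "a \<in> GS_half" unfolding a_def by (rule wig_sum_GS_half[OF S(1)])
    have ad: "distr_of a \<in> GS_half_dual" by (rule distr_of_GS_dual[OF aG])
    \<comment> \<open>\<open>C\<close> may be 0, whereas the lattice estimate needs a positive
      factor; hence \<open>C + 1\<close>.\<close>
    define T where "T = t * ((C + 1) * K1)"
    have T: "T > 0" using t C(1) K1(1) by (simp add: T_def)
    let ?h = "\<lambda>X Y. T * (\<Sum>s\<in>S. ?E (X - (of_int (fst s + snd s) / 2) *\<^sub>R ?e) * ?E (Y - (of_int (snd s - fst s) / 2) *\<^sub>R ?e))"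
    have le: "cmod (symp_stft \<Phi> (distr_of a) X Y) * (\<eta> (X - Y) / \<zeta> (X + Y)) \<le> ?h X Y" for X Y
    proof -
      have term_le: "t * (\<zeta> (?P (snd s)) / \<eta> (?P (fst s))) * cmod (symp_stft \<Phi> (distr_of (wig (lattice_pt b (fst s)) (lattice_pt b (snd s)))) X Y) * (\<eta> (X - Y) / \<zeta> (X + Y))
          \<le> T * (?E (X - (of_int (fst s + snd s) / 2) *\<^sub>R ?e) * ?E (Y - (of_int (snd s - fst s) / 2) *\<^sub>R ?e))" for s :: "int \<times> int"
      proof -
        let ?M = "(of_int (fst s + snd s) / 2) *\<^sub>R ?e" and ?N = "(of_int (snd s - fst s) / 2) *\<^sub>R ?e"
        let ?r = "(norm (X - ?M))\<^sup>2 + (norm (Y - ?N))\<^sup>2"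
        let ?V = "cmod (symp_stft \<Phi> (distr_of (wig (lattice_pt b (fst s)) (lattice_pt b (snd s)))) X Y)"
        have M: "((1/2) *\<^sub>R (lattice_pt b (fst s) + lattice_pt b (snd s)), 0) = ?M"
          and N: "((1/2) *\<^sub>R (lattice_pt b (snd s) - lattice_pt b (fst s)), 0) = ?N"
          by (simp_all add: lattice_pt_def flip: scaleR_add_left scaleR_diff_left)
        have MN: "?M - ?N = ?P (fst s)" "?M + ?N = ?P (snd s)"
          by (simp_all add: lattice_pt_def field_simps flip: scaleR_add_left scaleR_diff_left)
        have V: "?V \<le> (C + 1) * exp (- c * ?r)"
          using C(3)[of "X - ?M" "Y - ?N"] unfolding stft_wig[OF \<Phi>] M N
          by (rule order_trans) (auto intro: mult_right_mono)
        have w: "\<eta> (X - Y) / \<zeta> (X + Y) * (\<zeta> (?P (snd s)) / \<eta> (?P (fst s))) \<le> K1 * exp (c / 2 * ?r)"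
          using K1(2)[where M = ?M and N = ?N and X = X and Y = Y] unfolding MN .
        have "?V * (\<eta> (X - Y) / \<zeta> (X + Y) * (\<zeta> (?P (snd s)) / \<eta> (?P (fst s)))) \<le> ((C + 1) * exp (- c * ?r)) * (K1 * exp (c / 2 * ?r))"
          using C(1) by (intro mult_mono V w mult_nonneg_nonneg nn) auto
        also have "\<dots> = (C + 1) * K1 * (exp (- c * ?r) * exp (c / 2 * ?r))" by (simp only: mult_ac)
        also have "exp (- c * ?r) * exp (c / 2 * ?r) = ?E (X - ?M) * ?E (Y - ?N)"
          unfolding exp_add[symmetric] by (simp add: algebra_simps)
        finally have "t * (?V * (\<eta> (X - Y) / \<zeta> (X + Y) * (\<zeta> (?P (snd s)) / \<eta> (?P (fst s))))) \<le> t * ((C + 1) * K1 * (?E (X - ?M) * ?E (Y - ?N)))"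
          using t by (intro mult_left_mono) auto
        then show ?thesis unfolding T_def by (simp only: mult_ac)
      qed
      have "cmod (symp_stft \<Phi> (distr_of a) X Y) \<le> (\<Sum>s\<in>S. t * (\<zeta> (?P (snd s)) / \<eta> (?P (fst s))) *
          cmod (symp_stft \<Phi> (distr_of (wig (lattice_pt b (fst s)) (lattice_pt b (snd s)))) X Y))"
        unfolding a_def using t by (intro stft_wig_sum[OF \<Phi> S(1)] mult_nonneg_nonneg nn) auto
      then have "cmod (symp_stft \<Phi> (distr_of a) X Y) * (\<eta> (X - Y) / \<zeta> (X + Y)) \<le> (\<Sum>s\<in>S. t * (\<zeta> (?P (snd s)) / \<eta> (?P (fst s))) *
          cmod (symp_stft \<Phi> (distr_of (wig (lattice_pt b (fst s)) (lattice_pt b (snd s)))) X Y) * (\<eta> (X - Y) / \<zeta> (X + Y)))"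
        unfolding sum_distrib_right[symmetric] by (intro mult_right_mono nn)
      also have "\<dots> \<le> ?h X Y" unfolding sum_distrib_left by (rule sum_mono) (rule term_le)
      finally show ?thesis .
    qed
    have hm: "(\<lambda>(X, Y). ennreal (?h X Y)) \<in> borel_measurable borel"
    proof -
      have "(\<lambda>(X, Y). ennreal (?h X Y)) \<in> borel_measurable (borel \<Otimes>\<^sub>M borel)" by measurable
      then show ?thesis by (simp add: borel_prod)
    qed
    have "modulation_norm \<Phi> p q \<omega> (distr_of a) \<le> Lp_norm q (\<lambda>Y. Lp_norm p (\<lambda>X. ennreal (?h X Y)))"
      unfolding modulation_norm_borel(1)[OF \<Phi> ad W(1,2) W3]
    proof (rule Lp_norm_mono[OF q Lp_norm_section_measurable'[OF modulation_norm_borel(2)[OF \<Phi> ad W(1,2) W3] p]])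
      fix Y
      show "Lp_norm p (\<lambda>X. ennreal (cmod (symp_stft \<Phi> (distr_of a) X Y) * W (X, Y))) \<le> Lp_norm p (\<lambda>X. ennreal (?h X Y))"
      proof (rule Lp_norm_mono_AE[OF p section_measurable[OF modulation_norm_borel(2)[OF \<Phi> ad W(1,2) W3]] section_measurable[OF hm]])
        show "AE X in lebesgue. ennreal (cmod (symp_stft \<Phi> (distr_of a) X Y) * W (X, Y)) \<le> ennreal (?h X Y)"
          using W(3)[of Y]
        proof eventually_elim
          case (elim X)
          show ?case unfolding elim by (rule ennreal_leI[OF le])
        qed
      qed
    qed
    also have "\<dots> \<le> ennreal (T * K * A powr recip p * B powr recip q)" by (rule K(2)[OF S A B T cA cB])
    finally show ?thesis unfolding a_def T_def by (simp only: mult.assoc)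
  qed
  with C(1) K1(1) K(1) show ?thesis using that[of "(C + 1) * K1 * K"] by simp
qed

section \<open>Duality of modulation norms\<close>

lemma mixed_norm_hoelder:
  fixes f g :: "'m::euclidean_space \<Rightarrow> 'n::euclidean_space \<Rightarrow> ennreal"
  assumes p: "1 \<le> p" and q: "1 \<le> q"
    and f: "(\<lambda>(X, Y). f X Y) \<in> borel_measurable borel" and g: "(\<lambda>(X, Y). g X Y) \<in> borel_measurable borel"
  shows "(\<integral>\<^sup>+Y. (\<integral>\<^sup>+X. f X Y * g X Y \<partial>lebesgue) \<partial>lebesgue) \<le>
    Lp_norm q (\<lambda>Y. Lp_norm p (\<lambda>X. f X Y)) * Lp_norm (conj_exponent q) (\<lambda>Y. Lp_norm (conj_exponent p) (\<lambda>X. g X Y))"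
proof -
  have "(\<integral>\<^sup>+Y. (\<integral>\<^sup>+X. f X Y * g X Y \<partial>lebesgue) \<partial>lebesgue) \<le>
      (\<integral>\<^sup>+Y. Lp_norm p (\<lambda>X. f X Y) * Lp_norm (conj_exponent p) (\<lambda>X. g X Y) \<partial>lebesgue)"
    by (intro nn_integral_mono Lp_norm_hoelder[OF p section_measurable[OF f] section_measurable[OF g]])
  also have "\<dots> \<le> Lp_norm q (\<lambda>Y. Lp_norm p (\<lambda>X. f X Y)) * Lp_norm (conj_exponent q) (\<lambda>Y. Lp_norm (conj_exponent p) (\<lambda>X. g X Y))"
    by (rule Lp_norm_hoelder[OF q Lp_norm_section_measurable'[OF f p] Lp_norm_section_measurable'[OF g conj_exponent_ge_1[OF p]]])
  finally show ?thesis .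
qed

text \<open>The orthogonality relation combined with Hoelder in both variables; inserting
  \<open>\<omega>\<close> and its reciprocal changes nothing pointwise. The order of integration is
  exchanged because the norms take the \<open>X\<close> integral first. This bounds a pairing by the
  norm in the target space of the product.\<close>

lemma modulation_duality:
  fixes \<Phi> f b :: "'a::euclidean_space \<times> 'a \<Rightarrow> complex" and \<eta> \<zeta> :: "'a \<times> 'a \<Rightarrow> real"
  assumes \<Phi>: "\<Phi> \<in> GS_half" "\<Phi> \<noteq> (\<lambda>_. 0)" and p: "1 \<le> p" and q: "1 \<le> q"
    and \<eta>: "mod_weight \<eta>" and \<zeta>: "mod_weight \<zeta>" and f: "f \<in> GS_half" and b: "b \<in> GS_half"
    and \<omega>: "\<And>X Y. \<omega> (X, Y) = \<eta> (X - Y) / \<zeta> (X + Y)"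
  shows "ennreal ((LINT Z|lborel. (cmod (\<Phi> (- Z)))\<^sup>2) * cmod (LINT Z|lborel. f Z * cnj (b Z))) \<le>
    modulation_norm \<Phi> p q \<omega> (distr_of b) * modulation_norm \<Phi> (conj_exponent p) (conj_exponent q) (\<lambda>Z. 1 / \<omega> Z) (distr_of f)"
proof -
  obtain W where W: "W \<in> borel_measurable borel" "\<And>p. W p \<ge> 0"
    "\<And>Y. AE X in lebesgue. W (X, Y) = \<eta> (X - Y) / \<zeta> (X + Y)"
    by (rule weight_borel[OF \<eta> \<zeta>]) blast
  obtain U where U: "U \<in> borel_measurable borel" "\<And>p. U p \<ge> 0"
    "\<And>Y. AE X in lebesgue. U (X, Y) = (1 / \<eta> (X - Y)) / (1 / \<zeta> (X + Y))"
    by (rule weight_borel[OF mod_weight_inverse[OF \<eta>] mod_weight_inverse[OF \<zeta>]]) blast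
  have W3: "AE X in lebesgue. W (X, Y) = \<omega> (X, Y)" for Y using W(3) by (simp add: \<omega>)
  have U3: "AE X in lebesgue. U (X, Y) = 1 / \<omega> (X, Y)" for Y using U(3) by (simp add: \<omega>)
  have pos: "\<omega> (X, Y) > 0" for X Y
  proof -
    have "\<eta> (X - Y) > 0" "\<zeta> (X + Y) > 0" using \<eta> \<zeta> unfolding mod_weight_def by blast+
    then show ?thesis by (simp add: \<omega>)
  qed
  let ?V = "\<lambda>f X Y. cmod (symp_stft \<Phi> (distr_of f) X Y)"
  note fd = distr_of_GS_dual[OF f] and bd = distr_of_GS_dual[OF b]
  note mb = modulation_norm_borel[OF \<Phi>(1) bd W(1,2) W3] and mf = modulation_norm_borel[OF \<Phi>(1) fd U(1,2) U3]
  have k: "(\<lambda>(X, Y). ennreal (?V f X Y * ?V b X Y)) \<in> borel_measurable (lborel \<Otimes>\<^sub>M lborel)"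
  proof -
    have "(\<lambda>(X, Y). symp_stft \<Phi> (distr_of f) X Y) \<in> borel_measurable borel" "(\<lambda>(X, Y). symp_stft \<Phi> (distr_of b) X Y) \<in> borel_measurable borel"
      using symp_stft_continuous[OF \<Phi>(1) fd] symp_stft_continuous[OF \<Phi>(1) bd] by (auto intro: borel_measurable_continuous_onI)
    then have "(\<lambda>(X, Y). ennreal (?V f X Y * ?V b X Y)) \<in> borel_measurable borel"
      unfolding split_def by measurable
    then show ?thesis unfolding lborel_prod by simp
  qed
  have "ennreal ((LINT Z|lborel. (cmod (\<Phi> (- Z)))\<^sup>2) * cmod (LINT Z|lborel. f Z * cnj (b Z))) \<le>
      (\<integral>\<^sup>+X. (\<integral>\<^sup>+Y. ennreal (?V f X Y * ?V b X Y) \<partial>lborel) \<partial>lborel)"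
    by (rule stft_pairing[OF \<Phi> f b])
  also have "\<dots> = (\<integral>\<^sup>+Y. (\<integral>\<^sup>+X. ennreal (?V f X Y * ?V b X Y) \<partial>lborel) \<partial>lborel)"
    using lborel_pair.Fubini'[OF k] by (simp only: case_prod_conv)
  also have "\<dots> = (\<integral>\<^sup>+Y. (\<integral>\<^sup>+X. ennreal (?V f X Y * ?V b X Y) \<partial>lebesgue) \<partial>lebesgue)"
    by (simp only: nn_integral_completion)
  also have "\<dots> = (\<integral>\<^sup>+Y. (\<integral>\<^sup>+X. ennreal (?V b X Y * W (X, Y)) * ennreal (?V f X Y * U (X, Y)) \<partial>lebesgue) \<partial>lebesgue)"
  proof (rule nn_integral_cong)
    fix Y
    show "(\<integral>\<^sup>+X. ennreal (?V f X Y * ?V b X Y) \<partial>lebesgue) = (\<integral>\<^sup>+X. ennreal (?V b X Y * W (X, Y)) * ennreal (?V f X Y * U (X, Y)) \<partial>lebesgue)"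
    proof (rule nn_integral_cong_AE)
      show "AE X in lebesgue. ennreal (?V f X Y * ?V b X Y) = ennreal (?V b X Y * W (X, Y)) * ennreal (?V f X Y * U (X, Y))"
        using W3[of Y] U3[of Y]
      proof eventually_elim
        case (elim X)
        have "ennreal (?V b X Y * \<omega> (X, Y)) * ennreal (?V f X Y * (1 / \<omega> (X, Y))) = ennreal ((?V b X Y * \<omega> (X, Y)) * (?V f X Y * (1 / \<omega> (X, Y))))"
          using less_imp_le[OF pos[of X Y]] by (intro ennreal_mult[symmetric]) auto
        also have "(?V b X Y * \<omega> (X, Y)) * (?V f X Y * (1 / \<omega> (X, Y))) = ?V f X Y * ?V b X Y"
          using pos[of X Y] by simp
        finally show ?case unfolding elim by (rule sym)
      qed
    qed
  qed
  also have "\<dots> \<le> Lp_norm q (\<lambda>Y. Lp_norm p (\<lambda>X. ennreal (?V b X Y * W (X, Y)))) *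
      Lp_norm (conj_exponent q) (\<lambda>Y. Lp_norm (conj_exponent p) (\<lambda>X. ennreal (?V f X Y * U (X, Y))))"
    by (rule mixed_norm_hoelder[OF p q mb(2) mf(2)])
  finally show ?thesis unfolding mb(1) mf(1) .
qed

subsection \<open>Continuity at the origin and the counting inequality\<close>

lemma conj_recip:
  assumes "1 \<le> q"
  shows "recip (conj_exponent q) = 1 - recip q"
proof -
  have "enn2real (1 / q + 1 / conj_exponent q) = 1" using conj_exponent_sum[OF assms] by simp
  moreover have "1 / q < top" "1 / conj_exponent q < top"
    using conj_exponent_sum[OF assms] by (auto simp: less_top[symmetric])
  ultimately show ?thesis unfolding recip_def by (simp add: enn2real_plus)
qed

lemma recip_bounds:
  assumes "1 \<le> p"
  shows "0 \<le> recip p" "recip p \<le> 1"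
proof -
  show "0 \<le> recip p" by (simp add: recip_def)
  have "0 \<le> recip (conj_exponent p)" by (simp add: recip_def)
  then show "recip p \<le> 1" using conj_recip[OF assms] by simp
qed

lemma modulation_norm_zero:
  fixes \<Phi> :: "'a::euclidean_space \<times> 'a \<Rightarrow> complex"
  assumes \<Phi>: "\<Phi> \<in> GS_half" and "1 \<le> p" "1 \<le> q"
  shows "modulation_norm \<Phi> p q \<omega> (distr_of (\<lambda>_. 0)) = 0"
proof -
  have "symp_stft \<Phi> (distr_of (\<lambda>_. 0)) X Y = 0" for X Y
    unfolding symp_stft_distr_of[OF \<Phi> GS_half_zero] by (simp add: symp_fourier_def)
  then show ?thesis using assms by (simp add: modulation_norm_def Lp_norm_zero)
qed

text \<open>\<open>T\<close> is a bare continuous map, so only its behaviour near the origin is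
  exploited: the preimage of the unit ball contains a product of balls around 0. Homogeneity is
  recovered later by scaling the test symbols. The product enters as an abstract \<open>B\<close>
  with \<open>B 0 0 = 0\<close>, which makes the origin a point mapped to the origin.\<close>

lemma bilinear_continuous_bounded:
  fixes \<Phi> :: "'a::euclidean_space \<times> 'a \<Rightarrow> complex" and \<omega> :: "nat \<Rightarrow> ('a \<times> 'a) \<times> ('a \<times> 'a) \<Rightarrow> real"
    and p q :: "nat \<Rightarrow> ennreal"
  assumes \<Phi>: "\<Phi> \<in> GS_half" "\<Phi> \<noteq> (\<lambda>_. 0)" and p: "\<And>j. j < 3 \<Longrightarrow> 1 \<le> p j" and q: "\<And>j. j < 3 \<Longrightarrow> 1 \<le> q j"
    and \<eta>: "\<And>j. j < 3 \<Longrightarrow> mod_weight (\<eta> j)" and \<zeta>: "\<And>j. j < 3 \<Longrightarrow> mod_weight (\<zeta> j)"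
    and \<omega>: "\<And>j X Y. j < 3 \<Longrightarrow> \<omega> j (X, Y) = \<eta> j (X - Y) / \<zeta> j (X + Y)"
    and T: "continuous_map (prod_topology (modulation_topology \<Phi> (p 1) (q 1) (\<omega> 1)) (modulation_topology \<Phi> (p 2) (q 2) (\<omega> 2)))
        (modulation_topology \<Phi> (p 0) (q 0) (\<omega> 0)) T"
    and TB: "\<And>a b. a \<in> GS_half \<Longrightarrow> b \<in> GS_half \<Longrightarrow> T (distr_of a, distr_of b) = distr_of (B a b)"
    and B0: "B (\<lambda>_. 0) (\<lambda>_. 0) = (\<lambda>_. 0)"
  obtains \<delta> :: real where "\<delta> > 0" "\<And>a b. a \<in> GS_half \<Longrightarrow> b \<in> GS_half \<Longrightarrow>
    modulation_norm \<Phi> (p 1) (q 1) (\<omega> 1) (distr_of a) < ennreal \<delta> \<Longrightarrow>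
    modulation_norm \<Phi> (p 2) (q 2) (\<omega> 2) (distr_of b) < ennreal \<delta> \<Longrightarrow>
    modulation_norm \<Phi> (p 0) (q 0) (\<omega> 0) (distr_of (B a b)) \<le> 1"
proof -
  let ?N = "\<lambda>j. modulation_norm \<Phi> (p j) (q j) (\<omega> j)"
  let ?M = "\<lambda>j. modulation_space \<Phi> (p j) (q j) (\<omega> j)"
  let ?d = "\<lambda>j a b. enn2real (?N j (\<lambda>\<phi>. a \<phi> - b \<phi>))"
  let ?\<tau> = "\<lambda>j. Metric_space.mtopology (?M j) (?d j)"
  let ?o = "distr_of (\<lambda>_. 0) :: ('a \<times> 'a) distr"
  have ms: "Metric_space (?M j) (?d j)" if "j < 3" for j
    by (rule modulation_metric[OF \<Phi> p[OF that] q[OF that] \<eta>[OF that] \<zeta>[OF that] \<omega>[OF that]])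
  have oz: "?o = (\<lambda>_. 0)" by (auto simp: distr_of_def fun_eq_iff)
  have d0: "?d j ?o a = enn2real (?N j a)" if "j < 3" for j a
  proof -
    have "?d j ?o a = ?d j a ?o" by (rule Metric_space.commute[OF ms[OF that]])
    then show ?thesis unfolding oz by simp
  qed
  have M0: "?o \<in> ?M j" if "j < 3" for j
    using modulation_norm_zero[OF \<Phi>(1) p[OF that] q[OF that]] distr_of_GS_dual[OF GS_half_zero]
    by (simp add: modulation_space_def)
  have j3: "0 < (3::nat)" "1 < (3::nat)" "2 < (3::nat)" by simp_all
  have T0: "T (?o, ?o) = ?o" using TB[OF GS_half_zero GS_half_zero] B0 by simp
  have in0: "(?o, ?o) \<in> topspace (prod_topology (?\<tau> 1) (?\<tau> 2))"
    unfolding topspace_prod_topology Metric_space.topspace_mtopology[OF ms[OF j3(2)]] Metric_space.topspace_mtopology[OF ms[OF j3(3)]]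
    using M0[OF j3(2)] M0[OF j3(3)] by blast
  note TT = T[unfolded modulation_topology_def Metric_space.continuous_map_to_metric[OF ms[OF j3(1)]]]
  obtain O' where O': "openin (prod_topology (?\<tau> 1) (?\<tau> 2)) O'" "(?o, ?o) \<in> O'"
    "\<And>z. z \<in> O' \<Longrightarrow> T z \<in> Metric_space.mball (?M 0) (?d 0) ?o 1"
    using TT[rule_format, OF in0 zero_less_one] unfolding T0 by blast
  obtain U V where UV: "openin (?\<tau> 1) U" "openin (?\<tau> 2) V" "?o \<in> U" "?o \<in> V" "U \<times> V \<subseteq> O'"
    using O'(1)[unfolded openin_prod_topology_alt, rule_format, OF O'(2)] by blast
  obtain r where r: "r > 0" "Metric_space.mball (?M 1) (?d 1) ?o r \<subseteq> U"
    using UV(1)[unfolded Metric_space.openin_mtopology[OF ms[OF j3(2)]], THEN conjunct2, rule_format, OF UV(3)] by blast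
  obtain s where s: "s > 0" "Metric_space.mball (?M 2) (?d 2) ?o s \<subseteq> V"
    using UV(2)[unfolded Metric_space.openin_mtopology[OF ms[OF j3(3)]], THEN conjunct2, rule_format, OF UV(4)] by blast
  have ball: "distr_of a \<in> Metric_space.mball (?M j) (?d j) ?o t"
    if "j < 3" "a \<in> GS_half" "?N j (distr_of a) < ennreal t" for j a t
  proof -
    have "?N j (distr_of a) < \<infinity>" using that(3) by (rule less_trans) simp
    then have "distr_of a \<in> ?M j" using distr_of_GS_dual[OF that(2)] by (simp add: modulation_space_def)
    moreover have "?d j ?o (distr_of a) < t"
      unfolding d0[OF that(1)] using that(3) by (cases "?N j (distr_of a)") (auto simp: ennreal_less_iff)
    ultimately show ?thesis
      unfolding Metric_space.in_mball[OF ms[OF that(1)]] using M0[OF that(1)] by blast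
  qed
  show ?thesis
  proof (rule that[of "min r s"])
    show "min r s > 0" using r s by simp
    fix a b assume ab: "a \<in> GS_half" "b \<in> GS_half" "?N 1 (distr_of a) < ennreal (min r s)" "?N 2 (distr_of b) < ennreal (min r s)"
    have 1: "?N 1 (distr_of a) < ennreal r"
      by (rule less_le_trans[OF ab(3)]) (simp add: ennreal_leI)
    have 2: "?N 2 (distr_of b) < ennreal s"
      by (rule less_le_trans[OF ab(4)]) (simp add: ennreal_leI)
    have "(distr_of a, distr_of b) \<in> U \<times> V"
      using subsetD[OF r(2) ball[OF j3(2) ab(1) 1]] subsetD[OF s(2) ball[OF j3(3) ab(2) 2]] by (rule SigmaI)
    then have "distr_of (B a b) \<in> Metric_space.mball (?M 0) (?d 0) ?o 1"
      unfolding TB[OF ab(1,2), symmetric] by (rule O'(3)[OF subsetD[OF UV(5)]])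
    then have mb: "?o \<in> ?M 0 \<and> distr_of (B a b) \<in> ?M 0 \<and> ?d 0 ?o (distr_of (B a b)) < 1"
      unfolding Metric_space.in_mball[OF ms[OF j3(1)]] .
    have "?N 0 (distr_of (B a b)) < \<infinity>"
      using mb[THEN conjunct2, THEN conjunct1] unfolding modulation_space_def by simp
    moreover have "enn2real (?N 0 (distr_of (B a b))) < 1"
      using mb[THEN conjunct2, THEN conjunct2] unfolding d0[OF j3(1)] .
    ultimately show "?N 0 (distr_of (B a b)) \<le> 1"
      by (cases "?N 0 (distr_of (B a b))") (auto simp: ennreal_le_1)
  qed
qed

text \<open>Triangles on vertices i, j, k with edges (i, j) in \<open>S1\<close>, (j, k) in
  \<open>S2\<close> and (i, k) in \<open>S0\<close>: the index combinations for which a product of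
  two rank one symbols matches the third test symbol.\<close>

definition triples :: "(int \<times> int) set \<Rightarrow> (int \<times> int) set \<Rightarrow> (int \<times> int) set \<Rightarrow> (((int \<times> int) \<times> (int \<times> int)) \<times> (int \<times> int)) set" where
  "triples S1 S2 S0 = {((s, t), r). s \<in> S1 \<and> t \<in> S2 \<and> r \<in> S0 \<and> snd s = fst t \<and> fst r = fst s \<and> snd r = snd t}"

text \<open>The parameters \<open>a\<close> and \<open>b\<close> record whether the fibres of \<open>(i, j) \<mapsto> j - i\<close> on \<open>S\<close> and its image grow
  linearly with \<open>N\<close> (value \<open>1\<close>) or stay bounded (value \<open>0\<close>).\<close>

definition shape :: "nat \<Rightarrow> (int \<times> int) set \<Rightarrow> real \<Rightarrow> real \<Rightarrow> bool" where
  "shape N S a b \<longleftrightarrow> finite S \<and> S \<noteq> {} \<and> (\<forall>d. real (card {s \<in> S. snd s - fst s = d}) \<le> real N powr a) \<and>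
     real (card ((\<lambda>s. snd s - fst s) ` S)) \<le> 2 * real N powr b"

lemma lattice_sum_small:
  fixes \<Phi> :: "'a::euclidean_space \<times> 'a \<Rightarrow> complex" and \<eta> \<zeta> :: "'a \<times> 'a \<Rightarrow> real" and b :: 'a
  assumes \<Phi>: "\<Phi> \<in> GS_half" and p: "1 \<le> p" and q: "1 \<le> q" and b: "b \<in> Basis"
    and \<eta>: "mod_weight \<eta>" and \<zeta>: "mod_weight \<zeta>"
    and \<omega>: "\<And>X Y. \<omega> (X, Y) = \<eta> (X - Y) / \<zeta> (X + Y)"
  obtains K where "K > 0" "\<And>N S \<alpha> \<beta> t. N \<ge> 1 \<Longrightarrow> shape N S \<alpha> \<beta> \<Longrightarrow> \<alpha> \<ge> 0 \<Longrightarrow> \<beta> \<ge> 0 \<Longrightarrow> t > 0 \<Longrightarrow>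
      modulation_norm \<Phi> p q \<omega> (distr_of (lattice_sum b S (\<lambda>s. t * (\<zeta> (lattice_pt b (snd s), 0) / \<eta> (lattice_pt b (fst s), 0)))))
      \<le> ennreal (t * (K * real N powr (\<alpha> * recip p + \<beta> * recip q)))"
proof -
  obtain K where K: "K > 0" "\<And>S A B t. finite S \<Longrightarrow> S \<noteq> {} \<Longrightarrow> A \<ge> 1 \<Longrightarrow> B \<ge> 1 \<Longrightarrow> t > 0 \<Longrightarrow>
      (\<And>d. real (card {s \<in> S. snd s - fst s = d}) \<le> A) \<Longrightarrow> real (card ((\<lambda>s. snd s - fst s) ` S)) \<le> B \<Longrightarrow>
      modulation_norm \<Phi> p q \<omega> (distr_of (lattice_sum b S (\<lambda>s. t * (\<zeta> (lattice_pt b (snd s), 0) / \<eta> (lattice_pt b (fst s), 0)))))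
      \<le> ennreal (t * K * A powr recip p * B powr recip q)"
    by (rule modulation_norm_lattice_sum[OF \<Phi> p q b \<eta> \<zeta> \<omega>]) blast
  show ?thesis
  proof (rule that[of "K * 2 powr recip q"])
    show "K * 2 powr recip q > 0" using K(1) by simp
    fix N :: nat and S :: "(int \<times> int) set" and \<alpha> \<beta> t :: real
    assume N: "N \<ge> 1" and S: "shape N S \<alpha> \<beta>" and \<alpha>: "\<alpha> \<ge> 0" and \<beta>: "\<beta> \<ge> 0" and t: "t > 0"
    have 1: "real N powr \<alpha> \<ge> 1" "real N powr \<beta> \<ge> 1" using N \<alpha> \<beta> by (auto intro: ge_one_powr_ge_zero)
    have "modulation_norm \<Phi> p q \<omega> (distr_of (lattice_sum b S (\<lambda>s. t * (\<zeta> (lattice_pt b (snd s), 0) / \<eta> (lattice_pt b (fst s), 0)))))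
      \<le> ennreal (t * K * (real N powr \<alpha>) powr recip p * (2 * real N powr \<beta>) powr recip q)"
      using S 1 t unfolding shape_def by (intro K(2)) auto
    also have "t * K * (real N powr \<alpha>) powr recip p * (2 * real N powr \<beta>) powr recip q =
        t * (K * 2 powr recip q * real N powr (\<alpha> * recip p + \<beta> * recip q))"
      by (simp add: powr_mult powr_powr powr_add mult_ac)
    finally show "modulation_norm \<Phi> p q \<omega> (distr_of (lattice_sum b S (\<lambda>s. t * (\<zeta> (lattice_pt b (snd s), 0) / \<eta> (lattice_pt b (fst s), 0)))))
      \<le> ennreal (t * (K * 2 powr recip q * real N powr (\<alpha> * recip p + \<beta> * recip q)))" .
  qed
qed

lemma finite_triples: "finite S1 \<Longrightarrow> finite S2 \<Longrightarrow> finite S0 \<Longrightarrow> finite (triples S1 S2 S0)"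
  by (rule finite_subset[of _ "(S1 \<times> S2) \<times> S0"]) (auto simp: triples_def)

text \<open>The pairing of the product of two lattice sums with a third is at least a constant times
  the number of triangles, by positivity. From above it is controlled by continuity of the product
  and duality, hence by the three norms, each of which is a power of \<open>N\<close>.\<close>

lemma counting_inequality:
  fixes \<Phi> :: "'a::euclidean_space \<times> 'a \<Rightarrow> complex" and \<theta> :: "nat \<Rightarrow> 'a \<times> 'a \<Rightarrow> real"
    and \<omega> :: "nat \<Rightarrow> ('a \<times> 'a) \<times> ('a \<times> 'a) \<Rightarrow> real" and p q :: "nat \<Rightarrow> ennreal"
  assumes p: "\<And>j. j < 3 \<Longrightarrow> 1 \<le> p j" and q: "\<And>j. j < 3 \<Longrightarrow> 1 \<le> q j" and \<theta>: "\<And>j. j < 3 \<Longrightarrow> mod_weight (\<theta> j)"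
    and \<omega>: "\<And>X Y. \<omega> 0 (X, Y) = \<theta> 0 (X + Y) / \<theta> 2 (X - Y)" "\<And>X Y. \<omega> 1 (X, Y) = \<theta> 2 (X - Y) / \<theta> 1 (X + Y)"
      "\<And>X Y. \<omega> 2 (X, Y) = \<theta> 1 (X - Y) / \<theta> 0 (X + Y)"
    and \<Phi>: "\<Phi> \<in> GS_half" "\<Phi> \<noteq> (\<lambda>_. 0)"
    and T: "continuous_map
            (prod_topology (modulation_topology \<Phi> (p 1) (q 1) (\<omega> 1)) (modulation_topology \<Phi> (p 2) (q 2) (\<omega> 2)))
            (modulation_topology \<Phi> (conj_exponent (p 0)) (conj_exponent (q 0)) (\<lambda>Z. 1 / \<omega> 0 Z)) T"
    and TW: "\<And>a b. a \<in> GS_half \<Longrightarrow> b \<in> GS_half \<Longrightarrow> T (distr_of a, distr_of b) = distr_of (weyl_prod a b)"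
  obtains C where "\<forall>N S \<alpha> \<beta>. N \<ge> 1 \<longrightarrow> (\<forall>j<3. shape N (S j) (\<alpha> j) (\<beta> j) \<and> \<alpha> j \<ge> 0 \<and> \<beta> j \<ge> 0) \<longrightarrow>
      real (card (triples (S 1) (S 2) (S 0))) \<le> C * real N powr (\<Sum>j<3. \<alpha> j * recip (p j) + \<beta> j * recip (q j))"
proof -
  obtain b :: 'a where b: "b \<in> Basis" using nonempty_Basis by blast
  have j3: "0 < (3::nat)" "1 < (3::nat)" "2 < (3::nat)" by simp_all
  note p0 = p[OF j3(1)] and q0 = q[OF j3(1)] and p1 = p[OF j3(2)] and q1 = q[OF j3(2)] and p2 = p[OF j3(3)] and q2 = q[OF j3(3)]
  note th0 = \<theta>[OF j3(1)] and th1 = \<theta>[OF j3(2)] and th2 = \<theta>[OF j3(3)]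
  have pos: "\<theta> j x > 0" if "j < 3" for j x using \<theta>[OF that] unfolding mod_weight_def by blast
  note ps = pos[OF j3(1)] pos[OF j3(2)] pos[OF j3(3)]
  \<comment> \<open>\<open>\<omega> 0\<close> takes the form of a weight at \<open>X - Y\<close>
    over a weight at \<open>X + Y\<close> only with reciprocals; this form is needed for the third
    test symbol.\<close>
  define i0 where "i0 = (\<lambda>x. 1 / \<theta> 2 x)"
  define z0 where "z0 = (\<lambda>x. 1 / \<theta> 0 x)"
  have iz: "mod_weight i0" "mod_weight z0" unfolding i0_def z0_def by (rule mod_weight_inverse[OF th2], rule mod_weight_inverse[OF th0])
  have \<omega>0: "\<omega> 0 (X, Y) = i0 (X - Y) / z0 (X + Y)" for X Y by (simp add: \<omega>(1) i0_def z0_def)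
  \<comment> \<open>The target weight is \<open>1 / \<omega> 0\<close>, equal to
    \<open>\<theta> 2 (X - Y) / \<theta> 0 (X + Y)\<close>, so all three spaces fit one
    pattern.\<close>
  define \<omega>' where "\<omega>' j = (if j = 0 then (\<lambda>Z. 1 / \<omega> 0 Z) else \<omega> j)" for j
  have zero: "weyl_prod (\<lambda>_. 0) (\<lambda>_. 0) = (\<lambda>_::'a \<times> 'a. 0)"
  proof (rule weyl_prod_eq[OF GS_half_zero])
    show "weyl_op (\<lambda>_. 0) f = weyl_op (\<lambda>_::'a \<times> 'a. 0) (weyl_op (\<lambda>_. 0) f)" for f :: "'a \<Rightarrow> complex"
      by (rule ext) (simp add: weyl_op_def case_prod_unfold)
  qed
  obtain \<delta> :: real where \<delta>: "\<delta> > 0" "\<And>a b. a \<in> GS_half \<Longrightarrow> b \<in> GS_half \<Longrightarrow>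
    modulation_norm \<Phi> (p 1) (q 1) (\<omega> 1) (distr_of a) < ennreal \<delta> \<Longrightarrow>
    modulation_norm \<Phi> (p 2) (q 2) (\<omega> 2) (distr_of b) < ennreal \<delta> \<Longrightarrow>
    modulation_norm \<Phi> (conj_exponent (p 0)) (conj_exponent (q 0)) (\<lambda>Z. 1 / \<omega> 0 Z) (distr_of (weyl_prod a b)) \<le> 1"
  proof (rule bilinear_continuous_bounded[where p = "\<lambda>j. if j = 0 then conj_exponent (p 0) else p j"
        and q = "\<lambda>j. if j = 0 then conj_exponent (q 0) else q j" and \<omega> = \<omega>'
        and \<eta> = "\<lambda>j. if j = 2 then \<theta> 1 else \<theta> 2" and \<zeta> = "\<lambda>j. if j = 1 then \<theta> 1 else \<theta> 0" and T = T and B = weyl_prod, OF \<Phi>])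
    show "\<omega>' j (X, Y) = (if j = 2 then \<theta> 1 else \<theta> 2) (X - Y) / (if j = 1 then \<theta> 1 else \<theta> 0) (X + Y)" if "j < 3" for j X Y
    proof -
      have "j = 0 \<or> j = 1 \<or> j = 2" using that by auto
      then show ?thesis by (auto simp: \<omega>'_def \<omega>(1,3) \<omega>(2)[unfolded One_nat_def])
    qed
  qed (use p q th0 th1 th2 T TW zero conj_exponent_ge_1[OF p0] conj_exponent_ge_1[OF q0] in \<open>auto simp: \<omega>'_def\<close>)
  obtain K1 where K1: "K1 > 0" "\<And>N S \<alpha> \<beta> t. N \<ge> 1 \<Longrightarrow> shape N S \<alpha> \<beta> \<Longrightarrow> \<alpha> \<ge> 0 \<Longrightarrow> \<beta> \<ge> 0 \<Longrightarrow> t > 0 \<Longrightarrow>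
      modulation_norm \<Phi> (p 1) (q 1) (\<omega> 1) (distr_of (lattice_sum b S (\<lambda>s. t * (\<theta> 1 (lattice_pt b (snd s), 0) / \<theta> 2 (lattice_pt b (fst s), 0)))))
      \<le> ennreal (t * (K1 * real N powr (\<alpha> * recip (p 1) + \<beta> * recip (q 1))))"
    by (rule lattice_sum_small[OF \<Phi>(1) p1 q1 b th2 th1 \<omega>(2)]) blast
  obtain K2 where K2: "K2 > 0" "\<And>N S \<alpha> \<beta> t. N \<ge> 1 \<Longrightarrow> shape N S \<alpha> \<beta> \<Longrightarrow> \<alpha> \<ge> 0 \<Longrightarrow> \<beta> \<ge> 0 \<Longrightarrow> t > 0 \<Longrightarrow>
      modulation_norm \<Phi> (p 2) (q 2) (\<omega> 2) (distr_of (lattice_sum b S (\<lambda>s. t * (\<theta> 0 (lattice_pt b (snd s), 0) / \<theta> 1 (lattice_pt b (fst s), 0)))))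
      \<le> ennreal (t * (K2 * real N powr (\<alpha> * recip (p 2) + \<beta> * recip (q 2))))"
    by (rule lattice_sum_small[OF \<Phi>(1) p2 q2 b th1 th0 \<omega>(3)]) blast
  obtain K0 where K0: "K0 > 0" "\<And>N S \<alpha> \<beta> t. N \<ge> 1 \<Longrightarrow> shape N S \<alpha> \<beta> \<Longrightarrow> \<alpha> \<ge> 0 \<Longrightarrow> \<beta> \<ge> 0 \<Longrightarrow> t > 0 \<Longrightarrow>
      modulation_norm \<Phi> (p 0) (q 0) (\<omega> 0) (distr_of (lattice_sum b S (\<lambda>s. t * (z0 (lattice_pt b (snd s), 0) / i0 (lattice_pt b (fst s), 0)))))
      \<le> ennreal (t * (K0 * real N powr (\<alpha> * recip (p 0) + \<beta> * recip (q 0))))"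
    by (rule lattice_sum_small[OF \<Phi>(1) p0 q0 b iz \<omega>0]) blast
  define \<kappa> where "\<kappa> = (LINT Z|lborel. (cmod (\<Phi> (- Z)))\<^sup>2)"
  have \<kappa>: "\<kappa> > 0" unfolding \<kappa>_def by (rule window_mass_pos(1)[OF \<Phi>])
  define \<rho> where "\<rho> = wig_const TYPE('a) * sqrt pi ^ DIM('a) * sqrt (pi / 2) ^ DIM('a \<times> 'a)"
  have \<rho>: "\<rho> > 0" using wig_const_pos[where 'a='a] by (simp add: \<rho>_def)
  define C where "C = 4 * (K0 * K1 * K2) / (\<delta>\<^sup>2 * \<kappa> * \<rho>)"
  have "real (card (triples (S 1) (S 2) (S 0))) \<le> C * real N powr (\<Sum>j<3. \<alpha> j * recip (p j) + \<beta> j * recip (q j))"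
    if N: "N \<ge> 1" and hyp: "\<forall>j<3. shape N (S j) (\<alpha> j) (\<beta> j) \<and> \<alpha> j \<ge> 0 \<and> \<beta> j \<ge> 0"
    for N :: nat and S :: "nat \<Rightarrow> (int \<times> int) set" and \<alpha> \<beta> :: "nat \<Rightarrow> real"
  proof -
    have S: "shape N (S j) (\<alpha> j) (\<beta> j)" and \<alpha>: "\<alpha> j \<ge> 0" and \<beta>: "\<beta> j \<ge> 0" if "j < 3" for j
      using hyp that by blast+
    define X where "X j = real N powr (\<alpha> j * recip (p j) + \<beta> j * recip (q j))" for j
    have X: "X j > 0" for j using N by (simp add: X_def)
    have fin: "finite (S j)" if "j < 3" for j using S[OF that] by (simp add: shape_def)
    let ?P = "\<lambda>i. (lattice_pt b i, 0) :: 'a \<times> 'a"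
    \<comment> \<open>Scaling by the estimated norm brings both factors to norm at most
      \<open>\<delta> / 2\<close>, strictly inside the ball provided by continuity. The two halves
      cause the factor 4 in \<open>C\<close>.\<close>
    define t1 where "t1 = \<delta> / (2 * (K1 * X 1))"
    define t2 where "t2 = \<delta> / (2 * (K2 * X 2))"
    have t: "t1 > 0" "t2 > 0" using \<delta>(1) K1(1) K2(1) X by (auto simp: t1_def t2_def)
    let ?c1 = "\<lambda>s. t1 * (\<theta> 1 (?P (snd s)) / \<theta> 2 (?P (fst s)))"
    let ?c2 = "\<lambda>s. t2 * (\<theta> 0 (?P (snd s)) / \<theta> 1 (?P (fst s)))"
    let ?c0 = "\<lambda>s. 1 * (z0 (?P (snd s)) / i0 (?P (fst s)))"
    let ?a1 = "lattice_sum b (S 1) ?c1" and ?a2 = "lattice_sum b (S 2) ?c2" and ?b0 = "lattice_sum b (S 0) ?c0"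
    have G: "?a1 \<in> GS_half" "?a2 \<in> GS_half" "?b0 \<in> GS_half" by (rule wig_sum_GS_half, rule fin, simp)+
    have half: "ennreal (\<delta> / 2) < ennreal \<delta>" using \<delta>(1) by (simp add: ennreal_less_iff)
    have n1: "modulation_norm \<Phi> (p 1) (q 1) (\<omega> 1) (distr_of ?a1) < ennreal \<delta>"
    proof (rule le_less_trans[OF K1(2)[OF N S[OF j3(2)] \<alpha>[OF j3(2)] \<beta>[OF j3(2)] t(1)]])
      show "ennreal (t1 * (K1 * real N powr (\<alpha> 1 * recip (p 1) + \<beta> 1 * recip (q 1)))) < ennreal \<delta>"
        unfolding X_def[symmetric] t1_def using K1(1) X[of 1] half by simp
    qed
    have n2: "modulation_norm \<Phi> (p 2) (q 2) (\<omega> 2) (distr_of ?a2) < ennreal \<delta>"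
    proof (rule le_less_trans[OF K2(2)[OF N S[OF j3(3)] \<alpha>[OF j3(3)] \<beta>[OF j3(3)] t(2)]])
      show "ennreal (t2 * (K2 * real N powr (\<alpha> 2 * recip (p 2) + \<beta> 2 * recip (q 2)))) < ennreal \<delta>"
        unfolding X_def[symmetric] t2_def using K2(1) X[of 2] half by simp
    qed
    have n0: "modulation_norm \<Phi> (p 0) (q 0) (\<omega> 0) (distr_of ?b0) \<le> ennreal (K0 * X 0)"
      using K0(2)[OF N S[OF j3(1)] \<alpha>[OF j3(1)] \<beta>[OF j3(1)] zero_less_one] unfolding X_def[symmetric] mult_1_left .
    let ?k = "wig_const TYPE('a) * sqrt pi ^ DIM('a)"
    let ?c12 = "\<lambda>(s, t). ?c1 s * ?c2 t * (wig_const TYPE('a) * sqrt pi ^ DIM('a) * exp (- (1/4) * (norm (lattice_pt b (snd s) - lattice_pt b (fst t)))\<^sup>2))"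
    have wp: "weyl_prod ?a1 ?a2 = wig_sum (S 1 \<times> S 2) ?c12 (\<lambda>(s, t). lattice_pt b (fst s)) (\<lambda>(s, t). lattice_pt b (snd t))"
      by (rule weyl_prod_wig_sum[OF fin[OF j3(2)] fin[OF j3(3)]])
    have wG: "weyl_prod ?a1 ?a2 \<in> GS_half"
      unfolding wp by (intro wig_sum_GS_half finite_cartesian_product fin j3)
    have "ennreal (\<kappa> * cmod (LINT Z|lborel. weyl_prod ?a1 ?a2 Z * cnj (?b0 Z))) \<le> ennreal (K0 * X 0) * 1"
      unfolding \<kappa>_def
      by (rule order_trans[OF modulation_duality[OF \<Phi> p0 q0 iz wG G(3) \<omega>0] mult_mono[OF n0 \<delta>(2)[OF G(1,2) n1 n2]]]) auto
    then have upper: "\<kappa> * cmod (LINT Z|lborel. weyl_prod ?a1 ?a2 Z * cnj (?b0 Z)) \<le> K0 * X 0"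
      using K0(1) X[of 0] by (simp add: ennreal_le_iff)
    let ?R = "triples (S 1) (S 2) (S 0)"
    \<comment> \<open>Along a triangle i, j, k the quotients of \<open>\<theta> 1\<close> at j by
      \<open>\<theta> 2\<close> at i, of \<open>\<theta> 0\<close> at k by \<open>\<theta> 1\<close>
      at j, and of \<open>\<theta> 2\<close> at i by \<open>\<theta> 0\<close> at k cancel. The
      middle points coincide, so the overlap factor is \<open>exp 0\<close>.\<close>
    have coef: "?c12 x * ?c0 y = t1 * t2 * ?k" if "(x, y) \<in> ?R" for x y
    proof -
      obtain s t where st: "x = (s, t)" "snd s = fst t" "fst y = fst s" "snd y = snd t"
        using \<open>(x, y) \<in> ?R\<close> unfolding triples_def by auto
      have nz: "\<theta> 0 z \<noteq> 0" "\<theta> 1 z \<noteq> 0" "\<theta> 2 z \<noteq> 0" for z using ps by (metis less_irrefl)+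
      show ?thesis unfolding st(1) prod.case st(2-4) z0_def i0_def using nz by simp
    qed
    have c0: "wig_const TYPE('a) \<ge> 0" using wig_const_pos[where 'a='a] by simp
    have nn: "\<theta> i x / \<theta> j y \<ge> 0" if "i < 3" "j < 3" for i j x y
      using less_imp_le[OF pos[OF that(1)]] less_imp_le[OF pos[OF that(2)]] by (intro divide_nonneg_nonneg; blast)
    have "(\<Sum>(x, y)\<in>?R. ?c12 x * ?c0 y) * sqrt (pi / 2) ^ DIM('a \<times> 'a) \<le>
        cmod (LINT Z|lborel. wig_sum (S 1 \<times> S 2) ?c12 (\<lambda>(s, t). lattice_pt b (fst s)) (\<lambda>(s, t). lattice_pt b (snd t)) Z * cnj (?b0 Z))"
    proof (rule wig_sum_pairing)
      show "finite (S 1 \<times> S 2)" "finite (S 0)" by (intro finite_cartesian_product fin j3)+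
      show "?c12 s \<ge> 0" for s
        unfolding case_prod_unfold
        by (intro mult_nonneg_nonneg nn less_imp_le[OF t(1)] less_imp_le[OF t(2)] c0 j3) auto
      show "?c0 s \<ge> 0" for s using nn[OF j3(3) j3(1)] by (simp add: z0_def i0_def)
      show "?R \<subseteq> (S 1 \<times> S 2) \<times> S 0" by (auto simp: triples_def)
      show "(case s of (s, t) \<Rightarrow> lattice_pt b (fst s)) = lattice_pt b (fst t) \<and> (case s of (s, t) \<Rightarrow> lattice_pt b (snd t)) = lattice_pt b (snd t)"
        if "(s, t) \<in> ?R" for s t using that by (auto simp: triples_def)
    qed
    also have "(\<Sum>(x, y)\<in>?R. ?c12 x * ?c0 y) = (\<Sum>(x, y)\<in>?R. t1 * t2 * ?k)"
      by (rule sum.cong[OF refl]) (use coef in \<open>auto simp only: split_paired_all prod.case\<close>)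
    also have "\<dots> = real (card ?R) * (t1 * t2 * ?k)" by (simp add: case_prod_unfold)
    finally have lower: "real (card ?R) * (t1 * t2 * \<rho>) \<le> cmod (LINT Z|lborel. weyl_prod ?a1 ?a2 Z * cnj (?b0 Z))"
      unfolding wp \<rho>_def by (simp only: mult.assoc)
    have "\<kappa> * (real (card ?R) * (t1 * t2 * \<rho>)) \<le> K0 * X 0"
      using order_trans[OF mult_left_mono[OF lower less_imp_le[OF \<kappa>]] upper] .
    moreover have "\<kappa> * (real (card ?R) * (t1 * t2 * \<rho>)) = real (card ?R) * (\<delta>\<^sup>2 * \<kappa> * \<rho>) / (4 * (K1 * K2) * (X 1 * X 2))"
      using X[of 1] X[of 2] K1(1) K2(1) by (simp add: t1_def t2_def field_simps power2_eq_square)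
    ultimately have "real (card ?R) * (\<delta>\<^sup>2 * \<kappa> * \<rho>) \<le> K0 * X 0 * (4 * (K1 * K2) * (X 1 * X 2))"
      using X[of 1] X[of 2] K1(1) K2(1) by (simp add: pos_divide_le_eq)
    then have "real (card ?R) \<le> K0 * X 0 * (4 * (K1 * K2) * (X 1 * X 2)) / (\<delta>\<^sup>2 * \<kappa> * \<rho>)"
      using \<delta>(1) \<kappa> \<rho> by (subst pos_le_divide_eq) auto
    also have "\<dots> = C * (X 0 * X 1 * X 2)" by (simp add: C_def mult_ac)
    also have "X 0 * X 1 * X 2 = real N powr (\<Sum>j<3. \<alpha> j * recip (p j) + \<beta> j * recip (q j))"
      unfolding X_def powr_add[symmetric] by (simp add: eval_nat_numeral add_ac)
    finally show ?thesis .
  qed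
  then show ?thesis using that[of C] by blast
qed

subsection \<open>Choice of the lattice configurations\<close>

lemma growth_exponent_le:
  fixes C s t :: real
  assumes "\<And>N::nat. N \<ge> 1 \<Longrightarrow> real N powr t \<le> C * real N powr s"
  shows "t \<le> s"
proof (rule ccontr)
  assume "\<not> t \<le> s"
  then have d: "t - s > 0" by simp
  have le: "real N powr (t - s) \<le> C" if "1 \<le> N" for N :: nat
    using assms[OF that] that by (simp add: powr_diff divide_le_eq)
  have "eventually (\<lambda>N. real N powr (t - s) \<le> C) sequentially"
    by (rule eventually_sequentiallyI[of 1, OF le])
  moreover have "filterlim (\<lambda>N. real N powr (t - s)) at_top sequentially"
    using d by real_asymp
  then have "eventually (\<lambda>N. real N powr (t - s) > C) sequentially" by (simp add: filterlim_at_top_dense)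
  ultimately have "eventually (\<lambda>_. False) sequentially" by eventually_elim simp
  then show False by simp
qed

context
  fixes N :: nat
  assumes N: "N \<ge> 1"
begin

lemma shape_diag: "shape N ((\<lambda>i. (i, i)) ` {0..<int N}) 1 0"
proof -
  have "card {s \<in> (\<lambda>i. (i, i)) ` {0..<int N}. snd s - fst s = d} \<le> N" for d :: int
  proof -
    have "card {s \<in> (\<lambda>i. (i, i)) ` {0..<int N}. snd s - fst s = d} \<le> card ((\<lambda>i. (i, i)) ` {0..<int N})"
      by (rule card_mono) auto
    also have "\<dots> \<le> card {0..<int N}" by (rule card_image_le) simp
    finally show ?thesis by simp
  qed
  moreover have "card ((\<lambda>s. snd s - fst s) ` (\<lambda>i. (i, i)) ` {0..<int N}) \<le> card {0::int}"
    by (rule card_mono) auto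
  ultimately show ?thesis using N by (auto simp: shape_def)
qed

text \<open>Differences range over \<open>{- int N..<int N}\<close>, which explains the factor 2 in
  \<open>shape\<close>; for a given difference the first component determines the pair.\<close>

lemma shape_full: "shape N ({0..<int N} \<times> {0..<int N}) 1 1"
proof -
  have "card {s \<in> {0..<int N} \<times> {0..<int N}. snd s - fst s = d} \<le> card {0..<int N}" for d :: int
    by (rule card_inj_on_le[of fst]) (auto simp: inj_on_def)
  moreover have "card ((\<lambda>s. snd s - fst s) ` ({0..<int N} \<times> {0..<int N})) \<le> card {- int N..<int N}"
    by (rule card_mono) auto
  ultimately show ?thesis using N by (auto simp: shape_def)
qed

text \<open>With one endpoint fixed at 0 the difference determines the pair, so the fibres have at
  most one element while the number of differences grows linearly.\<close>

lemma shape_line: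
  assumes S: "S = {0} \<times> {0..<int N} \<or> S = {0..<int N} \<times> {0}"
  shows "shape N S 0 1"
proof -
  have "card {s \<in> S. snd s - fst s = d} \<le> card {0::int}" for d :: int
    by (rule card_inj_on_le[of "\<lambda>_. 0"]) (use S in \<open>auto simp: inj_on_def\<close>)
  moreover have "card ((\<lambda>s. snd s - fst s) ` S) \<le> card {- int N..<int N}"
    by (rule card_mono) (use S in auto)
  moreover have "finite S" using S by auto
  moreover have "(0, 0) \<in> S" using S N by auto
  then have "S \<noteq> {}" by blast
  ultimately show ?thesis using N by (auto simp: shape_def)
qed

lemma shape_point: "shape N {(0, 0)} 0 0"
proof -
  have "card {s \<in> {(0, 0)}. snd s - fst s = d} \<le> card {(0::int, 0::int)}" for d :: int
    by (rule card_mono) auto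
  then show ?thesis using N by (auto simp: shape_def)
qed

end

text \<open>Each inequality comes from one family of configurations. If \<open>m\<close> vertices of
  the triangle are free, there are at least \<open>N ^ m\<close> triangles, and the coefficients of
  \<open>P j\<close> and \<open>Q j\<close> are read off from the shape of the edge set with index
  \<open>j\<close>.\<close>

theorem weyl_product_exponent_conditions:
  fixes P Q :: "nat \<Rightarrow> real" and C :: real
  assumes count: "\<forall>N S \<alpha> \<beta>. N \<ge> 1 \<longrightarrow> (\<forall>j<3. shape N (S j) (\<alpha> j) (\<beta> j) \<and> \<alpha> j \<ge> 0 \<and> \<beta> j \<ge> 0) \<longrightarrow>
      real (card (triples (S 1) (S 2) (S 0))) \<le> C * real N powr (\<Sum>j<3. \<alpha> j * P j + \<beta> j * Q j)"
  shows "1 \<le> P 0 + P 1 + P 2"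
    and "3 \<le> P 0 + P 1 + P 2 + (Q 0 + Q 1 + Q 2)"
    and "2 \<le> P 0 + (Q 0 + Q 1 + Q 2)" "2 \<le> P 1 + (Q 0 + Q 1 + Q 2)" "2 \<le> P 2 + (Q 0 + Q 1 + Q 2)"
    and "1 \<le> Q 1 + Q 2" "1 \<le> Q 0 + Q 2" "1 \<le> Q 0 + Q 1"
proof -
  have main: "real m \<le> (a0 * P 0 + b0 * Q 0) + (a1 * P 1 + b1 * Q 1) + (a2 * P 2 + b2 * Q 2)"
    if S: "\<And>N. N \<ge> 1 \<Longrightarrow> shape N (S0 N) a0 b0" "\<And>N. N \<ge> 1 \<Longrightarrow> shape N (S1 N) a1 b1" "\<And>N. N \<ge> 1 \<Longrightarrow> shape N (S2 N) a2 b2"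
      and nn: "a0 \<ge> 0" "b0 \<ge> 0" "a1 \<ge> 0" "b1 \<ge> 0" "a2 \<ge> 0" "b2 \<ge> 0"
      and f: "\<And>N. N \<ge> 1 \<Longrightarrow> card (D N) = N ^ m" "\<And>N. N \<ge> 1 \<Longrightarrow> inj_on f (D N)"
        "\<And>N. N \<ge> 1 \<Longrightarrow> f ` D N \<subseteq> triples (S1 N) (S2 N) (S0 N)"
    for m a0 b0 a1 b1 a2 b2 S0 S1 S2 and D :: "nat \<Rightarrow> 'i set" and f
  proof (rule growth_exponent_le)
    fix N :: nat assume N: "N \<ge> 1"
    let ?S = "\<lambda>j::nat. if j = 0 then S0 N else if j = 1 then S1 N else S2 N"
    let ?a = "\<lambda>j::nat. if j = 0 then a0 else if j = 1 then a1 else a2"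
    let ?b = "\<lambda>j::nat. if j = 0 then b0 else if j = 1 then b1 else b2"
    have "finite (S0 N)" "finite (S1 N)" "finite (S2 N)" using S[OF N] by (auto simp: shape_def)
    then have "card (D N) \<le> card (triples (S1 N) (S2 N) (S0 N))"
      by (intro card_inj_on_le[OF f(2,3)[OF N]] finite_triples)
    then have "real N powr real m \<le> real (card (triples (S1 N) (S2 N) (S0 N)))"
      using N f(1)[OF N] by (simp add: powr_realpow flip: of_nat_power)
    also have "\<dots> \<le> C * real N powr (\<Sum>j<3. ?a j * P j + ?b j * Q j)"
      using count[rule_format, OF N, of ?S ?a ?b] S[OF N] nn by simp
    also have "(\<Sum>j<3. ?a j * P j + ?b j * Q j) = (a0 * P 0 + b0 * Q 0) + (a1 * P 1 + b1 * Q 1) + (a2 * P 2 + b2 * Q 2)"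
      by (simp add: eval_nat_numeral)
    finally show "real N powr real m \<le> C * real N powr ((a0 * P 0 + b0 * Q 0) + (a1 * P 1 + b1 * Q 1) + (a2 * P 2 + b2 * Q 2))" .
  qed
  let ?I = "\<lambda>N. {0..<int N}"
  let ?full = "\<lambda>N. ?I N \<times> ?I N" and ?row = "\<lambda>N. {0::int} \<times> ?I N" and ?col = "\<lambda>N. ?I N \<times> {0::int}" and ?pt = "\<lambda>N::nat. {(0::int, 0::int)}"
  let ?diag = "\<lambda>N. (\<lambda>i. (i, i)) ` ?I N"
  have line: "shape N (?row N) 0 1" "shape N (?col N) 0 1" if "N \<ge> 1" for N
    by (rule shape_line[OF that]; simp)+
  note simps = triples_def inj_on_def power2_eq_square power3_eq_cube card_cartesian_product
  \<comment> \<open>All three vertices coincide: one free vertex and only the difference 0, so no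
    \<open>Q j\<close> enters.\<close>
  have "real 1 \<le> (1 * P 0 + 0 * Q 0) + (1 * P 1 + 0 * Q 1) + (1 * P 2 + 0 * Q 2)"
    by (rule main[of ?diag 1 0 ?diag 1 0 ?diag 1 0 ?I 1 "\<lambda>i. (((i, i), (i, i)), (i, i))"]) (auto simp: simps intro: shape_diag)
  then show "1 \<le> P 0 + P 1 + P 2" by simp
  \<comment> \<open>Three free vertices, all edges allowed.\<close>
  have "real 3 \<le> (1 * P 0 + 1 * Q 0) + (1 * P 1 + 1 * Q 1) + (1 * P 2 + 1 * Q 2)"
    by (rule main[of ?full 1 1 ?full 1 1 ?full 1 1 "\<lambda>N. ?I N \<times> ?I N \<times> ?I N" 3 "\<lambda>(i, j, k). (((i, j), (j, k)), (i, k))"]) (auto simp: simps intro: shape_full)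
  then show "3 \<le> P 0 + P 1 + P 2 + (Q 0 + Q 1 + Q 2)" by simp
  \<comment> \<open>One vertex is fixed at 0 and two are free. The edge between the free vertices
    forms a full square, the other two edges are lines; the fixed vertex is the middle, the last and
    the first one in the three cases that follow.\<close>
  have "real 2 \<le> (1 * P 0 + 1 * Q 0) + (0 * P 1 + 1 * Q 1) + (0 * P 2 + 1 * Q 2)"
    by (rule main[of ?full 1 1 ?col 0 1 ?row 0 1 ?full 2 "\<lambda>(i, k). (((i, 0), (0, k)), (i, k))"]) (auto simp: simps intro: shape_full line)
  then show "2 \<le> P 0 + (Q 0 + Q 1 + Q 2)" by simp
  have "real 2 \<le> (0 * P 0 + 1 * Q 0) + (1 * P 1 + 1 * Q 1) + (0 * P 2 + 1 * Q 2)"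
    by (rule main[of ?col 0 1 ?full 1 1 ?col 0 1 ?full 2 "\<lambda>(i, j). (((i, j), (j, 0)), (i, 0))"]) (auto simp: simps intro: shape_full line)
  then show "2 \<le> P 1 + (Q 0 + Q 1 + Q 2)" by simp
  have "real 2 \<le> (0 * P 0 + 1 * Q 0) + (0 * P 1 + 1 * Q 1) + (1 * P 2 + 1 * Q 2)"
    by (rule main[of ?row 0 1 ?row 0 1 ?full 1 1 ?full 2 "\<lambda>(j, k). (((0, j), (j, k)), (0, k))"]) (auto simp: simps intro: shape_full line)
  then show "2 \<le> P 2 + (Q 0 + Q 1 + Q 2)" by simp
  \<comment> \<open>Two vertices are fixed at 0: their edge is the single point (0, 0) and
    contributes no growth, while the two edges at the free vertex are lines.\<close>
  have "real 1 \<le> (0 * P 0 + 0 * Q 0) + (0 * P 1 + 1 * Q 1) + (0 * P 2 + 1 * Q 2)"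
    by (rule main[of ?pt 0 0 ?row 0 1 ?col 0 1 ?I 1 "\<lambda>j. (((0, j), (j, 0)), (0, 0))"]) (auto simp: simps intro: shape_point line)
  then show "1 \<le> Q 1 + Q 2" by simp
  have "real 1 \<le> (0 * P 0 + 1 * Q 0) + (0 * P 1 + 0 * Q 1) + (0 * P 2 + 1 * Q 2)"
    by (rule main[of ?row 0 1 ?pt 0 0 ?row 0 1 ?I 1 "\<lambda>k. (((0, 0), (0, k)), (0, k))"]) (auto simp: simps intro: shape_point line)
  then show "1 \<le> Q 0 + Q 2" by simp
  have "real 1 \<le> (0 * P 0 + 1 * Q 0) + (0 * P 1 + 1 * Q 1) + (0 * P 2 + 0 * Q 2)"
    by (rule main[of ?col 0 1 ?col 0 1 ?pt 0 0 ?I 1 "\<lambda>i. (((i, 0), (0, 0)), (i, 0))"]) (auto simp: simps intro: shape_point line)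
  then show "1 \<le> Q 0 + Q 1" by simp
qed

theorem theorem4p1:
  fixes p q :: "nat \<Rightarrow> ennreal"
    and \<theta> :: "nat \<Rightarrow> (real ^ 'd) \<times> (real ^ 'd) \<Rightarrow> real"
    and \<omega> :: "nat \<Rightarrow> ((real ^ 'd) \<times> (real ^ 'd)) \<times> ((real ^ 'd) \<times> (real ^ 'd)) \<Rightarrow> real"
    and \<Phi> :: "(real ^ 'd) \<times> (real ^ 'd) \<Rightarrow> complex"
  assumes "\<And>j. j \<in> {0, 1, 2} \<Longrightarrow> 1 \<le> p j"
    and "\<And>j. j \<in> {0, 1, 2} \<Longrightarrow> 1 \<le> q j"
    and "\<And>j. j \<in> {0, 1, 2} \<Longrightarrow> poly_moderate (\<theta> j)"
    and "\<And>X Y. \<omega> 0 (X, Y) = \<theta> 0 (X + Y) / \<theta> 2 (X - Y)"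
    and "\<And>X Y. \<omega> 1 (X, Y) = \<theta> 2 (X - Y) / \<theta> 1 (X + Y)"
    and "\<And>X Y. \<omega> 2 (X, Y) = \<theta> 1 (X - Y) / \<theta> 0 (X + Y)"
    and "\<Phi> \<in> GS_half" and "\<Phi> \<noteq> (\<lambda>_. 0)"
    and "\<exists>T. continuous_map
            (prod_topology (modulation_topology \<Phi> (p 1) (q 1) (\<omega> 1))
                           (modulation_topology \<Phi> (p 2) (q 2) (\<omega> 2)))
            (modulation_topology \<Phi> (conj_exponent (p 0)) (conj_exponent (q 0)) (\<lambda>Z. 1 / \<omega> 0 Z))
            T \<and>
          (\<forall>a\<in>GS_half. \<forall>b\<in>GS_half.
             T (distr_of a, distr_of b) = distr_of (weyl_prod a b))"
  shows "max (R2 (\<lambda>j. conj_exponent (q j))) 0 \<le>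
     Min (\<Union>j\<in>{0, 1, 2}. {recip (p j), recip (conj_exponent (q j)), R2 p})"
proof -
  have j: "j \<in> {0, 1, 2}" if "j < 3" for j :: nat using that by auto
  note p = assms(1)[OF j] and q = assms(2)[OF j] and \<theta> = poly_moderate_mod_weight[OF assms(3)[OF j]]
  obtain T where T: "continuous_map
      (prod_topology (modulation_topology \<Phi> (p 1) (q 1) (\<omega> 1)) (modulation_topology \<Phi> (p 2) (q 2) (\<omega> 2)))
      (modulation_topology \<Phi> (conj_exponent (p 0)) (conj_exponent (q 0)) (\<lambda>Z. 1 / \<omega> 0 Z)) T"
    "\<And>a b. a \<in> GS_half \<Longrightarrow> b \<in> GS_half \<Longrightarrow> T (distr_of a, distr_of b) = distr_of (weyl_prod a b)"
    using assms(9) by blast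
  obtain C where count: "\<forall>N S \<alpha> \<beta>. N \<ge> 1 \<longrightarrow> (\<forall>j<3. shape N (S j) (\<alpha> j) (\<beta> j) \<and> \<alpha> j \<ge> 0 \<and> \<beta> j \<ge> 0) \<longrightarrow>
      real (card (triples (S 1) (S 2) (S 0))) \<le> C * real N powr (\<Sum>j<3. \<alpha> j * recip (p j) + \<beta> j * recip (q j))"
    by (rule counting_inequality[where p = p and q = q and \<theta> = \<theta> and \<omega> = \<omega> and \<Phi> = \<Phi> and T = T,
          OF p q \<theta> assms(4-8) T]) blast
  note ex = weyl_product_exponent_conditions[where P = "\<lambda>j. recip (p j)" and Q = "\<lambda>j. recip (q j)", OF count]
  have j012: "0 < (3::nat)" "1 < (3::nat)" "2 < (3::nat)" by simp_all
  note c = conj_recip[OF q[OF j012(1)]] conj_recip[OF q[OF j012(2)]] conj_recip[OF q[OF j012(3)]]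
  note rp = recip_bounds[OF p[OF j012(1)]] recip_bounds[OF p[OF j012(2)]] recip_bounds[OF p[OF j012(3)]]
  note rq = recip_bounds[OF q[OF j012(1)]] recip_bounds[OF q[OF j012(2)]] recip_bounds[OF q[OF j012(3)]]
  show ?thesis
  proof (rule Min.boundedI)
    fix x assume "x \<in> (\<Union>j\<in>{0, 1, 2}. {recip (p j), recip (conj_exponent (q j)), R2 p})"
    then have x: "x = recip (p 0) \<or> x = recip (p 1) \<or> x = recip (p 2) \<or> x = 1 - recip (q 0) \<or> x = 1 - recip (q 1) \<or>
        x = 1 - recip (q 2) \<or> x = recip (p 0) + recip (p 1) + recip (p 2) - 1"
      using c by (auto simp: R2_def)
    \<comment> \<open>The left side is \<open>R2\<close> of the conjugate exponents. The triangle
      families with two free vertices compare it with each \<open>recip (p j)\<close>, those with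
      one free vertex and a point edge with \<open>1 - recip (q j)\<close>, and the full family with
      \<open>R2 p\<close>.\<close>
    have "2 - (recip (q 0) + recip (q 1) + recip (q 2)) \<le> x"
      using x ex by (elim disjE; linarith)
    \<comment> \<open>The diagonal family supplies \<open>R2 p \<ge> 0\<close>; the remaining
      entries are nonnegative because the exponents are at least 1.\<close>
    moreover have "0 \<le> x"
      using x ex(1) rp rq by (elim disjE; linarith)
    moreover have "R2 (\<lambda>j. conj_exponent (q j)) = 2 - (recip (q 0) + recip (q 1) + recip (q 2))"
      unfolding R2_def c by simp
    ultimately show "max (R2 (\<lambda>j. conj_exponent (q j))) 0 \<le> x" by simp
  qed auto
qed

end
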